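(* Consider the stochastic differential delay equation $$dx(t)=f(x(t),x(t-\delta(t)),t)\,dt+g(x(t),x(t-\delta(t)),t)\,dB(t),\quad t\ge 0,\qquad x_0=\xi, \tag{E}$$ with the setting and notation of the context. Assume: (i) there is a constant $\eta<1$ with $\delta'(t)\le\eta$ for all $t\ge0$; (ii) (local Lipschitz) for any fixed $t>0$ and each $R$ there is $L_{R,t}>0$ such that $$|f(x,y,t)-f(x',y',t)|\vee|g(x,y,t)-g(x',y',t)|\le L_{R,t}(|x-x'|+|y-y'|)$$ for all $|x|\vee|x'|\vee|y|\vee|y'|\le R$; (iii) there are positive constants $K,\lambda_0,\lambda_1,\lambda_2$ such that for all $t\ge0$ and $x,y\in\mathbb{R}^n$ $$2\langle x,f(x,y,t)\rangle+|g(x,y,t)|^2\le\frac{K(1+t)^{-\lambda_0}-\lambda_1|x|^2+\lambda_2|y|^2}{1+t};$$ (iv) $\lambda_1-\frac{\lambda_2}{1-\eta}>0$. Then for any initial condition $\xi\in C^b_{\mathscr F_0}([-\tau,0];\mathbb{R}^n)$ there exists a unique global solution $x=\{x(t),t\in[-\tau,\infty)\}$ of equation (E). Moreover, if $\delta(t)\le\tau$ for all $t\ge 0$, or if $\delta$ is unbounded, then the solution $x(t)$ is also almost surely and mean square polynomially stable. That is, for any $\gamma\in(0,\gamma^* )$, $$\limsup_{t\to\infty}\frac{\log|x(t)|}{\log(1+t)}\le-\frac{\gamma}{2}\ \text{ a.s.},\qquad\text{and}\qquad \limsup_{t\to\infty}\frac{\log\mathbb{E}(|x(t)|^2)}{\log(1+t)}\le-\gamma,$$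 where $\gamma^*=\lambda_0\wedge\gamma_0$ if $\delta\le\tau$, with $\gamma_0$ the unique positive solution of $$\gamma_0-\lambda_1+\frac{\lambda_2\left(1\vee(1+\tau)^{\gamma_0-1}\right)}{1-\eta}=0,$$ and $\gamma^*=\lambda_0\wedge\left(\lambda_1-\frac{\lambda_2}{1-\eta}\right)\wedge1$ if $\delta$ is unbounded.
   Context: $(\Omega,\mathscr F,P)$ is a complete probability space with a filtration $\{\mathscr F_t\}_{t\ge0}$ satisfying the usual conditions, and $B(t)$ is a $d$-dimensional standard Brownian motion on it (with respect to this filtration). $\tau\ge0$ is a constant; $C([-\tau,0];\mathbb{R}^n)$ is the space of continuous functions with norm $\|\phi\|=\sup_{-\tau\le\theta\le0}|\phi(\theta)|$; $C^b_{\mathscr F_0}([-\tau,0];\mathbb{R}^n)$ is the family of bounded, $\mathscr F_0$-measurable, $C([-\tau,0];\mathbb{R}^n)$-valued random variables. The initial value is $x_0=\xi=\{\xi(\theta),\theta\in[-\tau,0]\}\in C^b_{\mathscr F_0}([-\tau,0];\mathbb{R}^n)$, with $\mathbb{E}\|\xi\|^2<\infty$. $\delta\in C^1(\mathbb{R}_+,\mathbb{R}_+)$ with $\delta(0)=\tau$. The functions $f:\mathbb{R}^n\times\mathbb{R}^n\times[0,\infty)\to\mathbb{R}^n$ and $g:\mathbb{R}^n\times\mathbb{R}^n\times[0,\infty)\to\mathbb{R}^{n}\otimes\mathbb{R}^{d}$ ($n\times d$ matrices) are Borel measurable, with $f(0,0,t)\equiv0$ and $g(0,0,t)\equiv0$.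 $|A|=\sqrt{\mathrm{trace}(A^{T}A)}$ for a matrix $A$; $a\vee b=\max\{a,b\}$, $a\wedge b=\min\{a,b\}$; $\log 0=-\infty$. Polynomial stability: the solution is mean square polynomially stable if there is $\gamma>0$ such that $\limsup_{t\to\infty}\frac{\log\mathbb{E}|x(t)|^2}{\log(1+t)}<-\gamma$ for any initial value $\xi\in C^b_{\mathscr F_0}([-\tau,0];\mathbb{R}^n)$; it is almost surely polynomially stable if there is $\gamma>0$ such that $\limsup_{t\to\infty}\frac{\log|x(t)|}{\log(1+t)}<-\gamma$ for almost all $\omega\in\Omega$, for any such initial value.
   Formalization: In (ii) the constant L_{R,t} is required to serve all times s in (0,t], not only the single time t; with a separate constant at each time existence fails, e.g. g=0, f(x,y,t)=-x/t for t>0, f(x,y,0)=-x has no solution with x(0)=1. *)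

theory Defs
  imports "HOL-Probability.Probability"
begin

section \<open>Stochastic bases and Brownian motion\<close>

text \<open>
  Time is the half-line \<open>t \<ge> 0\<close> inside \<^typ>\<open>real\<close>.  The values \<open>F t\<close> for \<open>t < 0\<close> exist only because
  the library's \<^locale>\<open>filtration\<close> is indexed by a whole type; a filtration on the half-line
  extends by \<open>F t = F 0\<close>, and no definition below looks at negative indices.
\<close>

locale stochastic_basis = prob_space M + complete_measure M + filtration "space M" F
  for M :: "'a measure" and F :: "real \<Rightarrow> 'a measure" +
  assumes sets_F_subset: "\<And>t. t \<ge> 0 \<Longrightarrow> sets (F t) \<subseteq> sets M"
    and right_continuous: "\<And>t. t \<ge> 0 \<Longrightarrow> sets (F t) = (\<Inter>u\<in>{t<..}. sets (F u))"
    and null_sets_F: "null_sets M \<subseteq> sets (F 0)"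

definition brownian_motion ::
    "'a measure \<Rightarrow> (real \<Rightarrow> 'a measure) \<Rightarrow> (real \<Rightarrow> 'a \<Rightarrow> real ^ 'd) \<Rightarrow> bool" where
  "brownian_motion M F B \<longleftrightarrow>
     (\<forall>t\<ge>0. B t \<in> borel_measurable (F t)) \<and>
     (AE \<omega> in M. B 0 \<omega> = 0) \<and>
     (AE \<omega> in M. continuous_on {0..} (\<lambda>t. B t \<omega>)) \<and>
     (\<forall>s t. 0 \<le> s \<and> s < t \<longrightarrow>
        distributed M lborel (\<lambda>\<omega>. B t \<omega> - B s \<omega>)
          (\<lambda>z. ennreal (\<Prod>i\<in>UNIV. normal_density 0 (sqrt (t - s)) (z $ i))) \<and>
        prob_space.indep_set M (sets (F s))
          (sets (vimage_algebra (space M) (\<lambda>\<omega>. B t \<omega> - B s \<omega>) borel)))"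

section \<open>The Ito integral\<close>

definition progressively_measurable ::
    "(real \<Rightarrow> 'a measure) \<Rightarrow> (real \<Rightarrow> 'a \<Rightarrow> 'b::topological_space) \<Rightarrow> bool" where
  "progressively_measurable F X \<longleftrightarrow>
     (\<forall>T\<ge>0. (\<lambda>(t, \<omega>). X t \<omega>) \<in> borel_measurable (restrict_space borel {0..T} \<Otimes>\<^sub>M F T))"

definition null_in_probability :: "'a measure \<Rightarrow> (nat \<Rightarrow> 'a \<Rightarrow> ennreal) \<Rightarrow> bool" where
  "null_in_probability M X \<longleftrightarrow>
     (\<forall>k. X k \<in> borel_measurable M) \<and>
     (\<forall>\<epsilon>>0. (\<lambda>k. measure M {\<omega> \<in> space M. ennreal \<epsilon> < X k \<omega>}) \<longlonglongrightarrow> 0)"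

text \<open>
  A triple \<open>(m, s, A)\<close> encodes the elementary process that equals \<open>A i\<close> on \<open>(s i, s (i + 1)]\<close> for
  \<open>i < m\<close> and vanishes elsewhere.
\<close>

definition elementary_process ::
    "'a measure \<Rightarrow> (real \<Rightarrow> 'a measure) \<Rightarrow> nat \<Rightarrow> (nat \<Rightarrow> real) \<Rightarrow> (nat \<Rightarrow> 'a \<Rightarrow> real ^ 'd ^ 'n) \<Rightarrow> bool" where
  "elementary_process M F m s A \<longleftrightarrow>
     0 \<le> s 0 \<and>
     (\<forall>i<m. s i \<le> s (Suc i) \<and> A i \<in> borel_measurable (F (s i)) \<and> bounded (A i ` space M))"

definition elementary_value ::
    "nat \<Rightarrow> (nat \<Rightarrow> real) \<Rightarrow> (nat \<Rightarrow> 'a \<Rightarrow> real ^ 'd ^ 'n) \<Rightarrow> real \<Rightarrow> 'a \<Rightarrow> real ^ 'd ^ 'n" where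
  "elementary_value m s A t \<omega> = (\<Sum>i<m. indicator {s i<..s (Suc i)} t *\<^sub>R A i \<omega>)"

definition elementary_integral ::
    "(real \<Rightarrow> 'a \<Rightarrow> real ^ 'd) \<Rightarrow> nat \<Rightarrow> (nat \<Rightarrow> real) \<Rightarrow> (nat \<Rightarrow> 'a \<Rightarrow> real ^ 'd ^ 'n)
      \<Rightarrow> real \<Rightarrow> 'a \<Rightarrow> real ^ 'n" where
  "elementary_integral B m s A t \<omega> =
     (\<Sum>i<m. A i \<omega> *v (B (min t (s (Suc i))) \<omega> - B (min t (s i)) \<omega>))"

text \<open>
  \<open>has_ito_integral M F B G I\<close>: the process \<open>I\<close> is (a version with continuous paths of) the
  Ito integral \<open>t \<mapsto> \<integral>\<^sub>0\<^sup>t G dB\<close> of a progressively measurable integrand that is almost surely locally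
  square integrable, namely the limit in probability of the integrals of elementary processes
  approximating \<open>G\<close> in \<open>L\<^sup>2[0,t]\<close> in probability.  The norm on \<^typ>\<open>real ^ 'd ^ 'n\<close> is the Frobenius
  norm \<open>sqrt (trace (A\<^sup>T A))\<close>.
\<close>

definition has_ito_integral ::
    "'a measure \<Rightarrow> (real \<Rightarrow> 'a measure) \<Rightarrow> (real \<Rightarrow> 'a \<Rightarrow> real ^ 'd)
      \<Rightarrow> (real \<Rightarrow> 'a \<Rightarrow> real ^ 'd ^ 'n) \<Rightarrow> (real \<Rightarrow> 'a \<Rightarrow> real ^ 'n) \<Rightarrow> bool" where
  "has_ito_integral M F B G I \<longleftrightarrow>
     progressively_measurable F G \<and>
     (\<forall>T\<ge>0. AE \<omega> in M. (\<integral>\<^sup>+u\<in>{0..T}. ennreal ((norm (G u \<omega>))\<^sup>2) \<partial>lborel) < \<infinity>) \<and>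
     (\<forall>t\<ge>0. I t \<in> borel_measurable (F t)) \<and>
     (AE \<omega> in M. continuous_on {0..} (\<lambda>t. I t \<omega>)) \<and>
     (\<forall>t\<ge>0. \<exists>m s A.
        (\<forall>k. elementary_process M F (m k) (s k) (A k)) \<and>
        null_in_probability M (\<lambda>k \<omega>. \<integral>\<^sup>+u\<in>{0..t}.
          ennreal ((norm (elementary_value (m k) (s k) (A k) u \<omega> - G u \<omega>))\<^sup>2) \<partial>lborel) \<and>
        null_in_probability M (\<lambda>k \<omega>.
          ennreal (norm (elementary_integral B (m k) (s k) (A k) t \<omega> - I t \<omega>))))"

section \<open>Initial segments\<close>

text \<open>
  An element of \<open>C([-\<tau>,0]; \<real>\<^sup>n)\<close> is represented by a function on \<^typ>\<open>real\<close> that is continuous on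
  \<open>[-\<tau>,0]\<close>; its values elsewhere are ignored by the norm, hence also by the Borel sets.
\<close>

definition segments :: "real \<Rightarrow> (real \<Rightarrow> real ^ 'n) set" where
  "segments \<tau> = {\<phi>. continuous_on {-\<tau>..0} \<phi>}"

definition segment_norm :: "real \<Rightarrow> (real \<Rightarrow> real ^ 'n) \<Rightarrow> real" where
  "segment_norm \<tau> \<phi> = (SUP \<theta>\<in>{-\<tau>..0}. norm (\<phi> \<theta>))"

definition segment_open :: "real \<Rightarrow> (real \<Rightarrow> real ^ 'n) set \<Rightarrow> bool" where
  "segment_open \<tau> U \<longleftrightarrow> U \<subseteq> segments \<tau> \<and>
     (\<forall>\<phi>\<in>U. \<exists>\<epsilon>>0. \<forall>\<psi>\<in>segments \<tau>. segment_norm \<tau> (\<lambda>\<theta>. \<psi> \<theta> - \<phi> \<theta>) < \<epsilon> \<longrightarrow> \<psi> \<in> U)"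

definition segment_borel :: "real \<Rightarrow> (real \<Rightarrow> real ^ 'n) measure" where
  "segment_borel \<tau> = sigma (segments \<tau>) {U. segment_open \<tau> U}"

text \<open>
  The family \<open>C\<^sup>b([-\<tau>,0]; \<real>\<^sup>n)\<close> of bounded \<open>F 0\<close>-measurable initial values.  Boundedness makes
  the second moment of the norm finite.
\<close>

definition initial_values ::
    "'a measure \<Rightarrow> (real \<Rightarrow> 'a measure) \<Rightarrow> real \<Rightarrow> ('a \<Rightarrow> real \<Rightarrow> real ^ 'n) set" where
  "initial_values M F \<tau> =
     {\<xi>. \<xi> \<in> measurable (F 0) (segment_borel \<tau>) \<and>
          (\<exists>C. \<forall>\<omega>\<in>space M. segment_norm \<tau> (\<xi> \<omega>) \<le> C)}"

section \<open>The delay equation\<close>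

text \<open>
  The equation is understood in integrated form.  \<open>F (max 0 t)\<close> expresses that \<open>x t\<close> is
  \<open>F 0\<close>-measurable for \<open>-\<tau> \<le> t \<le> 0\<close>.
\<close>

definition sdde_solution ::
    "'a measure \<Rightarrow> (real \<Rightarrow> 'a measure) \<Rightarrow> (real \<Rightarrow> 'a \<Rightarrow> real ^ 'd)
      \<Rightarrow> (real ^ 'n \<Rightarrow> real ^ 'n \<Rightarrow> real \<Rightarrow> real ^ 'n)
      \<Rightarrow> (real ^ 'n \<Rightarrow> real ^ 'n \<Rightarrow> real \<Rightarrow> real ^ 'd ^ 'n)
      \<Rightarrow> (real \<Rightarrow> real) \<Rightarrow> real \<Rightarrow> ('a \<Rightarrow> real \<Rightarrow> real ^ 'n) \<Rightarrow> (real \<Rightarrow> 'a \<Rightarrow> real ^ 'n) \<Rightarrow> bool" where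
  "sdde_solution M F B f g \<delta> \<tau> \<xi> x \<longleftrightarrow>
     (\<forall>t\<ge>-\<tau>. x t \<in> borel_measurable (F (max 0 t))) \<and>
     (\<forall>\<omega>\<in>space M. continuous_on {-\<tau>..} (\<lambda>t. x t \<omega>)) \<and>
     (AE \<omega> in M. \<forall>\<theta>\<in>{-\<tau>..0}. x \<theta> \<omega> = \<xi> \<omega> \<theta>) \<and>
     (\<forall>T\<ge>0. AE \<omega> in M. set_integrable lborel {0..T} (\<lambda>s. f (x s \<omega>) (x (s - \<delta> s) \<omega>) s)) \<and>
     (\<exists>I. has_ito_integral M F B (\<lambda>s \<omega>. g (x s \<omega>) (x (s - \<delta> s) \<omega>) s) I \<and>
        (AE \<omega> in M. \<forall>t\<ge>0.
           x t \<omega> = x 0 \<omega> + (LINT s:{0..t}|lborel. f (x s \<omega>) (x (s - \<delta> s) \<omega>) s) + I t \<omega>))"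

text \<open>
  The Lipschitz constant belongs to the time horizon \<open>t\<close> and serves all times \<open>0 < s \<le> t\<close>.
  A constant for each single time, with no uniformity, would not give existence: for
  \<open>f x y t = - x / t\<close> and \<open>g = 0\<close> no solution starts from \<open>x 0 \<noteq> 0\<close>.
\<close>

definition locally_Lipschitz_coefficients ::
    "(real ^ 'n \<Rightarrow> real ^ 'n \<Rightarrow> real \<Rightarrow> real ^ 'n)
      \<Rightarrow> (real ^ 'n \<Rightarrow> real ^ 'n \<Rightarrow> real \<Rightarrow> real ^ 'd ^ 'n) \<Rightarrow> bool" where
  "locally_Lipschitz_coefficients f g \<longleftrightarrow>
     (\<forall>t>0. \<forall>R. \<exists>L>0. \<forall>s\<in>{0<..t}. \<forall>x y x' y'.
        norm x \<le> R \<and> norm x' \<le> R \<and> norm y \<le> R \<and> norm y' \<le> R \<longrightarrow>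
        max (norm (f x y s - f x' y' s)) (norm (g x y s - g x' y' s))
          \<le> L * (norm (x - x') + norm (y - y')))"

section \<open>Polynomial stability\<close>

text \<open>
  The logarithm with \<open>log 0 = -\<infinity>\<close>.  Its argument is extended so that the second moment can be a
  Lebesgue integral in \<^typ>\<open>ennreal\<close>: a Bochner integral would turn an infinite moment into \<open>0\<close>.
\<close>

definition elog :: "ennreal \<Rightarrow> ereal" where
  "elog r = (if r = 0 then -\<infinity> else if r = \<infinity> then \<infinity> else ereal (ln (enn2real r)))"

definition pathwise_rate :: "(real \<Rightarrow> 'a \<Rightarrow> real ^ 'n) \<Rightarrow> 'a \<Rightarrow> ereal" where
  "pathwise_rate x \<omega> = Limsup at_top (\<lambda>t. elog (ennreal (norm (x t \<omega>))) / ereal (ln (1 + t)))"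

definition mean_square_rate :: "'a measure \<Rightarrow> (real \<Rightarrow> 'a \<Rightarrow> real ^ 'n) \<Rightarrow> ereal" where
  "mean_square_rate M x =
     Limsup at_top (\<lambda>t. elog (\<integral>\<^sup>+\<omega>. ennreal ((norm (x t \<omega>))\<^sup>2) \<partial>M) / ereal (ln (1 + t)))"

definition mean_square_polynomially_stable ::
    "'a measure \<Rightarrow> (real \<Rightarrow> 'a measure) \<Rightarrow> (real \<Rightarrow> 'a \<Rightarrow> real ^ 'd)
      \<Rightarrow> (real ^ 'n \<Rightarrow> real ^ 'n \<Rightarrow> real \<Rightarrow> real ^ 'n)
      \<Rightarrow> (real ^ 'n \<Rightarrow> real ^ 'n \<Rightarrow> real \<Rightarrow> real ^ 'd ^ 'n) \<Rightarrow> (real \<Rightarrow> real) \<Rightarrow> real \<Rightarrow> bool" where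
  "mean_square_polynomially_stable M F B f g \<delta> \<tau> \<longleftrightarrow>
     (\<exists>\<gamma>>0. \<forall>\<xi>\<in>initial_values M F \<tau>. \<forall>x. sdde_solution M F B f g \<delta> \<tau> \<xi> x \<longrightarrow>
        mean_square_rate M x < ereal (- \<gamma>))"

definition almost_surely_polynomially_stable ::
    "'a measure \<Rightarrow> (real \<Rightarrow> 'a measure) \<Rightarrow> (real \<Rightarrow> 'a \<Rightarrow> real ^ 'd)
      \<Rightarrow> (real ^ 'n \<Rightarrow> real ^ 'n \<Rightarrow> real \<Rightarrow> real ^ 'n)
      \<Rightarrow> (real ^ 'n \<Rightarrow> real ^ 'n \<Rightarrow> real \<Rightarrow> real ^ 'd ^ 'n) \<Rightarrow> (real \<Rightarrow> real) \<Rightarrow> real \<Rightarrow> bool" where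
  "almost_surely_polynomially_stable M F B f g \<delta> \<tau> \<longleftrightarrow>
     (\<exists>\<gamma>>0. \<forall>\<xi>\<in>initial_values M F \<tau>. \<forall>x. sdde_solution M F B f g \<delta> \<tau> \<xi> x \<longrightarrow>
        (AE \<omega> in M. pathwise_rate x \<omega> < ereal (- \<gamma>)))"

definition polynomial_rates_below ::
    "real \<Rightarrow> 'a measure \<Rightarrow> (real \<Rightarrow> 'a measure) \<Rightarrow> (real \<Rightarrow> 'a \<Rightarrow> real ^ 'd)
      \<Rightarrow> (real ^ 'n \<Rightarrow> real ^ 'n \<Rightarrow> real \<Rightarrow> real ^ 'n)
      \<Rightarrow> (real ^ 'n \<Rightarrow> real ^ 'n \<Rightarrow> real \<Rightarrow> real ^ 'd ^ 'n) \<Rightarrow> (real \<Rightarrow> real) \<Rightarrow> real \<Rightarrow> bool" where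
  "polynomial_rates_below \<gamma>star M F B f g \<delta> \<tau> \<longleftrightarrow>
     (\<forall>\<xi>\<in>initial_values M F \<tau>. \<forall>x. sdde_solution M F B f g \<delta> \<tau> \<xi> x \<longrightarrow>
        (\<forall>\<gamma>. 0 < \<gamma> \<and> \<gamma> < \<gamma>star \<longrightarrow>
           (AE \<omega> in M. pathwise_rate x \<omega> \<le> ereal (- \<gamma> / 2)) \<and>
           mean_square_rate M x \<le> ereal (- \<gamma>)))"

end

theory Submission
 imports Defs
begin

text \<open>
 The Ito integral is built for locally bounded integrands from dyadic left averages. For bounded,
 globally Lipschitz coefficients Picard iteration gives a solution; truncating \<open>f\<close> and \<open>g\<close> at radius \<open>k\<close>
 gives processes \<open>X\<^sub>k\<close>, and any solution agrees with \<open>X\<^sub>k\<close> as long as it stays in the ball of radius \<open>k\<close>.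

 Everything else follows from one estimate. Up to the exit from a region, (iii) bounds the growth of
 \<open>E (1 + t)\<^sup>\<gamma> |X\<^sub>k t|\<^sup>2\<close> by \<open>K (1 + t)\<^bsup>\<gamma> - 1 - \<lambda>\<^sub>0\<^esup> + (1 + t)\<^bsup>\<gamma> - 1\<^esup> ((\<gamma> - \<lambda>\<^sub>1) |X\<^sub>k t|\<^sup>2 + \<lambda>\<^sub>2 |X\<^sub>k (t - \<delta> t)|\<^sup>2)\<close>,
 and the substitution \<open>u = t - \<delta> t\<close>, whose derivative is at least \<open>1 - \<eta>\<close>, absorbs the delayed term as soon as
 \<open>\<gamma> - \<lambda>\<^sub>1 + \<lambda>\<^sub>2 c / (1 - \<eta>) \<le> 0\<close>. The bound depends neither on \<open>k\<close> nor on the region. For \<open>\<gamma> = 0\<close> it excludes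
 explosion, so that the \<open>X\<^sub>k\<close> can be patched together; for the other \<open>\<gamma>\<close> it bounds \<open>E (1 + t)\<^sup>\<gamma> |x t|\<^sup>2\<close>
 and, on exiting from \<open>{(1 + t)\<^sup>\<gamma> |x t|\<^sup>2 \<le> A}\<close>, the supremum of \<open>(1 + t)\<^sup>\<gamma> |x t|\<^sup>2\<close> over all times.
\<close>

text \<open>A solution comes with a stochastic integral known only as a limit in probability of
  elementary integrals, and its integrand need not be bounded, while all estimates are made for
  bounded integrands. The bridge is locality: the averages behind the integral act path by path, so
  on any event, even one that depends on the future, on which two integrands agree up to t, their
  integrals agree. This also removes exit times: to stop a process, its coefficients are multiplied
  by the indicator that it has not exited yet, and the energy at time T is then the energy at the
  exit.

  Only expectations are needed, so no pathwise Ito formula is proved; expanding the energy over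
  short intervals suffices. The delayed term must be finite before it can be absorbed, which the
  stopping at a bounded level guarantees.

  The condition \<gamma> < \<lambda>0 makes (1 + t)^(\<gamma> - 1 - \<lambda>0) integrable at
  infinity. A constant c compares the weight (1 + t)^(\<gamma> - 1) with its value at the delayed
  time; the two cases of the theorem differ only in c and the resulting range of \<gamma>.\<close>

abbreviation nsq :: "'a::real_normed_vector => real" where
 "nsq x \<equiv> (norm x)\<^sup>2"

abbreviation msq :: "'a measure => ('a => 'b::real_normed_vector) => ennreal" where
 "msq N X \<equiv> \<integral>\<^sup>+x. ennreal (nsq (X x)) \<partial>N"

abbreviation psq :: "real => (real => 'b::real_normed_vector) => ennreal" where
 "psq t u \<equiv> \<integral>\<^sup>+s\<in>{0..t}. ennreal (nsq (u s)) \<partial>lborel"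

abbreviation (in stochastic_basis) progressive :: "(real => 'a => 'b::topological_space) => bool" where
 "progressive \<equiv> progressively_measurable F"

section \<open>Joint measurability of continuous processes\<close>

lemma floor_approximation:
 fixes t :: real and n :: nat
 assumes t: "0 <= t"
 defines "r \<equiv> real_of_int \<lfloor>real (Suc n) * t\<rfloor> / real (Suc n)"
 shows "0 <= r" "r <= t" "t - r <= 1 / real (Suc n)"
proof -
 have a: "r * real (Suc n) = real_of_int \<lfloor>real (Suc n) * t\<rfloor>" by (simp add: r_def)
 show "0 <= r" using t by (simp add: r_def)
 have "r * real (Suc n) <= t * real (Suc n)" unfolding a by (metis mult.commute of_int_floor_le)
 then show "r <= t" by simp
 have "t * real (Suc n) <= (r + 1 / real (Suc n)) * real (Suc n)"
  unfolding distrib_right a by (simp add: field_simps) linarith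
 then show "t - r <= 1 / real (Suc n)" by (subst (asm) mult_le_cancel_right) auto
qed

text \<open>Rounding time down to the grid of mesh 1/(n+1) leaves countably many time sections, each
  of them measurable; continuity of the paths lets n tend to infinity. Rounding down keeps the
  rounded time inside \<open>{0..T}\<close>, where the sections are known to be measurable. With
  \<open>N = F T\<close> this yields progressive measurability.\<close>

lemma borel_measurable_caratheodory:
 fixes X :: "real => 'a => 'b::metric_space"
 assumes cont: "\<And>w. w \<in> space N ==> continuous_on {0..T} (\<lambda>t. X t w)"
  and meas: "\<And>t. 0 <= t ==> t <= T ==> X t \<in> borel_measurable N"
 shows "(\<lambda>(t, w). X t w) \<in> borel_measurable (restrict_space borel {0..T} \<Otimes>\<^sub>M N)"
proof -
 let ?R = "restrict_space borel {0..T} \<Otimes>\<^sub>M N"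
 define r where "r n t = real_of_int \<lfloor>real (Suc n) * t\<rfloor> / real (Suc n)" for n t
 have r: "0 <= r n t" "r n t <= t" "t - r n t <= 1 / real (Suc n)" if "0 <= t" for n t
  unfolding r_def by (rule floor_approximation[OF that])+
 have 1: "(\<lambda>p. X (r n (fst p)) (snd p)) \<in> borel_measurable ?R" for n
 proof -
  have fl: "(\<lambda>p. \<lfloor>real (Suc n) * fst p\<rfloor>) \<in> measurable ?R (count_space UNIV)"
  proof -
   have [measurable]: "fst \<in> borel_measurable ?R"
    by (rule measurable_compose[OF measurable_fst measurable_restrict_space1]) simp
   show ?thesis by measurable
  qed
  \<comment> \<open>Grid points outside \<open>[0, T]\<close> do not occur for points of the space,
    but the countable composition asks for a measurable section at every integer; \<open>X 0\<close>
    is the default, available once \<open>0 <= T\<close>.\<close>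
  define h where "h i p = (if 0 <= real_of_int i / real (Suc n) \<and> real_of_int i / real (Suc n) <= T
    then X (real_of_int i / real (Suc n)) (snd p) else X 0 (snd p))" for i and p :: "real \<times> 'a"
  have "(\<lambda>p. h \<lfloor>real (Suc n) * fst p\<rfloor> p) \<in> borel_measurable ?R"
  proof (cases "0 <= T")
   case True
   have "h i \<in> borel_measurable ?R" for i
    unfolding h_def using meas True
    by (cases "0 <= real_of_int i / real (Suc n) \<and> real_of_int i / real (Suc n) <= T")
     (auto intro!: measurable_compose[OF measurable_snd])
   then show ?thesis by (rule measurable_compose_countable[where f = h, OF _ fl])
  next
   case False
   then have "space ?R = {}" by (simp add: space_pair_measure space_restrict_space)
   then show ?thesis by (auto simp: measurable_def)
  qed
  also have "(\<lambda>p. h \<lfloor>real (Suc n) * fst p\<rfloor> p) \<in> borel_measurable ?R \<longleftrightarrow> ?thesis"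
  proof (rule measurable_cong)
   fix p assume "p \<in> space ?R"
   then have "0 <= fst p" "fst p <= T" by (auto simp: space_pair_measure space_restrict_space)
   with r[of "fst p" n] show "h \<lfloor>real (Suc n) * fst p\<rfloor> p = X (r n (fst p)) (snd p)"
    unfolding h_def r_def by force
  qed
  finally show ?thesis .
 qed
 have 2: "(\<lambda>n. X (r n (fst p)) (snd p)) \<longlonglongrightarrow> X (fst p) (snd p)" if "p \<in> space ?R" for p
 proof -
  have p: "0 <= fst p" "fst p <= T" "snd p \<in> space N"
   using that by (auto simp: space_pair_measure space_restrict_space)
  have "(\<lambda>n. r n (fst p)) \<longlonglongrightarrow> fst p"
  proof (rule tendsto_sandwich[of "\<lambda>n. fst p - 1 / real (Suc n)" _ _ "\<lambda>_. fst p"])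
   have "(\<lambda>n. fst p - 1 / real (Suc n)) \<longlonglongrightarrow> fst p - 0"
    by (intro tendsto_diff tendsto_const LIMSEQ_Suc lim_1_over_n)
   then show "(\<lambda>n. fst p - 1 / real (Suc n)) \<longlonglongrightarrow> fst p" by simp
  qed (use r[OF p(1)] in \<open>auto simp: algebra_simps\<close>)
  moreover have "\<forall>\<^sub>F n in sequentially. r n (fst p) \<in> {0..T}"
   using r[OF p(1)] p(2) by (intro always_eventually) (auto intro: order_trans)
  ultimately show ?thesis
   using p by (intro continuous_on_tendsto_compose[OF cont[OF p(3)]]) auto
 qed
 have "(\<lambda>p. X (fst p) (snd p)) \<in> borel_measurable ?R"
  by (rule borel_measurable_LIMSEQ_metric[OF 1 2])
 then show ?thesis by (simp add: case_prod_beta')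
qed

section \<open>Averaging over dyadic cells\<close>

definition dyad :: "nat => nat => real" where
 "dyad k i = real i / 2 ^ k"

text \<open>Each cell carries the average over the preceding cell, so that the step function is
 predictable; for \<open>i = 0\<close> the preceding cell is empty.\<close>

definition cell_avg :: "nat => (real => 'b::euclidean_space) => nat => 'b" where
 "cell_avg k g i = 2 ^ k *\<^sub>R (LINT u|lborel. indicator {dyad k (i - 1)<..dyad k i} u *\<^sub>R g u)"

text \<open>\<open>k * 2 ^ k\<close> cells of length \<open>1 / 2 ^ k\<close> cover
  \<open>(0, k]\<close>: mesh and horizon improve together, so one index serves every finite time
  interval.\<close>

definition step_avg :: "nat => (real => 'b::euclidean_space) => real => 'b" where
 "step_avg k g s = (\<Sum>i<k * 2 ^ k. indicator {dyad k i<..dyad k (Suc i)} s *\<^sub>R cell_avg k g i)"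

lemma dyad_0 [simp]: "dyad k 0 = 0" by (simp add: dyad_def)

lemma dyad_nonneg [simp]: "0 <= dyad k i" by (simp add: dyad_def)

lemma dyad_mono: "i <= j ==> dyad k i <= dyad k j" by (simp add: dyad_def divide_right_mono)

lemma dyad_Suc: "dyad k (Suc i) = dyad k i + 1 / 2 ^ k" by (simp add: dyad_def add_divide_distrib)

lemma dyad_le_Suc [simp]: "dyad k i <= dyad k (Suc i)" by (simp add: dyad_Suc)

lemma dyad_end [simp]: "dyad k (k * 2 ^ k) = real k" by (simp add: dyad_def)

lemma sum_indicator_cells:
 "(\<Sum>i<n. indicator {dyad k i<..dyad k (Suc i)} s :: 'b::comm_semiring_1) = indicator {0<..dyad k n} s"
proof (induction n)
 case (Suc n)
 have "0 <= dyad k n" "dyad k n <= dyad k (Suc n)" by simp_all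
 then show ?case using Suc by (simp add: indicator_def del: dyad_nonneg dyad_le_Suc)
qed simp

lemma cell_unique:
 assumes "s \<in> {dyad k i<..dyad k (Suc i)}" "s \<in> {dyad k j<..dyad k (Suc j)}"
 shows "i = j"
proof (rule ccontr)
 assume "i \<noteq> j"
 then consider "Suc i <= j" | "Suc j <= i" by linarith
 then show False
  using dyad_mono[of "Suc i" j k] dyad_mono[of "Suc j" i k] assms by cases auto
qed

lemma cell_exists:
 assumes "0 < s" "s <= real k"
 obtains i where "i < k * 2 ^ k" "s \<in> {dyad k i<..dyad k (Suc i)}"
proof -
 have "(\<Sum>i<k * 2 ^ k. indicator {dyad k i<..dyad k (Suc i)} s :: real) = 1"
  using assms unfolding sum_indicator_cells by simp
 then obtain i where "i < k * 2 ^ k" "indicator {dyad k i<..dyad k (Suc i)} s \<noteq> (0::real)"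
  by (metis (no_types, lifting) sum.neutral lessThan_iff zero_neq_one)
 then show ?thesis using that by (auto simp: indicator_def split: if_splits)
qed

lemma step_avg_cell:
 assumes "i < k * 2 ^ k" "s \<in> {dyad k i<..dyad k (Suc i)}"
 shows "step_avg k g s = cell_avg k g i"
proof -
 have "step_avg k g s = (\<Sum>j<k * 2 ^ k. if j = i then cell_avg k g i else 0)"
  unfolding step_avg_def
 proof (intro sum.cong refl)
  fix j assume "j \<in> {..<k * 2 ^ k}"
  show "indicator {dyad k j<..dyad k (Suc j)} s *\<^sub>R cell_avg k g j = (if j = i then cell_avg k g i else 0)"
   using cell_unique[OF assms(2), of j] assms(2) by (cases "j = i") (auto simp: indicator_def)
 qed
 then show ?thesis using assms by simp
qed

lemma step_avg_outside: "s <= 0 \<or> real k < s ==> step_avg k g s = 0"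
proof -
 assume s: "s <= 0 \<or> real k < s"
 have "s \<notin> {dyad k i<..dyad k (Suc i)}" if "i < k * 2 ^ k" for i
 proof -
  have "dyad k (Suc i) <= real k" using dyad_mono[of "Suc i" "k * 2 ^ k" k] that by simp
  moreover have "0 <= dyad k i" by simp
  ultimately show ?thesis using s by (simp del: dyad_nonneg) linarith
 qed
 then show ?thesis by (auto simp: step_avg_def)
qed

lemma dyad_diff: "dyad k i - dyad k (i - 1) <= 1 / 2 ^ k" "dyad k (i - 1) <= dyad k i"
 using dyad_Suc[of k "i - 1"] by (cases i; simp)+

text \<open>If the integrand over the cell is not integrable, the Bochner integral is 0 by
  convention and the bound persists.\<close>

lemma norm_cell_avg_le:
 assumes "\<And>u. norm (g u) <= C" "0 <= C"
 shows "norm (cell_avg k g i) <= C"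
proof (cases "integrable lborel (\<lambda>u. indicator {dyad k (i - 1)<..dyad k i} u *\<^sub>R g u)")
 case True
 have "norm (LINT u|lborel. indicator {dyad k (i - 1)<..dyad k i} u *\<^sub>R g u)
   <= (LINT u|lborel. indicator {dyad k (i - 1)<..dyad k i} u * C)"
 proof (rule Bochner_Integration.integral_norm_bound_integral[OF True])
  show "integrable lborel (\<lambda>u. indicator {dyad k (i - 1)<..dyad k i} u * C)"
   using dyad_diff(2)[of k i] by (intro integrable_mult_left integrable_real_indicator) auto
 qed (use assms(1) in \<open>auto simp: indicator_def\<close>)
 also have "\<dots> = C * (dyad k i - dyad k (i - 1))"
  using dyad_diff(2)[of k i] by simp
 also have "\<dots> <= C * (1 / 2 ^ k)" using dyad_diff(1) assms(2) by (intro mult_left_mono) auto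
 finally show ?thesis by (simp add: cell_avg_def field_simps)
next
 case False
 then show ?thesis using assms(2) by (simp add: cell_avg_def not_integrable_integral_eq)
qed

lemma norm_step_avg_le:
 assumes "\<And>u. norm (g u) <= C" "0 <= C"
 shows "norm (step_avg k g s) <= C"
proof (cases "0 < s \<and> s <= real k")
 case True
 then obtain i where "i < k * 2 ^ k" "s \<in> {dyad k i<..dyad k (Suc i)}" by (auto elim: cell_exists)
 then show ?thesis using norm_cell_avg_le[OF assms] by (simp add: step_avg_cell)
qed (use assms(2) in \<open>auto simp: step_avg_outside\<close>)

lemma step_avg_borel [measurable]: "step_avg k g \<in> borel_measurable borel"
 unfolding step_avg_def by measurable

lemma integrable_cell:
 fixes g :: "real => 'b::euclidean_space"
 assumes "g \<in> borel_measurable borel" "\<And>u. norm (g u) <= C"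
 shows "integrable lborel (\<lambda>u. indicator {a<..b} u *\<^sub>R g u)"
proof -
 have "integrable lborel (\<lambda>u. indicator {a..b} u *\<^sub>R g u)"
  using assms by (intro integrableI_bounded_set_indicator[where B = C]) (auto simp: emeasure_lborel_Icc_eq)
 then have "integrable lborel (\<lambda>u. indicator {a<..b} u *\<^sub>R (indicator {a..b} u *\<^sub>R g u))"
  by (rule integrable_mult_indicator[rotated]) auto
 also have "(\<lambda>u. indicator {a<..b} u *\<^sub>R (indicator {a..b} u *\<^sub>R g u)) = (\<lambda>u. indicator {a<..b} u *\<^sub>R g u)"
  by (auto simp: indicator_def)
 finally show ?thesis .
qed

text \<open>Each cell carries at most the mass of \<open>g\<close> on the preceding cell, and the
  preceding cells are disjoint. The contraction transfers convergence from continuous functions to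
  all bounded measurable ones.\<close>

lemma step_avg_contraction:
 fixes g :: "real => 'b::euclidean_space"
 assumes [measurable]: "g \<in> borel_measurable borel" and C: "\<And>u. norm (g u) <= C"
 shows "(\<integral>\<^sup>+s. ennreal (norm (step_avg k g s)) \<partial>lborel) <= (\<integral>\<^sup>+u. ennreal (norm (g u)) \<partial>lborel)"
proof -
 let ?n = "k * 2 ^ k"
 let ?cell = "\<lambda>i. {dyad k i<..dyad k (Suc i)}"
 have le: "ennreal (norm (cell_avg k g i)) * ennreal (1 / 2 ^ k)
   <= (\<integral>\<^sup>+u. indicator {dyad k (i - 1)<..dyad k i} u * ennreal (norm (g u)) \<partial>lborel)" for i
 proof -
  have "ennreal (norm (cell_avg k g i)) * ennreal (1 / 2 ^ k)
    = ennreal (norm (LINT u|lborel. indicator {dyad k (i - 1)<..dyad k i} u *\<^sub>R g u))"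
   unfolding cell_avg_def by (subst ennreal_mult[symmetric]) (auto simp: field_simps)
  also have "\<dots> <= (\<integral>\<^sup>+u. norm (indicator {dyad k (i - 1)<..dyad k i} u *\<^sub>R g u) \<partial>lborel)"
   by (intro integral_norm_bound_ennreal integrable_cell[OF _ C]) simp
  also have "\<dots> = (\<integral>\<^sup>+u. indicator {dyad k (i - 1)<..dyad k i} u * ennreal (norm (g u)) \<partial>lborel)"
   by (intro nn_integral_cong) (auto simp: indicator_def)
  finally show ?thesis .
 qed
 have "(\<integral>\<^sup>+s. ennreal (norm (step_avg k g s)) \<partial>lborel)
   <= (\<integral>\<^sup>+s. (\<Sum>i<?n. ennreal (norm (cell_avg k g i)) * indicator (?cell i) s) \<partial>lborel)"
 proof (rule nn_integral_mono)
  fix s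
  have "norm (step_avg k g s) <= (\<Sum>i<?n. norm (cell_avg k g i) * indicator (?cell i) s)"
   unfolding step_avg_def by (rule order_trans[OF norm_sum]) (auto intro!: sum_mono simp: mult.commute)
  then have "ennreal (norm (step_avg k g s)) <= ennreal (\<Sum>i<?n. norm (cell_avg k g i) * indicator (?cell i) s)"
   by (rule ennreal_leI)
  also have "\<dots> = (\<Sum>i<?n. ennreal (norm (cell_avg k g i)) * indicator (?cell i) s)"
   by (subst sum_ennreal[symmetric]) (auto intro!: sum.cong simp: ennreal_mult' ennreal_indicator)
  finally show "ennreal (norm (step_avg k g s)) <= (\<Sum>i<?n. ennreal (norm (cell_avg k g i)) * indicator (?cell i) s)" .
 qed
 also have "\<dots> = (\<Sum>i<?n. ennreal (norm (cell_avg k g i)) * ennreal (1 / 2 ^ k))"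
  by (subst nn_integral_sum) (auto simp: nn_integral_cmult dyad_Suc)
 also have "\<dots> <= (\<Sum>i<?n. \<integral>\<^sup>+u. indicator {dyad k (i - 1)<..dyad k i} u * ennreal (norm (g u)) \<partial>lborel)"
  by (intro sum_mono le)
 also have "\<dots> = (\<integral>\<^sup>+u. (\<Sum>i<?n. indicator {dyad k (i - 1)<..dyad k i} u) * ennreal (norm (g u)) \<partial>lborel)"
  unfolding sum_distrib_right by (subst nn_integral_sum) auto
 also have "\<dots> <= (\<integral>\<^sup>+u. 1 * ennreal (norm (g u)) \<partial>lborel)"
 proof (intro nn_integral_mono mult_right_mono)
  fix u
  show "(\<Sum>i<?n. indicator {dyad k (i - 1)<..dyad k i} u) <= (1::ennreal)"
  proof (cases ?n)
   case (Suc m)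
   \<comment> \<open>For \<open>i = 0\<close> truncated subtraction makes the preceding cell empty;
     the others are the cells with indices 0 to m - 1.\<close>
   have "(\<Sum>i<?n. indicator {dyad k (i - 1)<..dyad k i} u) = (indicator {0<..dyad k m} u :: ennreal)"
    unfolding Suc sum.lessThan_Suc_shift diff_Suc_1 sum_indicator_cells by simp
   then show ?thesis by (simp add: indicator_def)
  qed simp
 qed simp
 finally show ?thesis by simp
qed

lemma step_avg_tendsto:
 fixes h :: "real => 'b::euclidean_space"
 assumes h: "continuous_on UNIV h" and C: "\<And>u. norm (h u) <= C" and s: "0 < s"
 shows "(\<lambda>k. step_avg k h s) \<longlonglongrightarrow> h s"
proof (rule LIMSEQ_I)
 fix e :: real assume "0 < e"
 then obtain d where d: "0 < d" "\<And>u. dist u s < d ==> dist (h u) (h s) < e / 2"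
  using h unfolding continuous_on_iff by (metis UNIV_I half_gt_zero)
 \<comment> \<open>Since k < 2^k, these bounds put s inside the grid and beyond the first cell,
   whose preceding cell is empty, and they put its cell and the preceding one within d of s.\<close>
 obtain K where K: "real K > s" "real K > 2 / d" "real K > 1 / s"
  by (metis less_trans max_less_iff_conj reals_Archimedean2)
 have [measurable]: "h \<in> borel_measurable borel" using h by (rule borel_measurable_continuous_onI)
 show "\<exists>no. \<forall>k\<ge>no. norm (step_avg k h s - h s) < e"
 proof (intro exI allI impI)
  fix k assume k: "K <= k"
  have pk: "real k < 2 ^ k" by (rule of_nat_less_two_power)
  obtain i where i: "i < k * 2 ^ k" "s \<in> {dyad k i<..dyad k (Suc i)}"
   using s K k by (force elim: cell_exists[of s k])
  have k1: "1 / s < 2 ^ k" "2 / d < 2 ^ k" using K k pk by linarith+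
  have "1 / 2 ^ k < s" "2 / 2 ^ k < d" using k1 s d(1) by (simp_all add: field_simps)
  have "i \<noteq> 0" 
  proof
   assume "i = 0" with i(2) \<open>1 / 2 ^ k < s\<close> show False by (simp add: dyad_Suc)
  qed
  then obtain j where j: "i = Suc j" by (cases i) auto
  have len: "dyad k (Suc j) = dyad k j + 1 / 2 ^ k" by (rule dyad_Suc)
  have near: "dist (h u) (h s) < e / 2" if "u \<in> {dyad k j<..dyad k i}" for u
   using that i(2) \<open>2 / 2 ^ k < d\<close> unfolding j dyad_Suc by (intro d(2)) (auto simp: dist_real_def)
  let ?I = "indicator {dyad k j<..dyad k i} :: real => real"
  have int: "integrable lborel (\<lambda>u. ?I u *\<^sub>R h u)" "integrable lborel (\<lambda>u. ?I u *\<^sub>R h s)"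
   by (rule integrable_cell[OF _ C], simp, rule integrable_cell[where C = C], auto intro: C)
  have "step_avg k h s - h s = 2 ^ k *\<^sub>R (LINT u|lborel. ?I u *\<^sub>R h u) - 2 ^ k *\<^sub>R (LINT u|lborel. ?I u *\<^sub>R h s)"
   unfolding step_avg_cell[OF i] cell_avg_def j by (simp add: len)
  also have "\<dots> = 2 ^ k *\<^sub>R (LINT u|lborel. ?I u *\<^sub>R h u - ?I u *\<^sub>R h s)"
   by (subst Bochner_Integration.integral_diff[OF int]) (simp add: scaleR_diff_right)
  finally have "norm (step_avg k h s - h s) = 2 ^ k * norm (LINT u|lborel. ?I u *\<^sub>R h u - ?I u *\<^sub>R h s)"
   by simp
  also have "\<dots> <= 2 ^ k * (LINT u|lborel. ?I u * (e / 2))"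
  proof (intro mult_left_mono Bochner_Integration.integral_norm_bound_integral Bochner_Integration.integrable_diff int)
   show "integrable lborel (\<lambda>u. ?I u * (e / 2))"
    using integrable_cell[of "\<lambda>_. e / 2" "e / 2" "dyad k j" "dyad k i"] \<open>0 < e\<close> by simp
   show "norm (?I u *\<^sub>R h u - ?I u *\<^sub>R h s) <= ?I u * (e / 2)" for u
    using near[of u] by (auto simp: indicator_def dist_norm)
  qed simp
  also have "\<dots> = e / 2" by (simp add: j len)
  finally show "norm (step_avg k h s - h s) < e" using \<open>0 < e\<close> by simp
 qed
qed

lemma cell_avg_diff:
 fixes g h :: "real => 'b::euclidean_space"
 assumes "g \<in> borel_measurable borel" "\<And>u. norm (g u) <= C"
  and "h \<in> borel_measurable borel" "\<And>u. norm (h u) <= C"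
 shows "cell_avg k (\<lambda>u. g u - h u) i = cell_avg k g i - cell_avg k h i"
 unfolding cell_avg_def
 by (simp add: scaleR_diff_right integrable_cell[OF assms(1,2)] integrable_cell[OF assms(3,4)])

lemma step_avg_diff:
 fixes g h :: "real => 'b::euclidean_space"
 assumes "g \<in> borel_measurable borel" "\<And>u. norm (g u) <= C"
  and "h \<in> borel_measurable borel" "\<And>u. norm (h u) <= C"
 shows "step_avg k (\<lambda>u. g u - h u) s = step_avg k g s - step_avg k h s"
 unfolding step_avg_def by (simp add: cell_avg_diff[OF assms] scaleR_diff_right sum_subtractf)

lemma cell_avg_local:
 assumes "\<And>u. 0 < u ==> u <= dyad k i ==> g u = h u"
 shows "cell_avg k g i = cell_avg k h i"
 unfolding cell_avg_def using assms
 by (intro arg_cong[where f = "\<lambda>x. 2 ^ k *\<^sub>R x"] Bochner_Integration.integral_cong refl)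
  (auto simp: indicator_def intro: le_less_trans[OF dyad_nonneg])

text \<open>Causality of the averages: an integrand can be cut off after a horizon without changing
  them before it. The cellwise form gives the adaptedness of the cell values.\<close>

lemma step_avg_local:
 assumes "\<And>u. 0 < u ==> u < s ==> g u = h u"
 shows "step_avg k g s = step_avg k h s"
 unfolding step_avg_def
proof (intro sum.cong refl)
 fix i assume "i \<in> {..<k * 2 ^ k}"
 show "indicator {dyad k i<..dyad k (Suc i)} s *\<^sub>R cell_avg k g i
   = indicator {dyad k i<..dyad k (Suc i)} s *\<^sub>R cell_avg k h i"
  using assms by (cases "dyad k i < s") (auto simp: indicator_def intro!: cell_avg_local)
qed

lemma ennreal_tendsto_0I:
 fixes X :: "'c => ennreal"
 assumes "\<And>e::real. 0 < e ==> \<forall>\<^sub>F k in F. X k <= ennreal e"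
 shows "(X \<longlongrightarrow> 0) F"
proof (rule order_tendstoI)
 fix a :: ennreal assume "0 < a"
 then obtain b where b: "0 < b" "b < a" using dense by blast
 then have "b < top" using order.strict_trans top.not_eq_extremum by blast
 with b have "b = ennreal (enn2real b)" "0 < enn2real b"
  by (auto simp: enn2real_positive_iff)
 then have "\<forall>\<^sub>F k in F. X k <= b" using assms by metis
 then show "\<forall>\<^sub>F k in F. X k < a" by eventually_elim (use b in auto)
qed simp

text \<open>A measurable function is almost everywhere a limit of continuous ones. Projecting these
  onto the ball of radius \<open>C\<close> keeps them continuous and convergent and makes dominated
  convergence available on \<open>{0..T}\<close>.\<close>

lemma continuous_approximation_L1:
 fixes g :: "real => 'b::euclidean_space"
 assumes g [measurable]: "g \<in> borel_measurable borel" and C: "\<And>u. norm (g u) <= C" and e: "0 < e"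
 obtains h where "continuous_on UNIV h" "\<And>u. norm (h u) <= C"
  "(\<integral>\<^sup>+s\<in>{0..T}. ennreal (norm (g s - h s)) \<partial>lborel) <= ennreal e"
proof -
 have C0: "0 <= C" using C[of 0] norm_ge_zero order_trans by blast
 have "g \<in> borel_measurable lebesgue" using g by (simp add: measurable_completion)
 then have "g measurable_on UNIV" by (intro lebesgue_measurable_imp_measurable_on) auto
 then obtain N h where N: "negligible N" and h: "\<And>n. continuous_on UNIV (h n :: real => 'b)"
  and lim: "\<And>x. x \<notin> N ==> (\<lambda>n. h n x) \<longlonglongrightarrow> g x"
  unfolding measurable_on_def by auto
 define c where "c n x = closest_point (cball 0 C) (h n x)" for n x
 have cont: "continuous_on UNIV (c n)" for n
  unfolding c_def using continuous_on_compose[OF h[of n] continuous_on_closest_point[of "cball 0 C"]] C0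
  by (auto simp: o_def)
 have cC: "norm (c n x) <= C" for n x
  using closest_point_in_set[of "cball (0::'b) C" "h n x"] C0 by (auto simp: c_def)
 have [measurable]: "c n \<in> borel_measurable borel" for n
  using cont by (rule borel_measurable_continuous_onI)
 have clim: "(\<lambda>n. c n x) \<longlonglongrightarrow> g x" if "x \<notin> N" for x
 proof -
  have "(\<lambda>n. closest_point (cball 0 C) (h n x)) \<longlonglongrightarrow> closest_point (cball 0 C) (g x)"
   using C0 by (intro continuous_on_tendsto_compose[OF _ lim[OF that], where s = UNIV] continuous_on_closest_point) auto
  then show ?thesis using C[of x] by (simp add: c_def closest_point_self)
 qed
 have "(\<lambda>n. \<integral>\<^sup>+s\<in>{0..T}. ennreal (norm (g s - c n s)) \<partial>lborel) \<longlonglongrightarrow> (\<integral>\<^sup>+s. 0 \<partial>(lborel :: real measure))"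
 proof (rule nn_integral_dominated_convergence[where w = "\<lambda>s. ennreal (2 * C) * indicator {0..T} s"])
  show "AE s in lborel. ennreal (norm (g s - c n s)) * indicator {0..T} s <= ennreal (2 * C) * indicator {0..T} s" for n
   by (intro AE_I2 mult_right_mono ennreal_leI order_trans[OF norm_triangle_ineq4]) (use C cC in \<open>auto intro: add_mono[of _ C _ C, simplified]\<close>)
  show "(\<integral>\<^sup>+s. ennreal (2 * C) * indicator {0..T} s \<partial>lborel) < \<infinity>"
   by (simp add: nn_integral_cmult ennreal_mult_less_top emeasure_lborel_Icc_eq)
  have "AE s in lborel. s \<notin> N"
   using N AE_not_in[of N lebesgue] by (simp add: negligible_iff_null_sets AE_completion_iff)
  then show "AE s in lborel. (\<lambda>n. ennreal (norm (g s - c n s)) * indicator {0..T} s) \<longlonglongrightarrow> 0"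
  proof eventually_elim
   fix s assume "s \<notin> N"
   then have "(\<lambda>n. ennreal (norm (g s - c n s))) \<longlonglongrightarrow> ennreal (norm (g s - g s))"
    by (intro tendsto_ennrealI tendsto_norm tendsto_diff tendsto_const clim)
   then show "(\<lambda>n. ennreal (norm (g s - c n s)) * indicator {0..T} s) \<longlonglongrightarrow> 0"
    by (cases "s \<in> {0..T}") auto
  qed
 qed simp_all
 then have "(\<lambda>n. \<integral>\<^sup>+s\<in>{0..T}. ennreal (norm (g s - c n s)) \<partial>lborel) \<longlonglongrightarrow> 0" by simp
 then have "\<forall>\<^sub>F n in sequentially. (\<integral>\<^sup>+s\<in>{0..T}. ennreal (norm (g s - c n s)) \<partial>lborel) < ennreal e"
  using e by (intro order_tendstoD) auto
 then obtain n where "(\<integral>\<^sup>+s\<in>{0..T}. ennreal (norm (g s - c n s)) \<partial>lborel) <= ennreal e"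
  by (meson eventually_happens' less_imp_le sequentially_bot)
 then show ?thesis using that cont cC by blast
qed

lemma step_avg_tendsto_L1:
 fixes g :: "real => 'b::euclidean_space"
 assumes g [measurable]: "g \<in> borel_measurable borel" and C: "\<And>u. norm (g u) <= C"
 shows "(\<lambda>k. \<integral>\<^sup>+s\<in>{0..T}. ennreal (norm (step_avg k g s - g s)) \<partial>lborel) \<longlonglongrightarrow> 0"
proof (rule ennreal_tendsto_0I)
 let ?d = "\<lambda>k h s. norm (step_avg k h s - h s)"
 let ?e = "\<lambda>k h s. norm (step_avg k g s - step_avg k h s)"
 fix e :: real assume "0 < e"
 have C0: "0 <= C" using C[of 0] norm_ge_zero order_trans by blast
 obtain h where cont: "continuous_on UNIV h" and hC: "\<And>u. norm (h u) <= C"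
  and gh: "(\<integral>\<^sup>+s\<in>{0..T}. ennreal (norm (g s - h s)) \<partial>lborel) <= ennreal (e / 3)"
  using continuous_approximation_L1[OF g C, of "e / 3"] \<open>0 < e\<close> by (metis divide_pos_pos zero_less_numeral)
 have [measurable]: "h \<in> borel_measurable borel"
  using cont by (rule borel_measurable_continuous_onI)
 have 1: "(\<integral>\<^sup>+s\<in>{0..T}. ennreal (?e k h s) \<partial>lborel) <= ennreal (e / 3)" for k
 proof -
  \<comment> \<open>The cut-off to \<open>(0, T]\<close> makes the contraction, which concerns the
    whole line, cost only the error on \<open>{0..T}\<close>; by causality the averages on
    \<open>{0..T}\<close> are unchanged.\<close>
  let ?d = "\<lambda>u. indicator {0<..T} u *\<^sub>R (g u - h u)"
  have "step_avg k g s - step_avg k h s = step_avg k ?d s" if "s \<in> {0..T}" for s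
   using that by (subst step_avg_diff[OF g C _ hC, symmetric]) (auto simp: indicator_def intro!: step_avg_local)
  then have "(\<integral>\<^sup>+s\<in>{0..T}. ennreal (?e k h s) \<partial>lborel)
    <= (\<integral>\<^sup>+s. ennreal (norm (step_avg k ?d s)) \<partial>lborel)"
   by (intro nn_integral_mono) (auto simp: indicator_def)
  also have "\<dots> <= (\<integral>\<^sup>+s. ennreal (norm (?d s)) \<partial>lborel)"
   by (rule step_avg_contraction[where C = "2 * C"])
    (use add_mono[OF C hC] C0 in \<open>auto simp: indicator_def intro: order_trans[OF norm_triangle_ineq4]\<close>)
  also have "\<dots> <= (\<integral>\<^sup>+s\<in>{0..T}. ennreal (norm (g s - h s)) \<partial>lborel)"
   by (intro nn_integral_mono) (auto simp: indicator_def)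
  finally show ?thesis using gh by simp
 qed
 have "(\<lambda>k. \<integral>\<^sup>+s\<in>{0..T}. ennreal (?d k h s) \<partial>lborel) \<longlonglongrightarrow> (\<integral>\<^sup>+s. 0 \<partial>(lborel :: real measure))"
 proof (rule nn_integral_dominated_convergence[where w = "\<lambda>s. ennreal (2 * C) * indicator {0..T} s"])
  show "AE s in lborel. ennreal (?d k h s) * indicator {0..T} s <= ennreal (2 * C) * indicator {0..T} s" for k
   by (intro AE_I2 mult_right_mono ennreal_leI order_trans[OF norm_triangle_ineq4])
    (use norm_step_avg_le[OF hC C0] hC in \<open>auto intro: add_mono[of _ C _ C, simplified]\<close>)
  show "(\<integral>\<^sup>+s. ennreal (2 * C) * indicator {0..T} s \<partial>lborel) < \<infinity>"
   by (simp add: nn_integral_cmult ennreal_mult_less_top emeasure_lborel_Icc_eq)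
  show "AE s in lborel. (\<lambda>k. ennreal (?d k h s) * indicator {0..T} s) \<longlonglongrightarrow> 0"
   using AE_lborel_singleton[of 0]
  proof eventually_elim
   fix s :: real assume "s \<noteq> 0"
   show "(\<lambda>k. ennreal (?d k h s) * indicator {0..T} s) \<longlonglongrightarrow> 0"
   proof (cases "s \<in> {0..T}")
    case True
    then have "(\<lambda>k. ennreal (?d k h s)) \<longlonglongrightarrow> ennreal (norm (h s - h s))"
     using \<open>s \<noteq> 0\<close> by (intro tendsto_ennrealI tendsto_norm tendsto_diff tendsto_const step_avg_tendsto[OF cont hC]) auto
    then show ?thesis using True by simp
   qed simp
  qed
 qed simp_all
 then have "(\<lambda>k. \<integral>\<^sup>+s\<in>{0..T}. ennreal (?d k h s) \<partial>lborel) \<longlonglongrightarrow> 0" by simp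
 then have "\<forall>\<^sub>F k in sequentially. (\<integral>\<^sup>+s\<in>{0..T}. ennreal (?d k h s) \<partial>lborel) < ennreal (e / 3)"
  using \<open>0 < e\<close> by (intro order_tendstoD) auto
 then show "\<forall>\<^sub>F k in sequentially. (\<integral>\<^sup>+s\<in>{0..T}. ennreal (?d k g s) \<partial>lborel) <= ennreal e"
 proof eventually_elim
  fix k assume k: "(\<integral>\<^sup>+s\<in>{0..T}. ennreal (?d k h s) \<partial>lborel) < ennreal (e / 3)"
  have "(\<integral>\<^sup>+s\<in>{0..T}. ennreal (?d k g s) \<partial>lborel)
    <= (\<integral>\<^sup>+s. ennreal (?e k h s) * indicator {0..T} s
      + (ennreal (?d k h s) * indicator {0..T} s
       + ennreal (norm (g s - h s)) * indicator {0..T} s) \<partial>lborel)"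
  proof (rule nn_integral_mono)
   fix s
   have "norm (step_avg k g s - g s)
     <= norm (step_avg k g s - step_avg k h s) + (norm (step_avg k h s - h s) + norm (g s - h s))"
    using norm_triangle_ineq[of "step_avg k g s - step_avg k h s" "step_avg k h s - g s"]
     norm_triangle_ineq[of "step_avg k h s - h s" "h s - g s"] norm_minus_commute[of "h s" "g s"] by simp
   then have "ennreal (?d k g s)
     <= ennreal (?e k h s) + (ennreal (?d k h s) + ennreal (norm (g s - h s)))"
    by (simp add: ennreal_plus[symmetric] del: ennreal_plus)
   then show "ennreal (?d k g s) * indicator {0..T} s
     <= ennreal (?e k h s) * indicator {0..T} s
      + (ennreal (?d k h s) * indicator {0..T} s
       + ennreal (norm (g s - h s)) * indicator {0..T} s)"
    by (auto simp: indicator_def)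
  qed
  also have "\<dots> <= ennreal (e / 3) + (ennreal (e / 3) + ennreal (e / 3))"
   using 1[of k] k gh by (subst nn_integral_add, simp, simp)+ (intro add_mono, auto)
  also have "\<dots> = ennreal e" using \<open>0 < e\<close> by (simp add: ennreal_plus[symmetric] del: ennreal_plus)
  finally show "(\<integral>\<^sup>+s\<in>{0..T}. ennreal (?d k g s) \<partial>lborel) <= ennreal e" .
 qed
qed

text \<open>With everything bounded by \<open>C\<close>, the squared error is at most
  \<open>2 * C\<close> times the error, so convergence in the first mean is enough.\<close>

lemma step_avg_tendsto_L2:
 fixes g :: "real => 'b::euclidean_space"
 assumes g [measurable]: "g \<in> borel_measurable borel" and C: "\<And>u. norm (g u) <= C"
 shows "(\<lambda>k. psq T (\<lambda>s. step_avg k g s - g s)) \<longlonglongrightarrow> 0"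
proof (rule tendsto_sandwich[OF _ _ tendsto_const])
 have C0: "0 <= C" using C[of 0] norm_ge_zero order_trans by blast
 show "(\<lambda>k. ennreal (2 * C) * (\<integral>\<^sup>+s\<in>{0..T}. ennreal (norm (step_avg k g s - g s)) \<partial>lborel)) \<longlonglongrightarrow> 0"
  using tendsto_mult_ennreal[OF tendsto_const step_avg_tendsto_L1[OF g C], of "ennreal (2 * C)" T] by simp
 show "\<forall>\<^sub>F k in sequentially. (psq T (\<lambda>s. step_avg k g s - g s))
   <= ennreal (2 * C) * (\<integral>\<^sup>+s\<in>{0..T}. ennreal (norm (step_avg k g s - g s)) \<partial>lborel)"
 proof (rule always_eventually, rule allI)
  fix k
  have "norm (step_avg k g s - g s) <= 2 * C" for s
   using norm_triangle_ineq4[of "step_avg k g s" "g s"] norm_step_avg_le[where g = g and C = C, OF C C0, where k = k and s = s] C[of s] by simp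
  then have "nsq (step_avg k g s - g s) <= 2 * C * norm (step_avg k g s - g s)" for s
   unfolding power2_eq_square by (intro mult_right_mono) auto
  then have "ennreal (nsq (step_avg k g s - g s)) <= ennreal (2 * C) * ennreal (norm (step_avg k g s - g s))" for s
   using C0 by (subst ennreal_mult[symmetric]) (auto intro: ennreal_leI)
  then show "psq T (\<lambda>s. step_avg k g s - g s)
   <= ennreal (2 * C) * (\<integral>\<^sup>+s\<in>{0..T}. ennreal (norm (step_avg k g s - g s)) \<partial>lborel)"
   by (subst nn_integral_cmult[symmetric]) (auto intro!: nn_integral_mono simp: indicator_def)
 qed
qed simp

section \<open>Brownian increments\<close>

lemma measurable_vec_nth [measurable]: "(\<lambda>x. x $ i) \<in> borel_measurable borel"
 for i :: "'n::finite" and x :: "'b::euclidean_space ^ 'n"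
 by (intro borel_measurable_continuous_onI continuous_intros)

lemma Basis_real_vec: "(Basis :: (real ^ 'n) set) = range (\<lambda>i. axis i 1)"
 by (auto simp: Basis_vec_def)

text \<open>Lebesgue measure on vectors is the image of a product measure indexed by the basis
  vectors, so product integrands factor. This reduces Gaussian moments of increments to dimension
  one.\<close>

lemma integral_lborel_vec_prod:
 fixes \<phi> :: "'n::finite => real => real"
 assumes "\<And>i. integrable lborel (\<phi> i)"
 shows "has_bochner_integral lborel (\<lambda>z :: real ^ 'n. \<Prod>i\<in>UNIV. \<phi> i (z $ i)) (\<Prod>i\<in>UNIV. LINT x|lborel. \<phi> i x)"
proof -
 interpret product_sigma_finite "\<lambda>b :: real ^ 'n. lborel :: real measure" by standard
 \<comment> \<open>\<open>J\<close> recovers the coordinate from its basis vector and so translates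
   products over \<open>Basis\<close> into products over coordinates.\<close>
 define J :: "real ^ 'n => 'n" where "J = the_inv (\<lambda>i. axis i 1)"
 have inj: "inj (\<lambda>i :: 'n. axis i (1::real))" by (auto simp: inj_on_def axis_eq_axis)
 have J: "J (axis i 1) = i" for i unfolding J_def by (rule the_inv_f_f[OF inj])
 have re: "(\<Prod>b\<in>Basis. h (J b) b) = (\<Prod>i\<in>UNIV. h i (axis i 1))" for h :: "'n => real ^ 'n => real"
  unfolding Basis_real_vec by (simp add: prod.reindex[OF inj] J)
 let ?P = "\<Pi>\<^sub>M b\<in>(Basis :: (real ^ 'n) set). (lborel :: real measure)"
 let ?m = "\<lambda>f :: real ^ 'n => real. \<Sum>b\<in>Basis. f b *\<^sub>R b"
 have [measurable]: "\<phi> i \<in> borel_measurable borel" for i using assms[of i] by auto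
 have nth: "?m f $ i = f (axis i 1)" for f i
 proof -
  have "?m f = (\<Sum>j\<in>UNIV. f (axis j 1) *\<^sub>R axis j 1)"
   unfolding Basis_real_vec by (subst sum.reindex[OF inj]) simp
  also have "\<dots> $ i = (\<Sum>j\<in>UNIV. if j = i then f (axis j 1) else 0)"
   unfolding sum_component by (intro sum.cong) (auto simp: axis_def)
  finally show ?thesis by simp
 qed
 have 1: "integrable ?P (\<lambda>f. \<Prod>b\<in>Basis. \<phi> (J b) (f b))" by (rule product_integrable_prod) (use assms in auto)
 have 2: "(\<integral>f. (\<Prod>b\<in>Basis. \<phi> (J b) (f b)) \<partial>?P) = (\<Prod>b\<in>Basis. LINT x|lborel. \<phi> (J b) x)"
  by (rule product_integral_prod) (use assms in auto)
 have eq: "(\<Prod>i\<in>UNIV. \<phi> i (?m f $ i)) = (\<Prod>b\<in>Basis. \<phi> (J b) (f b))" for f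
  unfolding nth by (rule re[of "\<lambda>i b. \<phi> i (f b)", symmetric])
 have m [measurable]: "?m \<in> measurable ?P borel" by measurable
 have [measurable]: "(\<lambda>z :: real ^ 'n. \<Prod>i\<in>UNIV. \<phi> i (z $ i)) \<in> borel_measurable borel" by measurable
 have "integrable lborel (\<lambda>z :: real ^ 'n. \<Prod>i\<in>UNIV. \<phi> i (z $ i))"
  by (subst lborel_eq, subst integrable_distr_eq[OF m]) (simp_all only: eq 1, measurable)
 moreover have "(LINT z|lborel. (\<Prod>i\<in>UNIV. \<phi> i ((z :: real ^ 'n) $ i))) = (\<Prod>i\<in>UNIV. LINT x|lborel. \<phi> i x)"
  by (subst lborel_eq, subst integral_distr[OF m], measurable) (simp only: eq 2 re[of "\<lambda>i b. LINT x|lborel. \<phi> i x"])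
 ultimately show ?thesis by (simp add: has_bochner_integral_iff)
qed

locale brownian_basis = stochastic_basis M F for M :: "'a measure" and F +
 fixes B :: "real => 'a => real ^ 'd"
 assumes brownian: "brownian_motion M F B"
begin

lemma measurable_F_mono: "X \<in> measurable (F s) N ==> s <= t ==> X \<in> measurable (F t) N"
 using sets_F_mono[of s t] by (auto simp: measurable_def space_F)

lemma measurable_F_M: "X \<in> measurable (F s) N ==> 0 <= s ==> X \<in> measurable M N"
 using sets_F_subset[of s] by (auto simp: measurable_def space_F)

lemma B_measurable: "0 <= t ==> B t \<in> borel_measurable (F t)"
 using brownian by (simp add: brownian_motion_def)

text \<open>Independence of the increment from \<open>F s\<close> is given for \<sigma>-algebras.
  The preimage families of \<open>U\<close> and of \<psi> of the increment lie in them and are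
  stable under intersection, so the two random variables are independent and expectations
  factor.\<close>

lemma increment_indep:
 assumes st: "0 <= s" "s < t" and U: "U \<in> borel_measurable (F s)" "integrable M (U :: 'a => real)"
  and \<psi>: "\<psi> \<in> borel_measurable borel" "integrable M (\<lambda>w. \<psi> (B t w - B s w) :: real)"
 shows "integrable M (\<lambda>w. U w * \<psi> (B t w - B s w))"
  and "expectation (\<lambda>w. U w * \<psi> (B t w - B s w)) = expectation U * expectation (\<lambda>w. \<psi> (B t w - B s w))"
proof -
 let ?D = "\<lambda>w. B t w - B s w"
 have ind: "indep_set (sets (F s)) (sets (vimage_algebra (space M) ?D borel))"
  using brownian st by (auto simp: brownian_motion_def)
 have D: "?D \<in> borel_measurable M"
  using st by (intro borel_measurable_diff measurable_F_M[OF B_measurable]) auto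
 have "indep_var borel U borel (\<lambda>w. \<psi> (?D w))"
  unfolding indep_var_eq
 proof (intro conjI indep_set_sigma_sets)
  show "random_variable borel U" using U measurable_F_M st by blast
  show "random_variable borel (\<lambda>w. \<psi> (?D w))" using \<psi>(1) D by simp
  show "indep_set {U -` A \<inter> space M |A. A \<in> sets borel} {(\<lambda>w. \<psi> (?D w)) -` A \<inter> space M |A. A \<in> sets borel}"
  proof (rule indep_setI)
   have 1: "{U -` A \<inter> space M |A. A \<in> sets borel} \<subseteq> sets (F s)"
    using measurable_sets[OF U(1)] by (auto simp: space_F)
   have 2: "{(\<lambda>w. \<psi> (?D w)) -` A \<inter> space M |A. A \<in> sets borel} \<subseteq> sets (vimage_algebra (space M) ?D borel)"
   proof safe
    fix A :: "real set" assume "A \<in> sets borel"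
    then have "\<psi> -` A \<in> sets borel" using measurable_sets_borel[OF \<psi>(1)] by simp
    moreover have "(\<lambda>w. \<psi> (?D w)) -` A \<inter> space M = ?D -` (\<psi> -` A) \<inter> space M" by auto
    ultimately show "(\<lambda>w. \<psi> (?D w)) -` A \<inter> space M \<in> sets (vimage_algebra (space M) ?D borel)"
     by (simp add: in_vimage_algebra)
   qed
   show "{U -` A \<inter> space M |A. A \<in> sets borel} \<subseteq> events" 
    using 1 sets_F_subset[OF st(1)] by auto
   show "{(\<lambda>w. \<psi> (?D w)) -` A \<inter> space M |A. A \<in> sets borel} \<subseteq> events"
    using 2 indep_setD_ev2[OF ind] by auto
   show "prob (a \<inter> b) = prob a * prob b" if "a \<in> {U -` A \<inter> space M |A. A \<in> sets borel}"
    "b \<in> {(\<lambda>w. \<psi> (?D w)) -` A \<inter> space M |A. A \<in> sets borel}" for a b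
    by (rule indep_setD[OF ind subsetD[OF 1 that(1)] subsetD[OF 2 that(2)]])
  qed
  have stable: "Int_stable {X -` A \<inter> space M |A. A \<in> sets borel}" for X :: "'a => real"
  proof (rule Int_stableI, safe)
   fix A A' :: "real set" assume "A \<in> sets borel" "A' \<in> sets borel"
   then show "\<exists>C. X -` A \<inter> space M \<inter> (X -` A' \<inter> space M) = X -` C \<inter> space M \<and> C \<in> sets borel"
    by (intro exI[of _ "A \<inter> A'"]) auto
  qed
  show "Int_stable {U -` A \<inter> space M |A. A \<in> sets borel}"
   "Int_stable {(\<lambda>w. \<psi> (?D w)) -` A \<inter> space M |A. A \<in> sets borel}"
   by (rule stable)+
 qed
 from indep_var_lebesgue_integral[OF this U(2) \<psi>(2)] indep_var_integrable[OF this U(2) \<psi>(2)]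
 show "integrable M (\<lambda>w. U w * \<psi> (B t w - B s w))"
  and "expectation (\<lambda>w. U w * \<psi> (B t w - B s w)) = expectation U * expectation (\<lambda>w. \<psi> (B t w - B s w))"
  by simp_all
qed

text \<open>Products of one-variable functions cover all moments that occur: the identity in one or
  two coordinates and 1 in the others gives means and covariances.\<close>

lemma increment_prod_moment:
 assumes st: "0 <= s" "s < t" and \<phi>: "\<And>i. \<phi> i \<in> borel_measurable borel"
  "\<And>i. integrable lborel (\<lambda>x. normal_density 0 (sqrt (t - s)) x * \<phi> i x)"
 shows "has_bochner_integral M (\<lambda>w. \<Prod>i\<in>UNIV. \<phi> i ((B t w - B s w) $ i))
  (\<Prod>i\<in>UNIV. LINT x|lborel. normal_density 0 (sqrt (t - s)) x * \<phi> i x)"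
proof -
 let ?f = "\<lambda>z :: real ^ 'd. \<Prod>i\<in>UNIV. normal_density 0 (sqrt (t - s)) (z $ i)"
 let ?g = "\<lambda>z :: real ^ 'd. \<Prod>i\<in>UNIV. \<phi> i (z $ i)"
 have d: "distributed M lborel (\<lambda>w. B t w - B s w) (\<lambda>z. ennreal (?f z))"
  using brownian st by (auto simp: brownian_motion_def)
 have g [measurable]: "?g \<in> borel_measurable lborel" using \<phi>(1) by measurable
 have pos: "0 <= ?f z" for z by (intro prod_nonneg) auto
 have "has_bochner_integral lborel (\<lambda>z. ?f z * ?g z) (\<Prod>i\<in>UNIV. LINT x|lborel. normal_density 0 (sqrt (t - s)) x * \<phi> i x)"
  using integral_lborel_vec_prod[OF \<phi>(2)] by (simp add: prod.distrib)
 then show ?thesis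
  using distributed_integral[OF d g pos] distributed_integrable[OF d g pos]
  by (simp add: has_bochner_integral_iff)
qed

lemma increment_mean:
 assumes st: "0 <= s" "s < t"
 shows "has_bochner_integral M (\<lambda>w. (B t w - B s w) $ p) 0"
proof -
 let ?\<phi> = "\<lambda>i x::real. if i = p then x else 1"
 have s: "0 < sqrt (t - s)" using st by simp
 have "has_bochner_integral M (\<lambda>w. \<Prod>i\<in>UNIV. ?\<phi> i ((B t w - B s w) $ i))
  (\<Prod>i\<in>UNIV. LINT x|lborel. normal_density 0 (sqrt (t - s)) x * ?\<phi> i x)"
 proof (rule increment_prod_moment[OF st, of ?\<phi>])
  show "integrable lborel (\<lambda>x. normal_density 0 (sqrt (t - s)) x * (if i = p then x else 1))" for i
   using s by (cases "i = p") (simp_all add: integrable_normal_moment_nz_1)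
 qed auto
 moreover have "(LINT x|lborel. normal_density 0 (sqrt (t - s)) x * ?\<phi> i x) = (if i = p then 0 else 1)" for i
  by (auto simp: integral_normal_moment_nz_1[OF s] integral_normal_density[OF s])
 ultimately show ?thesis by (simp add: prod.delta)
qed

lemma increment_cov:
 assumes st: "0 <= s" "s < t"
 shows "has_bochner_integral M (\<lambda>w. (B t w - B s w) $ p * (B t w - B s w) $ q) (if p = q then t - s else 0)"
proof -
 let ?\<phi> = "\<lambda>i x::real. (if i = p then x else 1) * (if i = q then x else 1)"
 have s: "0 < sqrt (t - s)" using st by simp
 have sq: "has_bochner_integral lborel (\<lambda>x. normal_density 0 (sqrt (t - s)) x * (x * x)) (t - s)"
  using normal_moment_even[OF s, of 0 1] st by (simp add: power2_eq_square diff_divide_distrib)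
 have "has_bochner_integral M (\<lambda>w. \<Prod>i\<in>UNIV. ?\<phi> i ((B t w - B s w) $ i))
  (\<Prod>i\<in>UNIV. LINT x|lborel. normal_density 0 (sqrt (t - s)) x * ?\<phi> i x)"
 proof (rule increment_prod_moment[OF st, of ?\<phi>])
  show "integrable lborel (\<lambda>x. normal_density 0 (sqrt (t - s)) x * ?\<phi> i x)" for i
   using s sq by (cases "i = p"; cases "i = q") (simp_all add: integrable_normal_moment_nz_1 has_bochner_integral_iff)
 qed auto
 moreover have "(LINT x|lborel. normal_density 0 (sqrt (t - s)) x * ?\<phi> i x)
   = (if i = p then if i = q then t - s else 0 else if i = q then 0 else 1)" for i
  using sq by (auto simp: integral_normal_moment_nz_1[OF s] integral_normal_density[OF s] has_bochner_integral_iff)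
 moreover have "(\<Prod>i\<in>UNIV. if i = p then if i = q then t - s else 0 else if i = q then 0 else 1) = (if p = q then t - s else 0)"
 proof (cases "p = q")
  case True
  then have "(\<Prod>i\<in>UNIV. if i = p then if i = q then t - s else 0 else if i = q then 0 else 1) = (\<Prod>i\<in>UNIV. if i = p then t - s else 1)"
   by (intro prod.cong) auto
  then show ?thesis using True by simp
 next
  case False
  then show ?thesis by (auto intro!: prod_zero)
 qed
 moreover have "(\<Prod>i\<in>UNIV. ?\<phi> i (z $ i)) = z $ p * z $ q" for z :: "real ^ 'd"
  by (simp add: prod.distrib)
 ultimately show ?thesis by simp
qed

lemma increment_uncorrelated:
 assumes st: "0 <= s" "s <= t" and U: "U \<in> borel_measurable (F s)" "integrable M (U :: 'a => real)"
 shows "has_bochner_integral M (\<lambda>w. U w * (B t w - B s w) $ p) 0"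
  and "has_bochner_integral M (\<lambda>w. U w * ((B t w - B s w) $ p * (B t w - B s w) $ q))
   (expectation U * (if p = q then t - s else 0))"
proof -
 consider "s = t" | "s < t" using st by linarith
 then have "has_bochner_integral M (\<lambda>w. U w * (B t w - B s w) $ p) 0 \<and>
  has_bochner_integral M (\<lambda>w. U w * ((B t w - B s w) $ p * (B t w - B s w) $ q))
   (expectation U * (if p = q then t - s else 0))"
 proof cases
  case 2
  have 1: "(\<lambda>z :: real ^ 'd. z $ p * z $ q) \<in> borel_measurable borel" by measurable
  show ?thesis
   using increment_indep[OF st(1) 2 U, of "\<lambda>z. z $ p"] increment_mean[OF st(1) 2, of p]
    increment_indep[OF st(1) 2 U 1] increment_cov[OF st(1) 2, of p q]
   unfolding has_bochner_integral_iff by simp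
 qed (simp add: has_bochner_integral_zero)
 then show "has_bochner_integral M (\<lambda>w. U w * (B t w - B s w) $ p) 0"
  and "has_bochner_integral M (\<lambda>w. U w * ((B t w - B s w) $ p * (B t w - B s w) $ q))
   (expectation U * (if p = q then t - s else 0))" by blast+
qed

lemma integrable_bounded_rv:
 fixes U :: "'a => 'b::{banach, second_countable_topology}"
 assumes "U \<in> borel_measurable M" "bounded (U ` space M)"
 shows "integrable M U"
 using assms unfolding bounded_iff by (auto intro: integrable_const_bound)

lemma bounded_mult_rv:
 fixes U V :: "'a => real"
 assumes "bounded (U ` A)" "bounded (V ` A)"
 shows "bounded ((\<lambda>w. U w * V w) ` A)"
proof -
 obtain a b where "\<forall>w\<in>A. \<bar>U w\<bar> <= a" "\<forall>w\<in>A. \<bar>V w\<bar> <= b" using assms by (auto simp: bounded_iff)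
 then have "\<forall>w\<in>A. \<bar>U w * V w\<bar> <= a * b" by (auto simp: abs_mult intro!: mult_mono order_trans[OF abs_ge_zero])
 then show ?thesis by (auto simp: bounded_iff)
qed

text \<open>All factors except the last increment are \<open>F c\<close>-measurable, and that
  increment is independent of \<open>F c\<close> with mean zero. Boundedness of \<open>V\<close>
  keeps the product of the other factors integrable.\<close>

lemma increments_disjoint:
 assumes o: "0 <= a" "a <= b" "b <= c" "c <= d"
  and U: "U \<in> borel_measurable (F a)" "bounded (U ` space M)"
  and V: "V \<in> borel_measurable (F c)" "bounded (V ` space M)"
 shows "has_bochner_integral M (\<lambda>w. (U w * (B b w - B a w) $ p) * (V w * (B d w - B c w) $ q) :: real) 0"
proof -
 let ?W = "\<lambda>w. U w * (B b w - B a w) $ p * V w"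
 have UM: "U \<in> borel_measurable M" "V \<in> borel_measurable M" using U V o measurable_F_M by (meson order_trans)+
 have Bc: "B b \<in> borel_measurable (F c)" "B a \<in> borel_measurable (F c)" "U \<in> borel_measurable (F c)"
  using o U by (auto intro: measurable_F_mono[OF B_measurable] measurable_F_mono)
 have W: "?W \<in> borel_measurable (F c)" using Bc V(1) by measurable
 have "integrable M (\<lambda>w. U w * (B b w - B a w) $ p)"
  using increment_uncorrelated(1)[OF o(1,2) U(1) integrable_bounded_rv[OF UM(1) U(2)]] by (auto simp: has_bochner_integral_iff)
 moreover obtain v where "\<forall>w\<in>space M. norm (V w) <= v" using V(2) by (auto simp: bounded_iff)
 ultimately have int: "integrable M (\<lambda>w. norm (U w * (B b w - B a w) $ p) * v)" and
  v: "\<And>w. w \<in> space M ==> \<bar>V w\<bar> <= v" by auto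
 have c: "0 <= c" using o by linarith
 have "integrable M ?W"
 proof (rule Bochner_Integration.integrable_bound[OF int])
  show "?W \<in> borel_measurable M" using W c by (rule measurable_F_M)
  show "AE w in M. norm (?W w) <= norm (norm (U w * (B b w - B a w) $ p) * v)"
  proof (rule AE_I2)
   fix w assume "w \<in> space M"
   then have "\<bar>V w\<bar> <= \<bar>v\<bar>" using v by fastforce
   then show "norm (?W w) <= norm (norm (U w * (B b w - B a w) $ p) * v)"
    unfolding real_norm_def abs_mult abs_abs by (intro mult_left_mono) auto
  qed
 qed
 from increment_uncorrelated(1)[OF c o(4) W this, of q] show ?thesis by (simp only: mult.assoc)
qed

lemma increments_overlap:
 assumes o: "0 <= a" "a <= b" "0 <= c" "c <= d"
  and U: "U \<in> borel_measurable (F a)" "bounded (U ` space M)"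
  and V: "V \<in> borel_measurable (F c)" "bounded (V ` space M)"
 shows "has_bochner_integral M (\<lambda>w. (U w * (B b w - B a w) $ p) * (V w * (B d w - B c w) $ q) :: real)
  (expectation (\<lambda>w. U w * V w) * (if p = q then max 0 (min b d - max a c) else 0))"
proof -
 have main: "has_bochner_integral M (\<lambda>w. (U w * (B b w - B a w) $ p) * (V w * (B d w - B c w) $ q) :: real)
   (expectation (\<lambda>w. U w * V w) * (if p = q then max 0 (min b d - max a c) else 0))"
  if o: "0 <= a" "a <= b" "a <= c" "c <= d"
   and U: "U \<in> borel_measurable (F a)" "bounded (U ` space M)"
   and V: "V \<in> borel_measurable (F c)" "bounded (V ` space M)"
  for a b c d p q and U V :: "'a => real"
 proof (cases "b <= c")
  case True
  have "min b d - max a c <= 0" using True o by auto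
  then have val: "(if p = q then max 0 (min b d - max a c) else 0) = 0" by simp
  show ?thesis unfolding val mult_zero_right by (rule increments_disjoint[OF o(1,2) True o(4) U V])
 next
  case False
  \<comment> \<open>Here a <= c < b. The product is split at c and m; since m is b or d, one of the
    two increments after m is zero, and of the remaining terms only the square over (c, m] has
    nonzero mean.\<close>
  define m where "m = min b d"
  have m: "c <= m" "m <= b" "m <= d" "0 <= c" "m = b \<or> m = d" using False o by (auto simp: m_def)
  have Uc: "U \<in> borel_measurable (F c)" using U(1) o(3) by (rule measurable_F_mono)
  have UV: "(\<lambda>w. U w * V w) \<in> borel_measurable (F c)" "integrable M (\<lambda>w. U w * V w)"
  proof -
   show m1: "(\<lambda>w. U w * V w) \<in> borel_measurable (F c)" using Uc V(1) by measurable
   show "integrable M (\<lambda>w. U w * V w)"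
    by (intro integrable_bounded_rv bounded_mult_rv U(2) V(2) measurable_F_M[OF m1 m(4)])
  qed
  note 1 = increments_disjoint[OF o(1) o(3) order_refl o(4) U V, of p q]
  note 2 = increment_uncorrelated(2)[OF m(4,1) UV, of p q]

  have Vm: "V \<in> borel_measurable (F m)" "U \<in> borel_measurable (F m)"
   using V(1) Uc m(1) by (auto intro: measurable_F_mono)
  note 3 = increments_disjoint[OF m(4) m(1) order_refl m(3) Uc U(2) Vm(1) V(2), of p q]
  note 4 = increments_disjoint[OF m(4) m(1) order_refl m(2) V Vm(2) U(2), of q p]
  have eq: "(U w * (B b w - B a w) $ p) * (V w * (B d w - B c w) $ q) =
   (U w * (B c w - B a w) $ p) * (V w * (B d w - B c w) $ q) +
   (U w * V w * ((B m w - B c w) $ p * (B m w - B c w) $ q) +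
   ((U w * (B m w - B c w) $ p) * (V w * (B d w - B m w) $ q) +
    (V w * (B m w - B c w) $ q) * (U w * (B b w - B m w) $ p)))" for w
   using m(5) by (auto simp: algebra_simps)
  have mx: "max a c = c" "max 0 (min b d - c) = m - c" using o m by (auto simp: m_def max_def)
  then show ?thesis
   using has_bochner_integral_add[OF 1 has_bochner_integral_add[OF 2 has_bochner_integral_add[OF 3 4]]]
   unfolding eq mx by (simp only: add_0_left add_0_right)
 qed
 show ?thesis
 proof (cases "a <= c")
  case True
  then show ?thesis using main[OF o(1,2) True o(4) U V] by simp
 next
  case False
  then have "c <= a" by simp
  have "(\<lambda>w. (U w * (B b w - B a w) $ p) * (V w * (B d w - B c w) $ q))
   = (\<lambda>w. (V w * (B d w - B c w) $ q) * (U w * (B b w - B a w) $ p))"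
   "(\<lambda>w. U w * V w) = (\<lambda>w. V w * U w)"
   "(if p = q then max 0 (min b d - max a c) else 0) = (if q = p then max 0 (min d b - max c a) else 0)"
   by (auto simp: mult.commute min.commute max.commute)
  then show ?thesis using main[OF o(3,4) \<open>c <= a\<close> o(2) V U, of q p] by simp
 qed
qed

end

section \<open>Integrals of elementary processes\<close>

lemma inner_matrix_vector:
 fixes A C :: "real ^ 'd ^ 'n"
 shows "(A *v x) \<bullet> (C *v y) = (\<Sum>r\<in>UNIV. \<Sum>p\<in>UNIV. \<Sum>q\<in>UNIV. (A $ r $ p * x $ p) * (C $ r $ q * y $ q))"
 by (simp add: inner_vec_def matrix_vector_mult_def sum_product)

lemma inner_matrix:
 fixes A C :: "real ^ 'd ^ 'n"
 shows "A \<bullet> C = (\<Sum>r\<in>UNIV. \<Sum>p\<in>UNIV. A $ r $ p * C $ r $ p)"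
 by (simp add: inner_vec_def)

lemma power2_norm_sum:
 fixes x :: "'i => 'b::real_inner"
 shows "nsq (\<Sum>i\<in>I. x i) = (\<Sum>i\<in>I. \<Sum>j\<in>I. x i \<bullet> x j)"
 by (simp add: power2_norm_eq_inner inner_sum_left inner_sum_right) (rule sum.swap)

lemma borel_measurable_matrix_vector [measurable]:
 fixes A :: "'a => real ^ 'd ^ 'n"
 assumes [measurable]: "A \<in> borel_measurable N" "x \<in> borel_measurable N"
 shows "(\<lambda>w. A w *v x w) \<in> borel_measurable N"
proof -
 have "continuous_on UNIV (\<lambda>p :: (real ^ 'd ^ 'n) \<times> (real ^ 'd). fst p *v snd p)"
  unfolding matrix_vector_mult_def by (intro continuous_intros)
 from borel_measurable_continuous_Pair[OF assms this] show ?thesis by simp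
qed

text \<open>The intervals are indexed by an arbitrary set and may overlap. Hence the difference of
  two such processes is again of this form, over the disjoint sum of the index sets, and no common
  refinement of partitions is ever formed.\<close>

definition block_val :: "'i set => ('i => real) => ('i => real) => ('i => 'a => 'b::real_vector) => real => 'a => 'b" where
 "block_val I a b A t w = (\<Sum>i\<in>I. indicator {a i<..b i} t *\<^sub>R A i w)"

definition block_int :: "(real => 'a => real ^ 'd) => 'i set => ('i => real) => ('i => real)
  => ('i => 'a => real ^ 'd ^ 'n) => real => 'a => real ^ 'n" where
 "block_int B I a b A t w = (\<Sum>i\<in>I. A i w *v (B (min t (b i)) w - B (min t (a i)) w))"

context brownian_basis
begin

definition blocks :: "'i set => ('i => real) => ('i => real) => ('i => 'a => 'b::euclidean_space) => bool" where
 "blocks I a b A \<longleftrightarrow> finite I \<and>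
  (\<forall>i\<in>I. 0 <= a i \<and> a i <= b i \<and> A i \<in> borel_measurable (F (a i)) \<and> bounded (A i ` space M))"

lemma clipped_increments:
 assumes t: "0 <= t" and o: "0 <= a" "a <= b" "0 <= c" "c <= d"
  and U: "U \<in> borel_measurable (F a)" "bounded (U ` space M)"
  and V: "V \<in> borel_measurable (F c)" "bounded (V ` space M)"
 shows "has_bochner_integral M (\<lambda>w. (U w * (B (min t b) w - B (min t a) w) $ p) *
   (V w * (B (min t d) w - B (min t c) w) $ q) :: real)
  (expectation (\<lambda>w. U w * V w) * (if p = q then max 0 (min t (min b d) - max a c) else 0))"
proof -
 consider "t < a \<or> t < c" | "a <= t" "c <= t" by linarith
 then show ?thesis
 proof cases
  case 1
  then have "B (min t b) w - B (min t a) w = 0 \<or> B (min t d) w - B (min t c) w = 0" for w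
   using o by (auto simp: min_def)
  then have "(\<lambda>w. (U w * (B (min t b) w - B (min t a) w) $ p) *
   (V w * (B (min t d) w - B (min t c) w) $ q)) = (\<lambda>w. 0)"
   by (metis (no_types, opaque_lifting) mult_eq_0_iff zero_index)
  moreover have "max 0 (min t (min b d) - max a c) = 0" using 1 by auto
  ultimately show ?thesis by (simp only: if_cancel mult_zero_right has_bochner_integral_zero)
 next
  case 2
  then have mn: "min t a = a" "min t c = c" "a <= min t b" "c <= min t d" using o by auto
  have "min (min t b) (min t d) = min t (min b d)" by (auto simp: min_def)
  then show ?thesis using increments_overlap[OF o(1) mn(3) o(3) mn(4) U V, of p q] unfolding mn(1,2) by (simp only:)
 qed
qed

text \<open>Both sides expand to the same double sum over pairs of blocks, weighted with the length
  \<open>l i j\<close> of their common part up to \<open>t\<close>: on the left by the covariance of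
  overlapping increments, on the right by integrating products of indicators.\<close>

lemma block_isometry:
 fixes A :: "'i => 'a => real ^ 'd ^ 'n"
 assumes bl: "blocks I a b A" and t: "0 <= t"
 shows "msq M (block_int B I a b A t)
  = (\<integral>\<^sup>+w. (psq t (\<lambda>s. block_val I a b A s w)) \<partial>M)"
proof -
 have fin: "finite I" using bl by (simp add: blocks_def)
 have ab: "0 <= a i" "a i <= b i" if "i \<in> I" for i using bl that by (auto simp: blocks_def)
 define l where "l i j = max 0 (min t (min (b i) (b j)) - max (a i) (a j))" for i j
 define U where "U i r p w = A i w $ r $ p" for i r p w
 have U: "U i r p \<in> borel_measurable (F (a i))" "bounded (U i r p ` space M)" if "i \<in> I" for i r p
 proof -
  have [measurable]: "A i \<in> borel_measurable (F (a i))" using bl that by (auto simp: blocks_def)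
  show "U i r p \<in> borel_measurable (F (a i))" unfolding U_def by measurable
  have "bounded (A i ` space M)" using bl that by (auto simp: blocks_def)
  then obtain C where "\<forall>w\<in>space M. norm (A i w) <= C" by (auto simp: bounded_iff)
  then have "\<forall>w\<in>space M. norm (U i r p w) <= C"
   unfolding U_def by (meson Finite_Cartesian_Product.norm_nth_le order_trans)
  then show "bounded (U i r p ` space M)" by (auto simp: bounded_iff)
 qed
 define D where "D i w = B (min t (b i)) w - B (min t (a i)) w" for i w
 let ?S = "\<Sum>i\<in>I. \<Sum>j\<in>I. \<Sum>r\<in>UNIV. \<Sum>p\<in>UNIV. \<Sum>q\<in>UNIV.
   expectation (\<lambda>w. U i r p w * U j r q w) * (if p = q then l i j else 0)"
 have "has_bochner_integral M (\<lambda>w. \<Sum>i\<in>I. \<Sum>j\<in>I. \<Sum>r\<in>UNIV. \<Sum>p\<in>UNIV. \<Sum>q\<in>UNIV.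
   (U i r p w * D i w $ p) * (U j r q w * D j w $ q)) ?S"
  unfolding D_def l_def using ab U by (intro has_bochner_integral_sum clipped_increments t)
 then have 1: "has_bochner_integral M (\<lambda>w. nsq (block_int B I a b A t w)) ?S"
  unfolding block_int_def D_def U_def power2_norm_sum inner_matrix_vector .
 have UU: "integrable M (\<lambda>w. U i r p w * U j r p w)" if "i \<in> I" "j \<in> I" for i j r p
  by (intro integrable_bounded_rv bounded_mult_rv borel_measurable_times measurable_F_M[OF U(1)] U(2) ab that)
 define V where "V w = (\<Sum>i\<in>I. \<Sum>j\<in>I. \<Sum>r\<in>UNIV. \<Sum>p\<in>UNIV. U i r p w * U j r p w * l i j)" for w
 have 2: "has_bochner_integral M V ?S"
 proof -
  have "has_bochner_integral M V (\<Sum>i\<in>I. \<Sum>j\<in>I. \<Sum>r\<in>UNIV. \<Sum>p\<in>UNIV. expectation (\<lambda>w. U i r p w * U j r p w) * l i j)"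
   unfolding V_def by (intro has_bochner_integral_sum has_bochner_integral_mult_left has_bochner_integral_integrable UU)
  moreover have "(\<Sum>q\<in>UNIV. expectation (\<lambda>w. U i r p w * U j r q w) * (if p = q then l i j else 0))
    = expectation (\<lambda>w. U i r p w * U j r p w) * l i j" for i j r p
   by (subst sum.remove[of UNIV p]) (auto intro!: sum.neutral)
  ultimately show ?thesis by (simp only:)
 qed
 have 3: "psq t (\<lambda>s. block_val I a b A s w) = ennreal (V w)"
  "0 <= V w" for w
 proof -
  have ind: "has_bochner_integral lborel (\<lambda>s. indicator {0..t} s * (indicator {a i<..b i} s * indicator {a j<..b j} s)) (l i j)"
   if ij: "i \<in> I" "j \<in> I" for i j
  proof -
   have "(\<lambda>s. indicator {0..t} s * (indicator {a i<..b i} s * indicator {a j<..b j} s) :: real)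
     = indicator {max (a i) (a j)<..min t (min (b i) (b j))}"
    using ab[OF ij(1)] ab[OF ij(2)] by (auto simp: indicator_def)
   moreover have "has_bochner_integral lborel (indicator {x<..y} :: real => real) (max 0 (y - x))" for x y :: real
    using has_bochner_integral_real_indicator[of "{x<..y}" lborel]
    by (cases "x <= y") (simp_all add: max_def)
   ultimately show ?thesis by (simp only: l_def)
  qed
  have "has_bochner_integral lborel (\<lambda>s. \<Sum>i\<in>I. \<Sum>j\<in>I. \<Sum>r\<in>UNIV. \<Sum>p\<in>UNIV.
    U i r p w * U j r p w * (indicator {0..t} s * (indicator {a i<..b i} s * indicator {a j<..b j} s))) (V w)"
   unfolding V_def by (intro has_bochner_integral_sum has_bochner_integral_mult_right ind)
  moreover have "(\<Sum>i\<in>I. \<Sum>j\<in>I. \<Sum>r\<in>UNIV. \<Sum>p\<in>UNIV.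
    U i r p w * U j r p w * (indicator {0..t} s * (indicator {a i<..b i} s * indicator {a j<..b j} s)))
    = indicator {0..t} s * nsq (block_val I a b A s w)" for s
   unfolding block_val_def power2_norm_sum inner_matrix U_def
   by (simp add: sum_distrib_left sum_distrib_right ac_simps)
  ultimately have hb: "has_bochner_integral lborel (\<lambda>s. indicator {0..t} s * nsq (block_val I a b A s w)) (V w)"
   by simp
  then have "(\<integral>\<^sup>+s. ennreal (indicator {0..t} s * nsq (block_val I a b A s w)) \<partial>lborel) = ennreal (V w)"
   by (subst nn_integral_eq_integral) (auto simp: has_bochner_integral_iff)
  moreover have "ennreal (indicator {0..t} s * nsq (block_val I a b A s w))
    = ennreal (nsq (block_val I a b A s w)) * indicator {0..t} s" for s
   by (auto simp: indicator_def)
  ultimately show "psq t (\<lambda>s. block_val I a b A s w) = ennreal (V w)" by simp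
  show "0 <= V w" unfolding has_bochner_integral_integral_eq[OF hb, symmetric] by simp
 qed
 have "msq M (block_int B I a b A t) = ennreal ?S"
  using 1 by (subst nn_integral_eq_integral) (auto simp: has_bochner_integral_iff)
 also have "\<dots> = (\<integral>\<^sup>+w. ennreal (V w) \<partial>M)"
  using 2 3(2) by (subst nn_integral_eq_integral) (auto simp: has_bochner_integral_iff)
 finally show ?thesis by (simp only: 3(1))
qed

lemma block_int_measurable:
 assumes bl: "blocks I a b A" and t: "0 <= t"
 shows "block_int B I a b A t \<in> borel_measurable (F t)"
 unfolding block_int_def[abs_def]
proof (rule borel_measurable_sum)
 fix i assume i: "i \<in> I"
 then have ab: "0 <= a i" "a i <= b i" using bl by (auto simp: blocks_def)
 show "(\<lambda>w. A i w *v (B (min t (b i)) w - B (min t (a i)) w)) \<in> borel_measurable (F t)"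
 proof (cases "a i <= t")
  case True
  have "A i \<in> borel_measurable (F t)" using bl i True by (auto simp: blocks_def intro: measurable_F_mono)
  moreover have "B (min t (b i)) \<in> borel_measurable (F t)" "B (min t (a i)) \<in> borel_measurable (F t)"
   using t ab by (auto intro!: measurable_F_mono[OF B_measurable])
  ultimately show ?thesis by measurable
 next
  case False
  then have "min t (b i) = t" "min t (a i) = t" using ab by auto
  then show ?thesis by simp
 qed
qed

lemma integrable_L2_imp:
 fixes Z :: "'a => 'b::euclidean_space"
 assumes "Z \<in> borel_measurable M" "integrable M (\<lambda>w. nsq (Z w))"
 shows "integrable M Z"
proof (rule Bochner_Integration.integrable_bound[of M "\<lambda>w. 1 + nsq (Z w)"])
 have "x <= 1 + x\<^sup>2" if "0 <= x" for x :: real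
  using that sum_squares_ge_zero[of "x - 1" 0] by (simp add: power2_eq_square algebra_simps)
 then show "AE w in M. norm (Z w) <= norm (1 + nsq (Z w))" by (auto simp: abs_of_nonneg)
qed (use assms in auto)

text \<open>The increment of each block over \<open>[s, t]\<close> runs between its endpoints
  clipped to \<open>[s, t]\<close>, and both \<open>Z\<close> and the coefficient of the block are
  known at its left end.\<close>

lemma block_int_orthogonal:
 fixes A :: "'i => 'a => real ^ 'd ^ 'n"
 assumes bl: "blocks I a b A" and st: "0 <= s" "s <= t"
  and Z: "Z \<in> borel_measurable (F s)" "integrable M (\<lambda>w. nsq (Z w))"
 shows "has_bochner_integral M (\<lambda>w. Z w \<bullet> (block_int B I a b A t w - block_int B I a b A s w)) 0"
proof -
 define v where "v i = min t (max (b i) s)" for i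
 define u where "u i = min t (max (a i) s)" for i
 have "has_bochner_integral M (\<lambda>w. \<Sum>i\<in>I. \<Sum>r\<in>UNIV. \<Sum>p\<in>UNIV. (Z w $ r * A i w $ r $ p) * (B (v i) w - B (u i) w) $ p) (\<Sum>i\<in>I. \<Sum>r::'n\<in>UNIV. \<Sum>p::'d\<in>UNIV. 0)"
 proof (intro has_bochner_integral_sum)
  fix i r p assume i: "i \<in> I"
  then have ab: "0 <= a i" "a i <= b i" and A: "A i \<in> borel_measurable (F (a i))" "bounded (A i ` space M)"
   using bl by (auto simp: blocks_def)
  show "has_bochner_integral M (\<lambda>w. (Z w $ r * A i w $ r $ p) * (B (v i) w - B (u i) w) $ p) 0"
  proof (cases "a i <= t")
   case False
   then have "v i = t" "u i = t" using ab by (auto simp: u_def v_def)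
   then show ?thesis by (simp add: has_bochner_integral_zero)
  next
   case True
   then have u: "u i = max (a i) s" "0 <= u i" "u i <= v i" using st ab by (auto simp: u_def v_def)
   have [measurable]: "A i \<in> borel_measurable (F (u i))" "Z \<in> borel_measurable (F (u i))"
    using u(1) by (auto intro: measurable_F_mono A(1) Z(1))
   obtain C where C: "\<And>w. w \<in> space M ==> norm (A i w) <= C" using A(2) by (auto simp: bounded_iff)
   have m: "(\<lambda>w. Z w $ r * A i w $ r $ p) \<in> borel_measurable (F (u i))" by measurable
   have ZM: "integrable M Z" by (rule integrable_L2_imp[OF measurable_F_M[OF Z(1) st(1)] Z(2)])
   have "integrable M (\<lambda>w. Z w $ r * A i w $ r $ p)"
   proof (rule Bochner_Integration.integrable_bound[of M "\<lambda>w. norm (Z w) * C"])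
    show "AE w in M. norm (Z w $ r * A i w $ r $ p) <= norm (norm (Z w) * C)"
    proof (rule AE_I2)
     fix w assume "w \<in> space M"
     have "norm (A i w $ r $ p) <= norm (A i w)"
      using Finite_Cartesian_Product.norm_nth_le[of "A i w" r] Finite_Cartesian_Product.norm_nth_le[of "A i w $ r" p] by linarith
     also have "\<dots> <= \<bar>C\<bar>" using C[OF \<open>w \<in> space M\<close>] by linarith
     finally show "norm (Z w $ r * A i w $ r $ p) <= norm (norm (Z w) * C)"
      unfolding norm_mult using Finite_Cartesian_Product.norm_nth_le[of "Z w" r] by (intro mult_mono) auto
    qed
   qed (use ZM measurable_F_M[OF m u(2)] in auto)
   from increment_uncorrelated(1)[OF u(2,3) m this] show ?thesis .
  qed
 qed
 moreover have "Z w \<bullet> (block_int B I a b A t w - block_int B I a b A s w)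
   = (\<Sum>i\<in>I. \<Sum>r\<in>UNIV. \<Sum>p\<in>UNIV. (Z w $ r * A i w $ r $ p) * (B (v i) w - B (u i) w) $ p)" for w
 proof -
  have "block_int B I a b A t w - block_int B I a b A s w = (\<Sum>i\<in>I. A i w *v (B (v i) w - B (u i) w))"
   unfolding block_int_def sum_subtractf[symmetric]
  proof (rule sum.cong[OF refl])
   fix i assume i: "i \<in> I"
   then have ab: "0 <= a i" "a i <= b i" using bl by (auto simp: blocks_def)
   have "B (min t (b i)) w - B (min t (a i)) w - (B (min s (b i)) w - B (min s (a i)) w) = B (v i) w - B (u i) w"
    using st ab unfolding u_def v_def by (auto simp: min_def max_def)
   then show "A i w *v (B (min t (b i)) w - B (min t (a i)) w) - A i w *v (B (min s (b i)) w - B (min s (a i)) w)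
     = A i w *v (B (v i) w - B (u i) w)"
    by (simp only: matrix_vector_mult_diff_distrib[symmetric])
  qed
  then show ?thesis
   by (simp only: inner_sum_right) (simp add: inner_vec_def matrix_vector_mult_def sum_distrib_left mult.assoc)
 qed
 ultimately show ?thesis by simp
qed

lemma block_int_continuous: "AE w in M. continuous_on {0..} (\<lambda>t. block_int B I a b A t w)"
 if "blocks I a b A"
proof -
 have "AE w in M. continuous_on {0..} (\<lambda>t. B t w)" using brownian by (simp add: brownian_motion_def)
 then show ?thesis
 proof eventually_elim
  fix w assume B: "continuous_on {0..} (\<lambda>t. B t w)"
  have mn: "continuous_on {0..} (\<lambda>t. B (min t c) w)" if "0 <= c" for c
   using that by (intro continuous_on_compose2[OF B] continuous_intros) auto
  have bl: "continuous_on UNIV ((*v) A)" for A :: "real ^ 'd ^ 'c"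
   unfolding matrix_vector_mult_def by (intro continuous_intros)
  show "continuous_on {0..} (\<lambda>t. block_int B I a b A t w)"
   unfolding block_int_def using that
   by (intro continuous_on_sum continuous_on_compose2[OF bl] continuous_on_diff mn) (auto simp: blocks_def)
 qed
qed

lemma block_int_0 [simp]: "blocks I a b A ==> block_int B I a b A 0 w = 0"
 by (auto simp: block_int_def blocks_def min_absorb1 intro!: sum.neutral)

end

section \<open>Square integrable martingales\<close>

definition sq_integrable :: "'a measure => ('a => 'b::euclidean_space) => bool" where
 "sq_integrable N X \<longleftrightarrow> X \<in> borel_measurable N \<and> integrable N (\<lambda>x. nsq (X x))"

lemma norm_integral_le:
 fixes f :: "'a => 'b::{banach, second_countable_topology}"
 assumes "integrable N f" "integrable N g" "\<And>x. x \<in> space N ==> norm (f x) <= g x"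
 shows "norm (LINT x|N. f x) <= (LINT x|N. g x)"
 using assms by (intro order_trans[OF integral_norm_bound integral_mono]) auto

lemma power2_norm_add_le:
 fixes x y :: "'b::real_normed_vector"
 shows "nsq (x + y) <= 2 * nsq x + 2 * nsq y"
proof -
 have "nsq (x + y) <= (norm x + norm y)\<^sup>2" by (intro power_mono norm_triangle_ineq) auto
 also have "\<dots> <= 2 * nsq x + 2 * nsq y"
  using zero_le_power2[of "norm x - norm y"] by (simp add: power2_eq_square algebra_simps)
 finally show ?thesis .
qed

lemma norm_inner_le_weighted:
 fixes x y :: "'b::real_inner"
 assumes "0 < c"
 shows "\<bar>x \<bullet> y\<bar> <= (nsq x / c + c * nsq y) / 2"
proof -
 have "\<bar>x \<bullet> y\<bar> <= norm x * norm y" by (rule Cauchy_Schwarz_ineq2)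
 moreover have "0 <= (norm x - c * norm y)\<^sup>2 / c" using assms by simp
 moreover have "(norm x - c * norm y)\<^sup>2 / c = nsq x / c - 2 * (norm x * norm y) + c * nsq y"
  using assms by (simp add: power2_eq_square field_simps)
 ultimately show ?thesis by (simp add: field_simps)
qed

lemma sq_integrable_add:
 assumes "sq_integrable N X" "sq_integrable N Y"
 shows "sq_integrable N (\<lambda>x. X x + Y x)"
 unfolding sq_integrable_def
proof
 have "integrable N (\<lambda>x. 2 * nsq (X x) + 2 * nsq (Y x))" using assms by (simp add: sq_integrable_def)
 then show "integrable N (\<lambda>x. nsq (X x + Y x))"
  by (rule Bochner_Integration.integrable_bound)
   (use assms power2_norm_add_le in \<open>auto simp: sq_integrable_def\<close>)
qed (use assms in \<open>auto simp: sq_integrable_def\<close>)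

lemma sq_integrable_uminus: "sq_integrable N X ==> sq_integrable N (\<lambda>x. - X x)"
 by (simp add: sq_integrable_def)

lemma sq_integrable_diff:
 "sq_integrable N X ==> sq_integrable N Y ==> sq_integrable N (\<lambda>x. X x - Y x)"
 using sq_integrable_add[OF _ sq_integrable_uminus] by fastforce

lemma sq_integrable_inner:
 assumes X: "sq_integrable N X" and Y: "sq_integrable N Y"
 shows "integrable N (\<lambda>x. X x \<bullet> Y x)"
proof (rule Bochner_Integration.integrable_bound[of N "\<lambda>x. (nsq (X x) / 1 + 1 * nsq (Y x)) / 2"])
 show "AE x in N. norm (X x \<bullet> Y x) <= norm ((nsq (X x) / 1 + 1 * nsq (Y x)) / 2)"
  using norm_inner_le_weighted[of 1] by (auto simp: abs_of_nonneg)
qed (use X Y in \<open>auto simp: sq_integrable_def\<close>)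

lemma sq_integrable_nn:
 assumes "X \<in> borel_measurable N"
 shows "sq_integrable N X \<longleftrightarrow> (msq N X) < \<infinity>"
 using assms by (auto simp: sq_integrable_def integrable_iff_bounded)

lemma sq_integrable_nn_eq:
 "sq_integrable N X ==> (msq N X) = ennreal (LINT x|N. nsq (X x))"
 by (intro nn_integral_eq_integral) (auto simp: sq_integrable_def)

lemma nn_integral_square_add:
 assumes [measurable]: "X \<in> borel_measurable N" "Y \<in> borel_measurable N"
 shows "msq N (\<lambda>x. X x + Y x :: 'b::euclidean_space)
  <= 2 * msq N X + 2 * msq N Y"
proof -
 have "msq N (\<lambda>x. X x + Y x) <= (\<integral>\<^sup>+x. 2 * ennreal (nsq (X x)) + 2 * ennreal (nsq (Y x)) \<partial>N)"
 proof (rule nn_integral_mono)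
  fix x
  have "ennreal (nsq (X x + Y x)) <= ennreal (2 * nsq (X x) + 2 * nsq (Y x))"
   by (intro ennreal_leI power2_norm_add_le)
  then show "ennreal (nsq (X x + Y x)) <= 2 * ennreal (nsq (X x)) + 2 * ennreal (nsq (Y x))"
   by (simp add: ennreal_mult')
 qed
 then show ?thesis by (simp add: nn_integral_add nn_integral_cmult)
qed

lemma nn_integral_square_diff_triangle:
 assumes [measurable]: "X \<in> borel_measurable N" "Y \<in> borel_measurable N" "Z \<in> borel_measurable N"
 shows "msq N (\<lambda>x. X x - Z x :: 'b::euclidean_space)
  <= 2 * msq N (\<lambda>x. X x - Y x) + 2 * msq N (\<lambda>x. Y x - Z x)"
 using nn_integral_square_add[of "\<lambda>x. X x - Y x" N "\<lambda>x. Y x - Z x"] by simp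

lemma sq_integrable_limit:
 fixes X :: "'a => 'b::euclidean_space"
 assumes X: "\<And>k. sq_integrable N (Xk k)" "X \<in> borel_measurable N"
  and lim: "(\<lambda>k. msq N (\<lambda>x. Xk k x - X x)) \<longlonglongrightarrow> 0"
 shows "sq_integrable N X"
proof -
 have [measurable]: "Xk k \<in> borel_measurable N" for k using X by (simp add: sq_integrable_def)
 note X(2)[measurable]
 have "\<forall>\<^sub>F k in sequentially. (msq N (\<lambda>x. Xk k x - X x)) < 1"
  using lim by (intro order_tendstoD) auto
 then obtain k where k: "msq N (\<lambda>x. Xk k x - X x) < 1"
  by (meson eventually_happens' sequentially_bot)
 have "sq_integrable N (\<lambda>x. Xk k x - X x)"
  using order.strict_trans[OF k, of \<infinity>] by (subst sq_integrable_nn) auto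
 from sq_integrable_diff[OF X(1)[of k] this] show ?thesis by simp
qed

text \<open>The difference of the products splits into a product of errors and two mixed terms.
  Young's inequality with weight \<open>c\<close> bounds the mixed terms by errors divided by
  \<open>c\<close> plus \<open>c\<close> times fixed norms; \<open>c\<close> is chosen small first,
  then \<open>k\<close> large.\<close>

lemma sq_integrable_inner_tendsto:
 fixes X Y :: "'a => 'b::euclidean_space"
 assumes X: "\<And>k. sq_integrable N (Xk k)" "X \<in> borel_measurable N"
  and Y: "\<And>k. sq_integrable N (Yk k)" "Y \<in> borel_measurable N"
  and limX: "(\<lambda>k. msq N (\<lambda>x. Xk k x - X x)) \<longlonglongrightarrow> 0"
  and limY: "(\<lambda>k. msq N (\<lambda>x. Yk k x - Y x)) \<longlonglongrightarrow> 0"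
 shows "(\<lambda>k. LINT x|N. Xk k x \<bullet> Yk k x) \<longlonglongrightarrow> (LINT x|N. X x \<bullet> Y x)"
proof -
 let ?s = "\<lambda>k x. nsq (Xk k x - X x) + nsq (Yk k x - Y x)"
 note SX = sq_integrable_limit[OF X limX]
 note SY = sq_integrable_limit[OF Y limY]
 define a where "a k = (LINT x|N. nsq (Xk k x - X x))" for k
 define b where "b k = (LINT x|N. nsq (Yk k x - Y x))" for k
 define p where "p = (LINT x|N. nsq (X x))"
 define q where "q = (LINT x|N. nsq (Y x))"
 have SdX: "sq_integrable N (\<lambda>x. Xk k x - X x)" and SdY: "sq_integrable N (\<lambda>x. Yk k x - Y x)" for k
  by (intro sq_integrable_diff X Y SX SY)+
 have pos: "0 <= a k" "0 <= b k" "0 <= p" "0 <= q" for k by (auto simp: a_def b_def p_def q_def)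
 have a: "a \<longlonglongrightarrow> 0" and b: "b \<longlonglongrightarrow> 0"
  using limX limY unfolding sq_integrable_nn_eq[OF SdX] sq_integrable_nn_eq[OF SdY] a_def[symmetric] b_def[symmetric]
  using tendsto_ennrealD[of a 0] tendsto_ennrealD[of b 0] pos by auto
 have est: "\<bar>(LINT x|N. Xk k x \<bullet> Yk k x) - (LINT x|N. X x \<bullet> Y x)\<bar>
   <= ((a k + b k) + (a k + b k) / c) / 2 + c * (p + q) / 2" if c: "0 < c" for k c
 proof -
  have "(LINT x|N. Xk k x \<bullet> Yk k x) - (LINT x|N. X x \<bullet> Y x) = (LINT x|N. Xk k x \<bullet> Yk k x - X x \<bullet> Y x)"
   by (rule Bochner_Integration.integral_diff[symmetric]; intro sq_integrable_inner X Y SX SY)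
  also have "\<bar>\<dots>\<bar> <= (LINT x|N. (?s k x
    + ?s k x / c) / 2 + c * (nsq (X x) + nsq (Y x)) / 2)"
   unfolding real_norm_def[symmetric]
  proof (rule norm_integral_le)
   show "integrable N (\<lambda>x. Xk k x \<bullet> Yk k x - X x \<bullet> Y x)"
    by (intro Bochner_Integration.integrable_diff sq_integrable_inner X Y SX SY)
   show "integrable N (\<lambda>x. (?s k x
    + ?s k x / c) / 2 + c * (nsq (X x) + nsq (Y x)) / 2)"
    using SdX SdY SX SY by (simp add: sq_integrable_def)
   fix x
   have "Xk k x \<bullet> Yk k x - X x \<bullet> Y x = (Xk k x - X x) \<bullet> (Yk k x - Y x) + ((Xk k x - X x) \<bullet> Y x + (Yk k x - Y x) \<bullet> X x)"
    by (simp add: inner_diff_left inner_diff_right inner_commute)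
   moreover have "((p' + q') + (p' + q') / c) / 2 + c * (u + v) / 2
     = (p' / 1 + 1 * q') / 2 + ((p' / c + c * v) / 2 + (q' / c + c * u) / 2)" for p' q' u v :: real
    by (simp add: add_divide_distrib distrib_left)
   ultimately show "norm (Xk k x \<bullet> Yk k x - X x \<bullet> Y x) <= (?s k x
    + ?s k x / c) / 2 + c * (nsq (X x) + nsq (Y x)) / 2"
    using norm_inner_le_weighted[OF zero_less_one, of "Xk k x - X x" "Yk k x - Y x"]
     norm_inner_le_weighted[OF c, of "Xk k x - X x" "Y x"]
     norm_inner_le_weighted[OF c, of "Yk k x - Y x" "X x"] unfolding real_norm_def
    by (smt (verit))
  qed
  also have "\<dots> = ((a k + b k) + (a k + b k) / c) / 2 + c * (p + q) / 2"
   unfolding a_def b_def p_def q_def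
   by (rule has_bochner_integral_integral_eq)
    (rule has_bochner_integral_add has_bochner_integral_divide_zero has_bochner_integral_mult_right
     has_bochner_integral_integrable SdX[unfolded sq_integrable_def, THEN conjunct2]
     SdY[unfolded sq_integrable_def, THEN conjunct2] SX[unfolded sq_integrable_def, THEN conjunct2]
     SY[unfolded sq_integrable_def, THEN conjunct2])+
  finally show ?thesis .
 qed
 show ?thesis
 proof (rule LIMSEQ_I)
  fix r :: real assume "0 < r"
  define c where "c = r / (p + q + 1)"
  have c: "0 < c" "c * (p + q) <= r" using \<open>0 < r\<close> pos(3,4) by (auto simp: c_def field_simps)
  have "(\<lambda>k. ((a k + b k) + (a k + b k) / c) / 2) \<longlonglongrightarrow> ((0 + 0) + (0 + 0) / c) / 2"
   using c by (intro tendsto_intros a b) auto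
  then have "(\<lambda>k. ((a k + b k) + (a k + b k) / c) / 2) \<longlonglongrightarrow> 0" by simp
  then have "\<forall>\<^sub>F k in sequentially. ((a k + b k) + (a k + b k) / c) / 2 < r / 2"
   using \<open>0 < r\<close> by (intro order_tendstoD(2)[where y = 0]) auto
  then obtain K where K: "\<And>k. K <= k ==> ((a k + b k) + (a k + b k) / c) / 2 < r / 2"
   by (auto simp: eventually_sequentially)
  show "\<exists>no. \<forall>k\<ge>no. norm ((LINT x|N. Xk k x \<bullet> Yk k x) - (LINT x|N. X x \<bullet> Y x)) < r"
  proof (intro exI allI impI)
   fix k assume "K <= k"
   from K[OF this] est[OF c(1), of k] c(2) show "norm ((LINT x|N. Xk k x \<bullet> Yk k x) - (LINT x|N. X x \<bullet> Y x)) < r"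
    unfolding real_norm_def by linarith
  qed
 qed
qed

lemma continuous_on_atLeastI:
 fixes f :: "real => 'b::topological_space"
 assumes "\<And>T. 0 <= T ==> continuous_on {a..T} f"
 shows "continuous_on {a..} f"
 unfolding continuous_on_eq_continuous_within
proof
 fix x assume "x \<in> {a..}"
 then have "continuous (at x within {a..\<bar>x\<bar> + 1}) f"
  using assms[of "\<bar>x\<bar> + 1"] by (auto simp: continuous_on_eq_continuous_within)
 moreover have "at x within {a..\<bar>x\<bar> + 1} = at x within {a..}"
  by (rule at_within_nhd[of x "{..<\<bar>x\<bar> + 1}"]) auto
 ultimately show "continuous (at x within {a..}) f" by simp
qed

context brownian_basis
begin

text \<open>The martingale property is expressed as orthogonality of increments to square integrable
  variables known at time \<open>s\<close>. This form avoids conditional expectations and passes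
  directly to L^2 limits.\<close>

definition l2_martingale :: "(real => 'a => 'b::euclidean_space) => bool" where
 "l2_martingale X \<longleftrightarrow> (\<forall>t\<ge>0. X t \<in> borel_measurable (F t)) \<and> (\<forall>t\<ge>0. sq_integrable M (X t)) \<and>
  (\<forall>s t Z. 0 <= s \<and> s <= t \<and> Z \<in> borel_measurable (F s) \<and> sq_integrable M Z -->
   expectation (\<lambda>w. Z w \<bullet> (X t w - X s w)) = 0)"

text \<open>Testing with the indicator of \<open>A\<close> times \<open>X s\<close> kills the linear
  term in the expansion of |X t|^2 around X s, and the quadratic term is nonnegative.\<close>

lemma l2_martingale_submartingale:
 assumes X: "l2_martingale X" and st: "0 <= s" "s <= t" and A: "A \<in> sets (F s)"
 shows "expectation (\<lambda>w. indicator A w * nsq (X s w)) <= expectation (\<lambda>w. indicator A w * nsq (X t w))"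
proof -
 have AM: "A \<in> events" using A sets_F_subset st by auto
 let ?Z = "\<lambda>w. indicator A w *\<^sub>R X s w"
 have Xs: "X s \<in> borel_measurable (F s)" "sq_integrable M (X s)" "sq_integrable M (X t)"
  using X st by (auto simp: l2_martingale_def)
 have ind: "integrable M (\<lambda>w. indicator A w * nsq (X u w))" if "sq_integrable M (X u)" for u
  using integrable_mult_indicator[OF AM, of "\<lambda>w. nsq (X u w)"] that by (simp add: sq_integrable_def)
 have Z: "?Z \<in> borel_measurable (F s)" using A Xs by (intro borel_measurable_scaleR borel_measurable_indicator)
 have ZM: "sq_integrable M ?Z"
  unfolding sq_integrable_def
 proof
  have "nsq (?Z w) = indicator A w * nsq (X s w)" for w by (auto simp: indicator_def)
  then show "integrable M (\<lambda>w. nsq (?Z w))" using ind Xs by simp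
 qed (rule measurable_F_M[OF Z st(1)])
 have 0: "expectation (\<lambda>w. ?Z w \<bullet> (X t w - X s w)) = 0"
  using X st Z ZM unfolding l2_martingale_def by blast
 have "expectation (\<lambda>w. indicator A w * nsq (X s w))
   = expectation (\<lambda>w. indicator A w * nsq (X s w) + 2 * (?Z w \<bullet> (X t w - X s w)))"
  using 0 ind[OF Xs(2)] sq_integrable_inner[OF ZM sq_integrable_diff[OF Xs(3,2)]] by simp
 also have "\<dots> <= expectation (\<lambda>w. indicator A w * nsq (X t w))"
 proof (rule integral_mono)
  show "integrable M (\<lambda>w. indicator A w * nsq (X s w) + 2 * (?Z w \<bullet> (X t w - X s w)))"
   using ind[OF Xs(2)] sq_integrable_inner[OF ZM sq_integrable_diff[OF Xs(3,2)]] by simp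
  show "indicator A w * nsq (X s w) + 2 * (?Z w \<bullet> (X t w - X s w)) <= indicator A w * nsq (X t w)" for w
  proof -
   have "nsq (X t w) = nsq (X s w) + 2 * (X s w \<bullet> (X t w - X s w)) + nsq (X t w - X s w)"
    by (simp add: power2_norm_eq_inner algebra_simps inner_commute)
   then show ?thesis by (auto simp: indicator_def)
  qed
 qed (use ind Xs in auto)
 finally show ?thesis .
qed

text \<open>Doob's inequality by induction on the last index: on the event reached so far the
  submartingale inequality moves the bound to the next time, and on the newly reached part the norm
  exceeds \<open>e\<close> at that very time. No first hitting index is introduced.\<close>

lemma maximal_discrete:
 fixes u :: "nat => real"
 assumes X: "l2_martingale X" and u: "mono u" "0 <= u 0" and e: "0 <= e"
 shows "e\<^sup>2 * prob {w \<in> space M. \<exists>i\<le>n. e < norm (X (u i) w)}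
   <= expectation (\<lambda>w. indicator {w \<in> space M. \<exists>i\<le>n. e < norm (X (u i) w)} w * nsq (X (u n) w))"
  and "{w \<in> space M. \<exists>i\<le>n. e < norm (X (u i) w)} \<in> sets (F (u n))"
proof -
 define E where "E n = {w \<in> space M. \<exists>i\<le>n. e < norm (X (u i) w)}" for n
 have u0: "0 <= u i" for i by (rule order_trans[OF u(2) monoD[OF u(1) le0]])
 have Xm: "X (u i) \<in> borel_measurable (F (u j))" if "i <= j" for i j
  using X u0[of i] monoD[OF u(1) that] by (auto simp: l2_martingale_def intro: measurable_F_mono)
 have X2: "sq_integrable M (X (u i))" for i using X u0 by (auto simp: l2_martingale_def)
 have E: "E n \<in> sets (F (u n))" for n
 proof -
  have "E n = (\<Union>i\<in>{..n}. {w \<in> space (F (u n)). e < norm (X (u i) w)})" by (auto simp: E_def space_F)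
  moreover have "{w \<in> space (F (u n)). e < norm (X (u i) w)} \<in> sets (F (u n))" if "i <= n" for i
   using Xm[OF that] by measurable
  ultimately show ?thesis by auto
 qed
 have EM: "E n \<in> events" for n using E sets_F_subset u0 by blast
 have ind: "integrable M (\<lambda>w. indicator A w * nsq (X (u i) w))" if "A \<in> events" for A i
  using integrable_mult_indicator[OF that, of "\<lambda>w. nsq (X (u i) w)"] X2[of i] by (simp add: sq_integrable_def)
 have step: "e\<^sup>2 * prob A <= expectation (\<lambda>w. indicator A w * nsq (X (u i) w))"
  if A: "A \<in> events" "\<And>w. w \<in> A ==> e < norm (X (u i) w)" for A i
 proof -
  have "e\<^sup>2 * prob A = expectation (\<lambda>w. indicator A w * e\<^sup>2)" using A(1) by simp
  also have "\<dots> <= expectation (\<lambda>w. indicator A w * nsq (X (u i) w))"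
  proof (rule integral_mono[OF _ ind[OF A(1)]])
   show "integrable M (\<lambda>w. indicator A w * e\<^sup>2)"
    using A(1) by (intro integrable_mult_left integrable_real_indicator) (auto simp: less_top[symmetric])
  qed (use A e in \<open>auto simp: indicator_def intro!: power_mono order_less_imp_le\<close>)
  finally show ?thesis .
 qed
 have "e\<^sup>2 * prob (E n) <= expectation (\<lambda>w. indicator (E n) w * nsq (X (u n) w))"
 proof (induction n)
  case 0
  show ?case by (rule step[OF EM]) (auto simp: E_def)
 next
  case (Suc n)
  let ?D = "E (Suc n) - E n"
  have D: "?D \<in> events" using EM by auto
  have eq: "indicator (E (Suc n)) w = (indicator (E n) w + indicator ?D w :: real)" for w
   by (auto simp: indicator_def E_def intro: le_SucI)
  have "E n \<subseteq> E (Suc n)" by (auto simp: E_def intro: le_SucI)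
  then have "prob (E (Suc n)) = prob (E n) + prob ?D"
   using finite_measure_Union[OF EM[of n] D] by (simp add: Un_absorb1 Un_Diff_cancel)
  then have "e\<^sup>2 * prob (E (Suc n)) = e\<^sup>2 * prob (E n) + e\<^sup>2 * prob ?D" by (simp add: distrib_left)
  also have "\<dots> <= expectation (\<lambda>w. indicator (E n) w * nsq (X (u (Suc n)) w))
    + expectation (\<lambda>w. indicator ?D w * nsq (X (u (Suc n)) w))"
  proof (rule add_mono)
   show "e\<^sup>2 * prob (E n) <= expectation (\<lambda>w. indicator (E n) w * nsq (X (u (Suc n)) w))"
    using Suc l2_martingale_submartingale[OF X u0 monoD[OF u(1)] E, of n "Suc n"] by simp
   show "e\<^sup>2 * prob ?D <= expectation (\<lambda>w. indicator ?D w * nsq (X (u (Suc n)) w))"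
    by (rule step[OF D]) (auto simp: E_def le_Suc_eq)
  qed
  also have "\<dots> = expectation (\<lambda>w. indicator (E (Suc n)) w * nsq (X (u (Suc n)) w))"
   unfolding eq distrib_right by (rule Bochner_Integration.integral_add[symmetric]; rule ind) (use EM D in auto)
  finally show ?case .
 qed
 then show "e\<^sup>2 * prob {w \<in> space M. \<exists>i\<le>n. e < norm (X (u i) w)}
   <= expectation (\<lambda>w. indicator {w \<in> space M. \<exists>i\<le>n. e < norm (X (u i) w)} w * nsq (X (u n) w))"
  by (simp add: E_def)
 show "{w \<in> space M. \<exists>i\<le>n. e < norm (X (u i) w)} \<in> sets (F (u n))" by (rule E[unfolded E_def])
qed

text \<open>Dyadic grids are nested, so the discrete events increase and their union obeys the same
  bound. Outside the union a path is at most \<open>e\<close> on all grids, hence everywhere on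
  \<open>{0..T}\<close> by continuity.\<close>

lemma maximal_continuous:
 assumes X: "l2_martingale X" and cont: "AE w in M. continuous_on {0..} (\<lambda>t. X t w)" and e: "0 <= e" and T: "0 <= T"
 obtains E where "E \<in> events" "ennreal (e\<^sup>2) * emeasure M E <= msq M (X T)"
  "AE w in M. w \<notin> E --> (\<forall>t\<in>{0..T}. norm (X t w) <= e)"
proof -
 \<comment> \<open>The minimum freezes the grid at \<open>T\<close> from index \<open>2 ^ n\<close>
   on, because the discrete inequality expects a monotone sequence of times over all
   naturals.\<close>
 define u where "u n i = T * (real (min i (2 ^ n)) / 2 ^ n)" for n i
 have u: "mono (u n)" "0 <= u n 0" "u n (2 ^ n) = T" for n
  using T by (auto simp: u_def mono_def intro!: mult_left_mono divide_right_mono)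
 define E where "E n = {w \<in> space M. \<exists>i\<le>2 ^ n. e < norm (X (u n i) w)}" for n
 have X2: "sq_integrable M (X T)" using X T by (auto simp: l2_martingale_def)
 have E: "E n \<in> events" for n
  using maximal_discrete(2)[OF X u(1,2) e, of "2 ^ n" n] sets_F_subset[OF T] unfolding E_def u(3) by blast
 have "e\<^sup>2 * prob (E n) <= expectation (\<lambda>w. nsq (X T w))" for n
 proof -
  have "e\<^sup>2 * prob (E n) <= expectation (\<lambda>w. indicator (E n) w * nsq (X T w))"
   using maximal_discrete(1)[OF X u(1,2) e, of "2 ^ n" n] unfolding E_def u(3) by simp
  also have "\<dots> <= expectation (\<lambda>w. nsq (X T w))"
   using integrable_mult_indicator[OF E[of n], of "\<lambda>w. nsq (X T w)"] X2
   by (intro integral_mono) (auto simp: sq_integrable_def indicator_def)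
  finally show ?thesis .
 qed
 then have le: "ennreal (e\<^sup>2) * emeasure M (E n) <= msq M (X T)" for n
  by (simp add: emeasure_eq_measure sq_integrable_nn_eq[OF X2] ennreal_mult'[symmetric] ennreal_leI)
 have inc: "incseq E"
 proof (rule incseq_SucI, safe)
  fix n w assume "w \<in> E n"
  then obtain i where i: "w \<in> space M" "i <= 2 ^ n" "e < norm (X (u n i) w)" by (auto simp: E_def)
  have "u (Suc n) (2 * i) = u n i" using i(2) by (simp add: u_def min_absorb1)
  then show "w \<in> E (Suc n)" using i by (auto simp: E_def intro!: exI[of _ "2 * i"])
 qed
 have "(\<lambda>n. ennreal (e\<^sup>2) * emeasure M (E n)) \<longlonglongrightarrow> ennreal (e\<^sup>2) * emeasure M (\<Union>n. E n)"
  by (intro tendsto_mult_ennreal tendsto_const Lim_emeasure_incseq inc) (use E in auto)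
 then have "ennreal (e\<^sup>2) * emeasure M (\<Union>n. E n) <= msq M (X T)"
  by (rule LIMSEQ_le_const2) (use le in auto)
 moreover have "AE w in M. w \<notin> (\<Union>n. E n) --> (\<forall>t\<in>{0..T}. norm (X t w) <= e)"
  using cont AE_space
 proof eventually_elim
  fix w assume c: "continuous_on {0..} (\<lambda>t. X t w)" and w: "w \<in> space M"
  show "w \<notin> (\<Union>n. E n) --> (\<forall>t\<in>{0..T}. norm (X t w) <= e)"
  proof (intro impI ballI)
   fix t assume nE: "w \<notin> (\<Union>n. E n)" and t: "t \<in> {0..T}"
   define v where "v = (if T = 0 then 0 else t / T)"
   have v: "0 <= v" "v <= 1" "t = T * v" using t by (auto simp: v_def divide_le_eq)
   define i where "i n = nat \<lfloor>2 ^ n * v\<rfloor>" for n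
   have il: "i n <= 2 ^ n" for n
   proof -
    have "2 ^ n * v <= 2 ^ n" using v by (intro mult_left_le) auto
    then have "\<lfloor>2 ^ n * v\<rfloor> <= 2 ^ n" by (metis floor_mono floor_numeral_power)
    then show ?thesis by (simp add: i_def nat_le_iff)
   qed
   have ri: "real (i n) = real_of_int \<lfloor>2 ^ n * v\<rfloor>" for n using v by (simp add: i_def)
   have "(\<lambda>n. u n (i n)) \<longlonglongrightarrow> t"
   proof -
    have "(\<lambda>n. real (i n) / 2 ^ n) \<longlonglongrightarrow> v"
    proof (rule tendsto_sandwich[of "\<lambda>n. v - 1 / 2 ^ n" _ _ "\<lambda>n. v"])
     have "(\<lambda>n. v - (1 / 2) ^ n) \<longlonglongrightarrow> v - 0" by (intro tendsto_intros LIMSEQ_power_zero) auto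
     then show "(\<lambda>n. v - 1 / 2 ^ n) \<longlonglongrightarrow> v" by (simp add: power_one_over)
     show "\<forall>\<^sub>F n in sequentially. v - 1 / 2 ^ n <= real (i n) / 2 ^ n"
     proof (rule always_eventually, rule allI)
      fix n
      have "2 ^ n * v - 1 <= real (i n)" unfolding ri by linarith
      then have "(2 ^ n * v - 1) / 2 ^ n <= real (i n) / 2 ^ n" by (rule divide_right_mono) simp
      then show "v - 1 / 2 ^ n <= real (i n) / 2 ^ n" by (simp add: diff_divide_distrib)
     qed
     show "\<forall>\<^sub>F n in sequentially. real (i n) / 2 ^ n <= v"
     proof (rule always_eventually, rule allI)
      fix n
      have "real (i n) <= 2 ^ n * v" unfolding ri by linarith
      then show "real (i n) / 2 ^ n <= v" by (simp add: divide_le_eq mult.commute)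
     qed
    qed simp
    then have "(\<lambda>n. T * (real (i n) / 2 ^ n)) \<longlonglongrightarrow> T * v" by (intro tendsto_intros)
    then show ?thesis using il by (simp add: u_def v(3) min_absorb1)
   qed
   then have "(\<lambda>n. X (u n (i n)) w) \<longlonglongrightarrow> X t w"
    using t T by (intro continuous_on_tendsto_compose[OF c]) (auto simp: u_def)
   then have "(\<lambda>n. norm (X (u n (i n)) w)) \<longlonglongrightarrow> norm (X t w)" by (rule tendsto_norm)
   moreover have "norm (X (u n (i n)) w) <= e" for n
    using nE il[of n] w by (auto simp: E_def not_less)
   ultimately show "norm (X t w) <= e" by (intro LIMSEQ_le_const2) auto
  qed
 qed
 ultimately show ?thesis using that[of "\<Union>n. E n"] E by auto
qed

section \<open>Uniform limits of continuous adapted processes\<close>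

lemma null_sets_measurable_F: "N \<in> null_sets M ==> 0 <= t ==> N \<in> sets (F t)"
 using null_sets_F sets_F_mono[of 0 t] by auto

lemma AE_null_set:
 assumes "AE w in M. P w"
 obtains N where "N \<in> null_sets M" "\<And>w. w \<in> space M ==> w \<notin> N ==> P w"
 using assms by (auto elim!: AE_E intro: that simp: null_sets_def)

text \<open>By Borel-Cantelli the increments are eventually at most 2^-j, so the telescoping series
  converges uniformly by the Weierstrass test. The bound is demanded on \<open>{0..real j}\<close>
  only; the growing horizon still covers every compact interval.\<close>

lemma limit_process:
 fixes Y :: "nat => real => 'a => 'b::euclidean_space"
 assumes meas: "\<And>j t. 0 <= t ==> Y j t \<in> borel_measurable (F t)"
  and cont: "\<And>j. AE w in M. continuous_on {0..} (\<lambda>t. Y j t w)"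
  and zero: "\<And>j w. w \<in> space M ==> Y j 0 w = 0"
  and E: "\<And>j. E j \<in> events" "summable (\<lambda>j. prob (E j))"
  and close: "\<And>j. AE w in M. w \<notin> E j --> (\<forall>t\<in>{0..real j}. norm (Y (Suc j) t w - Y j t w) <= (1 / 2) ^ j)"
 obtains X where "\<And>t. 0 <= t ==> X t \<in> borel_measurable (F t)"
  "\<And>w. w \<in> space M ==> continuous_on {0..} (\<lambda>t. X t w)" "\<And>w. w \<in> space M ==> X 0 w = 0"
  "AE w in M. \<forall>T. uniform_limit {0..T} (\<lambda>j t. Y j t w) (\<lambda>t. X t w) sequentially"
proof -
 have "AE w in M. \<forall>\<^sub>F j in sequentially. w \<in> space M - E j"
  by (rule borel_cantelli_AE1) (use E in \<open>auto simp: emeasure_eq_measure\<close>)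
 moreover have "AE w in M. \<forall>j. continuous_on {0..} (\<lambda>t. Y j t w)" using cont by (simp add: AE_all_countable)
 moreover have "AE w in M. \<forall>j. w \<notin> E j --> (\<forall>t\<in>{0..real j}. norm (Y (Suc j) t w - Y j t w) <= (1 / 2) ^ j)"
  using close by (simp add: AE_all_countable)
 ultimately have "AE w in M. (\<forall>\<^sub>F j in sequentially. w \<in> space M - E j) \<and> (\<forall>j. continuous_on {0..} (\<lambda>t. Y j t w))
   \<and> (\<forall>j. w \<notin> E j --> (\<forall>t\<in>{0..real j}. norm (Y (Suc j) t w - Y j t w) <= (1 / 2) ^ j))"
  by eventually_elim auto
 then obtain N where N: "N \<in> null_sets M" and good: "\<And>w. w \<in> space M ==> w \<notin> N ==>
   (\<forall>\<^sub>F j in sequentially. w \<in> space M - E j) \<and> (\<forall>j. continuous_on {0..} (\<lambda>t. Y j t w))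
   \<and> (\<forall>j. w \<notin> E j --> (\<forall>t\<in>{0..real j}. norm (Y (Suc j) t w - Y j t w) <= (1 / 2) ^ j))"
  by (rule AE_null_set) blast
 \<comment> \<open>The value 0 on \<open>N\<close> makes every path continuous and keeps the process
   adapted, because null sets belong to every \<open>F t\<close>.\<close>
 define X where "X t w = (if w \<in> N then 0 else lim (\<lambda>j. Y j t w))" for t w
 have unif: "uniform_limit {0..T} (\<lambda>j t. Y j t w) (\<lambda>t. X t w) sequentially"
  if w: "w \<in> space M" "w \<notin> N" for w T
 proof -
  note g = good[OF w]
  have "\<forall>\<^sub>F j in sequentially. \<forall>t\<in>{0..T}. norm (Y (Suc j) t w - Y j t w) <= (1 / 2) ^ j"
   using g[THEN conjunct1] eventually_ge_at_top[of "nat \<lceil>T\<rceil>"]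
  proof eventually_elim
   fix j assume "w \<in> space M - E j" "nat \<lceil>T\<rceil> <= j"
   moreover then have "T <= real j" by linarith
   ultimately show "\<forall>t\<in>{0..T}. norm (Y (Suc j) t w - Y j t w) <= (1 / 2) ^ j" using g by auto
  qed
  from Weierstrass_m_test_ev[OF this] summable_geometric[of "1 / 2 :: real"]
  have "uniform_limit {0..T} (\<lambda>n t. \<Sum>i<n. Y (Suc i) t w - Y i t w) (\<lambda>t. suminf (\<lambda>i. Y (Suc i) t w - Y i t w)) sequentially"
   by simp
  from uniform_limit_add[OF this uniform_limit_const[of "\<lambda>t. Y 0 t w"]]
  have ul0: "uniform_limit {0..T} (\<lambda>n t. (\<Sum>i<n. Y (Suc i) t w - Y i t w) + Y 0 t w)
   (\<lambda>t. suminf (\<lambda>i. Y (Suc i) t w - Y i t w) + Y 0 t w) sequentially" .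
  then have ul: "uniform_limit {0..T} (\<lambda>j t. Y j t w) (\<lambda>t. suminf (\<lambda>i. Y (Suc i) t w - Y i t w) + Y 0 t w) sequentially"
  proof -
   have "(\<Sum>i<n. Y (Suc i) t w - Y i t w) = Y n t w - Y 0 t w" for n t
    by (rule sum_lessThan_telescope)
   with ul0 show ?thesis by simp
  qed
  have eq: "X t w = suminf (\<lambda>i. Y (Suc i) t w - Y i t w) + Y 0 t w" if "t \<in> {0..T}" for t
   using tendsto_uniform_limitI[OF ul that] w(2) by (simp add: X_def limI)
  show ?thesis by (rule uniform_limit_cong'[THEN iffD2, OF _ _ ul]) (use eq in auto)
 qed
 show ?thesis
 proof (rule that[of X])
  show "X t \<in> borel_measurable (F t)" if "0 <= t" for t
  proof -
   have "N \<inter> space (F t) \<in> sets (F t)" using null_sets_measurable_F[OF N that] by auto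
   moreover have "(\<lambda>w. lim (\<lambda>j. Y j t w)) \<in> borel_measurable (F t)"
    using meas[OF that] by (rule borel_measurable_lim_metric)
   ultimately show ?thesis unfolding X_def[abs_def] by (intro measurable_If_set measurable_const) auto
  qed
  show "continuous_on {0..} (\<lambda>t. X t w)" if "w \<in> space M" for w
  proof (cases "w \<in> N")
   case False
   note g = good[OF that False]
   show ?thesis
   proof (rule continuous_on_atLeastI)
    fix T :: real
    show "continuous_on {0..T} (\<lambda>t. X t w)"
    proof (rule uniform_limit_theorem[OF _ unif[OF that False]])
     show "\<forall>\<^sub>F n in sequentially. continuous_on {0..T} (\<lambda>t. Y n t w)"
      using g by (auto intro!: always_eventually continuous_on_subset[of "{0..}" _ "{0..T}"])
    qed simp
   qed
  qed (simp add: X_def)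
  show "X 0 w = 0" if "w \<in> space M" for w
   using zero[OF that] by (simp add: X_def limI)
  show "AE w in M. \<forall>T. uniform_limit {0..T} (\<lambda>j t. Y j t w) (\<lambda>t. X t w) sequentially"
   using AE_not_in[OF N] AE_space by eventually_elim (use unif in auto)
 qed
qed

section \<open>Progressively measurable integrands\<close>

lemma measurable_ident_F: "0 <= t ==> (\<lambda>w. w) \<in> measurable M (F t)"
proof (rule measurableI)
 fix A assume "0 <= t" "A \<in> sets (F t)"
 then have "A \<in> events" using sets_F_subset by blast
 then show "(\<lambda>w. w) -` A \<inter> space M \<in> events" by simp
qed (simp add: space_F)

text \<open>The cut-off turns progressive measurability up to \<open>T\<close> into ordinary
  measurability on a product with the whole line, so that Fubini and L^2 norms over
  \<open>[0, T]\<close> do not involve restricted spaces.\<close>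

definition cutoff :: "real => (real => 'a => 'b::real_vector) => real \<times> 'a => 'b" where
 "cutoff T G p = indicator {0..T} (fst p) *\<^sub>R G (fst p) (snd p)"

lemma progressively_measurable_iff:
 fixes G :: "real => 'a => 'b::euclidean_space"
 shows "progressive G \<longleftrightarrow> (\<forall>T\<ge>0. cutoff T G \<in> borel_measurable (borel \<Otimes>\<^sub>M F T))"
proof -
 have "(\<lambda>(t, w). G t w) \<in> borel_measurable (restrict_space borel {0..T} \<Otimes>\<^sub>M F T)
   \<longleftrightarrow> cutoff T G \<in> borel_measurable (borel \<Otimes>\<^sub>M F T)" if T: "0 <= T" for T
 proof
  assume G: "(\<lambda>(t, w). G t w) \<in> borel_measurable (restrict_space borel {0..T} \<Otimes>\<^sub>M F T)"
  \<comment> \<open>Clamping time to \<open>{0..T}\<close> transports measurability from the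
    restricted product to the full one.\<close>
  have "(\<lambda>p. (max 0 (min T (fst p)), snd p)) \<in> measurable (borel \<Otimes>\<^sub>M F T) (restrict_space borel {0..T} \<Otimes>\<^sub>M F T)"
   using T by (intro measurable_Pair measurable_restrict_space2) auto
  from measurable_compose[OF this G]
  have [measurable]: "(\<lambda>p. G (max 0 (min T (fst p))) (snd p)) \<in> borel_measurable (borel \<Otimes>\<^sub>M F T)" by simp
  have "cutoff T G = (\<lambda>p. indicator {0..T} (fst p) *\<^sub>R G (max 0 (min T (fst p))) (snd p))"
   by (auto simp: cutoff_def indicator_def fun_eq_iff)
  then show "cutoff T G \<in> borel_measurable (borel \<Otimes>\<^sub>M F T)" by simp
 next
  assume G: "cutoff T G \<in> borel_measurable (borel \<Otimes>\<^sub>M F T)"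
  have "(\<lambda>p. p) \<in> measurable (restrict_space borel {0..T} \<Otimes>\<^sub>M F T) (borel \<Otimes>\<^sub>M F T)"
  proof -
   have "(\<lambda>p. (fst p, snd p)) \<in> measurable (restrict_space borel {0..T} \<Otimes>\<^sub>M F T) (borel \<Otimes>\<^sub>M F T)"
    by (intro measurable_Pair measurable_compose[OF measurable_fst] measurable_restrict_space1 measurable_snd) simp
   then show ?thesis by simp
  qed
  from measurable_compose[OF this G]
  have "cutoff T G \<in> borel_measurable (restrict_space borel {0..T} \<Otimes>\<^sub>M F T)" .
  also have "?this \<longleftrightarrow> (\<lambda>(t, w). G t w) \<in> borel_measurable (restrict_space borel {0..T} \<Otimes>\<^sub>M F T)"
   by (rule measurable_cong) (auto simp: cutoff_def space_pair_measure space_restrict_space)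
  finally show "(\<lambda>(t, w). G t w) \<in> borel_measurable (restrict_space borel {0..T} \<Otimes>\<^sub>M F T)" .
 qed
 then show ?thesis by (auto simp: progressively_measurable_def)
qed

lemma cutoff_F:
 "progressive G ==> 0 <= T ==> cutoff T (G :: real => 'a => 'b::euclidean_space) \<in> borel_measurable (borel \<Otimes>\<^sub>M F T)"
 by (simp add: progressively_measurable_iff)

lemma cutoff_M:
 fixes G :: "real => 'a => 'b::euclidean_space"
 assumes "progressive G" "0 <= T"
 shows "cutoff T G \<in> borel_measurable (lborel \<Otimes>\<^sub>M M)"
proof -
 have "(\<lambda>p. (fst p, snd p)) \<in> measurable (lborel \<Otimes>\<^sub>M M) (borel \<Otimes>\<^sub>M F T)"
  by (intro measurable_Pair measurable_compose[OF measurable_snd measurable_ident_F] assms) auto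
 from measurable_compose[OF this cutoff_F[OF assms]] show ?thesis by simp
qed

lemma progressive_path_measurable:
 fixes G :: "real => 'a => 'b::euclidean_space"
 assumes "progressive G" "0 <= T" "w \<in> space M"
 shows "(\<lambda>u. indicator {0..T} u *\<^sub>R G u w) \<in> borel_measurable borel"
 using measurable_Pair1[OF cutoff_M[OF assms(1,2)] assms(3)] by (simp add: cutoff_def)

lemma progressive_adapted:
 fixes G :: "real => 'a => 'b::euclidean_space"
 assumes "progressive G" "0 <= t"
 shows "G t \<in> borel_measurable (F t)"
 using measurable_Pair2[OF cutoff_F[OF assms], of t] assms(2) by (simp add: cutoff_def)

lemma progressive_compose:
 assumes "progressive G" "h \<in> borel_measurable borel"
 shows "progressive (\<lambda>t w. h (G t w))"
 using assms(1) unfolding progressively_measurable_def case_prod_beta'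
 by (auto intro!: measurable_compose[OF _ assms(2)])

lemma progressive_add:
 fixes G H :: "real => 'a => 'b::euclidean_space"
 assumes "progressive G" "progressive H"
 shows "progressive (\<lambda>t w. G t w + H t w)"
 using assms unfolding progressively_measurable_def case_prod_beta' by (auto intro!: borel_measurable_add)

lemma progressive_diff:
 fixes G H :: "real => 'a => 'b::euclidean_space"
 assumes "progressive G" "progressive H"
 shows "progressive (\<lambda>t w. G t w - H t w)"
 using assms unfolding progressively_measurable_def case_prod_beta' by (auto intro!: borel_measurable_diff)

lemma progressive_scaleR:
 fixes H :: "real => 'a => 'b::euclidean_space"
 assumes "progressive G" "progressive H"
 shows "progressive (\<lambda>t w. G t w *\<^sub>R H t w)"
 using assms unfolding progressively_measurable_def case_prod_beta' by (auto intro!: borel_measurable_scaleR)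

lemma progressive_inner:
 fixes G H :: "real => 'a => 'b::euclidean_space"
 assumes "progressive G" "progressive H"
 shows "progressive (\<lambda>t w. G t w \<bullet> H t w)"
 using assms unfolding progressively_measurable_def case_prod_beta' by (auto intro!: borel_measurable_inner)

lemma progressive_time:
 fixes h :: "real => 'b::euclidean_space"
 assumes "h \<in> borel_measurable borel"
 shows "progressive (\<lambda>t w. h t)"
 unfolding progressively_measurable_def case_prod_beta'
 by (intro allI impI measurable_compose[OF measurable_fst] measurable_restrict_space1 assms)

lemma progressive_continuous:
 fixes X :: "real => 'a => 'b::euclidean_space"
 assumes "\<And>w. w \<in> space M ==> continuous_on {0..} (\<lambda>t. X t w)" "\<And>t. 0 <= t ==> X t \<in> borel_measurable (F t)"
 shows "progressive X"
 unfolding progressively_measurable_def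
proof (intro allI impI borel_measurable_caratheodory)
 show "continuous_on {0..T} (\<lambda>t. X t w)" if "w \<in> space (F T)" for T w
  using assms(1)[of w] that by (auto simp: space_F intro: continuous_on_subset)
qed (use assms(2) measurable_F_mono in blast)

lemma progressive_after:
 fixes Z :: "'a => 'b::euclidean_space"
 assumes Z: "Z \<in> borel_measurable (F s)" and s: "0 <= s"
 shows "progressive (\<lambda>t w. indicator {s<..} t *\<^sub>R Z w)"
 unfolding progressively_measurable_def case_prod_beta'
proof (intro allI impI)
 fix T :: real assume T: "0 <= T"
 show "(\<lambda>p. indicator {s<..} (fst p) *\<^sub>R Z (snd p)) \<in> borel_measurable (restrict_space borel {0..T} \<Otimes>\<^sub>M F T)"
 proof (cases "s <= T")
  case True
  have "(\<lambda>p. Z (snd p)) \<in> borel_measurable (restrict_space borel {0..T} \<Otimes>\<^sub>M F T)"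
   by (rule measurable_compose[OF measurable_snd measurable_F_mono[OF Z True]])
  moreover have "(\<lambda>p. indicator {s<..} (fst p) :: real) \<in> borel_measurable (restrict_space borel {0..T} \<Otimes>\<^sub>M F T)"
   by (intro measurable_compose[OF measurable_fst] measurable_restrict_space1) simp
  ultimately show ?thesis by (intro borel_measurable_scaleR)
 next
  case False
  have "(\<lambda>p. indicator {s<..} (fst p) *\<^sub>R Z (snd p)) \<in> borel_measurable (restrict_space borel {0..T} \<Otimes>\<^sub>M F T)
   \<longleftrightarrow> (\<lambda>p. 0 :: 'b) \<in> borel_measurable (restrict_space borel {0..T} \<Otimes>\<^sub>M F T)"
   using False by (intro measurable_cong) (auto simp: space_pair_measure space_restrict_space)
  then show ?thesis by simp
 qed
qed

text \<open>Bounds are uniform in the outcome but may depend on the horizon. The class contains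
  elementary processes, time integrals and the coefficients of truncated equations, is closed under
  sums and products, and makes square integrability automatic.\<close>

definition prog_bdd :: "(real => 'a => 'b::euclidean_space) => bool" where
 "prog_bdd G \<longleftrightarrow> progressive G \<and>
  (\<forall>T\<ge>0. \<exists>C. \<forall>t\<in>{0..T}. \<forall>w\<in>space M. norm (G t w) <= C)"

lemma prog_bddD: "prog_bdd G ==> progressive G" by (simp add: prog_bdd_def)

lemma prog_bdd_bound:
 assumes "prog_bdd G" "0 <= T"
 obtains C where "0 <= C" "\<And>t w. 0 <= t ==> t <= T ==> w \<in> space M ==> norm (G t w) <= C"
proof -
 obtain C where C: "\<forall>t\<in>{0..T}. \<forall>w\<in>space M. norm (G t w) <= C" using assms unfolding prog_bdd_def by blast
 show ?thesis by (rule that[of "\<bar>C\<bar>"]) (use C in \<open>auto intro: order_trans[OF _ abs_ge_self]\<close>)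
qed

lemma prog_bddI:
 assumes "progressive G"
  "\<And>T. 0 <= T ==> \<exists>C. \<forall>t w. 0 <= t --> t <= T --> w \<in> space M --> norm (G t w) <= C"
 shows "prog_bdd G"
 unfolding prog_bdd_def using assms by fastforce

lemma prog_bdd_add:
 assumes "prog_bdd G" "prog_bdd H" shows "prog_bdd (\<lambda>t w. G t w + H t w)"
proof (rule prog_bddI)
 fix T :: real assume T: "0 <= T"
 obtain C D where "\<And>t w. 0 <= t ==> t <= T ==> w \<in> space M ==> norm (G t w) <= C"
  "\<And>t w. 0 <= t ==> t <= T ==> w \<in> space M ==> norm (H t w) <= D"
  by (metis prog_bdd_bound[OF assms(1) T] prog_bdd_bound[OF assms(2) T])
 then show "\<exists>C. \<forall>t w. 0 <= t --> t <= T --> w \<in> space M --> norm (G t w + H t w) <= C"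
  by (intro exI[of _ "C + D"]) (auto intro: norm_triangle_mono)
qed (intro progressive_add prog_bddD assms)

lemma prog_bdd_diff:
 assumes "prog_bdd G" "prog_bdd H" shows "prog_bdd (\<lambda>t w. G t w - H t w)"
proof (rule prog_bddI)
 fix T :: real assume T: "0 <= T"
 obtain C D where "\<And>t w. 0 <= t ==> t <= T ==> w \<in> space M ==> norm (G t w) <= C"
  "\<And>t w. 0 <= t ==> t <= T ==> w \<in> space M ==> norm (H t w) <= D"
  by (metis prog_bdd_bound[OF assms(1) T] prog_bdd_bound[OF assms(2) T])
 then show "\<exists>C. \<forall>t w. 0 <= t --> t <= T --> w \<in> space M --> norm (G t w - H t w) <= C"
  by (intro exI[of _ "C + D"]) (auto intro: order_trans[OF norm_triangle_ineq4 add_mono])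
qed (intro progressive_diff prog_bddD assms)

lemma prog_bdd_scaleR:
 assumes "prog_bdd G" "prog_bdd H" shows "prog_bdd (\<lambda>t w. G t w *\<^sub>R H t w)"
proof (rule prog_bddI)
 fix T :: real assume T: "0 <= T"
 obtain C D where "0 <= C" "\<And>t w. 0 <= t ==> t <= T ==> w \<in> space M ==> norm (G t w) <= C"
  "\<And>t w. 0 <= t ==> t <= T ==> w \<in> space M ==> norm (H t w) <= D"
  by (metis prog_bdd_bound[OF assms(1) T] prog_bdd_bound[OF assms(2) T])
 then show "\<exists>C. \<forall>t w. 0 <= t --> t <= T --> w \<in> space M --> norm (G t w *\<^sub>R H t w) <= C"
  by (intro exI[of _ "C * D"]) (auto intro!: mult_mono)
qed (intro progressive_scaleR prog_bddD assms)

lemma prog_bdd_block_val: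
 fixes A :: "'i => 'a => 'b::euclidean_space"
 assumes bl: "blocks I a b A"
 shows "prog_bdd (block_val I a b A)"
proof -
 have fin: "finite I" using bl by (simp add: blocks_def)
 have one: "prog_bdd (\<lambda>t w. indicator {a i<..b i} t *\<^sub>R A i w)" if i: "i \<in> I" for i
 proof (rule prog_bddI)
  have "progressive (\<lambda>t w. indicator {..b i} t *\<^sub>R (indicator {a i<..} t *\<^sub>R A i w))"
   using bl i by (intro progressive_scaleR progressive_time progressive_after) (auto simp: blocks_def)
  also have "(\<lambda>t w. indicator {..b i} t *\<^sub>R (indicator {a i<..} t *\<^sub>R A i w)) = (\<lambda>t w. indicator {a i<..b i} t *\<^sub>R A i w)"
   by (auto simp: indicator_def fun_eq_iff)
  finally show "progressive (\<lambda>t w. indicator {a i<..b i} t *\<^sub>R A i w)" .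
  have "bounded (A i ` space M)" using bl i by (auto simp: blocks_def)
  then obtain C where C: "\<And>w. w \<in> space M ==> norm (A i w) <= C" by (auto simp: bounded_iff)
  show "\<exists>C. \<forall>t w. 0 <= t --> t <= T --> w \<in> space M --> norm (indicator {a i<..b i} t *\<^sub>R A i w) <= C" for T
   using C by (intro exI[of _ "\<bar>C\<bar>"]) (auto simp: indicator_def intro: order_trans[OF _ abs_ge_self])
 qed
 have zero: "prog_bdd (\<lambda>t w. 0 :: 'b)"
  by (rule prog_bddI) (auto intro!: progressive_time)
 have "J \<subseteq> I ==> prog_bdd (\<lambda>t w. \<Sum>i\<in>J. indicator {a i<..b i} t *\<^sub>R A i w)" if "finite J" for J
  using that
 proof (induction J rule: finite_induct)
  case empty
  show ?case unfolding sum.empty by (rule zero)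
 next
  case (insert j J)
  show ?case unfolding sum.insert[OF insert.hyps(1,2)] using insert by (intro prog_bdd_add one) auto
 qed
 from this[OF fin order_refl] show ?thesis by (simp add: block_val_def[abs_def])
qed

sublocale time_product: pair_sigma_finite "lborel :: real measure" M ..

definition sq_norm :: "real => (real => 'a => 'b::euclidean_space) => ennreal" where
 "sq_norm t G = (\<integral>\<^sup>+p. ennreal (nsq (cutoff t G p)) \<partial>(lborel \<Otimes>\<^sub>M M))"

lemma nn_square_section:
 "ennreal (nsq (cutoff t G (u, w))) = ennreal (nsq (G u w)) * indicator {0..t} u"
 by (auto simp: cutoff_def indicator_def)

lemma sq_norm_paths:
 assumes "progressive G" "0 <= t"
 shows "sq_norm t G = (\<integral>\<^sup>+w. (psq t (\<lambda>u. G u w)) \<partial>M)"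
  and "(\<lambda>w. psq t (\<lambda>u. G u w)) \<in> borel_measurable M"
proof -
 have [measurable]: "cutoff t G \<in> borel_measurable (lborel \<Otimes>\<^sub>M M)" by (rule cutoff_M[OF assms])
 have "(\<lambda>w. \<integral>\<^sup>+u. ennreal (nsq (cutoff t G (u, w))) \<partial>lborel) \<in> borel_measurable M" by measurable
 then show "(\<lambda>w. psq t (\<lambda>u. G u w)) \<in> borel_measurable M"
  by (simp add: nn_square_section)
 have "sq_norm t G = (\<integral>\<^sup>+w. (\<integral>\<^sup>+u. ennreal (nsq (cutoff t G (u, w))) \<partial>lborel) \<partial>M)"
  unfolding sq_norm_def by (subst time_product.nn_integral_snd[symmetric]) (auto simp: case_prod_beta')
 then show "sq_norm t G = (\<integral>\<^sup>+w. (psq t (\<lambda>u. G u w)) \<partial>M)"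
  by (simp add: nn_square_section)
qed

lemma sq_norm_times:
 assumes "progressive G" "0 <= t"
 shows "sq_norm t G = (\<integral>\<^sup>+u\<in>{0..t}. (msq M (G u)) \<partial>lborel)"
proof -
 have [measurable]: "cutoff t G \<in> borel_measurable (lborel \<Otimes>\<^sub>M M)" by (rule cutoff_M[OF assms])
 have "sq_norm t G = (\<integral>\<^sup>+u. (msq M (\<lambda>w. cutoff t G (u, w))) \<partial>lborel)"
  unfolding sq_norm_def by (subst nn_integral_fst[symmetric]) (auto simp: case_prod_beta')
 also have "\<dots> = (\<integral>\<^sup>+u\<in>{0..t}. (msq M (G u)) \<partial>lborel)"
  by (intro nn_integral_cong) (auto simp: cutoff_def indicator_def)
 finally show ?thesis .
qed

lemma sq_norm_mono: "s <= t ==> sq_norm s G <= sq_norm t G"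
 unfolding sq_norm_def cutoff_def by (intro nn_integral_mono) (auto simp: indicator_def)

lemma sq_norm_diff_triangle:
 assumes "progressive G" "progressive H" "progressive K" "0 <= t"
 shows "sq_norm t (\<lambda>u w. G u w - K u w) <= 2 * sq_norm t (\<lambda>u w. G u w - H u w) + 2 * sq_norm t (\<lambda>u w. H u w - K u w)"
 using nn_integral_square_diff_triangle[OF cutoff_M[OF assms(1,4)] cutoff_M[OF assms(2,4)] cutoff_M[OF assms(3,4)]]
 by (simp add: sq_norm_def cutoff_def scaleR_diff_right)

lemma sq_norm_minus_commute: "sq_norm t (\<lambda>u w. G u w - H u w) = sq_norm t (\<lambda>u w. H u w - G u w)"
 unfolding sq_norm_def cutoff_def by (intro nn_integral_cong) (auto simp: norm_minus_commute indicator_def)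

lemma sq_norm_bounded:
 assumes "0 <= t" "\<And>u w. 0 <= u ==> u <= t ==> w \<in> space M ==> norm (G u w) <= C"
 shows "sq_norm t G <= ennreal (C\<^sup>2 * t)"
proof -
 have "sq_norm t G <= (\<integral>\<^sup>+p. ennreal (C\<^sup>2) * indicator ({0..t} \<times> space M) p \<partial>(lborel \<Otimes>\<^sub>M M))"
  unfolding sq_norm_def
 proof (rule nn_integral_mono)
  fix p :: "real \<times> 'a" assume p: "p \<in> space (lborel \<Otimes>\<^sub>M M)"
  show "ennreal (nsq (cutoff t G p)) <= ennreal (C\<^sup>2) * indicator ({0..t} \<times> space M) p"
   using p assms(2)[of "fst p" "snd p"]
   by (cases p) (auto simp: cutoff_def indicator_def space_pair_measure intro!: ennreal_leI power_mono)
 qed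
 also have "\<dots> = ennreal (C\<^sup>2 * t)"
  using assms(1) by (subst nn_integral_cmult_indicator)
   (auto simp: emeasure_pair_measure_Times emeasure_space_1 ennreal_mult'[symmetric])
 finally show ?thesis .
qed

lemma sq_norm_finite: "prog_bdd G ==> 0 <= t ==> sq_norm t G < \<infinity>"
proof -
 assume G: "prog_bdd G" and t: "0 <= t"
 show ?thesis
 proof (rule prog_bdd_bound[OF G t])
  fix C assume C: "\<And>u w. 0 <= u ==> u <= t ==> w \<in> space M ==> norm (G u w) <= C"
  have "sq_norm t G <= ennreal (C\<^sup>2 * t)" by (rule sq_norm_bounded[OF t]) (rule C)
  also have "\<dots> < \<infinity>" by simp
  finally show "sq_norm t G < \<infinity>" .
 qed
qed

lemma block_isometry_sq_norm:
 fixes A :: "'i => 'a => real ^ 'd ^ 'n"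
 assumes "blocks I a b A" "0 <= t"
 shows "msq M (block_int B I a b A t) = sq_norm t (block_val I a b A)"
 using block_isometry[OF assms] sq_norm_paths(1)[OF prog_bddD[OF prog_bdd_block_val[OF assms(1)]] assms(2)] by simp

lemma block_int_l2_martingale:
 fixes A :: "'i => 'a => real ^ 'd ^ 'n"
 assumes bl: "blocks I a b A"
 shows "l2_martingale (block_int B I a b A)"
 unfolding l2_martingale_def
proof (intro conjI allI impI)
 show 1: "block_int B I a b A t \<in> borel_measurable (F t)" if "0 <= t" for t
  using block_int_measurable[OF bl that] .
 show "sq_integrable M (block_int B I a b A t)" if "0 <= t" for t
  using block_isometry_sq_norm[OF bl that] sq_norm_finite[OF prog_bdd_block_val[OF bl] that]
  by (subst sq_integrable_nn[OF measurable_F_M[OF 1[OF that] that]]) simp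
 show "expectation (\<lambda>w. Z w \<bullet> (block_int B I a b A t w - block_int B I a b A s w)) = 0"
  if "0 <= s \<and> s <= t \<and> Z \<in> borel_measurable (F s) \<and> sq_integrable M Z" for s t Z
  using block_int_orthogonal[OF bl, of s t Z] that by (auto simp: sq_integrable_def has_bochner_integral_iff)
qed

text \<open>Joining two block families with a sign realizes their difference, so the isometry for
  one family yields the isometry for differences.\<close>

lemma blocks_Plus:
 assumes "blocks I a b A" "blocks J c d C"
 shows "blocks (I <+> J) (case_sum a c) (case_sum b d) (case_sum A (\<lambda>j w. - C j w))"
 using assms by (auto simp: blocks_def bounded_iff)

lemma block_val_Plus:
 "blocks I a b A ==> blocks J c d C ==>
  block_val (I <+> J) (case_sum a c) (case_sum b d) (case_sum A (\<lambda>j w. - C j w)) t w = block_val I a b A t w - block_val J c d C t w"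
 unfolding block_val_def blocks_def by (subst sum.Plus) (simp_all only: o_def sum.case scaleR_minus_right sum_negf diff_conv_add_uminus)

lemma uminus_matrix_vector: "(- A) *v x = - (A *v x)" for A :: "real ^ 'c ^ 'n"
 by (simp add: matrix_vector_mult_def vec_eq_iff sum_negf)

lemma block_int_Plus:
 "blocks I a b A ==> blocks J c d C ==>
  block_int B (I <+> J) (case_sum a c) (case_sum b d) (case_sum A (\<lambda>j w. - C j w)) t w = block_int B I a b A t w - block_int B J c d C t w"
 unfolding block_int_def blocks_def
 by (subst sum.Plus) (simp_all only: o_def sum.case uminus_matrix_vector sum_negf diff_conv_add_uminus)

lemma block_diff_isometry:
 fixes A :: "'i => 'a => real ^ 'd ^ 'n" and C :: "'j => 'a => real ^ 'd ^ 'n"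
 assumes "blocks I a b A" "blocks J c d C" "0 <= t"
 shows "msq M (\<lambda>w. block_int B I a b A t w - block_int B J c d C t w)
  = sq_norm t (\<lambda>u w. block_val I a b A u w - block_val J c d C u w)"
 using block_isometry_sq_norm[OF blocks_Plus[OF assms(1,2)] assms(3)]
 unfolding block_int_Plus[OF assms(1,2)] block_val_Plus[OF assms(1,2), abs_def] .

section \<open>Predictable averages of a bounded integrand\<close>

definition avg_blocks :: "nat => (real => 'a => 'b::euclidean_space) => nat => 'a => 'b" where
 "avg_blocks k G i w = cell_avg k (\<lambda>u. G u w) i"

definition avg_process :: "nat => (real => 'a => 'b::euclidean_space) => real => 'a => 'b" where
 "avg_process k G = block_val {..<k * 2 ^ k} (dyad k) (\<lambda>i. dyad k (Suc i)) (avg_blocks k G)"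

definition avg_integral :: "nat => (real => 'a => real ^ 'd ^ 'n) => real => 'a => real ^ 'n" where
 "avg_integral k G = block_int B {..<k * 2 ^ k} (dyad k) (\<lambda>i. dyad k (Suc i)) (avg_blocks k G)"

lemma avg_process_eq: "avg_process k G u w = step_avg k (\<lambda>u. G u w) u"
 by (simp add: avg_process_def step_avg_def block_val_def avg_blocks_def)

lemma prog_bdd_path:
 assumes "prog_bdd G" "0 <= T" "w \<in> space M"
 obtains C where "0 <= C" "(\<lambda>u. indicator {0..T} u *\<^sub>R G u w) \<in> borel_measurable borel"
  "\<And>u. norm (indicator {0..T} u *\<^sub>R G u w) <= C"
proof -
 obtain C where C: "0 <= C" "\<And>t w. 0 <= t ==> t <= T ==> w \<in> space M ==> norm (G t w) <= C"
  using prog_bdd_bound[OF assms(1,2)] by blast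
 show ?thesis
  by (rule that[OF C(1) progressive_path_measurable[OF prog_bddD[OF assms(1)] assms(2,3)]])
   (use C assms(3) in \<open>auto simp: indicator_def\<close>)
qed

lemma avg_blocks_upto:
 assumes "dyad k i <= T"
 shows "avg_blocks k G i w = cell_avg k (\<lambda>u. indicator {0..T} u *\<^sub>R G u w) i"
 unfolding avg_blocks_def using assms by (intro cell_avg_local) auto

text \<open>The average carried by a cell uses the integrand only up to the left end of the cell;
  hence it is known at that time and inherits the bound of \<open>G\<close> there.\<close>

lemma blocks_avg:
 assumes G: "prog_bdd G"
 shows "blocks {..<n} (dyad k) (\<lambda>i. dyad k (Suc i)) (avg_blocks k G)"
 unfolding blocks_def
proof (intro conjI ballI)
 fix i assume "i \<in> {..<n}"
 let ?T = "dyad k i"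
 obtain C where C: "0 <= C" "\<And>t w. 0 <= t ==> t <= ?T ==> w \<in> space M ==> norm (G t w) <= C"
  using prog_bdd_bound[OF G dyad_nonneg] by blast
 have "norm (avg_blocks k G i w) <= C" if "w \<in> space M" for w
  unfolding avg_blocks_upto[OF order_refl]
  by (rule norm_cell_avg_le) (use C that in \<open>auto simp: indicator_def\<close>)
 then show "bounded (avg_blocks k G i ` space M)" by (auto simp: bounded_iff)
 have [measurable]: "cutoff ?T G \<in> borel_measurable (borel \<Otimes>\<^sub>M F ?T)"
  by (rule cutoff_F[OF prog_bddD[OF G]]) simp
 have "(\<lambda>p. cutoff ?T G (snd p, fst p)) \<in> borel_measurable (F ?T \<Otimes>\<^sub>M lborel)"
  by (rule measurable_compose[of "\<lambda>p. (snd p, fst p)"]) measurable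
 then have [measurable]: "(\<lambda>p. indicator {0..?T} (snd p) *\<^sub>R G (snd p) (fst p)) \<in> borel_measurable (F ?T \<Otimes>\<^sub>M lborel)"
  by (simp add: cutoff_def)
 have "(\<lambda>w. LINT u|lborel. indicator {dyad k (i - 1)<..dyad k i} u *\<^sub>R (indicator {0..?T} u *\<^sub>R G u w)) \<in> borel_measurable (F ?T)"
  unfolding cutoff_def
  by (rule lborel.borel_measurable_lebesgue_integral, unfold case_prod_beta', rule borel_measurable_scaleR) measurable
 then show "avg_blocks k G i \<in> borel_measurable (F ?T)"
  unfolding avg_blocks_upto[OF order_refl, abs_def] cell_avg_def by measurable
qed auto

lemma prog_bdd_avg_process: "prog_bdd G ==> prog_bdd (avg_process k G)"
 unfolding avg_process_def by (intro prog_bdd_block_val blocks_avg)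

lemma avg_integral_l2_martingale: "prog_bdd G ==> l2_martingale (avg_integral k G)"
 unfolding avg_integral_def by (intro block_int_l2_martingale blocks_avg)

lemma avg_blocks_diff:
 assumes G: "prog_bdd G" and H: "prog_bdd H" and w: "w \<in> space M"
 shows "avg_blocks k (\<lambda>u w. G u w - H u w) i w = avg_blocks k G i w - avg_blocks k H i w"
proof -
 let ?T = "dyad k i"
 obtain C where C: "0 <= C" "(\<lambda>u. indicator {0..?T} u *\<^sub>R G u w) \<in> borel_measurable borel"
  "\<And>u. norm (indicator {0..?T} u *\<^sub>R G u w) <= C" using prog_bdd_path[OF G dyad_nonneg w] by blast
 obtain D where D: "0 <= D" "(\<lambda>u. indicator {0..?T} u *\<^sub>R H u w) \<in> borel_measurable borel"
  "\<And>u. norm (indicator {0..?T} u *\<^sub>R H u w) <= D" using prog_bdd_path[OF H dyad_nonneg w] by blast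
 show ?thesis unfolding avg_blocks_upto[OF order_refl] scaleR_diff_right
  by (rule cell_avg_diff[where C = "max C D", OF C(2) _ D(2)]) (use C(3) D(3) in \<open>auto simp: le_max_iff_disj\<close>)
qed

lemma avg_blocks_scaleR:
 shows "avg_blocks k (\<lambda>u w. Z w *\<^sub>R G u w) i w = Z w *\<^sub>R avg_blocks k G i w"
proof -
 let ?T = "dyad k i"
 have eq: "indicator {dyad k (i - 1)<..dyad k i} u *\<^sub>R indicator {0..?T} u *\<^sub>R Z w *\<^sub>R G u w
   = Z w *\<^sub>R (indicator {dyad k (i - 1)<..dyad k i} u *\<^sub>R (indicator {0..?T} u *\<^sub>R G u w))" for u
  by (simp add: scaleR_left_commute)
 show ?thesis
  unfolding avg_blocks_upto[OF order_refl] cell_avg_def eq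
   integral_scaleR_right by (rule scaleR_left_commute)
qed

lemma avg_integral_diff:
 assumes "prog_bdd G" "prog_bdd H" "w \<in> space M"
 shows "avg_integral k (\<lambda>u w. G u w - H u w) t w = avg_integral k G t w - avg_integral k H t w"
 unfolding avg_integral_def block_int_def avg_blocks_diff[OF assms]
 by (simp add: matrix_vector_mult_diff_rdistrib sum_subtractf)

text \<open>Averaging acts path by path, so a factor depending on the outcome alone, even an
  anticipating one, passes through. The locality of the integral rests on this.\<close>

lemma avg_integral_scaleR:
 "avg_integral k (\<lambda>u w. Z w *\<^sub>R G u w) t w = Z w *\<^sub>R avg_integral k G t w"
 unfolding avg_integral_def block_int_def avg_blocks_scaleR
 by (simp add: scaleR_matrix_vector_assoc[symmetric] scaleR_sum_right)

lemma avg_integral_local: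
 assumes "\<And>u. 0 < u ==> u <= t ==> G u w = H u w"
 shows "avg_integral k G t w = avg_integral k H t w"
 unfolding avg_integral_def block_int_def
proof (rule sum.cong[OF refl])
 fix i
 show "avg_blocks k G i w *v (B (min t (dyad k (Suc i))) w - B (min t (dyad k i)) w)
   = avg_blocks k H i w *v (B (min t (dyad k (Suc i))) w - B (min t (dyad k i)) w)"
 proof (cases "dyad k i <= t")
  case True
  then have "avg_blocks k G i w = avg_blocks k H i w"
   unfolding avg_blocks_def using assms by (intro cell_avg_local) auto
  then show ?thesis by simp
 next
  case False
  then have "min t (dyad k (Suc i)) = t" "min t (dyad k i) = t"
   using dyad_le_Suc[of k i] by (auto simp del: dyad_le_Suc)
  then show ?thesis by simp
 qed
qed

text \<open>The averages converge in L^2 along each path; since they share the bound of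
  \<open>G\<close>, dominated convergence over the outcomes finishes the argument.\<close>

lemma avg_process_tendsto:
 assumes G: "prog_bdd G" and t: "0 <= t"
 shows "(\<lambda>k. sq_norm t (\<lambda>u w. avg_process k G u w - G u w)) \<longlonglongrightarrow> 0"
proof -
 obtain C where C: "0 <= C" "\<And>u w. 0 <= u ==> u <= t ==> w \<in> space M ==> norm (G u w) <= C"
  using prog_bdd_bound[OF G t] by blast
 have prog: "progressive (\<lambda>u w. avg_process k G u w - G u w)" for k
  by (intro progressive_diff prog_bddD prog_bdd_avg_process G)
 let ?g = "\<lambda>w u. indicator {0..t} u *\<^sub>R G u w"
 have eq: "psq t (\<lambda>u. avg_process k G u w - G u w)
   = psq t (\<lambda>u. step_avg k (?g w) u - ?g w u)" for k w
 proof (rule nn_integral_cong)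
  fix u
  have "u \<in> {0..t} ==> avg_process k G u w = step_avg k (?g w) u"
   unfolding avg_process_eq by (intro step_avg_local) auto
  then show "ennreal (nsq (avg_process k G u w - G u w)) * indicator {0..t} u
   = ennreal (nsq (step_avg k (?g w) u - ?g w u)) * indicator {0..t} u"
   by (auto simp: indicator_def)
 qed
 have g: "?g w \<in> borel_measurable borel" "\<And>u. norm (?g w u) <= C" if "w \<in> space M" for w
  using progressive_path_measurable[OF prog_bddD[OF G] t that] C that by (auto simp: indicator_def)
 have "(\<lambda>k. \<integral>\<^sup>+w. (psq t (\<lambda>u. avg_process k G u w - G u w)) \<partial>M) \<longlonglongrightarrow> (\<integral>\<^sup>+w. 0 \<partial>M)"
 proof (rule nn_integral_dominated_convergence[where w = "\<lambda>w. ennreal ((2 * C)\<^sup>2 * t)"])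
  show "(\<lambda>w. psq t (\<lambda>u. avg_process k G u w - G u w)) \<in> borel_measurable M" for k
   by (rule sq_norm_paths(2)[OF prog t])
  show "AE w in M. (psq t (\<lambda>u. avg_process k G u w - G u w)) <= ennreal ((2 * C)\<^sup>2 * t)" for k
  proof (rule AE_I2)
   fix w assume w: "w \<in> space M"
   have "psq t (\<lambda>u. step_avg k (?g w) u - ?g w u) <= (\<integral>\<^sup>+u. ennreal ((2 * C)\<^sup>2) * indicator {0..t} u \<partial>lborel)"
   proof (intro nn_integral_mono mult_right_mono ennreal_leI power_mono)
    show "norm (step_avg k (?g w) u - ?g w u) <= 2 * C" for u
     using norm_triangle_ineq4[of "step_avg k (?g w) u" "?g w u"]
      norm_step_avg_le[where g = "?g w", OF g(2)[OF w] C(1), of k u] g(2)[OF w, of u] by linarith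
   qed auto
   also have "\<dots> = ennreal ((2 * C)\<^sup>2 * t)"
    using t by (subst nn_integral_cmult_indicator) (auto simp: ennreal_mult'[symmetric])
   finally show "psq t (\<lambda>u. avg_process k G u w - G u w) <= ennreal ((2 * C)\<^sup>2 * t)"
    unfolding eq .
  qed
  show "AE w in M. (\<lambda>k. psq t (\<lambda>u. avg_process k G u w - G u w)) \<longlonglongrightarrow> 0"
   unfolding eq using step_avg_tendsto_L2[OF g] by (intro AE_I2) auto
 qed (auto simp: emeasure_space_1)
 then show ?thesis by (simp add: sq_norm_paths(1)[OF prog t])
qed

end

section \<open>The Ito integral of a locally bounded integrand\<close>

lemma L2_limit_unique:
 fixes X Y :: "'a => 'b::euclidean_space"
 assumes [measurable]: "\<And>k. Xk k \<in> borel_measurable N" "X \<in> borel_measurable N" "Y \<in> borel_measurable N"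
  and X: "(\<lambda>k. msq N (\<lambda>x. Xk k x - X x)) \<longlonglongrightarrow> 0"
  and Y: "(\<lambda>k. msq N (\<lambda>x. Xk k x - Y x)) \<longlonglongrightarrow> 0"
 shows "AE x in N. X x = Y x"
proof -
 have "msq N (\<lambda>x. X x - Y x) <= 0"
 proof (rule LIMSEQ_le_const)
  have "(\<lambda>k. 2 * msq N (\<lambda>x. Xk k x - X x) + 2 * msq N (\<lambda>x. Xk k x - Y x)) \<longlonglongrightarrow> 2 * 0 + 2 * 0"
   by (intro tendsto_add tendsto_mult_ennreal tendsto_const X Y) auto
  then show "(\<lambda>k. 2 * msq N (\<lambda>x. Xk k x - X x) + 2 * msq N (\<lambda>x. Xk k x - Y x)) \<longlonglongrightarrow> 0"
   by simp
  have "msq N (\<lambda>x. X x - Y x) <= 2 * msq N (\<lambda>x. Xk k x - X x)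
    + 2 * msq N (\<lambda>x. Xk k x - Y x)" for k
   using nn_integral_square_diff_triangle[of X N "Xk k" Y] by (simp add: norm_minus_commute)
  then show "\<exists>K. \<forall>k\<ge>K. (msq N (\<lambda>x. X x - Y x)) <= 2 * msq N (\<lambda>x. Xk k x - X x)
    + 2 * msq N (\<lambda>x. Xk k x - Y x)" by blast
 qed
 then have "AE x in N. ennreal (nsq (X x - Y x)) = 0"
  by (subst nn_integral_0_iff_AE[symmetric]) auto
 then show ?thesis by eventually_elim (simp add: ennreal_eq_0_iff)
qed

context brownian_basis
begin

lemma l2_martingaleD:
 assumes "l2_martingale X" "0 <= t"
 shows "X t \<in> borel_measurable (F t)" "sq_integrable M (X t)"
 using assms by (auto simp: l2_martingale_def)

lemma l2_martingale_orthogonal: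
 assumes "l2_martingale X" "0 <= s" "s <= t" "Z \<in> borel_measurable (F s)" "sq_integrable M Z"
 shows "expectation (\<lambda>w. Z w \<bullet> (X t w - X s w)) = 0"
 using assms unfolding l2_martingale_def by blast

lemma l2_martingale_diff:
 fixes X Y :: "real => 'a => 'b::euclidean_space"
 assumes X: "l2_martingale X" and Y: "l2_martingale Y"
 shows "l2_martingale (\<lambda>t w. X t w - Y t w)"
 unfolding l2_martingale_def
proof (intro conjI allI impI)
 show "(\<lambda>w. X t w - Y t w) \<in> borel_measurable (F t)" if "0 <= t" for t
  by (intro borel_measurable_diff l2_martingaleD X Y that)
 have sq: "sq_integrable M (X t)" "sq_integrable M (Y t)" if "0 <= t" for t
  by (intro l2_martingaleD X Y that)+
 then show "sq_integrable M (\<lambda>w. X t w - Y t w)" if "0 <= t" for t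
  using that by (intro sq_integrable_diff)
 fix s t and Z :: "'a => 'b"
 assume a: "0 <= s \<and> s <= t \<and> Z \<in> borel_measurable (F s) \<and> sq_integrable M Z"
 have "expectation (\<lambda>w. Z w \<bullet> (X t w - X s w)) = 0" "expectation (\<lambda>w. Z w \<bullet> (Y t w - Y s w)) = 0"
  using a by (auto intro: l2_martingale_orthogonal X Y)
 moreover have "expectation (\<lambda>w. Z w \<bullet> (X t w - X s w) - Z w \<bullet> (Y t w - Y s w))
   = expectation (\<lambda>w. Z w \<bullet> (X t w - X s w)) - expectation (\<lambda>w. Z w \<bullet> (Y t w - Y s w))"
  using a sq[of s] sq[of t] by (intro Bochner_Integration.integral_diff sq_integrable_inner sq_integrable_diff) auto
 moreover have "(\<lambda>w. Z w \<bullet> (X t w - Y t w - (X s w - Y s w)))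
   = (\<lambda>w. Z w \<bullet> (X t w - X s w) - Z w \<bullet> (Y t w - Y s w))"
  by (simp add: inner_diff_right algebra_simps)
 ultimately show "expectation (\<lambda>w. Z w \<bullet> (X t w - Y t w - (X s w - Y s w))) = 0" by simp
qed

lemma l2_martingale_increment:
 assumes X: "l2_martingale X" and st: "0 <= s" "s <= t"
 shows "msq M (X t)
  = msq M (X s) + msq M (\<lambda>w. X t w - X s w)"
proof -
 have sq: "sq_integrable M (X s)" "sq_integrable M (X t)" and Xs: "X s \<in> borel_measurable (F s)"
  using st by (auto intro: l2_martingaleD X)
 have d: "sq_integrable M (\<lambda>w. X t w - X s w)" by (intro sq_integrable_diff sq)
 have 0: "expectation (\<lambda>w. X s w \<bullet> (X t w - X s w)) = 0"
  by (rule l2_martingale_orthogonal[OF X st Xs sq(1)])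
 have "(\<lambda>w. nsq (X t w)) = (\<lambda>w. nsq (X s w) + nsq (X t w - X s w) + 2 * (X s w \<bullet> (X t w - X s w)))"
  by (simp add: power2_norm_eq_inner algebra_simps inner_commute)
 then have "expectation (\<lambda>w. nsq (X t w)) = expectation (\<lambda>w. nsq (X s w)) + expectation (\<lambda>w. nsq (X t w - X s w))"
  using sq d sq_integrable_inner[OF sq(1) d] 0 by (simp add: sq_integrable_def)
 then show ?thesis
  unfolding sq_integrable_nn_eq[OF sq(1)] sq_integrable_nn_eq[OF sq(2)] sq_integrable_nn_eq[OF d]
  by (simp add: ennreal_plus)
qed

lemma avg_integral_isometry:
 "prog_bdd G ==> 0 <= t ==>
  (msq M (\<lambda>w. avg_integral k G t w - avg_integral l G t w))
   = sq_norm t (\<lambda>u w. avg_process k G u w - avg_process l G u w)"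
 unfolding avg_integral_def avg_process_def by (intro block_diff_isometry blocks_avg)

text \<open>A subsequence \<open>r\<close> with errors 8^-j on \<open>[0, j]\<close> is fast enough:
  Doob's inequality at level 2^-j costs 4^j and leaves the summable bound 4 * 2^-j. Fatou along the
  subsequence gives the estimate against every average, so the whole sequence converges in mean
  square at each time.\<close>

lemma ito_exists:
 fixes G :: "real => 'a => real ^ 'd ^ 'n"
 assumes G: "prog_bdd G"
 shows "\<exists>I. (\<forall>t\<ge>0. I t \<in> borel_measurable (F t)) \<and> (\<forall>w\<in>space M. continuous_on {0..} (\<lambda>t. I t w)) \<and>
  (\<forall>w\<in>space M. I 0 w = 0) \<and>
  (\<forall>t\<ge>0. \<forall>k. (msq M (\<lambda>w. I t w - avg_integral k G t w))
   <= 2 * sq_norm t (\<lambda>u w. avg_process k G u w - G u w))"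
proof -
 have pG: "progressive G" and pA: "progressive (avg_process k G)" for k
  using G prog_bdd_avg_process prog_bddD by auto
 have ex_r: "\<exists>k. sq_norm (real j) (\<lambda>u w. avg_process k G u w - G u w) <= ennreal ((1 / 8) ^ j)" for j
 proof -
  have "\<forall>\<^sub>F k in sequentially. sq_norm (real j) (\<lambda>u w. avg_process k G u w - G u w) < ennreal ((1 / 8) ^ j)"
   by (rule order_tendstoD(2)[OF avg_process_tendsto[OF G]]) auto
  from eventually_happens'[OF sequentially_bot this] show ?thesis by (auto intro: less_imp_le)
 qed
 have "\<exists>r. \<forall>j. sq_norm (real j) (\<lambda>u w. avg_process (r j) G u w - G u w) <= ennreal ((1 / 8) ^ j)"
  by (intro choice allI ex_r)
 then obtain r
  where r: "\<And>j. sq_norm (real j) (\<lambda>u w. avg_process (r j) G u w - G u w) <= ennreal ((1 / 8) ^ j)"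
  by blast
 have mart: "l2_martingale (avg_integral k G)" for k by (rule avg_integral_l2_martingale[OF G])
 have cont: "AE w in M. continuous_on {0..} (\<lambda>t. avg_integral k G t w)" for k
  unfolding avg_integral_def by (intro block_int_continuous blocks_avg G)
 have ex_E: "\<forall>j. \<exists>E. E \<in> events \<and> ennreal (((1 / 2) ^ j)\<^sup>2) * emeasure M E
    <= msq M (\<lambda>w. avg_integral (r (Suc j)) G (real j) w - avg_integral (r j) G (real j) w) \<and>
   (AE w in M. w \<notin> E --> (\<forall>t\<in>{0..real j}. norm (avg_integral (r (Suc j)) G t w - avg_integral (r j) G t w) <= (1 / 2) ^ j))"
  (is "\<forall>j. ?E j")
 proof
  fix j
  have "AE w in M. continuous_on {0..} (\<lambda>t. avg_integral (r (Suc j)) G t w - avg_integral (r j) G t w)"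
   using cont[of "r (Suc j)"] cont[of "r j"] by eventually_elim (rule continuous_on_diff)
  then show "?E j"
   by (rule maximal_continuous[OF l2_martingale_diff[OF mart mart], of "r (Suc j)" "r j" "(1 / 2) ^ j" "real j"]) auto
 qed
 from choice[OF ex_E] obtain E where E: "\<And>j. E j \<in> events"
  "\<And>j. ennreal (((1 / 2) ^ j)\<^sup>2) * emeasure M (E j)
    <= msq M (\<lambda>w. avg_integral (r (Suc j)) G (real j) w - avg_integral (r j) G (real j) w)"
  "\<And>j. AE w in M. w \<notin> E j --> (\<forall>t\<in>{0..real j}. norm (avg_integral (r (Suc j)) G t w - avg_integral (r j) G t w) <= (1 / 2) ^ j)"
  by blast
 have "prob (E j) <= 4 * (1 / 2) ^ j" for j
 proof -
  have "ennreal (((1 / 2) ^ j)\<^sup>2) * emeasure M (E j) <= sq_norm (real j) (\<lambda>u w. avg_process (r (Suc j)) G u w - avg_process (r j) G u w)"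
   using E(2)[of j] by (simp add: avg_integral_isometry[OF G])
  also have "\<dots> <= 2 * sq_norm (real j) (\<lambda>u w. avg_process (r (Suc j)) G u w - G u w) + 2 * sq_norm (real j) (\<lambda>u w. G u w - avg_process (r j) G u w)"
   by (intro sq_norm_diff_triangle pA pG) simp
  also have "\<dots> <= 2 * ennreal ((1 / 8) ^ j) + 2 * ennreal ((1 / 8) ^ j)"
  proof (intro add_mono mult_left_mono)
   have "sq_norm (real j) (\<lambda>u w. avg_process (r (Suc j)) G u w - G u w) <= ennreal ((1 / 8) ^ Suc j)"
    by (rule order_trans[OF sq_norm_mono r]) simp
   also have "\<dots> <= ennreal ((1 / 8) ^ j)" by (intro ennreal_leI power_decreasing) auto
   finally show "sq_norm (real j) (\<lambda>u w. avg_process (r (Suc j)) G u w - G u w) <= ennreal ((1 / 8) ^ j)" .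
   show "sq_norm (real j) (\<lambda>u w. G u w - avg_process (r j) G u w) <= ennreal ((1 / 8) ^ j)"
    using r by (subst sq_norm_minus_commute) simp
  qed auto
  also have "\<dots> = ennreal (4 * (1 / 8) ^ j)"
   by (simp add: ennreal_mult' ennreal_numeral[symmetric] distrib_right[symmetric] del: ennreal_numeral) (simp add: ennreal_plus[symmetric] del: ennreal_plus)
  finally have "((1 / 2) ^ j)\<^sup>2 * prob (E j) <= 4 * (1 / 8) ^ j"
   by (simp add: emeasure_eq_measure ennreal_mult'[symmetric])
  moreover have "((1 / 2) ^ j)\<^sup>2 = (1 / 4 :: real) ^ j" "(1 / 4 :: real) ^ j * (4 * (1 / 2) ^ j) = 4 * (1 / 8) ^ j"
   by (simp_all add: power_mult_distrib[symmetric] power2_eq_square)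
  ultimately have "(1 / 4) ^ j * prob (E j) <= (1 / 4) ^ j * (4 * (1 / 2) ^ j)" by (simp only:)
  then show ?thesis by (rule mult_left_le_imp_le) simp
 qed
 then have sumE: "summable (\<lambda>j. prob (E j))"
  by (intro summable_comparison_test'[where N = 0, OF summable_mult[OF summable_geometric[of "1 / 2"], of 4]]) auto
 have m: "avg_integral k G t \<in> borel_measurable (F t)" if "0 <= t" for k t
  by (rule l2_martingaleD(1)[OF mart that])
 have z: "avg_integral k G 0 w = 0" for k w unfolding avg_integral_def by (intro block_int_0 blocks_avg G)
 obtain X where X: "\<And>t. 0 <= t ==> X t \<in> borel_measurable (F t)"
  "\<And>w. w \<in> space M ==> continuous_on {0..} (\<lambda>t. X t w)" "\<And>w. w \<in> space M ==> X 0 w = 0"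
  "AE w in M. \<forall>T. uniform_limit {0..T} (\<lambda>j t. avg_integral (r j) G t w) (\<lambda>t. X t w) sequentially"
  using limit_process[of "\<lambda>j. avg_integral (r j) G", OF m cont z E(1) sumE E(3)] by blast
 have "msq M (\<lambda>w. X t w - avg_integral k G t w) <= 2 * sq_norm t (\<lambda>u w. avg_process k G u w - G u w)"
  if t: "0 <= t" for t k
 proof -
  have [measurable]: "avg_integral k G t \<in> borel_measurable M" for k using m[OF t] t by (rule measurable_F_M)
  let ?S = "sq_norm t (\<lambda>u w. avg_process k G u w - G u w)"
  let ?d = "\<lambda>j w. avg_integral (r j) G t w - avg_integral k G t w"
  have "AE w in M. ennreal (nsq (X t w - avg_integral k G t w))
    = liminf (\<lambda>j. ennreal (nsq (?d j w)))"
   using X(4)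
  proof eventually_elim
   fix w assume "\<forall>T. uniform_limit {0..T} (\<lambda>j t. avg_integral (r j) G t w) (\<lambda>t. X t w) sequentially"
   then have "(\<lambda>j. avg_integral (r j) G t w) \<longlonglongrightarrow> X t w"
    using t by (intro tendsto_uniform_limitI[where S = "{0..t}"]) auto
   then have "(\<lambda>j. ennreal (nsq (?d j w)))
     \<longlonglongrightarrow> ennreal (nsq (X t w - avg_integral k G t w))"
    by (intro tendsto_intros)
   from lim_imp_Liminf[OF sequentially_bot this]
   show "ennreal (nsq (X t w - avg_integral k G t w))
    = liminf (\<lambda>j. ennreal (nsq (?d j w)))"
    by (rule sym)
  qed
  then have "msq M (\<lambda>w. X t w - avg_integral k G t w)
    = (\<integral>\<^sup>+w. liminf (\<lambda>j. ennreal (nsq (?d j w))) \<partial>M)"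
   by (rule nn_integral_cong_AE)
  also have "\<dots> <= liminf (\<lambda>j. msq M (?d j))"
   by (rule nn_integral_liminf) measurable
  also have "\<dots> <= liminf (\<lambda>j. 2 * ennreal ((1 / 8) ^ j) + 2 * ?S)"
  proof (rule Liminf_mono)
   show "\<forall>\<^sub>F j in sequentially. (msq M (?d j)) <= 2 * ennreal ((1 / 8) ^ j) + 2 * ?S"
    using eventually_ge_at_top[of "nat \<lceil>t\<rceil>"]
   proof eventually_elim
    fix j assume "nat \<lceil>t\<rceil> <= j"
    then have j: "t <= real j" by linarith
    have "msq M (?d j)
      <= 2 * sq_norm t (\<lambda>u w. avg_process (r j) G u w - G u w) + 2 * sq_norm t (\<lambda>u w. G u w - avg_process k G u w)"
     unfolding avg_integral_isometry[OF G t] by (intro sq_norm_diff_triangle pA pG t)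
    also have "\<dots> <= 2 * ennreal ((1 / 8) ^ j) + 2 * ?S"
     by (intro add_mono mult_left_mono order_trans[OF sq_norm_mono[OF j] r]) (simp_all add: sq_norm_minus_commute[of t G])
    finally show "msq M (?d j) <= 2 * ennreal ((1 / 8) ^ j) + 2 * ?S" .
   qed
  qed
  also have "\<dots> = 2 * ?S"
  proof (rule lim_imp_Liminf)
   have "(\<lambda>j. ennreal ((1 / 8) ^ j)) \<longlonglongrightarrow> ennreal 0"
    by (intro tendsto_ennrealI LIMSEQ_power_zero) simp
   then have "(\<lambda>j. 2 * ennreal ((1 / 8) ^ j) + 2 * ?S) \<longlonglongrightarrow> 2 * ennreal 0 + 2 * ?S"
    by (intro tendsto_add tendsto_mult_ennreal tendsto_const) auto
   then show "(\<lambda>j. 2 * ennreal ((1 / 8) ^ j) + 2 * ?S) \<longlonglongrightarrow> 2 * ?S" by simp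
  qed simp
  finally show ?thesis .
 qed
 with X show ?thesis by blast
qed

definition ito :: "(real => 'a => real ^ 'd ^ 'n) => real => 'a => real ^ 'n" where
 "ito G = (SOME I. (\<forall>t\<ge>0. I t \<in> borel_measurable (F t)) \<and> (\<forall>w\<in>space M. continuous_on {0..} (\<lambda>t. I t w)) \<and>
  (\<forall>w\<in>space M. I 0 w = 0) \<and>
  (\<forall>t\<ge>0. \<forall>k. (msq M (\<lambda>w. I t w - avg_integral k G t w))
   <= 2 * sq_norm t (\<lambda>u w. avg_process k G u w - G u w)))"

lemma
 fixes G :: "real => 'a => real ^ 'd ^ 'n"
 assumes G: "prog_bdd G"
 shows ito_measurable: "0 <= t ==> ito G t \<in> borel_measurable (F t)"
  and ito_continuous: "w \<in> space M ==> continuous_on {0..} (\<lambda>t. ito G t w)"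
  and ito_0: "w \<in> space M ==> ito G 0 w = 0"
  and ito_approx: "0 <= t ==> (msq M (\<lambda>w. ito G t w - avg_integral k G t w))
   <= 2 * sq_norm t (\<lambda>u w. avg_process k G u w - G u w)"
 using someI_ex[OF ito_exists[OF G]] unfolding ito_def[symmetric] by blast+

lemma ito_tendsto:
 assumes G: "prog_bdd G" and t: "0 <= t"
 shows "(\<lambda>k. msq M (\<lambda>w. avg_integral k G t w - ito G t w)) \<longlonglongrightarrow> 0"
proof (rule tendsto_sandwich[OF _ _ tendsto_const])
 have "(\<lambda>k. 2 * sq_norm t (\<lambda>u w. avg_process k G u w - G u w)) \<longlonglongrightarrow> 2 * 0"
  by (intro tendsto_mult_ennreal tendsto_const avg_process_tendsto G t) auto
 then show "(\<lambda>k. 2 * sq_norm t (\<lambda>u w. avg_process k G u w - G u w)) \<longlonglongrightarrow> 0" by simp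
 show "\<forall>\<^sub>F k in sequentially. (msq M (\<lambda>w. avg_integral k G t w - ito G t w))
   <= 2 * sq_norm t (\<lambda>u w. avg_process k G u w - G u w)"
  using ito_approx[OF G t] by (simp add: norm_minus_commute)
qed simp

lemma ito_measurable_M: "prog_bdd G ==> 0 <= t ==> ito G t \<in> borel_measurable M"
 using ito_measurable measurable_F_M by blast

lemma avg_integral_sq_integrable: "prog_bdd G ==> 0 <= t ==> sq_integrable M (avg_integral k G t)"
 using avg_integral_l2_martingale by (auto simp: l2_martingale_def)

lemma ito_sq_integrable: "prog_bdd G ==> 0 <= t ==> sq_integrable M (ito G t)"
 by (rule sq_integrable_limit[OF avg_integral_sq_integrable ito_measurable_M ito_tendsto])

lemma cutoff_sq_integrable:
 assumes "prog_bdd G" "0 <= t"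
 shows "sq_integrable (lborel \<Otimes>\<^sub>M M) (cutoff t G)"
 using sq_norm_finite[OF assms] cutoff_M[OF prog_bddD[OF assms(1)] assms(2)]
 by (subst sq_integrable_nn) (auto simp: sq_norm_def)

text \<open>The isometry for the averages passes to the limit on both sides: squared norms are inner
  products, which are continuous under L^2 convergence.\<close>

lemma ito_isometry:
 assumes G: "prog_bdd G" and t: "0 <= t"
 shows "msq M (ito G t) = sq_norm t G"
proof -
 let ?Q = "lborel \<Otimes>\<^sub>M M"
 note A = avg_integral_sq_integrable[OF G t] and S = cutoff_sq_integrable[OF prog_bdd_avg_process[OF G] t]
 have mG: "cutoff t G \<in> borel_measurable ?Q" by (rule cutoff_M[OF prog_bddD[OF G] t])
 have 1: "(\<lambda>k. LINT w|M. avg_integral k G t w \<bullet> avg_integral k G t w) \<longlonglongrightarrow> (LINT w|M. ito G t w \<bullet> ito G t w)"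
  by (intro sq_integrable_inner_tendsto A ito_measurable_M ito_tendsto G t)
 have d: "(\<lambda>k. \<integral>\<^sup>+p. ennreal (nsq (cutoff t (avg_process k G) p - cutoff t G p)) \<partial>?Q) \<longlonglongrightarrow> 0"
  using avg_process_tendsto[OF G t] by (simp add: sq_norm_def cutoff_def scaleR_diff_right)
 have 2: "(\<lambda>k. LINT p|?Q. cutoff t (avg_process k G) p \<bullet> cutoff t (avg_process k G) p)
   \<longlonglongrightarrow> (LINT p|?Q. cutoff t G p \<bullet> cutoff t G p)"
  by (intro sq_integrable_inner_tendsto S mG d)
 have "(LINT w|M. avg_integral k G t w \<bullet> avg_integral k G t w)
   = (LINT p|?Q. cutoff t (avg_process k G) p \<bullet> cutoff t (avg_process k G) p)" for k
 proof -
  have "msq M (avg_integral k G t) = sq_norm t (avg_process k G)"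
   unfolding avg_integral_def avg_process_def by (intro block_isometry_sq_norm blocks_avg G t)
  then show ?thesis
   unfolding sq_norm_def sq_integrable_nn_eq[OF A] sq_integrable_nn_eq[OF S] by (simp add: power2_norm_eq_inner)
 qed
 then have "(LINT w|M. ito G t w \<bullet> ito G t w) = (LINT p|?Q. cutoff t G p \<bullet> cutoff t G p)"
  using LIMSEQ_unique[OF 1] 2 by simp
 then show ?thesis
  unfolding sq_norm_def sq_integrable_nn_eq[OF ito_sq_integrable[OF G t]]
   sq_integrable_nn_eq[OF cutoff_sq_integrable[OF G t]] by (simp add: power2_norm_eq_inner)
qed

lemma ito_l2_martingale:
 fixes G :: "real => 'a => real ^ 'd ^ 'n"
 assumes G: "prog_bdd G"
 shows "l2_martingale (ito G)"
 unfolding l2_martingale_def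
proof (intro conjI allI impI)
 fix s t and Z :: "'a => real ^ 'n"
 assume a: "0 <= s \<and> s <= t \<and> Z \<in> borel_measurable (F s) \<and> sq_integrable M Z"
 then have t: "0 <= t" "0 <= s" by auto
 have lim: "(\<lambda>k. LINT w|M. Z w \<bullet> avg_integral k G u w) \<longlonglongrightarrow> (LINT w|M. Z w \<bullet> ito G u w)" if "0 <= u" for u
  using a that by (intro sq_integrable_inner_tendsto avg_integral_sq_integrable ito_measurable_M ito_tendsto G)
   (auto simp: sq_integrable_def)
 have eq: "expectation (\<lambda>w. Z w \<bullet> (X t w - X s w)) = (LINT w|M. Z w \<bullet> X t w) - (LINT w|M. Z w \<bullet> X s w)"
  if "sq_integrable M (X s)" "sq_integrable M (X t)" for X
  using a that by (simp add: inner_diff_right sq_integrable_inner)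
 have "(\<lambda>k. expectation (\<lambda>w. Z w \<bullet> (avg_integral k G t w - avg_integral k G s w))) \<longlonglongrightarrow> expectation (\<lambda>w. Z w \<bullet> (ito G t w - ito G s w))"
  using tendsto_diff[OF lim lim, of t s] t G
  by (simp add: eq avg_integral_sq_integrable ito_sq_integrable)
 moreover have "expectation (\<lambda>w. Z w \<bullet> (avg_integral k G t w - avg_integral k G s w)) = 0" for k
  using a by (auto intro: l2_martingale_orthogonal avg_integral_l2_martingale G)
 ultimately show "expectation (\<lambda>w. Z w \<bullet> (ito G t w - ito G s w)) = 0"
  by (simp add: LIMSEQ_const_iff)
qed (use G ito_measurable ito_sq_integrable in auto)

section \<open>Linearity and locality of the integral\<close>

lemma AE_eq_of_L2_limit:
 assumes "prog_bdd G" "0 <= t" "Y \<in> borel_measurable M"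
  and "(\<lambda>k. msq M (\<lambda>w. avg_integral k G t w - Y w)) \<longlonglongrightarrow> 0"
 shows "AE w in M. ito G t w = Y w"
proof (rule L2_limit_unique[OF _ ito_measurable_M[OF assms(1,2)] assms(3) ito_tendsto[OF assms(1,2)] assms(4)])
 show "avg_integral k G t \<in> borel_measurable M" for k
  using avg_integral_sq_integrable[OF assms(1,2)] by (simp add: sq_integrable_def)
qed

lemma avg_integral_measurable: "prog_bdd G ==> 0 <= t ==> avg_integral k G t \<in> borel_measurable M"
 by (rule avg_integral_sq_integrable[unfolded sq_integrable_def, THEN conjunct1])

lemma ito_diff:
 fixes G H :: "real => 'a => real ^ 'd ^ 'n"
 assumes G: "prog_bdd G" and H: "prog_bdd H" and t: "0 <= t"
 shows "AE w in M. ito (\<lambda>u w. G u w - H u w) t w = ito G t w - ito H t w"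
proof (rule AE_eq_of_L2_limit[OF prog_bdd_diff[OF G H] t])
 let ?h = "\<lambda>k w. avg_integral k (\<lambda>u w. G u w - H u w) t w - (ito G t w - ito H t w)"
 note [measurable] = ito_measurable_M[OF G t] ito_measurable_M[OF H t] avg_integral_measurable[OF G t] avg_integral_measurable[OF H t]
 show "(\<lambda>w. ito G t w - ito H t w) \<in> borel_measurable M" by measurable
 show "(\<lambda>k. msq M (?h k)) \<longlonglongrightarrow> 0"
 proof (rule tendsto_sandwich[OF _ _ tendsto_const])
  let ?b = "\<lambda>k. 2 * msq M (\<lambda>w. avg_integral k G t w - ito G t w)
   + 2 * msq M (\<lambda>w. avg_integral k H t w - ito H t w)"
  have "?b \<longlonglongrightarrow> 2 * 0 + 2 * 0"
   by (intro tendsto_add tendsto_mult_ennreal tendsto_const ito_tendsto G H t) auto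
  then show "?b \<longlonglongrightarrow> 0" by simp
  show "\<forall>\<^sub>F k in sequentially. (msq M (?h k)) <= ?b k"
  proof (rule always_eventually, rule allI)
   fix k
   have "msq M (?h k)
    = msq M (\<lambda>w. (avg_integral k G t w - ito G t w) + (ito H t w - avg_integral k H t w))"
    by (intro nn_integral_cong) (simp add: avg_integral_diff[OF G H] algebra_simps)
   also have "\<dots> <= 2 * msq M (\<lambda>w. avg_integral k G t w - ito G t w)
    + 2 * msq M (\<lambda>w. ito H t w - avg_integral k H t w)"
    by (rule nn_integral_square_add) measurable
   finally show "msq M (?h k) <= ?b k"
    by (simp add: norm_minus_commute)
  qed
 qed simp
qed

text \<open>The identity holds path by path for the averages and survives the limit because
  \<open>Z\<close> is bounded. As \<open>Z\<close> is any bounded \<open>M\<close>-measurable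
  factor, it may be the indicator of an arbitrary event.\<close>

lemma ito_scaleR:
 fixes G H :: "real => 'a => real ^ 'd ^ 'n"
 assumes G: "prog_bdd G" and H: "prog_bdd H" and t: "0 <= t"
  and Z: "Z \<in> borel_measurable M" "\<And>w. w \<in> space M ==> \<bar>Z w\<bar> <= C"
  and eq: "\<And>u w. 0 < u ==> u <= t ==> w \<in> space M ==> H u w = Z w *\<^sub>R G u w"
 shows "AE w in M. ito H t w = Z w *\<^sub>R ito G t w"
proof (rule AE_eq_of_L2_limit[OF H t])
 let ?h = "\<lambda>k w. avg_integral k H t w - Z w *\<^sub>R ito G t w"
 note [measurable] = ito_measurable_M[OF G t] avg_integral_measurable[OF G t] Z(1)
 show "(\<lambda>w. Z w *\<^sub>R ito G t w) \<in> borel_measurable M" by measurable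
 show "(\<lambda>k. msq M (?h k)) \<longlonglongrightarrow> 0"
 proof (rule tendsto_sandwich[OF _ _ tendsto_const])
  let ?b = "\<lambda>k. ennreal (C\<^sup>2) * msq M (\<lambda>w. avg_integral k G t w - ito G t w)"
  have "?b \<longlonglongrightarrow> ennreal (C\<^sup>2) * 0"
   by (intro tendsto_mult_ennreal tendsto_const ito_tendsto G t) auto
  then show "?b \<longlonglongrightarrow> 0" by simp
  show "\<forall>\<^sub>F k in sequentially. (msq M (?h k)) <= ?b k"
  proof (rule always_eventually, rule allI)
   fix k
   have "msq M (?h k)
    <= (\<integral>\<^sup>+w. ennreal (C\<^sup>2) * ennreal (nsq (avg_integral k G t w - ito G t w)) \<partial>M)"
   proof (rule nn_integral_mono)
    fix w assume w: "w \<in> space M"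
    have "avg_integral k H t w = avg_integral k (\<lambda>u w. Z w *\<^sub>R G u w) t w"
     by (rule avg_integral_local) (use eq w in auto)
    then have "avg_integral k H t w - Z w *\<^sub>R ito G t w = Z w *\<^sub>R (avg_integral k G t w - ito G t w)"
     by (simp add: avg_integral_scaleR scaleR_diff_right)
    then have "nsq (?h k w) = \<bar>Z w\<bar>\<^sup>2 * nsq (avg_integral k G t w - ito G t w)"
     by (simp add: power_mult_distrib)
    also have "\<dots> <= C\<^sup>2 * nsq (avg_integral k G t w - ito G t w)"
     using Z(2)[OF w] by (intro mult_right_mono power_mono) auto
    finally show "ennreal (nsq (?h k w))
     <= ennreal (C\<^sup>2) * ennreal (nsq (avg_integral k G t w - ito G t w))"
     by (simp add: ennreal_mult'[symmetric] ennreal_leI)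
   qed
   also have "\<dots> = ?b k" by (rule nn_integral_cmult) measurable
   finally show "msq M (?h k) <= ?b k" .
  qed
 qed simp
qed

lemma prog_bdd_zero: "prog_bdd (\<lambda>u w. 0)"
 by (rule prog_bddI) (auto intro!: progressive_time)

text \<open>With \<open>Z\<close> the indicator of \<open>A\<close> minus the exceptional null set,
  \<open>Z\<close> times \<open>G - H\<close> is the zero integrand up to \<open>t\<close>, so
  \<open>Z\<close> times the integral of the difference vanishes.\<close>

lemma ito_cong_on:
 fixes G H :: "real => 'a => real ^ 'd ^ 'n"
 assumes G: "prog_bdd G" and H: "prog_bdd H" and t: "0 <= t" and A: "A \<in> events"
  and eq: "AE w in M. w \<in> A --> (\<forall>u. 0 < u --> u <= t --> G u w = H u w)"
 shows "AE w in M. w \<in> A --> ito G t w = ito H t w"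
proof -
 obtain N where N: "N \<in> null_sets M" and
  NE: "\<And>w. w \<in> space M ==> w \<notin> N ==> w \<in> A --> (\<forall>u. 0 < u --> u <= t --> G u w = H u w)"
  using AE_null_set[OF eq] by blast
 define Z :: "'a => real" where "Z = indicator (A - N)"
 note D = prog_bdd_diff[OF G H]
 have Z: "Z \<in> borel_measurable M" unfolding Z_def using A N by (intro borel_measurable_indicator) auto
 have "AE w in M. ito (\<lambda>u w. 0) t w = Z w *\<^sub>R ito (\<lambda>u w. G u w - H u w) t w"
 proof (rule ito_scaleR[OF D prog_bdd_zero t Z])
  show "\<bar>Z w\<bar> <= 1" for w by (simp add: Z_def indicator_def)
  show "0 = Z w *\<^sub>R (G u w - H u w)" if "0 < u" "u <= t" "w \<in> space M" for u w
   using NE[OF that(3)] that by (auto simp: Z_def indicator_def)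
 qed
 \<comment> \<open>Scaling by the factor 0 shows that the zero integrand has integral zero.\<close>
 moreover have "AE w in M. ito (\<lambda>u w. 0 :: real ^ 'd ^ 'n) t w = 0 *\<^sub>R ito (\<lambda>u w. 0) t w"
  by (rule ito_scaleR[OF prog_bdd_zero prog_bdd_zero t, where C = 0]) auto
 moreover note ito_diff[OF G H t] AE_not_in[OF N]
 ultimately show ?thesis
  by eventually_elim (auto simp: Z_def)
qed

text \<open>No energy is added after \<open>s\<close>. By the isometry and the orthogonality of
  increments nothing is left for the mean square of the increment; the cancellation uses that the
  energy up to \<open>s\<close> is finite.\<close>

lemma ito_const:
 assumes G: "prog_bdd G" and st: "0 <= s" "s <= t" and z: "\<And>u w. s < u ==> u <= t ==> w \<in> space M ==> G u w = 0"
 shows "AE w in M. ito G t w = ito G s w"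
proof -
 have t: "0 <= t" using st by simp
 have "sq_norm t G = sq_norm s G"
  unfolding sq_norm_def cutoff_def
 proof (rule nn_integral_cong)
  fix p :: "real \<times> 'a" assume "p \<in> space (lborel \<Otimes>\<^sub>M M)"
  then have "snd p \<in> space M" by (auto simp: space_pair_measure)
  then show "ennreal (nsq (indicator {0..t} (fst p) *\<^sub>R G (fst p) (snd p))) = ennreal (nsq (indicator {0..s} (fst p) *\<^sub>R G (fst p) (snd p)))"
   using z[of "fst p" "snd p"] st by (auto simp: indicator_def)
 qed
 then have "sq_norm s G = sq_norm s G + msq M (\<lambda>w. ito G t w - ito G s w)"
  using l2_martingale_increment[OF ito_l2_martingale[OF G] st] by (simp add: ito_isometry[OF G] st t)
 then have "msq M (\<lambda>w. ito G t w - ito G s w) = 0"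
  using sq_norm_finite[OF G st(1)]
   ennreal_add_left_cancel[of "sq_norm s G" 0 "\<integral>\<^sup>+w. ennreal (nsq (ito G t w - ito G s w)) \<partial>M"]
  by auto
 moreover have "(\<lambda>w. ennreal (nsq (ito G t w - ito G s w))) \<in> borel_measurable M"
  using ito_measurable_M[OF G] st t by measurable
 ultimately have "AE w in M. ennreal (nsq (ito G t w - ito G s w)) = 0"
  by (subst nn_integral_0_iff_AE[symmetric]) auto
 then show ?thesis by eventually_elim (simp add: ennreal_eq_0_iff)
qed

lemma prog_bdd_after:
 assumes G: "prog_bdd G" and s: "0 <= s" and Z: "Z \<in> borel_measurable (F s)" "\<And>w. w \<in> space M ==> \<bar>Z w\<bar> <= C"
 shows "prog_bdd (\<lambda>u w. (indicator {s<..} u * Z w) *\<^sub>R G u w)"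
proof (rule prog_bdd_scaleR[OF prog_bddI G])
 show "progressive (\<lambda>t w. indicator {s<..} t * Z w)"
  using progressive_after[OF Z(1) s] by simp
 show "\<exists>C. \<forall>t w. 0 <= t --> t <= T --> w \<in> space M --> norm (indicator {s<..} t * Z w) <= C" for T :: real
  using Z(2) by (intro exI[of _ "\<bar>C\<bar>"]) (auto simp: indicator_def intro: order_trans[OF _ abs_ge_self])
qed

text \<open>Split \<open>G\<close> at \<open>s\<close>: the part up to \<open>s\<close> has an
  integral that is constant afterwards, and from the remaining part \<open>Z\<close> can be pulled
  out. Measurability of \<open>Z\<close> at time \<open>s\<close> keeps the weighted integrand
  progressive.\<close>

lemma ito_after:
 fixes G :: "real => 'a => real ^ 'd ^ 'n"
 assumes G: "prog_bdd G" and st: "0 <= s" "s <= t" and Z: "Z \<in> borel_measurable (F s)" "\<And>w. w \<in> space M ==> \<bar>Z w\<bar> <= C"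
 shows "AE w in M. ito (\<lambda>u w. (indicator {s<..} u * Z w) *\<^sub>R G u w) t w = Z w *\<^sub>R (ito G t w - ito G s w)"
proof -
 have t: "0 <= t" using st by simp
 let ?G2 = "\<lambda>u w. (indicator {s<..} u * 1) *\<^sub>R G u w" and ?G1 = "\<lambda>u w. G u w - (indicator {s<..} u * 1) *\<^sub>R G u w"
 have G2: "prog_bdd ?G2" by (rule prog_bdd_after[OF G st(1), where Z = "\<lambda>_. 1"]) auto
 note G1 = prog_bdd_diff[OF G G2]
 have "AE w in M. w \<in> space M --> ito ?G1 s w = ito G s w"
  by (rule ito_cong_on[OF G1 G st(1)]) auto
 moreover have "AE w in M. ito ?G1 t w = ito ?G1 s w"
  by (rule ito_const[OF G1 st]) auto
 moreover note ito_diff[OF G G2 t]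
 moreover have "AE w in M. ito (\<lambda>u w. (indicator {s<..} u * Z w) *\<^sub>R G u w) t w = Z w *\<^sub>R ito ?G2 t w"
  by (rule ito_scaleR[OF G2 prog_bdd_after[OF G st(1) Z] t measurable_F_M[OF Z(1) st(1)] Z(2)]) (auto simp: mult.commute)
 ultimately show ?thesis using AE_space
 proof eventually_elim
  case (elim w)
  then have "ito ?G2 t w = ito G t w - ito G s w" by (simp add: algebra_simps)
  then show ?case using elim(4) by simp
 qed
qed

lemma ito_const_on:
 fixes G :: "real => 'a => real ^ 'd ^ 'n"
 assumes G: "prog_bdd G" and st: "0 <= s" "s <= t" and A: "A \<in> events"
  and z: "\<And>u w. s < u ==> u <= t ==> w \<in> A ==> G u w = 0"
 shows "AE w in M. w \<in> A --> ito G t w = ito G s w"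
proof -
 have t: "0 <= t" using st by simp
 let ?G2 = "\<lambda>u w. (indicator {s<..} u * 1) *\<^sub>R G u w"
 have G2: "prog_bdd ?G2" by (rule prog_bdd_after[OF G st(1), where Z = "\<lambda>_. 1"]) auto
 have "AE w in M. w \<in> A --> ito ?G2 t w = ito (\<lambda>u w. 0) t w"
  by (rule ito_cong_on[OF G2 prog_bdd_zero t A]) (use z in \<open>auto simp: indicator_def\<close>)
 moreover have "AE w in M. ito (\<lambda>u w. 0 :: real ^ 'd ^ 'n) t w = 0 *\<^sub>R ito (\<lambda>u w. 0) t w"
  by (rule ito_scaleR[OF prog_bdd_zero prog_bdd_zero t, where C = 0]) auto
 moreover have "AE w in M. ito ?G2 t w = 1 *\<^sub>R (ito G t w - ito G s w)"
  by (rule ito_after[OF G st, where Z = "\<lambda>_. 1"]) auto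
 ultimately show ?thesis by eventually_elim simp
qed

text \<open>The averages of a block process are again blocks, so the isometry measures the distance
  of their integrals to the block integral by the distance of the integrands.\<close>

lemma ito_block:
 fixes A :: "'i => 'a => real ^ 'd ^ 'n"
 assumes bl: "blocks I a b A" and t: "0 <= t"
 shows "AE w in M. ito (block_val I a b A) t w = block_int B I a b A t w"
proof (rule AE_eq_of_L2_limit[OF prog_bdd_block_val[OF bl] t])
 show "block_int B I a b A t \<in> borel_measurable M"
  using block_int_measurable[OF bl t] t by (rule measurable_F_M)
 have "msq M (\<lambda>w. avg_integral k (block_val I a b A) t w - block_int B I a b A t w)
  = sq_norm t (\<lambda>u w. avg_process k (block_val I a b A) u w - block_val I a b A u w)" for k
  unfolding avg_integral_def avg_process_def by (intro block_diff_isometry blocks_avg prog_bdd_block_val bl t)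
 then show "(\<lambda>k. msq M (\<lambda>w. avg_integral k (block_val I a b A) t w - block_int B I a b A t w)) \<longlonglongrightarrow> 0"
  using avg_process_tendsto[OF prog_bdd_block_val[OF bl] t] by simp
qed

section \<open>Approximation in probability by elementary processes\<close>

lemma null_in_probabilityI:
 assumes X: "\<And>k. X k \<in> borel_measurable M" and lim: "(\<lambda>k. \<integral>\<^sup>+w. X k w \<partial>M) \<longlonglongrightarrow> 0"
 shows "null_in_probability M X"
 unfolding null_in_probability_def
proof (intro conjI allI impI)
 fix e :: real assume e: "0 < e"
 note X[measurable]
 let ?I = "\<lambda>k. \<integral>\<^sup>+w. X k w \<partial>M"
 let ?P = "\<lambda>k. {w \<in> space M. ennreal e < X k w}"
 have "measure M (?P k) <= enn2real (ennreal (1 / e) * ?I k)"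
  if "?I k < \<infinity>" for k
 proof -
  have "emeasure M (?P k) <= emeasure M {w \<in> space M. 1 <= ennreal (1 / e) * X k w}"
  proof (rule emeasure_mono)
   have "1 <= ennreal (1 / e) * x" if "ennreal e < x" for x
   proof -
    have "1 = ennreal (1 / e) * ennreal e" using e by (simp add: ennreal_mult'[symmetric])
    also have "\<dots> <= ennreal (1 / e) * x" using that by (intro mult_left_mono) auto
    finally show ?thesis .
   qed
   then show "(?P k) \<subseteq> {w \<in> space M. 1 <= ennreal (1 / e) * X k w}" by auto
  qed measurable
  also have "\<dots> <= ennreal (1 / e) * (\<integral>\<^sup>+w. X k w * indicator (space M) w \<partial>M)"
   using nn_integral_Markov_inequality[of "X k" "space M" M "ennreal (1 / e)"] by simp
  also have "(\<integral>\<^sup>+w. X k w * indicator (space M) w \<partial>M) = ?I k"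
   by (intro nn_integral_cong) simp
  finally have "emeasure M (?P k) <= ennreal (1 / e) * ?I k" .
  then show ?thesis unfolding measure_def
   using that by (intro enn2real_mono) (auto simp: ennreal_mult_less_top)
 qed
 moreover have "\<forall>\<^sub>F k in sequentially. ?I k < \<infinity>"
  by (rule order_tendstoD(2)[OF lim]) simp
 ultimately have ev: "\<forall>\<^sub>F k in sequentially. measure M (?P k) <= enn2real (ennreal (1 / e) * ?I k)"
  by (auto elim: eventually_mono)
 show "(\<lambda>k. measure M (?P k)) \<longlonglongrightarrow> 0"
 proof (rule tendsto_sandwich[OF _ ev tendsto_const])
  have "(\<lambda>k. ennreal (1 / e) * ?I k) \<longlonglongrightarrow> ennreal (1 / e) * 0"
   by (rule tendsto_mult_ennreal[OF tendsto_const lim]) simp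
  then have "(\<lambda>k. enn2real (ennreal (1 / e) * ?I k)) \<longlonglongrightarrow> enn2real (ennreal (1 / e) * 0)"
   by (intro tendsto_enn2real) simp_all
  then show "(\<lambda>k. enn2real (ennreal (1 / e) * ?I k)) \<longlonglongrightarrow> 0" by simp
 qed simp
qed (rule X)

lemma null_in_probability_sqrt:
 assumes "null_in_probability M (\<lambda>k w. ennreal ((Y k w)\<^sup>2))" "\<And>k. Y k \<in> borel_measurable M" "\<And>k w. 0 <= Y k w"
 shows "null_in_probability M (\<lambda>k w. ennreal (Y k w))"
 unfolding null_in_probability_def
proof (intro conjI allI impI)
 fix e :: real assume e: "0 < e"
 have "ennreal (e\<^sup>2) < ennreal ((Y k w)\<^sup>2) \<longleftrightarrow> ennreal e < ennreal (Y k w)" for k w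
  using e assms(3)[of k w] power_mono_iff[of "Y k w" e 2] by (simp add: ennreal_less_iff not_le[symmetric])
 moreover have "(\<lambda>k. measure M {w \<in> space M. ennreal (e\<^sup>2) < ennreal ((Y k w)\<^sup>2)}) \<longlonglongrightarrow> 0"
  using assms(1) e by (simp add: null_in_probability_def)
 ultimately show "(\<lambda>k. measure M {w \<in> space M. ennreal e < ennreal (Y k w)}) \<longlonglongrightarrow> 0" by simp
qed (use assms(2) in auto)

lemma elementary_blocks:
 assumes "elementary_process M F m s A"
 shows "blocks {..<m} s (\<lambda>i. s (Suc i)) A"
proof -
 have "i <= m ==> 0 <= s i" for i
  using assms by (induction i) (auto simp: elementary_process_def intro: order_trans)
 then show ?thesis using assms by (auto simp: blocks_def elementary_process_def)
qed

lemma elementary_value_block: "elementary_value m s A = block_val {..<m} s (\<lambda>i. s (Suc i)) A"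
 by (simp add: elementary_value_def block_val_def fun_eq_iff)

lemma elementary_integral_block: "elementary_integral B m s A = block_int B {..<m} s (\<lambda>i. s (Suc i)) A"
 by (simp add: elementary_integral_def block_int_def fun_eq_iff)

lemma elementary_avg:
 assumes "prog_bdd G"
 shows "elementary_process M F (k * 2 ^ k) (dyad k) (avg_blocks k G)"
 using blocks_avg[OF assms, of "k * 2 ^ k" k] by (auto simp: elementary_process_def blocks_def)

lemma has_ito_integral_ito:
 fixes G :: "real => 'a => real ^ 'd ^ 'n"
 assumes G: "prog_bdd G"
 shows "has_ito_integral M F B G (ito G)"
 unfolding has_ito_integral_def
proof (intro conjI allI impI)
 note pG = prog_bddD[OF G]
 show "progressive G" by (rule pG)
 show "AE w in M. (psq T (\<lambda>u. G u w)) < \<infinity>" if "0 <= T" for T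
  using nn_integral_noteq_infinite[OF sq_norm_paths(2)[OF pG that]] sq_norm_finite[OF G that]
  by (simp add: sq_norm_paths(1)[OF pG that] less_top)
 show "ito G t \<in> borel_measurable (F t)" if "0 <= t" for t by (rule ito_measurable[OF G that])
 show "AE w in M. continuous_on {0..} (\<lambda>t. ito G t w)"
  using ito_continuous[OF G] by (intro AE_I2)
 fix t :: real assume t: "0 <= t"
 let ?m = "\<lambda>k. k * 2 ^ k"
 have pd: "progressive (\<lambda>u w. avg_process k G u w - G u w)" for k
  by (intro progressive_diff prog_bddD prog_bdd_avg_process G)
 have v: "elementary_value (?m k) (dyad k) (avg_blocks k G) = avg_process k G"
  "elementary_integral B (?m k) (dyad k) (avg_blocks k G) = avg_integral k G" for k
  by (simp_all add: elementary_value_block elementary_integral_block avg_process_def avg_integral_def)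
 note [measurable] = ito_measurable_M[OF G t] avg_integral_measurable[OF G t]
 have "null_in_probability M (\<lambda>k w. psq t (\<lambda>u. avg_process k G u w - G u w))"
  using sq_norm_paths(2)[OF pd t] avg_process_tendsto[OF G t]
  by (intro null_in_probabilityI) (simp_all add: sq_norm_paths(1)[OF pd t])
 moreover have "null_in_probability M (\<lambda>k w. ennreal (norm (avg_integral k G t w - ito G t w)))"
  by (rule null_in_probability_sqrt[OF null_in_probabilityI[OF _ ito_tendsto[OF G t]]]) auto
 ultimately show "\<exists>m s A. (\<forall>k. elementary_process M F (m k) (s k) (A k)) \<and>
   null_in_probability M (\<lambda>k w. psq t (\<lambda>u. elementary_value (m k) (s k) (A k) u w - G u w)) \<and>
   null_in_probability M (\<lambda>k w. ennreal (norm (elementary_integral B (m k) (s k) (A k) t w - ito G t w)))"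
  using elementary_avg[OF G]
  by (intro exI[of _ ?m] exI[of _ dyad] exI[of _ "\<lambda>k. avg_blocks k G"]) (simp add: v)
qed

section \<open>Time integrals of bounded integrands\<close>

definition tint :: "(real => 'a => 'b::euclidean_space) => real => 'a => 'b" where
 "tint a t w = (LINT s:{0..t}|lborel. a s w)"

lemma tint_set_integrable:
 assumes a: "prog_bdd a" and t: "0 <= s" and w: "w \<in> space M"
 shows "set_integrable lborel {s..t} (\<lambda>u. a u w)"
proof (cases "s <= t")
 case True
 then have t0: "0 <= t" using t by simp
 obtain C where C: "0 <= C" "(\<lambda>u. indicator {0..t} u *\<^sub>R a u w) \<in> borel_measurable borel"
  "\<And>u. norm (indicator {0..t} u *\<^sub>R a u w) <= C" using prog_bdd_path[OF a t0 w] by blast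
 have "integrable lborel (\<lambda>u. indicator {s..t} u *\<^sub>R (indicator {0..t} u *\<^sub>R a u w))"
  using C by (intro integrableI_bounded_set_indicator[where B = C]) (auto simp: emeasure_lborel_Icc_eq)
 also have "(\<lambda>u. indicator {s..t} u *\<^sub>R (indicator {0..t} u *\<^sub>R a u w)) = (\<lambda>u. indicator {s..t} u *\<^sub>R a u w)"
  using t by (auto simp: indicator_def)
 finally show ?thesis by (simp add: set_integrable_def)
qed (simp add: set_integrable_def)

lemma tint_increment:
 assumes a: "prog_bdd a" and st: "0 <= s" "s <= t" and w: "w \<in> space M"
 shows "tint a t w - tint a s w = (LINT u:{s<..t}|lborel. a u w)"
  and "set_integrable lborel {s<..t} (\<lambda>u. a u w)"
proof -
 have i: "set_integrable lborel {0..t} (\<lambda>u. a u w)" by (rule tint_set_integrable[OF a order_refl w])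
 show i2: "set_integrable lborel {s<..t} (\<lambda>u. a u w)" by (rule set_integrable_subset[OF i]) (use st in auto)
 have i1: "set_integrable lborel {0..s} (\<lambda>u. a u w)" by (rule set_integrable_subset[OF i]) (use st in auto)
 have "{0..t} = {0..s} \<union> {s<..t}" "{0..s} \<inter> {s<..t} = {}" using st by auto
 then show "tint a t w - tint a s w = (LINT u:{s<..t}|lborel. a u w)"
  using set_integral_Un[OF _ i1 i2] by (simp add: tint_def)
qed

lemma tint_lipschitz:
 assumes a: "prog_bdd a" and st: "0 <= s" "s <= t" "t <= T" and w: "w \<in> space M"
  and C: "\<And>u. s < u ==> u <= t ==> norm (a u w) <= C"
 shows "norm (tint a t w - tint a s w) <= C * (t - s)"
proof -
 have "norm (LINT u:{s<..t}|lborel. a u w) <= (LINT u|lborel. indicator {s<..t} u * C)"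
  unfolding set_lebesgue_integral_def
 proof (rule norm_integral_le)
  show "integrable lborel (\<lambda>u. indicator {s<..t} u *\<^sub>R a u w)"
   using tint_increment(2)[OF a st(1,2) w] by (simp add: set_integrable_def)
  show "integrable lborel (\<lambda>u. indicator {s<..t} u * C)"
   using st by (intro integrable_mult_left integrable_real_indicator) auto
 qed (use C in \<open>auto simp: indicator_def\<close>)
 then show ?thesis using tint_increment(1)[OF a st(1,2) w] st by (simp add: mult.commute)
qed

lemma tint_0 [simp]: "tint a 0 w = 0"
proof -
 have "(\<lambda>s. indicator {0..0} s *\<^sub>R a s w) = (\<lambda>s. indicator {0} s *\<^sub>R a 0 w)"
  by (auto simp: indicator_def)
 moreover have "(LINT s|lborel. indicator {0::real} s *\<^sub>R a 0 w) = (LINT s|(lborel :: real measure). 0)"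
  by (rule integral_cong_AE) (use AE_lborel_singleton[of "0::real"] in \<open>auto elim!: eventually_mono\<close>)
 ultimately show ?thesis by (simp add: tint_def set_lebesgue_integral_def)
qed

lemma tint_continuous:
 assumes a: "prog_bdd a" and w: "w \<in> space M"
 shows "continuous_on {0..} (\<lambda>t. tint a t w)"
proof (rule continuous_on_atLeastI)
 fix T :: real assume T: "0 <= T"
 obtain C where C: "0 <= C" "\<And>t w. 0 <= t ==> t <= T ==> w \<in> space M ==> norm (a t w) <= C"
  using prog_bdd_bound[OF a T] by blast
 have "dist (tint a t w) (tint a s w) <= C * dist t s" if st: "s \<in> {0..T}" "t \<in> {0..T}" for s t
 proof (cases "s <= t")
  case True
  then show ?thesis using tint_lipschitz[OF a _ True _ w, of T C] C(2) w st by (auto simp: dist_norm)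
 next
  case False
  then have ts: "t <= s" by simp
  then show ?thesis using tint_lipschitz[OF a _ ts _ w, of T C] C(2) w st
   by (auto simp: dist_norm norm_minus_commute)
 qed
 then have "C-lipschitz_on {0..T} (\<lambda>t. tint a t w)" using C(1) by (intro lipschitz_onI) auto
 then show "continuous_on {0..T} (\<lambda>t. tint a t w)" by (rule lipschitz_on_continuous_on)
qed

lemma tint_measurable:
 assumes a: "progressive a" and t: "0 <= t"
 shows "tint a t \<in> borel_measurable (F t)"
proof -
 have "(\<lambda>p. cutoff t a (snd p, fst p)) \<in> borel_measurable (F t \<Otimes>\<^sub>M lborel)"
  by (rule measurable_compose[OF _ cutoff_F[OF a t], of "\<lambda>p. (snd p, fst p)"]) measurable
 then have "(\<lambda>w. LINT u|lborel. cutoff t a (u, w)) \<in> borel_measurable (F t)"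
  by (intro lborel.borel_measurable_lebesgue_integral) (simp add: case_prod_beta')
 then show ?thesis by (simp add: tint_def[abs_def] set_lebesgue_integral_def cutoff_def)
qed

lemma prog_bdd_tint:
 assumes a: "prog_bdd a"
 shows "prog_bdd (tint a)"
proof (rule prog_bddI)
 show "progressive (tint a)"
  by (intro progressive_continuous tint_continuous tint_measurable prog_bddD a)
 fix T :: real assume T: "0 <= T"
 obtain C where C: "0 <= C" "\<And>t w. 0 <= t ==> t <= T ==> w \<in> space M ==> norm (a t w) <= C"
  using prog_bdd_bound[OF a T] by blast
 have "norm (tint a t w) <= C * T" if "0 <= t" "t <= T" "w \<in> space M" for t w
  using tint_lipschitz[OF a order_refl that(1) that(2,3), of C] C(2)[OF _ _ that(3)] that mult_left_mono[OF that(2) C(1)] by force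
 then show "\<exists>C. \<forall>t w. 0 <= t --> t <= T --> w \<in> space M --> norm (tint a t w) <= C" by blast
qed

lemma tint_diff:
 assumes "prog_bdd a" "prog_bdd b" "0 <= t" "w \<in> space M"
 shows "tint (\<lambda>u w. a u w - b u w) t w = tint a t w - tint b t w"
 unfolding tint_def by (intro set_integral_diff tint_set_integrable assms order_refl)

lemma tint_cong:
 assumes a: "prog_bdd a" and b: "prog_bdd b" and t: "0 <= t" and w: "w \<in> space M"
  and eq: "\<And>u. 0 < u ==> u <= t ==> a u w = b u w"
 shows "tint a t w = tint b t w"
 using tint_increment(1)[OF a order_refl t w] tint_increment(1)[OF b order_refl t w]
  set_lebesgue_integral_cong[of "{0<..t}" lborel "\<lambda>u. a u w" "\<lambda>u. b u w"] eq by simp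

lemma tint_nonneg_nn:
 fixes a :: "real => 'a => real"
 assumes a: "prog_bdd a" and w: "w \<in> space M" and pos: "\<And>u. 0 <= u ==> 0 <= a u w"
 shows "(\<integral>\<^sup>+u\<in>{0..t}. ennreal (a u w) \<partial>lborel) = ennreal (tint a t w)"
proof -
 have "(\<integral>\<^sup>+u\<in>{0..t}. ennreal (a u w) \<partial>lborel) = (\<integral>\<^sup>+u. ennreal (indicator {0..t} u * a u w) \<partial>lborel)"
  by (intro nn_integral_cong) (auto simp: indicator_def)
 also have "\<dots> = ennreal (tint a t w)"
  unfolding tint_def set_lebesgue_integral_def real_scaleR_def
  by (rule nn_integral_eq_integral) (use tint_set_integrable[OF a order_refl w, of t] pos in \<open>auto simp: set_integrable_def indicator_def\<close>)
 finally show ?thesis .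
qed

lemma prog_bdd_norm2: "prog_bdd G ==> prog_bdd (\<lambda>u w. nsq (G u w))"
proof (rule prog_bddI)
 assume G: "prog_bdd G"
 show "progressive (\<lambda>u w. nsq (G u w))"
  by (rule progressive_compose[OF prog_bddD[OF G]]) measurable
 fix T :: real assume T: "0 <= T"
 obtain C where C: "0 <= C" "\<And>t w. 0 <= t ==> t <= T ==> w \<in> space M ==> norm (G t w) <= C"
  using prog_bdd_bound[OF G T] by blast
 then show "\<exists>C. \<forall>t w. 0 <= t --> t <= T --> w \<in> space M --> norm (nsq (G t w)) <= C"
  by (intro exI[of _ "C\<^sup>2"]) (auto intro: power_mono)
qed

section \<open>Uniqueness of the Ito integral\<close>

text \<open>Truncating the integrand as soon as its running energy exceeds \<open>\<delta>\<close> gives an integrand of energy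
 at most \<open>\<delta>\<close> whose integral is unchanged wherever the energy up to \<open>t\<close> is at most \<open>\<delta>\<close>.\<close>

lemma ito_small_energy:
 fixes G :: "real => 'a => real ^ 'd ^ 'n"
 assumes G: "prog_bdd G" and t: "0 <= t" and e: "0 < e" and d: "0 <= \<delta>"
 shows "e\<^sup>2 * prob {w \<in> space M. (psq t (\<lambda>u. G u w)) <= ennreal \<delta> \<and> e < norm (ito G t w)} <= \<delta>"
proof -
 let ?n = "\<lambda>u w. nsq (G u w)"
 note n = prog_bdd_norm2[OF G]
 have nn: "(\<integral>\<^sup>+u\<in>{0..s}. ennreal (?n u w) \<partial>lborel) = ennreal (tint ?n s w)" if "w \<in> space M" for s w
  by (rule tint_nonneg_nn[OF n that]) simp
 have mono: "tint ?n s w <= tint ?n u w" if "0 <= s" "s <= u" "w \<in> space M" for s u w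
 proof -
  have "ennreal (tint ?n s w) <= ennreal (tint ?n u w)"
   unfolding nn[OF that(3), symmetric] using that by (intro nn_integral_mono) (auto simp: indicator_def)
  moreover have "0 <= tint ?n u w" unfolding tint_def set_lebesgue_integral_def by (intro integral_nonneg_AE AE_I2) auto
  ultimately show ?thesis by (simp add: ennreal_le_iff)
 qed
 define c where "c u w = (indicator {..\<delta>} (tint ?n u w) :: real)" for u w
 have c: "prog_bdd c"
 proof (rule prog_bddI)
  show "progressive c"
   unfolding c_def by (rule progressive_compose[OF prog_bddD[OF prog_bdd_tint[OF n]]]) simp
 qed (auto simp: c_def intro!: exI[of _ 1])
 define H where "H u w = c u w *\<^sub>R G u w" for u w
 have H: "prog_bdd H" unfolding H_def by (rule prog_bdd_scaleR[OF c G])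
 have "psq t (\<lambda>u. H u w) <= ennreal \<delta>" if w: "w \<in> space M" for w
 proof -
  let ?S = "{u \<in> {0..t}. tint ?n u w <= \<delta>}"
  have cont: "continuous_on {0..t} (\<lambda>u. tint ?n u w)"
   by (rule continuous_on_subset[OF tint_continuous[OF n w]]) auto
  have "closed ({0..t} \<inter> (\<lambda>u. tint ?n u w) -` {..\<delta>})"
   by (rule continuous_closed_preimage[OF cont]) auto
  also have "{0..t} \<inter> (\<lambda>u. tint ?n u w) -` {..\<delta>} = ?S" by auto
  finally have "closed ?S" .
  then have "compact ?S" by (simp add: compact_eq_bounded_closed) (rule bounded_subset[of "{0..t}"], auto)
  moreover have "0 \<in> ?S" using t d by simp
  \<comment> \<open>\<sigma> is the last time in \<open>[0, t]\<close> at which the running energy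
    is at most \<delta>. The truncated integrand vanishes after it, so its total energy is bounded
    by the running energy at \<sigma>.\<close>
  ultimately obtain \<sigma> where \<sigma>: "\<sigma> \<in> ?S" "\<And>u. u \<in> ?S ==> u <= \<sigma>"
   using compact_attains_sup[of ?S] by blast
  have "psq t (\<lambda>u. H u w) <= (\<integral>\<^sup>+u\<in>{0..\<sigma>}. ennreal (?n u w) \<partial>lborel)"
  proof (rule nn_integral_mono)
   fix u
   show "ennreal (nsq (H u w)) * indicator {0..t} u <= ennreal (?n u w) * indicator {0..\<sigma>} u"
    using \<sigma>(2)[of u] by (auto simp: H_def c_def indicator_def)
  qed
  also have "\<dots> <= ennreal \<delta>" unfolding nn[OF w] using \<sigma>(1) by (intro ennreal_leI) auto
  finally show ?thesis .
 qed
 then have "sq_norm t H <= (\<integral>\<^sup>+w. ennreal \<delta> \<partial>M)"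
  unfolding sq_norm_paths(1)[OF prog_bddD[OF H] t] by (intro nn_integral_mono) auto
 then have H2: "msq M (ito H t) <= ennreal \<delta>"
  by (simp add: ito_isometry[OF H t] emeasure_space_1)
 note [measurable] = ito_measurable_M[OF H t] ito_measurable_M[OF G t] sq_norm_paths(2)[OF prog_bddD[OF G] t]
 let ?A = "{w \<in> space M. (psq t (\<lambda>u. G u w)) <= ennreal \<delta>}"
 have A: "?A \<in> events" by measurable
 have loc: "AE w in M. w \<in> ?A --> ito H t w = ito G t w"
 proof (rule ito_cong_on[OF H G t A], rule AE_I2, intro impI allI)
  fix w u assume w: "w \<in> space M" "w \<in> ?A" and u: "0 < u" "u <= t"
  have "tint ?n t w <= \<delta>" using w nn[OF w(1)] d by (simp add: ennreal_le_iff)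
  then have "tint ?n u w <= \<delta>" using mono[of u t w] u w by simp
  then show "H u w = G u w" by (simp add: H_def c_def)
 qed
 let ?E = "{w \<in> space M. e < norm (ito H t w)}"
 have "prob {w \<in> space M. (psq t (\<lambda>u. G u w)) <= ennreal \<delta> \<and> e < norm (ito G t w)} <= prob ?E"
  by (rule finite_measure_mono_AE) (use loc in \<open>auto elim!: eventually_mono\<close>)
 moreover have "e\<^sup>2 * prob ?E <= \<delta>"
 proof -
  have "ennreal (e\<^sup>2 * prob ?E) = (\<integral>\<^sup>+w. ennreal (e\<^sup>2) * indicator ?E w \<partial>M)"
   by (subst nn_integral_cmult_indicator) (auto simp: emeasure_eq_measure ennreal_mult')
  also have "\<dots> <= msq M (ito H t)"
   using e by (intro nn_integral_mono) (auto simp: indicator_def intro!: ennreal_leI power_mono)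
  also note H2
  finally show ?thesis using d by (simp add: ennreal_le_iff)
 qed
 ultimately show ?thesis using mult_left_mono[of _ "prob ?E" "e\<^sup>2"] by (meson order_trans zero_le_power2)
qed

text \<open>\<open>I\<close> is accessible only through elementary approximations, whose integrals
  are \<open>ito\<close> of the approximants. On \<open>A\<close>, a deviation of \<open>I\<close>
  from \<open>ito H\<close> above 2r forces a large error of the approximating integrals, a large
  energy error, or, by the small-energy bound, an event of probability at most
  \<open>\<delta> / r\<^sup>2\<close>. First the index tends to infinity, then \<delta> to
  0.\<close>

lemma has_ito_integral_cong_on:
 fixes G H :: "real => 'a => real ^ 'd ^ 'n"
 assumes I: "has_ito_integral M F B G I" and H: "prog_bdd H" and t: "0 <= t" and A: "A \<in> events"
  and eq: "AE w in M. w \<in> A --> (\<forall>u. 0 < u --> u <= t --> G u w = H u w)"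
 shows "AE w in M. w \<in> A --> I t w = ito H t w"
proof -
 obtain m s C where el: "\<And>k. elementary_process M F (m k) (s k) (C k)"
  and n1: "null_in_probability M (\<lambda>k w. psq t (\<lambda>u. elementary_value (m k) (s k) (C k) u w - G u w))"
  and n2: "null_in_probability M (\<lambda>k w. ennreal (norm (elementary_integral B (m k) (s k) (C k) t w - I t w)))"
  using I t unfolding has_ito_integral_def by blast
 define e where "e k = elementary_value (m k) (s k) (C k)" for k
 define J where "J k = elementary_integral B (m k) (s k) (C k) t" for k
 note bl = elementary_blocks[OF el]
 have eb: "prog_bdd (e k)" for k unfolding e_def elementary_value_block by (rule prog_bdd_block_val[OF bl])
 have Je: "AE w in M. ito (e k) t w = J k w" for k
  unfolding e_def J_def elementary_value_block elementary_integral_block by (rule ito_block[OF bl t])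
 have mJ: "J k \<in> borel_measurable M" for k
  unfolding J_def elementary_integral_block by (rule measurable_F_M[OF block_int_measurable[OF bl t] t])
 have mI: "I t \<in> borel_measurable M" using I t by (auto simp: has_ito_integral_def intro: measurable_F_M)
 have mG: "(\<lambda>w. psq t (\<lambda>u. e k u w - G u w)) \<in> borel_measurable M" for k
  using n1 unfolding null_in_probability_def e_def by blast
 note [measurable] = mJ mI mG ito_measurable_M[OF H t] A
 have bad: "prob {w \<in> space M. w \<in> A \<and> 2 * r < norm (I t w - ito H t w)} = 0" if r: "0 < r" for r :: real
 proof -
  let ?S = "{w \<in> space M. w \<in> A \<and> 2 * r < norm (I t w - ito H t w)}"
  have "prob ?S <= \<delta> / r\<^sup>2" if d: "0 < \<delta>" for \<delta> :: real
  proof -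
   let ?P = "\<lambda>k. {w \<in> space M. ennreal r < ennreal (norm (J k w - I t w))}"
   let ?Q = "\<lambda>k. {w \<in> space M. ennreal \<delta> < psq t (\<lambda>u. e k u w - G u w)}"
   let ?a = "\<lambda>k. prob (?P k)"
   let ?b = "\<lambda>k. prob (?Q k)"
   have la: "?a \<longlonglongrightarrow> 0" using n2 r unfolding null_in_probability_def J_def by blast
   have lb: "?b \<longlonglongrightarrow> 0" using n1 d unfolding null_in_probability_def e_def by blast
   have "prob ?S <= ?a k + (?b k + \<delta> / r\<^sup>2)" for k
   proof -
    note D = prog_bdd_diff[OF eb[of k] H]
    let ?c = "{w \<in> space M. (psq t (\<lambda>u. e k u w - H u w)) <= ennreal \<delta>
      \<and> r < norm (ito (\<lambda>u w. e k u w - H u w) t w)}"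
    note [measurable] = ito_measurable_M[OF D t] sq_norm_paths(2)[OF prog_bddD[OF D] t]
    have "AE w in M. w \<in> ?S --> w \<in> ?P k
      \<union> (?Q k \<union> ?c)"
     using Je[of k] ito_diff[OF eb H t, of k] eq AE_space
    proof eventually_elim
     case (elim w)
     show ?case
     proof (intro impI)
      assume S: "w \<in> ?S"
      \<comment> \<open>\<open>G\<close> and \<open>H\<close> are compared at positive times only;
        the time 0 is a Lebesgue null set.\<close>
      have nneq: "psq t (\<lambda>u. e k u w - G u w) = psq t (\<lambda>u. e k u w - H u w)"
      proof (rule nn_integral_cong_AE)
       show "AE u in lborel. ennreal (nsq (e k u w - G u w)) * indicator {0..t} u = ennreal (nsq (e k u w - H u w)) * indicator {0..t} u"
        using AE_lborel_singleton[of "0::real"]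
       proof eventually_elim
        fix u :: real assume "u \<noteq> 0"
        then show "ennreal (nsq (e k u w - G u w)) * indicator {0..t} u = ennreal (nsq (e k u w - H u w)) * indicator {0..t} u"
         using elim S by (cases "0 < u \<and> u <= t") (auto simp: indicator_def)
       qed
      qed
      have "norm (I t w - ito H t w) <= norm (J k w - I t w) + norm (J k w - ito H t w)"
       using norm_triangle_ineq[of "I t w - J k w" "J k w - ito H t w"] by (simp add: norm_minus_commute)
      then have "r < norm (J k w - I t w) \<or> r < norm (J k w - ito H t w)" using S by auto
      then show "w \<in> ?P k
       \<union> (?Q k \<union> ?c)"
       using elim r nneq by (auto simp: ennreal_less_iff not_le)
     qed
    qed
    then have "prob ?S <= prob (?P k
      \<union> (?Q k \<union> ?c))"
     by (rule finite_measure_mono_AE) measurable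
    also have "\<dots> <= ?a k + (?b k + prob ?c)"
     by (intro order_trans[OF measure_Un_le] add_left_mono measure_Un_le) measurable
    also have "prob ?c <= \<delta> / r\<^sup>2"
     using ito_small_energy[OF D t r less_imp_le[OF d]] r by (simp add: pos_le_divide_eq mult.commute)
    finally show ?thesis by simp
   qed
   moreover have "(\<lambda>k. ?a k + (?b k + \<delta> / r\<^sup>2)) \<longlonglongrightarrow> 0 + (0 + \<delta> / r\<^sup>2)"
    by (intro tendsto_add la lb tendsto_const)
   ultimately show ?thesis using LIMSEQ_le_const[of "\<lambda>k. ?a k + (?b k + \<delta> / r\<^sup>2)" "\<delta> / r\<^sup>2" "prob ?S"] by simp
  qed
  note le = this
  have "prob ?S <= 0 + \<epsilon>" if "0 < \<epsilon>" for \<epsilon> :: real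
   using le[of "\<epsilon> * r\<^sup>2"] that r by simp
  then have "prob ?S <= 0" by (rule field_le_epsilon)
  then show ?thesis using measure_nonneg[of M ?S] by linarith
 qed
 have ae: "AE w in M. \<not> (w \<in> A \<and> 2 * (1 / real (Suc j)) < norm (I t w - ito H t w))" for j
  using bad[of "1 / real (Suc j)"]
  by (subst AE_iff_measurable[OF _ refl]) (auto simp: emeasure_eq_measure)
 have "AE w in M. \<forall>j. \<not> (w \<in> A \<and> 2 * (1 / real (Suc j)) < norm (I t w - ito H t w))"
  unfolding AE_all_countable using ae by blast
 then show ?thesis
 proof eventually_elim
  case (elim w)
  show ?case
  proof
   assume "w \<in> A"
   then have le: "norm (I t w - ito H t w) <= 2 * (1 / real (Suc j))" for j using elim by (simp add: not_less)
   have "(\<lambda>j. 2 * (1 / real (Suc j))) \<longlonglongrightarrow> 2 * 0"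
    by (intro tendsto_mult tendsto_const LIMSEQ_Suc lim_1_over_n)
   then have "norm (I t w - ito H t w) <= 2 * 0" by (rule LIMSEQ_le_const) (use le in auto)
   then show "I t w = ito H t w" by simp
  qed
 qed
qed

end

section \<open>The energy identity\<close>

text \<open>Increments of order h^(3/2) make the difference quotients of order sqrt h, so the
  derivative is zero everywhere.\<close>

lemma constant_of_increments:
 fixes f :: "real => real"
 assumes T: "0 <= T" and K: "\<And>s t. 0 <= s ==> s <= t ==> t <= T ==> t - s <= 1 ==> \<bar>f t - f s\<bar> <= K * ((t - s) * sqrt (t - s))"
 shows "f T = f 0"
proof -
 have le: "\<bar>f y - f x\<bar> <= \<bar>K\<bar> * (\<bar>y - x\<bar> * sqrt \<bar>y - x\<bar>)" if xy: "x \<in> {0..T}" "y \<in> {0..T}" "\<bar>y - x\<bar> <= 1" for x y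
 proof -
  have "\<bar>f y - f x\<bar> <= K * (\<bar>y - x\<bar> * sqrt \<bar>y - x\<bar>)"
   using K[of x y] K[of y x] xy by (cases "x <= y") (auto simp: abs_minus_commute)
  also have "\<dots> <= \<bar>K\<bar> * (\<bar>y - x\<bar> * sqrt \<bar>y - x\<bar>)" by (intro mult_right_mono) auto
  finally show ?thesis .
 qed
 have "(f has_field_derivative 0) (at x within {0..T})" if x: "x \<in> {0..T}" for x
  unfolding has_field_derivative_iff
 proof (rule Lim_null_comparison)
  have "((\<lambda>y. \<bar>K\<bar> * sqrt \<bar>y - x\<bar>) \<longlongrightarrow> \<bar>K\<bar> * sqrt \<bar>x - x\<bar>) (at x within {0..T})"
   by (intro tendsto_intros)
  then show "((\<lambda>y. \<bar>K\<bar> * sqrt \<bar>y - x\<bar>) \<longlongrightarrow> 0) (at x within {0..T})" by simp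
  show "\<forall>\<^sub>F y in at x within {0..T}. norm ((f y - f x) / (y - x)) <= \<bar>K\<bar> * sqrt \<bar>y - x\<bar>"
   unfolding eventually_at
  proof (intro exI[of _ 1] conjI ballI impI)
   fix y assume y: "y \<in> {0..T}" "y \<noteq> x \<and> dist y x < 1"
   then have "\<bar>f y - f x\<bar> <= \<bar>y - x\<bar> * (\<bar>K\<bar> * sqrt \<bar>y - x\<bar>)" using le[OF x y(1)] by (simp add: dist_real_def ac_simps)
   then show "norm ((f y - f x) / (y - x)) <= \<bar>K\<bar> * sqrt \<bar>y - x\<bar>"
    using y(2) by (simp add: abs_divide pos_divide_le_eq mult.commute)
  qed simp
 qed
 then obtain c where "\<And>x. x \<in> {0..T} ==> f x = c"
  using has_field_derivative_zero_constant[of "{0..T}" f] by auto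
 then show ?thesis using T by simp
qed

text \<open>The weight \<open>e\<close> is free. It is later the square root of the interval length
  h, and as |x - y|^2 is of order h in the mean, both terms are then of order sqrt h.\<close>

lemma abs_diff_norm_squares:
 fixes x y :: "'b::real_inner"
 assumes e: "0 < e"
 shows "\<bar>nsq x - nsq y\<bar> <= nsq (x - y) / e + e * (nsq x + nsq y)"
proof -
 have "nsq x - nsq y = (x - y) \<bullet> (x + y)"
  by (simp add: power2_norm_eq_inner inner_diff_left inner_add_right) (simp add: inner_commute)
 then have "\<bar>nsq x - nsq y\<bar> <= (nsq (x - y) / e + e * nsq (x + y)) / 2"
  using norm_inner_le_weighted[OF e, of "x - y" "x + y"] by simp
 also have "\<dots> <= (nsq (x - y) / e + e * (2 * nsq x + 2 * nsq y)) / 2"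
  using e power2_norm_add_le[of x y] by (intro divide_right_mono add_left_mono mult_left_mono) auto
 also have "\<dots> = nsq (x - y) / e / 2 + e * (nsq x + nsq y)"
  by (simp add: algebra_simps add_divide_distrib)
 finally have "\<bar>nsq x - nsq y\<bar> <= nsq (x - y) / e / 2 + e * (nsq x + nsq y)" .
 moreover have "z / 2 <= z" if "0 <= z" for z :: real using that by simp
 from this[of "nsq (x - y) / e"] have "nsq (x - y) / e / 2 <= nsq (x - y) / e" using e by simp
 ultimately show ?thesis by (meson add_right_mono order_trans)
qed

lemma le_weighted_square:
 fixes z e :: real
 assumes e: "0 < e" shows "z <= z\<^sup>2 / e + e"
proof -
 have "z <= (z\<^sup>2 / e + e * 1\<^sup>2) / 2" using norm_inner_le_weighted[OF e, of z 1] by simp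
 moreover have "0 <= z\<^sup>2 / e + e" using e by simp
 ultimately show ?thesis by simp
qed

context brownian_basis
begin

abbreviation time_space :: "(real \<times> 'a) measure" where
 "time_space \<equiv> lborel \<Otimes>\<^sub>M M"

lemma window_bound:
 fixes f :: "real \<times> 'a => real"
 assumes f: "f \<in> borel_measurable time_space" and st: "s <= t" and c: "0 <= c"
  and out: "\<And>u w. w \<in> space M ==> u \<notin> {s..t} ==> f (u, w) = 0"
  and b: "\<And>u. s <= u ==> u <= t ==> (\<integral>\<^sup>+w. ennreal \<bar>f (u, w)\<bar> \<partial>M) <= ennreal c"
 shows "integrable time_space f" "\<bar>LINT p|time_space. f p\<bar> <= c * (t - s)"
proof -
 note f[measurable]
 have "(\<integral>\<^sup>+p. ennreal \<bar>f p\<bar> \<partial>time_space) = (\<integral>\<^sup>+u. (\<integral>\<^sup>+w. ennreal \<bar>f (u, w)\<bar> \<partial>M) \<partial>lborel)"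
  by (subst nn_integral_fst[symmetric]) (auto simp: case_prod_beta')
 also have "\<dots> <= (\<integral>\<^sup>+u. ennreal c * indicator {s..t} u \<partial>lborel)"
 proof (rule nn_integral_mono)
  fix u
  show "(\<integral>\<^sup>+w. ennreal \<bar>f (u, w)\<bar> \<partial>M) <= ennreal c * indicator {s..t} u"
  proof (cases "u \<in> {s..t}")
   case False
   then have "(\<integral>\<^sup>+w. ennreal \<bar>f (u, w)\<bar> \<partial>M) = (\<integral>\<^sup>+w. 0 \<partial>M)"
    using out by (intro nn_integral_cong) auto
   then show ?thesis by simp
  qed (use b in simp)
 qed
 also have "\<dots> = ennreal (c * (t - s))"
  using st c by (subst nn_integral_cmult_indicator) (auto simp: ennreal_mult')
 finally have le: "(\<integral>\<^sup>+p. ennreal \<bar>f p\<bar> \<partial>time_space) <= ennreal (c * (t - s))" .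
 then show int: "integrable time_space f"
  by (intro integrableI_bounded) (auto intro: le_less_trans)
 have "ennreal (LINT p|time_space. \<bar>f p\<bar>) <= ennreal (c * (t - s))"
  using le int by (subst nn_integral_eq_integral[symmetric]) auto
 then have "(LINT p|time_space. \<bar>f p\<bar>) <= c * (t - s)"
  using st c by (simp add: ennreal_le_iff)
 then show "\<bar>LINT p|time_space. f p\<bar> <= c * (t - s)"
  using integral_abs_bound[of time_space f] by linarith
qed

text \<open>Half-open at \<open>s\<close>, so that a window is exactly the difference of the
  cut-offs at \<open>t\<close> and at \<open>s\<close>.\<close>

definition window :: "real => real => (real => 'a => 'b::real_vector) => real \<times> 'a => 'b" where
 "window s t g p = indicator {s<..t} (fst p) *\<^sub>R g (fst p) (snd p)"

lemma window_measurable: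
 fixes G :: "real => 'a => 'b::euclidean_space"
 assumes "progressive G" "0 <= s" "s <= t"
 shows "window s t G \<in> borel_measurable time_space"
proof -
 have "window s t G = (\<lambda>p. indicator {s<..t} (fst p) *\<^sub>R cutoff t G p)"
  using assms(2) by (auto simp: window_def cutoff_def indicator_def fun_eq_iff)
 moreover have "(\<lambda>p. indicator {s<..t} (fst p) :: real) \<in> borel_measurable time_space"
  by (rule measurable_compose[OF measurable_fst]) simp
 moreover have "cutoff t G \<in> borel_measurable time_space" using assms by (intro cutoff_M) auto
 ultimately show ?thesis by (simp only: borel_measurable_scaleR)
qed

text \<open>Rewriting the pairing of a time-integral increment with \<open>Y\<close> as a space-time
  integral allows all contributions to the energy to be compared with one density under one
  integral.\<close>

lemma window_fubini:
 fixes a :: "real => 'a => 'b::euclidean_space"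
 assumes a: "prog_bdd a" and st: "0 <= s" "s <= t" and Y: "integrable M Y"
 shows "has_bochner_integral time_space (window s t (\<lambda>u w. a u w \<bullet> Y w))
  (expectation (\<lambda>w. (tint a t w - tint a s w) \<bullet> Y w))"
proof -
 have t: "0 <= t" using st by simp
 obtain C where C: "0 <= C" "\<And>u w. 0 <= u ==> u <= t ==> w \<in> space M ==> norm (a u w) <= C"
  using prog_bdd_bound[OF a t] by blast
 let ?f = "window s t (\<lambda>u w. a u w \<bullet> Y w)"
 have wa: "window s t a \<in> borel_measurable time_space" by (intro window_measurable prog_bddD a st)
 have YQ: "(\<lambda>p. Y (snd p)) \<in> borel_measurable time_space"
  by (rule measurable_compose[OF measurable_snd]) (use Y in auto)
 have "?f = (\<lambda>p. window s t a p \<bullet> Y (snd p))" by (simp add: window_def fun_eq_iff)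
 then have m: "?f \<in> borel_measurable time_space" using wa YQ by simp
 have "integrable time_space ?f"
 proof (rule window_bound(1)[OF m st(2), where c = "C * expectation (\<lambda>w. norm (Y w))"])
  fix u assume u: "s <= u" "u <= t"
  have "(\<integral>\<^sup>+w. ennreal \<bar>?f (u, w)\<bar> \<partial>M) <= (\<integral>\<^sup>+w. ennreal (C * norm (Y w)) \<partial>M)"
  proof (intro nn_integral_mono ennreal_leI)
   fix w assume w: "w \<in> space M"
   have "\<bar>a u w \<bullet> Y w\<bar> <= norm (a u w) * norm (Y w)" by (rule Cauchy_Schwarz_ineq2)
   also have "\<dots> <= C * norm (Y w)" using C(2)[of u w] u w st by (intro mult_right_mono) auto
   finally show "\<bar>?f (u, w)\<bar> <= C * norm (Y w)" using C(1) by (auto simp: window_def indicator_def)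
  qed
  also have "\<dots> = ennreal (C * expectation (\<lambda>w. norm (Y w)))"
   using Y C(1) by (subst nn_integral_eq_integral) auto
  finally show "(\<integral>\<^sup>+w. ennreal \<bar>?f (u, w)\<bar> \<partial>M) <= ennreal (C * expectation (\<lambda>w. norm (Y w)))" .
 qed (use C(1) in \<open>auto simp: window_def\<close>)
 moreover have "(LINT p|time_space. ?f p) = expectation (\<lambda>w. (tint a t w - tint a s w) \<bullet> Y w)"
 proof -
  have "(LINT p|time_space. ?f p) = expectation (\<lambda>w. LINT u|lborel. ?f (u, w))"
   using time_product.integral_snd[of "\<lambda>u w. ?f (u, w)"] calculation by simp
  also have "\<dots> = expectation (\<lambda>w. (tint a t w - tint a s w) \<bullet> Y w)"
  proof (rule Bochner_Integration.integral_cong[OF refl])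
   fix w assume w: "w \<in> space M"
   have "(LINT u|lborel. ?f (u, w)) = (LINT u|lborel. (indicator {s<..t} u *\<^sub>R a u w) \<bullet> Y w)"
    by (simp add: window_def)
   also have "\<dots> = (LINT u|lborel. indicator {s<..t} u *\<^sub>R a u w) \<bullet> Y w"
    using tint_increment(2)[OF a st w] by (intro integral_inner_left) (simp add: set_integrable_def)
   finally show "(LINT u|lborel. ?f (u, w)) = (tint a t w - tint a s w) \<bullet> Y w"
    using tint_increment(1)[OF a st w] by (simp add: set_lebesgue_integral_def)
  qed
  finally show ?thesis .
 qed
 ultimately show ?thesis by (simp add: has_bochner_integral_iff)
qed

lemma ito_increment_bound:
 fixes b :: "real => 'a => real ^ 'd ^ 'n"
 assumes b: "prog_bdd b" and st: "0 <= s" "s <= t"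
  and C: "\<And>u w. s < u ==> u <= t ==> w \<in> space M ==> norm (b u w) <= C"
 shows "expectation (\<lambda>w. nsq (ito b t w - ito b s w)) <= C\<^sup>2 * (t - s)"
proof -
 have t: "0 <= t" using st by simp
 let ?b = "\<lambda>u w. (indicator {s<..} u * 1) *\<^sub>R b u w"
 have bb: "prog_bdd ?b" by (rule prog_bdd_after[OF b st(1), where Z = "\<lambda>_. 1"]) auto
 have AE: "AE w in M. ito ?b t w = 1 *\<^sub>R (ito b t w - ito b s w)"
  by (rule ito_after[OF b st, where Z = "\<lambda>_. 1"]) auto
 have sq: "sq_integrable M (\<lambda>w. ito b t w - ito b s w)"
  by (intro sq_integrable_diff ito_sq_integrable b st t)
 have "ennreal (expectation (\<lambda>w. nsq (ito b t w - ito b s w))) = msq M (\<lambda>w. ito ?b t w)"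
  unfolding sq_integrable_nn_eq[OF sq, symmetric] using AE by (intro nn_integral_cong_AE) (auto elim!: eventually_mono)
 also have "\<dots> = sq_norm t ?b" by (rule ito_isometry[OF bb t])
 also have "\<dots> <= (\<integral>\<^sup>+p. ennreal (C\<^sup>2) * indicator ({s<..t} \<times> space M) p \<partial>time_space)"
  unfolding sq_norm_def
 proof (rule nn_integral_mono)
  fix p :: "real \<times> 'a" assume p: "p \<in> space time_space"
  show "ennreal (nsq (cutoff t ?b p)) <= ennreal (C\<^sup>2) * indicator ({s<..t} \<times> space M) p"
   using p C[of "fst p" "snd p"]
   by (cases p) (auto simp: cutoff_def indicator_def space_pair_measure intro!: ennreal_leI power_mono)
 qed
 also have "\<dots> = ennreal (C\<^sup>2 * (t - s))"
  using st by (subst nn_integral_cmult_indicator)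
   (auto simp: emeasure_pair_measure_Times emeasure_space_1 ennreal_mult'[symmetric])
 finally show ?thesis using st by (simp add: ennreal_le_iff)
qed

text \<open>The weight is known at \<open>s\<close>, so its square root can be carried into the
  integrand after \<open>s\<close>, and the isometry without weight applies.\<close>

lemma weighted_isometry:
 fixes b :: "real => 'a => real ^ 'd ^ 'n"
 assumes b: "prog_bdd b" and st: "0 <= s" "s <= t"
  and W: "W \<in> borel_measurable (F s)" "\<And>w. w \<in> space M ==> 0 <= W w \<and> W w <= C"
 shows "has_bochner_integral time_space (window s t (\<lambda>u w. W w * nsq (b u w)))
  (expectation (\<lambda>w. W w * nsq (ito b t w - ito b s w)))"
proof -
 have t: "0 <= t" using st by simp
 let ?Z = "\<lambda>w. sqrt (W w)"
 have Z: "?Z \<in> borel_measurable (F s)" "\<And>w. w \<in> space M ==> \<bar>?Z w\<bar> <= sqrt C"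
  using W by (auto simp: borel_measurable_sqrt)
 let ?b = "\<lambda>u w. (indicator {s<..} u * ?Z w) *\<^sub>R b u w"
 have bb: "prog_bdd ?b" by (rule prog_bdd_after[OF b st(1) Z(1)]) (rule Z(2))
 have AE: "AE w in M. ito ?b t w = ?Z w *\<^sub>R (ito b t w - ito b s w)"
  by (rule ito_after[OF b st Z(1)]) (rule Z(2))
 note S = cutoff_sq_integrable[OF bb t] and I = ito_sq_integrable[OF bb t]
 have "ennreal (expectation (\<lambda>w. nsq (ito ?b t w))) = sq_norm t ?b"
  by (rule trans[OF sq_integrable_nn_eq[OF I, symmetric] ito_isometry[OF bb t]])
 also have "\<dots> = ennreal (LINT p|time_space. nsq (cutoff t ?b p))"
  unfolding sq_norm_def by (rule sq_integrable_nn_eq[OF S])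
 finally have "expectation (\<lambda>w. nsq (ito ?b t w)) = (LINT p|time_space. nsq (cutoff t ?b p))"
  by (subst (asm) ennreal_inj) auto
 moreover have "expectation (\<lambda>w. nsq (ito ?b t w)) = expectation (\<lambda>w. W w * nsq (ito b t w - ito b s w))"
 proof (rule integral_cong_AE)
  note [measurable] = ito_measurable_M[OF b t] ito_measurable_M[OF b st(1)] ito_measurable_M[OF bb t] measurable_F_M[OF W(1) st(1)]
  show "(\<lambda>w. nsq (ito ?b t w)) \<in> borel_measurable M" "(\<lambda>w. W w * nsq (ito b t w - ito b s w)) \<in> borel_measurable M"
   by measurable
  show "AE w in M. nsq (ito ?b t w) = W w * nsq (ito b t w - ito b s w)"
   using AE AE_space by eventually_elim (use W(2) in \<open>simp add: power_mult_distrib\<close>)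
 qed
 moreover have "has_bochner_integral time_space (\<lambda>p. nsq (cutoff t ?b p)) (LINT p|time_space. nsq (cutoff t ?b p))"
  using S by (simp add: sq_integrable_def has_bochner_integral_integrable)
 moreover have "has_bochner_integral time_space (\<lambda>p. nsq (cutoff t ?b p)) x
   \<longleftrightarrow> has_bochner_integral time_space (window s t (\<lambda>u w. W w * nsq (b u w))) x" for x
 proof (rule has_bochner_integral_cong[OF refl _ refl])
  fix p assume "p \<in> space time_space"
  then have "0 <= W (snd p)" using W(2) by (auto simp: space_pair_measure)
  then show "nsq (cutoff t ?b p) = window s t (\<lambda>u w. W w * nsq (b u w)) p"
   using st by (auto simp: cutoff_def window_def indicator_def power_mult_distrib)
 qed
 ultimately show ?thesis by simp
qed

text \<open>Ito's formula for \<open>(1 + \<integral>v) |X|\<^sup>2\<close>, in expectation. The difference of the two sides has increments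
 of order \<open>h\<^bsup>3/2\<^esup>\<close> over intervals of length \<open>h\<close>, so it is constant in time.\<close>

lemma energy_identity:
 fixes a :: "real => 'a => real ^ 'n" and b :: "real => 'a => real ^ 'd ^ 'n" and v :: "real => 'a => real"
 assumes a: "prog_bdd a" and b: "prog_bdd b" and v: "prog_bdd v" and T: "0 <= T"
  and x0: "x0 \<in> borel_measurable (F 0)" "\<And>w. w \<in> space M ==> norm (x0 w) <= C0"
  and w_nonneg: "\<And>t w. 0 <= t ==> w \<in> space M ==> 0 <= 1 + tint v t w"
 defines "X \<equiv> \<lambda>t w. x0 w + tint a t w + ito b t w" and "wt \<equiv> \<lambda>t w. 1 + tint v t w"
 defines "h \<equiv> \<lambda>u w. v u w * nsq (X u w) + wt u w * (2 * (X u w \<bullet> a u w) + nsq (b u w))"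
 shows "integrable time_space (cutoff T h)"
  and "integrable M (\<lambda>w. wt T w * nsq (X T w))"
  and "expectation (\<lambda>w. wt T w * nsq (X T w))
   = expectation (\<lambda>w. nsq (x0 w)) + (LINT p|time_space. cutoff T h p)"
proof -
 let ?Z = "\<lambda>s w. (2 * wt s w) *\<^sub>R X s w"
 obtain Ca where Ca: "0 <= Ca" "\<And>t w. 0 <= t ==> t <= T ==> w \<in> space M ==> norm (a t w) <= Ca"
  using prog_bdd_bound[OF a T] by blast
 obtain Cb where Cb: "0 <= Cb" "\<And>t w. 0 <= t ==> t <= T ==> w \<in> space M ==> norm (b t w) <= Cb"
  using prog_bdd_bound[OF b T] by blast
 obtain Cv where Cv: "0 <= Cv" "\<And>t w. 0 <= t ==> t <= T ==> w \<in> space M ==> norm (v t w) <= Cv"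
  using prog_bdd_bound[OF v T] by blast
 define C where "C = Ca + Cb + Cv + 1"
 have C: "1 <= C" using Ca(1) Cb(1) Cv(1) by (simp add: C_def)
 have aC: "norm (a t w) <= C" and bC: "norm (b t w) <= C" and vC: "\<bar>v t w\<bar> <= C"
  if "0 <= t" "t <= T" "w \<in> space M" for t w
  using Ca(2)[OF that] Cb(2)[OF that] Cv(2)[OF that] Ca(1) Cb(1) Cv(1) by (auto simp: C_def)
 have bC2: "nsq (b t w) <= C\<^sup>2" if "0 <= t" "t <= T" "w \<in> space M" for t w
  using bC[OF that] by (intro power_mono) auto
 define W where "W = 1 + C * T"
 have W1: "1 <= W" using C T by (simp add: W_def)
 have dA: "norm (tint a t w - tint a s w) <= C * (t - s)" and dw: "\<bar>wt t w - wt s w\<bar> <= C * (t - s)"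
  if "0 <= s" "s <= t" "t <= T" "w \<in> space M" for s t w
 proof -
  show "norm (tint a t w - tint a s w) <= C * (t - s)"
   by (rule tint_lipschitz[OF a that]) (use aC that in auto)
  have "norm (tint v t w - tint v s w) <= C * (t - s)"
   by (rule tint_lipschitz[OF v that]) (use vC that in auto)
  then show "\<bar>wt t w - wt s w\<bar> <= C * (t - s)" by (simp add: wt_def)
 qed
 have w0: "0 <= wt t w" if "0 <= t" "w \<in> space M" for t w using w_nonneg[OF that] by (simp add: wt_def)
 have wW: "wt t w <= W" if "0 <= t" "t <= T" "w \<in> space M" for t w
 proof -
  have "\<bar>wt t w - wt 0 w\<bar> <= C * (t - 0)" by (rule dw) (use that in auto)
  moreover have "wt 0 w = 1" by (simp add: wt_def)
  moreover have "C * t <= C * T" using that C by (intro mult_left_mono) auto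
  ultimately show ?thesis by (simp add: W_def)
 qed
 have mw: "wt t \<in> borel_measurable (F t)" if "0 <= t" for t
  unfolding wt_def using tint_measurable[OF prog_bddD[OF v] that] by simp
 have mX: "X t \<in> borel_measurable (F t)" if "0 <= t" for t
  unfolding X_def using tint_measurable[OF prog_bddD[OF a] that] ito_measurable[OF b that]
   measurable_F_mono[OF x0(1) that] by simp
 have contX: "continuous_on {0..} (\<lambda>t. X t w)" if "w \<in> space M" for w
  unfolding X_def by (intro continuous_intros tint_continuous[OF a that] ito_continuous[OF b that])
 have pX: "progressive X" by (rule progressive_continuous[OF contX mX])
 have pw: "progressive wt"
  unfolding wt_def by (intro progressive_add progressive_time prog_bddD prog_bdd_tint v) simp
 have ph: "progressive h"
 proof -
  have "progressive (\<lambda>u w. v u w *\<^sub>R nsq (X u w) + wt u w *\<^sub>R (2 *\<^sub>R (X u w \<bullet> a u w) + nsq (b u w)))"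
   by (intro progressive_add progressive_scaleR progressive_inner progressive_time pX pw prog_bddD a v prog_bdd_norm2 b
     progressive_compose[OF pX]) auto
  then show ?thesis by (simp add: h_def)
 qed
 have sI: "sq_integrable M (ito b t)" if "0 <= t" for t by (rule ito_sq_integrable[OF b that])
 have sbd: "sq_integrable M Y" if "Y \<in> borel_measurable M" "\<And>w. w \<in> space M ==> norm (Y w) <= c" for Y :: "'a => real ^ 'n" and c
 proof -
  have "norm (nsq (Y w)) <= c\<^sup>2" if "w \<in> space M" for w using that \<open>w \<in> space M ==> norm (Y w) <= c\<close> by (auto intro: power_mono)
  then show ?thesis using that(1) unfolding sq_integrable_def by (intro conjI integrable_const_bound[where B = "c\<^sup>2"] AE_I2) auto
 qed
 have sA: "sq_integrable M (\<lambda>w. tint a t w - tint a s w)" if "0 <= s" "s <= t" "t <= T" for s t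
 proof (rule sbd)
  show "(\<lambda>w. tint a t w - tint a s w) \<in> borel_measurable M"
   using that by (intro borel_measurable_diff measurable_F_M[OF tint_measurable[OF prog_bddD[OF a]]]) auto
 qed (use dA[OF that] in auto)
 have sx: "sq_integrable M x0" by (rule sbd[OF measurable_F_M[OF x0(1)] x0(2)]) auto
 have sX: "sq_integrable M (X t)" if "0 <= t" "t <= T" for t
  using sq_integrable_add[OF sq_integrable_add[OF sx sA[of 0 t]] sI[of t]] that by (simp add: X_def[abs_def])
 define D where "D = 4 * C\<^sup>2"
 have dI: "expectation (\<lambda>w. nsq (ito b t w - ito b s w)) <= C\<^sup>2 * (t - s)" if "0 <= s" "s <= t" "t <= T" for s t
  by (rule ito_increment_bound[OF b that(1,2)]) (use bC that in auto)
 have dX: "expectation (\<lambda>w. nsq (X t w - X s w)) <= D * (t - s)" if "0 <= s" "s <= t" "t <= T" "t - s <= 1" for s t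
 proof -
  note sd = sq_integrable_diff[OF sI sI, of t s]
  have "expectation (\<lambda>w. nsq (X t w - X s w)) <= expectation (\<lambda>w. 2 * (C\<^sup>2 * (t - s)) + 2 * nsq (ito b t w - ito b s w))"
  proof (rule integral_mono)
   show "integrable M (\<lambda>w. nsq (X t w - X s w))"
    using sq_integrable_diff[OF sX sX, of t s] that by (auto simp: sq_integrable_def)
   show "integrable M (\<lambda>w. 2 * (C\<^sup>2 * (t - s)) + 2 * nsq (ito b t w - ito b s w))"
    using sd that by (auto simp: sq_integrable_def)
   fix w assume "w \<in> space M"
   have "X t w - X s w = (tint a t w - tint a s w) + (ito b t w - ito b s w)" by (simp add: X_def)
   then have "nsq (X t w - X s w) <= 2 * nsq (tint a t w - tint a s w) + 2 * nsq (ito b t w - ito b s w)"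
    using power2_norm_add_le by metis
   moreover have "nsq (tint a t w - tint a s w) <= (C * (t - s))\<^sup>2"
    by (intro power_mono dA that \<open>w \<in> space M\<close>) auto
   moreover have "(C * (t - s))\<^sup>2 = C\<^sup>2 * ((t - s) * (t - s))" by (simp add: power2_eq_square)
   moreover have "C\<^sup>2 * ((t - s) * (t - s)) <= C\<^sup>2 * (t - s)"
    using that by (intro mult_left_mono mult_left_le) auto
   ultimately show "nsq (X t w - X s w) <= 2 * (C\<^sup>2 * (t - s)) + 2 * nsq (ito b t w - ito b s w)" by linarith
  qed
  also have "\<dots> = 2 * (C\<^sup>2 * (t - s)) + 2 * expectation (\<lambda>w. nsq (ito b t w - ito b s w))"
   using sd that by (subst Bochner_Integration.integral_add) (auto simp: sq_integrable_def prob_space)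
  also have "\<dots> <= D * (t - s)" using dI[OF that(1-3)] by (simp add: D_def algebra_simps)
  finally show ?thesis .
 qed
 define N where "N = 2 * (C0 + C * T)\<^sup>2 + 2 * (C\<^sup>2 * T)"
 have EX: "expectation (\<lambda>w. nsq (X t w)) <= N" if t: "0 <= t" "t <= T" for t
 proof -
  have "expectation (\<lambda>w. nsq (X t w)) <= expectation (\<lambda>w. 2 * (C0 + C * T)\<^sup>2 + 2 * nsq (ito b t w - ito b 0 w))"
  proof (rule integral_mono)
   show "integrable M (\<lambda>w. nsq (X t w))" using sX[OF t] by (auto simp: sq_integrable_def)
   show "integrable M (\<lambda>w. 2 * (C0 + C * T)\<^sup>2 + 2 * nsq (ito b t w - ito b 0 w))"
    using sq_integrable_diff[OF sI sI, of t 0] t by (auto simp: sq_integrable_def)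
   fix w assume w: "w \<in> space M"
   have "norm (x0 w + tint a t w) <= C0 + C * T"
   proof (intro norm_triangle_mono x0(2)[OF w])
    have "norm (tint a t w - tint a 0 w) <= C * (t - 0)" by (rule dA) (use t w in auto)
    also have "\<dots> <= C * T" using t C by (intro mult_left_mono) auto
    finally show "norm (tint a t w) <= C * T" by simp
   qed
   then have "nsq (x0 w + tint a t w) <= (C0 + C * T)\<^sup>2" by (intro power_mono) auto
   moreover have "nsq (X t w) <= 2 * nsq (x0 w + tint a t w) + 2 * nsq (ito b t w - ito b 0 w)"
    using power2_norm_add_le[of "x0 w + tint a t w" "ito b t w"] ito_0[OF b w] by (simp add: X_def)
   ultimately show "nsq (X t w) <= 2 * (C0 + C * T)\<^sup>2 + 2 * nsq (ito b t w - ito b 0 w)" by linarith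
  qed
  also have "\<dots> = 2 * (C0 + C * T)\<^sup>2 + 2 * expectation (\<lambda>w. nsq (ito b t w - ito b 0 w))"
   using sq_integrable_diff[OF sI sI, of t 0] t
   by (subst Bochner_Integration.integral_add) (auto simp: sq_integrable_def prob_space)
  also have "\<dots> <= N"
  proof -
   have "expectation (\<lambda>w. nsq (ito b t w - ito b 0 w)) <= C\<^sup>2 * (t - 0)" by (rule dI) (use t in auto)
   also have "\<dots> <= C\<^sup>2 * T" using t by (intro mult_left_mono) auto
   finally show ?thesis by (simp add: N_def)
  qed
  finally show ?thesis .
 qed
 have nnX: "(\<integral>\<^sup>+w. ennreal (p + q * nsq (Y w) + r * nsq (Z w)) \<partial>M) <= ennreal (p + q * m + r * k)"
  if "sq_integrable M Y" "sq_integrable M Z" "0 <= p" "0 <= q" "0 <= r"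
   "expectation (\<lambda>w. nsq (Y w)) <= m" "expectation (\<lambda>w. nsq (Z w)) <= k"
  for Y Z :: "'a => real ^ 'n" and p q r m k
 proof -
  have i: "integrable M (\<lambda>w. p + q * nsq (Y w) + r * nsq (Z w))"
   using that(1,2) by (auto simp: sq_integrable_def)
  have "(\<integral>\<^sup>+w. ennreal (p + q * nsq (Y w) + r * nsq (Z w)) \<partial>M)
   = ennreal (expectation (\<lambda>w. p + q * nsq (Y w) + r * nsq (Z w)))"
   using that(3-5) by (intro nn_integral_eq_integral i AE_I2) auto
  also have "expectation (\<lambda>w. p + q * nsq (Y w) + r * nsq (Z w))
   = p + q * expectation (\<lambda>w. nsq (Y w)) + r * expectation (\<lambda>w. nsq (Z w))"
   using that(1,2) by (simp add: sq_integrable_def prob_space)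
  also have "ennreal \<dots> <= ennreal (p + q * m + r * k)"
   using that(4-7) by (intro ennreal_leI add_mono mult_left_mono order_refl) auto
  finally show ?thesis .
 qed
 have N0: "0 <= N" using C T by (simp add: N_def)
 have hnn: "(\<integral>\<^sup>+w. ennreal \<bar>cutoff t h (u, w)\<bar> \<partial>M) <= ennreal (W * (2 * C\<^sup>2) + (C + W) * N + 0 * N)"
  if t: "0 <= t" "t <= T" and u: "0 <= u" "u <= t" for t u
 proof -
  from u have uT: "0 <= u" "u <= T" using t by auto
  have "(\<integral>\<^sup>+w. ennreal \<bar>cutoff t h (u, w)\<bar> \<partial>M) <= (\<integral>\<^sup>+w. ennreal (W * (2 * C\<^sup>2) + (C + W) * nsq (X u w) + 0 * nsq (X u w)) \<partial>M)"
  proof (intro nn_integral_mono ennreal_leI)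
   fix w assume w: "w \<in> space M"
   have "\<bar>2 * (X u w \<bullet> a u w)\<bar> <= nsq (X u w) + nsq (a u w)"
    using norm_inner_le_weighted[OF zero_less_one, of "X u w" "a u w"] by simp
   moreover have "nsq (a u w) <= C\<^sup>2" using aC[OF uT w] by (intro power_mono) auto
   moreover have "0 <= nsq (b u w)" by simp
   ultimately have "\<bar>2 * (X u w \<bullet> a u w) + nsq (b u w)\<bar> <= nsq (X u w) + 2 * C\<^sup>2"
    using bC2[OF uT w] by linarith
   then have 1: "\<bar>wt u w * (2 * (X u w \<bullet> a u w) + nsq (b u w))\<bar> <= W * (nsq (X u w) + 2 * C\<^sup>2)"
    using w0[OF uT(1) w] wW[OF uT w] unfolding abs_mult by (intro mult_mono) auto
   have 2: "\<bar>v u w * nsq (X u w)\<bar> <= C * nsq (X u w)"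
    using vC[OF uT w] unfolding abs_mult by (intro mult_mono) auto
   have "\<bar>cutoff t h (u, w)\<bar> = \<bar>v u w * nsq (X u w) + wt u w * (2 * (X u w \<bullet> a u w) + nsq (b u w))\<bar>"
    using u by (simp add: cutoff_def h_def)
   also have "\<dots> <= C * nsq (X u w) + W * (nsq (X u w) + 2 * C\<^sup>2)" using 1 2 by linarith
   also have "\<dots> = W * (2 * C\<^sup>2) + (C + W) * nsq (X u w) + 0 * nsq (X u w)" by (simp add: algebra_simps)
   finally show "\<bar>cutoff t h (u, w)\<bar> <= W * (2 * C\<^sup>2) + (C + W) * nsq (X u w) + 0 * nsq (X u w)" .
  qed
  also have "\<dots> <= ennreal (W * (2 * C\<^sup>2) + (C + W) * N + 0 * N)"
   using C W1 by (intro nnX sX EX uT) auto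
  finally show "(\<integral>\<^sup>+w. ennreal \<bar>cutoff t h (u, w)\<bar> \<partial>M) <= ennreal (W * (2 * C\<^sup>2) + (C + W) * N + 0 * N)" .
 qed
 have hwb: "integrable time_space (cutoff t h)" "\<bar>LINT p|time_space. cutoff t h p\<bar> <= (W * (2 * C\<^sup>2) + (C + W) * N + 0 * N) * (t - 0)"
  if t: "0 <= t" "t <= T" for t
  by (rule window_bound[OF cutoff_M[OF ph t(1)] t(1) _ _ hnn[OF t]]; use C W1 N0 in \<open>auto simp: cutoff_def\<close>)+
 note hint = hwb(1)
 show "integrable time_space (cutoff T h)" by (rule hint[OF T order_refl])
 have iwX: "integrable M (\<lambda>w. Z w * Y w)"
  if "integrable M Y" "Z \<in> borel_measurable M" "\<And>w. w \<in> space M ==> \<bar>Z w\<bar> <= c" for Y Z :: "'a => real" and c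
 proof (rule Bochner_Integration.integrable_bound[of M "\<lambda>w. c * Y w"])
  show "AE w in M. norm (Z w * Y w) <= norm (c * Y w)"
   using that(3) by (intro AE_I2) (auto simp: abs_mult intro!: mult_right_mono intro: order_trans[OF _ abs_ge_self])
 qed (use that in auto)
 have mwM: "wt t \<in> borel_measurable M" if "0 <= t" for t using mw[OF that] that by (rule measurable_F_M)
 have awW: "\<bar>wt t w\<bar> <= W" if "0 <= t" "t <= T" "w \<in> space M" for t w using w0[OF that(1,3)] wW[OF that] by simp
 have iw: "integrable M (\<lambda>w. wt s w * Y w)" if "0 <= s" "s <= T" "integrable M Y" for s and Y :: "'a => real"
  by (rule iwX[OF that(3) mwM[OF that(1)] awW[OF that(1,2)]])
 show "integrable M (\<lambda>w. wt T w * nsq (X T w))"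
  using iw[OF T order_refl] sX[OF T order_refl] by (simp add: sq_integrable_def)
 define \<Phi> where "\<Phi> t = expectation (\<lambda>w. wt t w * nsq (X t w)) - (LINT p|time_space. cutoff t h p)" for t
 \<comment> \<open>\<open>e * \<kappa>\<close> will bound the expected error at each time of a
   window, with \<open>e\<close> the root of its length; the additional
   \<open>3 * W * C\<^sup>2\<close> below comes from the remainder \<open>R\<close>.\<close>
 define \<kappa> where "\<kappa> = C * (D + 2 * N) + 2 * (C\<^sup>2 * (1 + N) + W * C * (D + 1)) + C ^ 3"
 have inc: "\<bar>\<Phi> t - \<Phi> s\<bar> <= (\<kappa> + 3 * W * C\<^sup>2) * ((t - s) * sqrt (t - s))"
  if st: "0 <= s" "s <= t" "t <= T" "t - s <= 1" for s t
 proof (cases "s = t")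
  case True
  then show ?thesis by simp
 next
  case False
  \<comment> \<open>This Young weight balances the two kinds of error, (t - s) / e and e. Both are
    of order sqrt (t - s), and integration over the window supplies the missing factor t -
    s.\<close>
  define e where "e = sqrt (t - s)"
  have e: "0 < e" "e <= 1" "t - s = e * e" "t - s <= e"
  proof -
   show "0 < e" "e <= 1" "t - s = e * e" using False st by (auto simp: e_def)
   then show "t - s <= e" by (simp add: mult_left_le)
  qed
  have t0: "0 <= t" "s <= T" using st by auto
  define A where "A w = tint a t w - tint a s w" for w
  define J where "J w = ito b t w - ito b s w" for w
  have sqA: "sq_integrable M A" unfolding A_def using sA st by blast
  have sqJ: "sq_integrable M J" unfolding J_def using st t0 by (intro sq_integrable_diff sI) auto
  note sqXt = sX[OF t0(1) st(3)] and sqXs = sX[OF st(1) t0(2)]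
  have sqZ: "sq_integrable M (?Z s)"
   unfolding sq_integrable_def
  proof
   have "integrable M (\<lambda>w. wt s w * (wt s w * (4 * nsq (X s w))))"
    using sqXs by (intro iw st t0) (simp add: sq_integrable_def)
   also have "(\<lambda>w. wt s w * (wt s w * (4 * nsq (X s w)))) = (\<lambda>w. nsq (?Z s w))"
    by (rule ext) (simp only: norm_scaleR power_mult_distrib power2_abs, simp add: power2_eq_square)
   finally show "integrable M (\<lambda>w. nsq (?Z s w))" .
  qed (use mwM[OF st(1)] sqXs in \<open>auto simp: sq_integrable_def\<close>)
  have Zs: "(?Z s) \<in> borel_measurable (F s)" using mw[OF st(1)] mX[OF st(1)] by simp
  have 1: "has_bochner_integral time_space (window s t (\<lambda>u w. v u w * nsq (X t w)))
    (expectation (\<lambda>w. (wt t w - wt s w) * nsq (X t w)))"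
   using window_fubini[OF v st(1,2), of "\<lambda>w. nsq (X t w)"] sqXt by (simp add: wt_def sq_integrable_def)
  have 2: "has_bochner_integral time_space (window s t (\<lambda>u w. a u w \<bullet> (?Z s w)))
    (expectation (\<lambda>w. A w \<bullet> (?Z s w)))"
   unfolding A_def
   by (rule window_fubini[OF a st(1,2) integrable_L2_imp[OF sqZ[unfolded sq_integrable_def, THEN conjunct1]
     sqZ[unfolded sq_integrable_def, THEN conjunct2]]])
  have 3: "has_bochner_integral time_space (window s t (\<lambda>u w. wt s w * nsq (b u w)))
    (expectation (\<lambda>w. wt s w * nsq (J w)))"
   unfolding J_def by (rule weighted_isometry[OF b st(1,2) mw[OF st(1)], where C = W]) (use w0 wW st t0 in auto)
  have 4: "has_bochner_integral time_space (window s t h)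
    ((LINT p|time_space. cutoff t h p) - (LINT p|time_space. cutoff s h p))"
  proof -
   have "window s t h = (\<lambda>p. cutoff t h p - cutoff s h p)"
    using st by (auto simp: window_def cutoff_def indicator_def fun_eq_iff)
   then show ?thesis using hint[OF t0(1) st(3)] hint[OF st(1) t0(2)]
    by (simp add: has_bochner_integral_iff)
  qed
  \<comment> \<open>\<open>g\<close> is the error of freezing: the densities in 1, 2 and 3 have some
    factors frozen at \<open>s\<close> or \<open>t\<close>, while \<open>h\<close> has all of them
    at the running time \<open>u\<close>.\<close>
  define g where "g u w = v u w * (nsq (X t w) - nsq (X u w))
    + 2 * ((wt s w *\<^sub>R X s w - wt u w *\<^sub>R X u w) \<bullet> a u w) + (wt s w - wt u w) * nsq (b u w)" for u w
  have "has_bochner_integral time_space (window s t g)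
   (expectation (\<lambda>w. (wt t w - wt s w) * nsq (X t w)) + (expectation (\<lambda>w. A w \<bullet> (?Z s w))
    + expectation (\<lambda>w. wt s w * nsq (J w))) - ((LINT p|time_space. cutoff t h p) - (LINT p|time_space. cutoff s h p)))"
  proof -
   have "window s t g = (\<lambda>p. window s t (\<lambda>u w. v u w * nsq (X t w)) p + (window s t (\<lambda>u w. a u w \<bullet> (?Z s w)) p
     + window s t (\<lambda>u w. wt s w * nsq (b u w)) p) - window s t h p)"
    by (auto simp: window_def g_def h_def fun_eq_iff algebra_simps inner_commute)
   then show ?thesis using has_bochner_integral_diff[OF has_bochner_integral_add[OF 1 has_bochner_integral_add[OF 2 3]] 4] by simp
  qed
  note ig = this
  \<comment> \<open>The part of the second-order expansion without a counterpart in
    \<open>h\<close>. It is of order (t - s)^(3/2) in the mean because \<open>A\<close> is of order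
    t - s and \<open>J\<close> of order sqrt (t - s).\<close>
  define R where "R w = wt s w * (2 * (A w \<bullet> J w) + nsq (A w))" for w
  have iR: "integrable M R"
   unfolding R_def using sq_integrable_inner[OF sqA sqJ] sqA by (intro iw st t0) (simp add: sq_integrable_def)
  have iT1: "integrable M (\<lambda>w. (wt t w - wt s w) * nsq (X t w))"
   using iw[OF t0(1) st(3), of "\<lambda>w. nsq (X t w)"] iw[OF st(1) t0(2), of "\<lambda>w. nsq (X t w)"] sqXt
   by (simp add: left_diff_distrib sq_integrable_def)
  have iT5: "integrable M (\<lambda>w. wt s w * nsq (J w))"
   using sqJ by (intro iw st t0) (simp add: sq_integrable_def)
  have iXs: "integrable M (\<lambda>w. wt s w * nsq (X s w))"
   using sqXs by (intro iw st t0) (simp add: sq_integrable_def)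
  have orth: "expectation (\<lambda>w. (?Z s w) \<bullet> J w) = 0"
   unfolding J_def by (rule l2_martingale_orthogonal[OF ito_l2_martingale[OF b] st(1,2) Zs sqZ])
  \<comment> \<open>Pairing the increment of the weight with the value of \<open>X\<close> at the
    right end makes the product rule exact, without a mixed term.\<close>
  have "expectation (\<lambda>w. wt t w * nsq (X t w)) = expectation (\<lambda>w. wt s w * nsq (X s w) + ((wt t w - wt s w) * nsq (X t w)
    + (A w \<bullet> (?Z s w) + ((?Z s w) \<bullet> J w + (R w + wt s w * nsq (J w))))))"
  proof (rule Bochner_Integration.integral_cong[OF refl])
   fix w
   have "X t w = X s w + (A w + J w)" by (simp add: X_def A_def J_def)
   then have "nsq (X t w) = nsq (X s w) + 2 * (A w \<bullet> X s w) + 2 * (X s w \<bullet> J w) + (2 * (A w \<bullet> J w) + nsq (A w)) + nsq (J w)"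
    by (simp add: power2_norm_eq_inner inner_add_left inner_add_right inner_commute)
   then have "wt s w * nsq (X t w) = wt s w * (nsq (X s w) + 2 * (A w \<bullet> X s w) + 2 * (X s w \<bullet> J w) + (2 * (A w \<bullet> J w) + nsq (A w)) + nsq (J w))"
    by (rule arg_cong)
   then show "wt t w * nsq (X t w) = wt s w * nsq (X s w) + ((wt t w - wt s w) * nsq (X t w)
    + (A w \<bullet> (?Z s w) + ((?Z s w) \<bullet> J w + (R w + wt s w * nsq (J w)))))"
    unfolding R_def by (simp add: algebra_simps)
  qed
  also have "\<dots> = expectation (\<lambda>w. wt s w * nsq (X s w)) + (expectation (\<lambda>w. (wt t w - wt s w) * nsq (X t w))
    + (expectation (\<lambda>w. A w \<bullet> (?Z s w)) + (expectation (\<lambda>w. (?Z s w) \<bullet> J w)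
    + (expectation R + expectation (\<lambda>w. wt s w * nsq (J w))))))"
   by (rule has_bochner_integral_integral_eq, intro has_bochner_integral_add)
    (rule has_bochner_integral_integrable iXs iT1 iR iT5 sq_integrable_inner sqA sqZ sqJ)+
  finally have \<Phi>: "\<Phi> t - \<Phi> s = (LINT p|time_space. window s t g p) + expectation R"
   unfolding \<Phi>_def has_bochner_integral_integral_eq[OF ig] orth by simp
  have gb: "(\<integral>\<^sup>+w. ennreal \<bar>window s t g (u, w)\<bar> \<partial>M) <= ennreal (e * \<kappa>)" if u: "s <= u" "u <= t" for u
  proof -
   have uT: "0 <= u" "u <= T" using u st by auto
   define p where "p w = C * (nsq (X t w - X u w) / e + e * (nsq (X t w) + nsq (X u w)))
     + 2 * ((C\<^sup>2 * e) * (1 + nsq (X s w)) + (W * C) * (nsq (X u w - X s w) / e + e)) + C ^ 3 * e" for w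
   have hc: "has_bochner_integral M (\<lambda>_. c) c" for c :: real by (simp add: has_bochner_integral_iff prob_space)
   have hs: "has_bochner_integral M (\<lambda>w. nsq (Y w)) (expectation (\<lambda>w. nsq (Y w)))" if "sq_integrable M Y" for Y :: "'a => real ^ 'n"
    using that by (simp add: sq_integrable_def has_bochner_integral_integrable)
   note sqXu = sX[OF uT]
   have hp: "has_bochner_integral M p (C * (expectation (\<lambda>w. nsq (X t w - X u w)) / e + e * (expectation (\<lambda>w. nsq (X t w)) + expectation (\<lambda>w. nsq (X u w))))
     + 2 * ((C\<^sup>2 * e) * (1 + expectation (\<lambda>w. nsq (X s w))) + (W * C) * (expectation (\<lambda>w. nsq (X u w - X s w)) / e + e)) + C ^ 3 * e)"
    unfolding p_def
    by (rule hc has_bochner_integral_add has_bochner_integral_divide_zero has_bochner_integral_mult_right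
      hs[OF sqXt] hs[OF sqXs] hs[OF sqXu] hs[OF sq_integrable_diff[OF sqXt sqXu]] hs[OF sq_integrable_diff[OF sqXu sqXs]])+
   have De: "x / e <= D * e" if "x <= D * r" "r <= t - s" for x r
   proof -
    have "D * r <= D * (e * e)" using that(2) e(3) by (intro mult_left_mono) (auto simp: D_def)
    then have "x <= D * (e * e)" using that(1) by simp
    then show ?thesis using e(1) by (simp add: pos_divide_le_eq mult.assoc)
   qed
   have Ep: "expectation p <= e * \<kappa>"
   proof -
    have "expectation p <= C * (D * e + e * (N + N)) + 2 * ((C\<^sup>2 * e) * (1 + N) + (W * C) * (D * e + e)) + C ^ 3 * e"
     unfolding has_bochner_integral_integral_eq[OF hp]
     using C W1 e(1) st u uT t0
     by (intro add_mono mult_left_mono order_refl EX De[OF dX]) auto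
    also have "\<dots> = e * \<kappa>" by (simp add: \<kappa>_def algebra_simps)
    finally show ?thesis .
   qed
   have p0: "0 <= p w" for w unfolding p_def using C W1 e by simp
   have "(\<integral>\<^sup>+w. ennreal \<bar>window s t g (u, w)\<bar> \<partial>M) <= (\<integral>\<^sup>+w. ennreal (p w) \<partial>M)"
   proof (intro nn_integral_mono ennreal_leI)
    fix w assume wM: "w \<in> space M"
    have g1: "\<bar>v u w * (nsq (X t w) - nsq (X u w))\<bar> <= C * (nsq (X t w - X u w) / e + e * (nsq (X t w) + nsq (X u w)))"
     unfolding abs_mult using vC[OF uT wM] abs_diff_norm_squares[OF e(1)] C by (intro mult_mono) auto
    have dws: "\<bar>wt s w - wt u w\<bar> <= C * e"
    proof -
     have "\<bar>wt u w - wt s w\<bar> <= C * (u - s)" by (rule dw[OF st(1) u(1) uT(2) wM])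
     also have "\<dots> <= C * e" using u e(4) C by (intro mult_left_mono) auto
     finally show ?thesis by (simp add: abs_minus_commute)
    qed
    have g2: "\<bar>(wt s w *\<^sub>R X s w - wt u w *\<^sub>R X u w) \<bullet> a u w\<bar> <= (C\<^sup>2 * e) * (1 + nsq (X s w)) + (W * C) * (nsq (X u w - X s w) / e + e)"
    proof -
     have "wt s w *\<^sub>R X s w - wt u w *\<^sub>R X u w = (wt s w - wt u w) *\<^sub>R X s w + wt u w *\<^sub>R (X s w - X u w)"
      by (simp add: algebra_simps)
     then have "norm (wt s w *\<^sub>R X s w - wt u w *\<^sub>R X u w) <= \<bar>wt s w - wt u w\<bar> * norm (X s w) + \<bar>wt u w\<bar> * norm (X u w - X s w)"
      by (metis norm_triangle_ineq norm_scaleR norm_minus_commute)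
     also have "\<dots> <= (C * e) * (1 + nsq (X s w)) + W * (nsq (X u w - X s w) / e + e)"
      using dws awW[OF uT wM] le_weighted_square[OF zero_less_one, of "norm (X s w)"] le_weighted_square[OF e(1), of "norm (X u w - X s w)"] W1 C e(1)
      by (intro add_mono mult_mono) auto
     finally have "norm (wt s w *\<^sub>R X s w - wt u w *\<^sub>R X u w) * norm (a u w)
       <= ((C * e) * (1 + nsq (X s w)) + W * (nsq (X u w - X s w) / e + e)) * C"
      using aC[OF uT wM] C W1 e(1) by (intro mult_mono) auto
     also have "\<dots> = (C\<^sup>2 * e) * (1 + nsq (X s w)) + (W * C) * (nsq (X u w - X s w) / e + e)"
      by (simp add: algebra_simps power2_eq_square)
     finally show ?thesis using Cauchy_Schwarz_ineq2 order_trans by blast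
    qed
    have g3: "\<bar>(wt s w - wt u w) * nsq (b u w)\<bar> <= C ^ 3 * e"
    proof -
     have "\<bar>(wt s w - wt u w) * nsq (b u w)\<bar> <= (C * e) * C\<^sup>2"
      unfolding abs_mult using dws bC2[OF uT wM] C e(1) by (intro mult_mono) auto
     also have "\<dots> = C ^ 3 * e" by (simp add: power3_eq_cube power2_eq_square)
     finally show ?thesis .
    qed
    have "\<bar>x + 2 * y + z\<bar> <= x' + 2 * y' + z'" if "\<bar>x\<bar> <= x'" "\<bar>y\<bar> <= y'" "\<bar>z\<bar> <= z'" for x y z x' y' z' :: real
     using that by linarith
    from this[OF g1 g2 g3] have "\<bar>g u w\<bar> <= p w" unfolding g_def p_def .
    then show "\<bar>window s t g (u, w)\<bar> <= p w" using p0 by (auto simp: window_def indicator_def)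
   qed
   also have "\<dots> = ennreal (expectation p)"
    using hp p0 by (intro nn_integral_eq_integral) (auto simp: has_bochner_integral_iff)
   also have "\<dots> <= ennreal (e * \<kappa>)" by (intro ennreal_leI Ep)
   finally show ?thesis .
  qed
  have "0 <= \<kappa>" using C W1 N0 by (simp add: \<kappa>_def D_def)
  then have b1: "\<bar>LINT p|time_space. window s t g p\<bar> <= (e * \<kappa>) * (t - s)"
   using e(1) by (intro window_bound(2)[OF borel_measurable_integrable[OF integrable.intros[OF ig]] st(2) _ _ gb])
    (auto simp: window_def)
  have b2: "\<bar>expectation R\<bar> <= 3 * W * C\<^sup>2 * ((t - s) * e)"
  proof -
   let ?h = "t - s"
   have R: "\<bar>R w\<bar> <= W * (2 * (C\<^sup>2 * (?h * e)) + e * nsq (J w))" if wM: "w \<in> space M" for w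
   proof -
    have "nsq (A w) <= (C * ?h)\<^sup>2" unfolding A_def by (intro power_mono dA st wM) auto
    also have "(C * ?h)\<^sup>2 = C\<^sup>2 * (?h * ?h)" by (simp add: power2_eq_square)
    finally have A2: "nsq (A w) <= C\<^sup>2 * (?h * ?h)" .
    also have "\<dots> <= C\<^sup>2 * (?h * e)" using e st by (intro mult_left_mono) auto
    finally have A3: "nsq (A w) <= C\<^sup>2 * (?h * e)" .
    have hh: "?h * ?h = ?h * (e * e)" using e(3) by (rule arg_cong)
    have "nsq (A w) <= C\<^sup>2 * (?h * e) * e" using A2 unfolding hh by (simp only: mult.assoc)
    then have A4: "nsq (A w) / e <= C\<^sup>2 * (?h * e)" unfolding pos_divide_le_eq[OF e(1)] .
    have "\<bar>2 * (A w \<bullet> J w)\<bar> <= nsq (A w) / e + e * nsq (J w)"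
     using norm_inner_le_weighted[OF e(1), of "A w" "J w"] by simp
    then have "\<bar>2 * (A w \<bullet> J w) + nsq (A w)\<bar> <= 2 * (C\<^sup>2 * (?h * e)) + e * nsq (J w)"
     using A3 A4 zero_le_power2[of "norm (A w)"] by linarith
    then show ?thesis unfolding R_def abs_mult using awW[OF st(1) t0(2) wM] W1 by (intro mult_mono) auto
   qed
   have iJ: "integrable M (\<lambda>w. W * (2 * (C\<^sup>2 * (?h * e)) + e * nsq (J w)))"
    using sqJ by (simp add: sq_integrable_def)
   have "\<bar>expectation R\<bar> <= expectation (\<lambda>w. W * (2 * (C\<^sup>2 * (?h * e)) + e * nsq (J w)))"
    using norm_integral_le[OF iR iJ] R by simp
   also have "\<dots> = W * (2 * (C\<^sup>2 * (?h * e)) + e * expectation (\<lambda>w. nsq (J w)))"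
    using sqJ by (simp add: sq_integrable_def prob_space)
   also have "\<dots> <= W * (2 * (C\<^sup>2 * (?h * e)) + e * (C\<^sup>2 * ?h))"
    using dI[OF st(1-3)] W1 e(1) unfolding J_def by (intro mult_left_mono add_left_mono) auto
   also have "\<dots> = 3 * W * C\<^sup>2 * (?h * e)" by (simp add: algebra_simps)
   finally show ?thesis .
  qed
  have "\<bar>\<Phi> t - \<Phi> s\<bar> <= (e * \<kappa>) * (t - s) + 3 * W * C\<^sup>2 * ((t - s) * e)"
   unfolding \<Phi> using b1 b2 by linarith
  also have "\<dots> = (\<kappa> + 3 * W * C\<^sup>2) * ((t - s) * sqrt (t - s))"
   unfolding e_def[symmetric] by (simp add: algebra_simps)
  finally show ?thesis .
 qed
 have "\<Phi> T = \<Phi> 0" by (rule constant_of_increments[OF T inc])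
 moreover have "(LINT p|time_space. cutoff 0 h p) = 0" using hwb(2)[of 0] T by simp
 moreover have "expectation (\<lambda>w. wt 0 w * nsq (X 0 w)) = expectation (\<lambda>w. nsq (x0 w))"
  by (intro Bochner_Integration.integral_cong) (auto simp: wt_def X_def ito_0[OF b])
 ultimately show "expectation (\<lambda>w. wt T w * nsq (X T w))
   = expectation (\<lambda>w. nsq (x0 w)) + (LINT p|time_space. cutoff T h p)"
  by (simp add: \<Phi>_def)
qed

end

section \<open>Identities at all times and mean-square bounds for the drift\<close>

lemma rational_below:
 fixes t :: real
 assumes t: "0 <= t"
 obtains r where "\<And>n. 0 <= r n" "\<And>n. r n <= t" "\<And>n. r n \<in> \<rat>" "r \<longlonglongrightarrow> t"
proof -
 define r where "r n = real_of_int \<lfloor>real (Suc n) * t\<rfloor> / real (Suc n)" for n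
 have r: "0 <= r n" "r n <= t" "t - 1 / real (Suc n) <= r n" "r n \<in> \<rat>" for n
  unfolding r_def using floor_approximation[OF t, of n] by (auto intro!: Rats_divide Rats_of_int Rats_of_nat simp del: of_nat_Suc)
 have "r \<longlonglongrightarrow> t"
 proof (rule tendsto_sandwich[of "\<lambda>n. t - 1 / real (Suc n)" _ _ "\<lambda>_. t"])
  have "(\<lambda>n. t - 1 / real (Suc n)) \<longlonglongrightarrow> t - 0"
   by (intro tendsto_diff tendsto_const LIMSEQ_Suc lim_1_over_n)
  then show "(\<lambda>n. t - 1 / real (Suc n)) \<longlonglongrightarrow> t" by simp
 qed (use r in auto)
 with r show thesis by (intro that[of r]) auto
qed

context brownian_basis
begin

text \<open>Continuity reduces the claim to rational times, that is, to countably many null sets.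
  \<open>P\<close> is inherited by earlier times, so the rationals approaching \<open>t\<close> from
  below satisfy it too.\<close>

lemma AE_all_times:
 fixes X Y :: "real => 'a => 'b::euclidean_space"
 assumes X: "\<And>w. w \<in> space M ==> continuous_on {0..} (\<lambda>t. X t w)"
  and Y: "\<And>w. w \<in> space M ==> continuous_on {0..} (\<lambda>t. Y t w)"
  and P: "\<And>w s t. P t w ==> 0 <= s ==> s <= t ==> P s w"
  and eq: "\<And>t. 0 <= t ==> AE w in M. P t w --> X t w = Y t w"
 shows "AE w in M. \<forall>t\<ge>0. P t w --> X t w = Y t w"
proof -
 have "AE w in M. \<forall>q\<in>\<rat> \<inter> {0..}. P q w --> X q w = Y q w"
  using eq by (intro AE_ball_countable[THEN iffD2]) (auto intro: countable_Int1 countable_rat)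
 then show ?thesis using AE_space
 proof eventually_elim
  case (elim w)
  show ?case
  proof (intro allI impI)
   fix t :: real assume t: "0 <= t" "P t w"
   obtain r where r: "\<And>n. 0 <= r n" "\<And>n. r n <= t" "\<And>n. r n \<in> \<rat>" and lim: "r \<longlonglongrightarrow> t"
    by (rule rational_below[OF t(1)]) blast
   have "(\<lambda>n. X (r n) w) \<longlonglongrightarrow> X t w" "(\<lambda>n. Y (r n) w) \<longlonglongrightarrow> Y t w"
    using t r by (auto intro!: continuous_on_tendsto_compose[OF X lim] continuous_on_tendsto_compose[OF Y lim] elim)
   moreover have "X (r n) w = Y (r n) w" for n
    using elim(1) r[of n] P[OF t(2) r(1,2)] by auto
   ultimately show "X t w = Y t w" using LIMSEQ_unique by simp
  qed
 qed
qed

text \<open>Cauchy-Schwarz with the constant \<open>K\<close> for every \<open>t\<close>, since the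
  integrand vanishes after \<open>K\<close>. It follows by integrating 2 (S / K) |\<alpha>| <=
  |\<alpha>|^2 + (S / K)^2 with \<open>S\<close> the integral of the norm. A constant common to all
  horizons is what the iteration needs.\<close>

lemma tint_cauchy_schwarz:
 fixes \<alpha> :: "real => 'a => 'b::euclidean_space"
 assumes \<alpha>: "prog_bdd \<alpha>" and K: "0 < K" "\<And>u. K < u ==> \<alpha> u w = 0" and w: "w \<in> space M" and t: "0 <= t"
 shows "(tint (\<lambda>u w. norm (\<alpha> u w)) t w)\<^sup>2 <= K * tint (\<lambda>u w. nsq (\<alpha> u w)) t w"
  and "norm (tint \<alpha> t w) <= tint (\<lambda>u w. norm (\<alpha> u w)) t w"
  and "prog_bdd (\<lambda>u w. norm (\<alpha> u w))"
proof -
 show n: "prog_bdd (\<lambda>u w. norm (\<alpha> u w))"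
  using \<alpha> progressive_compose[OF prog_bddD[OF \<alpha>], of norm] by (auto simp: prog_bdd_def)
 note n2 = prog_bdd_norm2[OF \<alpha>]
 have i1: "integrable lborel (\<lambda>u. indicator {0..t} u * norm (\<alpha> u w))"
  and i2: "integrable lborel (\<lambda>u. indicator {0..t} u * nsq (\<alpha> u w))"
  and i0: "integrable lborel (\<lambda>u. indicator {0..t} u *\<^sub>R \<alpha> u w)"
  using tint_set_integrable[OF n order_refl w, of t] tint_set_integrable[OF n2 order_refl w, of t]
   tint_set_integrable[OF \<alpha> order_refl w, of t] by (simp_all add: set_integrable_def)
 show "norm (tint \<alpha> t w) <= tint (\<lambda>u w. norm (\<alpha> u w)) t w"
  unfolding tint_def set_lebesgue_integral_def real_scaleR_def
  by (rule norm_integral_le[OF i0 i1]) (auto simp: indicator_def)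
 define S where "S = tint (\<lambda>u w. norm (\<alpha> u w)) t w"
 define S2 where "S2 = tint (\<lambda>u w. nsq (\<alpha> u w)) t w"
 have SS: "S = (LINT u|lborel. indicator {0..t} u * norm (\<alpha> u w))" "S2 = (LINT u|lborel. indicator {0..t} u * nsq (\<alpha> u w))"
  by (simp_all add: S_def S2_def tint_def set_lebesgue_integral_def)
 have i3: "integrable lborel (\<lambda>u. indicator {0..K} u * (S / K)\<^sup>2)"
  using K(1) by (intro integrable_mult_left integrable_real_indicator) (auto simp: emeasure_lborel_Icc_eq)
 have "2 * (S / K) * S <= S2 + K * (S / K)\<^sup>2"
 proof -
  have "2 * (S / K) * S = (LINT u|lborel. 2 * (S / K) * (indicator {0..t} u * norm (\<alpha> u w)))" by (simp add: SS(1))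
  also have "\<dots> <= (LINT u|lborel. indicator {0..t} u * nsq (\<alpha> u w) + indicator {0..K} u * (S / K)\<^sup>2)"
  proof (rule integral_mono)
   fix u
   have "2 * (S / K) * norm (\<alpha> u w) <= nsq (\<alpha> u w) + (S / K)\<^sup>2"
    using zero_le_power2[of "norm (\<alpha> u w) - S / K"] by (simp add: power2_eq_square algebra_simps)
   then show "2 * (S / K) * (indicator {0..t} u * norm (\<alpha> u w)) <= indicator {0..t} u * nsq (\<alpha> u w) + indicator {0..K} u * (S / K)\<^sup>2"
    using K(2)[of u] by (auto simp: indicator_def not_le)
  qed (use i1 i2 i3 in auto)
  also have "\<dots> = S2 + K * (S / K)\<^sup>2" using i2 i3 K(1) by (simp add: SS(2))
  finally show ?thesis .
 qed
 then have "S\<^sup>2 / K <= S2" using K(1) by (simp add: power2_eq_square field_simps)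
 then show "(tint (\<lambda>u w. norm (\<alpha> u w)) t w)\<^sup>2 <= K * tint (\<lambda>u w. nsq (\<alpha> u w)) t w"
  using K(1) by (simp add: S_def S2_def pos_divide_le_eq mult.commute)
qed

lemma tint_square:
 fixes \<alpha> :: "real => 'a => 'b::euclidean_space"
 assumes \<alpha>: "prog_bdd \<alpha>" and K: "0 < K" "\<And>u w. K < u ==> w \<in> space M ==> \<alpha> u w = 0" and t: "0 <= t"
 shows "(\<integral>\<^sup>+w. ennreal ((tint (\<lambda>u w. norm (\<alpha> u w)) t w)\<^sup>2) \<partial>M) <= ennreal K * sq_norm t \<alpha>"
  and "msq M (tint \<alpha> t) <= ennreal K * sq_norm t \<alpha>"
proof -
 let ?m = "tint (\<lambda>u w. norm (\<alpha> u w)) t"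
 note cs = tint_cauchy_schwarz[OF \<alpha> K(1) _ _ t, OF K(2)]
 show le: "(\<integral>\<^sup>+w. ennreal ((?m w)\<^sup>2) \<partial>M) <= ennreal K * sq_norm t \<alpha>"
 proof -
  have "(\<integral>\<^sup>+w. ennreal ((?m w)\<^sup>2) \<partial>M)
   <= (\<integral>\<^sup>+w. ennreal K * psq t (\<lambda>u. \<alpha> u w) \<partial>M)"
  proof (rule nn_integral_mono)
   fix w assume w: "w \<in> space M"
   have "ennreal ((?m w)\<^sup>2) <= ennreal (K * tint (\<lambda>u w. nsq (\<alpha> u w)) t w)"
    by (intro ennreal_leI cs(1) w)
   also have "\<dots> = ennreal K * psq t (\<lambda>u. \<alpha> u w)"
    using K(1) tint_nonneg_nn[OF prog_bdd_norm2[OF \<alpha>] w] by (simp add: ennreal_mult')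
   finally show "ennreal ((?m w)\<^sup>2)
     <= ennreal K * psq t (\<lambda>u. \<alpha> u w)" .
  qed
  also have "\<dots> = ennreal K * sq_norm t \<alpha>"
   using sq_norm_paths[OF prog_bddD[OF \<alpha>] t] by (simp add: nn_integral_cmult)
  finally show ?thesis .
 qed
 have "msq M (tint \<alpha> t) <= (\<integral>\<^sup>+w. ennreal ((?m w)\<^sup>2) \<partial>M)"
  by (intro nn_integral_mono ennreal_leI power_mono cs(2)) auto
 also note le
 finally show "msq M (tint \<alpha> t) <= ennreal K * sq_norm t \<alpha>" .
qed

lemma sq_norm_vanish:
 assumes "\<And>u w. K < u ==> w \<in> space M ==> G u w = 0"
 shows "sq_norm t G <= sq_norm K G"
 unfolding sq_norm_def
proof (rule nn_integral_mono)
 fix p :: "real \<times> 'a" assume "p \<in> space time_space"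
 then have "snd p \<in> space M" by (auto simp: space_pair_measure)
 then show "ennreal (nsq (cutoff t G p)) <= ennreal (nsq (cutoff K G p))"
  using assms[of "fst p" "snd p"] by (auto simp: cutoff_def indicator_def not_le)
qed

lemma AE_time_space:
 assumes N: "N \<in> null_sets M"
 shows "AE p in time_space. fst p \<noteq> 0 \<and> snd p \<notin> N"
proof (rule time_product.AE_pair_measure)
 have [measurable]: "N \<in> events" using N by auto
 show "{p \<in> space time_space. fst p \<noteq> 0 \<and> snd p \<notin> N} \<in> sets time_space" by measurable
 show "AE u in lborel. AE w in M. fst (u :: real, w) \<noteq> 0 \<and> snd (u, w) \<notin> N"
  using AE_lborel_singleton[of 0] AE_not_in[OF N] by (auto elim!: eventually_mono)
qed

lemma sq_norm_tendsto_0: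
 fixes G :: "nat => real => 'a => 'b::euclidean_space"
 assumes G: "\<And>k. progressive (G k)" and t: "0 <= t"
  and C: "\<And>k u w. 0 <= u ==> u <= t ==> w \<in> space M ==> norm (G k u w) <= C"
  and lim: "AE w in M. \<forall>u. 0 <= u --> u <= t --> (\<lambda>k. G k u w) \<longlonglongrightarrow> 0"
 shows "(\<lambda>k. sq_norm t (G k)) \<longlonglongrightarrow> 0"
proof -
 obtain N where N: "N \<in> null_sets M"
  "\<And>w. w \<in> space M ==> w \<notin> N ==> \<forall>u. 0 <= u --> u <= t --> (\<lambda>k. G k u w) \<longlonglongrightarrow> 0"
  using AE_null_set[OF lim] by blast
 have "(\<lambda>k. \<integral>\<^sup>+p. ennreal (nsq (cutoff t (G k) p)) \<partial>time_space) \<longlonglongrightarrow> (\<integral>\<^sup>+p. 0 \<partial>time_space)"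
 proof (rule nn_integral_dominated_convergence[where w = "\<lambda>p. ennreal (C\<^sup>2) * indicator ({0..t} \<times> space M) p"])
  show "(\<lambda>p. ennreal (nsq (cutoff t (G k) p))) \<in> borel_measurable time_space" for k
   using cutoff_M[OF G t] by measurable
  show "AE p in time_space. ennreal (nsq (cutoff t (G k) p)) <= ennreal (C\<^sup>2) * indicator ({0..t} \<times> space M) p" for k
   using C by (intro AE_I2) (auto simp: cutoff_def indicator_def space_pair_measure intro!: ennreal_leI power_mono)
  show "(\<integral>\<^sup>+p. ennreal (C\<^sup>2) * indicator ({0..t} \<times> space M) p \<partial>time_space) < \<infinity>"
   using t by (subst nn_integral_cmult_indicator) (auto simp: emeasure_pair_measure_Times emeasure_space_1 ennreal_mult_less_top)
  show "AE p in time_space. (\<lambda>k. ennreal (nsq (cutoff t (G k) p))) \<longlonglongrightarrow> 0"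
   using AE_time_space[OF N(1)] AE_space
  proof eventually_elim
   case (elim p)
   have "(\<lambda>k. cutoff t (G k) p) \<longlonglongrightarrow> 0"
    using N(2)[of "snd p"] elim by (auto simp: cutoff_def indicator_def space_pair_measure)
   then have "(\<lambda>k. ennreal (nsq (cutoff t (G k) p))) \<longlonglongrightarrow> ennreal (nsq (0 :: 'b))" by (intro tendsto_intros)
   then show ?case by simp
  qed
 qed auto
 then show ?thesis by (simp add: sq_norm_def)
qed

end

section \<open>Equations with globally Lipschitz coefficients\<close>

text \<open>Vanishing after some time \<open>K\<close> is included so that the constants of the
  iteration do not depend on the horizon; truncation in time provides it.\<close>

definition regular_coefficient :: "('b::euclidean_space => 'b => real => 'c::euclidean_space) => bool" where
 "regular_coefficient c \<longleftrightarrow> (\<lambda>(x, y, s). c x y s) \<in> borel_measurable borel \<and>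
  (\<exists>C. \<forall>x y s. norm (c x y s) <= C) \<and>
  (\<exists>L. \<forall>x y x' y' s. norm (c x y s - c x' y' s) <= L * (norm (x - x') + norm (y - y'))) \<and>
  (\<exists>K. \<forall>x y s. K < s --> c x y s = 0)"

lemma regular_coefficientE:
 assumes "regular_coefficient c"
 obtains C L K where "(\<lambda>(x, y, s). c x y s) \<in> borel_measurable borel" "0 < C" "\<And>x y s. norm (c x y s) <= C"
  "0 < L" "\<And>x y x' y' s. norm (c x y s - c x' y' s) <= L * (norm (x - x') + norm (y - y'))"
  "0 < K" "\<And>x y s. K < s ==> c x y s = 0"
proof -
 obtain C L K where c: "(\<lambda>(x, y, s). c x y s) \<in> borel_measurable borel" "\<And>x y s. norm (c x y s) <= C"
  "\<And>x y x' y' s. norm (c x y s - c x' y' s) <= L * (norm (x - x') + norm (y - y'))"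
  "\<And>x y s. K < s ==> c x y s = 0"
  using assms unfolding regular_coefficient_def by blast
 show ?thesis
 proof (rule that[of "\<bar>C\<bar> + 1" "\<bar>L\<bar> + 1" "\<bar>K\<bar> + 1"])
  show "norm (c x y s) <= \<bar>C\<bar> + 1" for x y s using c(2)[of x y s] by linarith
  show "norm (c x y s - c x' y' s) <= (\<bar>L\<bar> + 1) * (norm (x - x') + norm (y - y'))" for x y x' y' s
   by (rule order_trans[OF c(3)]) (intro mult_right_mono, auto)
  show "c x y s = 0" if "\<bar>K\<bar> + 1 < s" for x y s using c(4)[of s x y] that by linarith
 qed (use c(1) in auto)
qed

lemma delayed_measurable:
 fixes \<phi> :: "real => ennreal"
 assumes \<delta>: "continuous_on {0..} \<delta>" and [measurable]: "\<phi> \<in> borel_measurable borel"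
 shows "(\<lambda>s. \<phi> (s - \<delta> s) * indicator {s. 0 <= s \<and> s <= t \<and> 0 <= s - \<delta> s} s) \<in> borel_measurable lborel"
proof -
 have [measurable]: "(\<lambda>s. indicator {0..} s *\<^sub>R \<delta> s) \<in> borel_measurable borel"
  by (rule borel_measurable_continuous_on_indicator[OF _ \<delta>]) simp
 have "(\<lambda>s. \<phi> (s - indicator {0..} s *\<^sub>R \<delta> s) * indicator {s. 0 <= s \<and> s <= t \<and> 0 <= s - indicator {0..} s *\<^sub>R \<delta> s} s) \<in> borel_measurable borel"
  by measurable
 also have "(\<lambda>s. \<phi> (s - indicator {0..} s *\<^sub>R \<delta> s) * indicator {s. 0 <= s \<and> s <= t \<and> 0 <= s - indicator {0..} s *\<^sub>R \<delta> s} s)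
   = (\<lambda>s. \<phi> (s - \<delta> s) * indicator {s. 0 <= s \<and> s <= t \<and> 0 <= s - \<delta> s} s)"
  by (auto simp: indicator_def fun_eq_iff)
 finally show ?thesis by simp
qed

text \<open>The delay acts on mean squares only through \<open>delay_substitution\<close>. The
  constant \<kappa> will be \<open>1 / (1 - \<eta>)\<close>, from the change of variables
  \<open>u = s - \<delta> s\<close>; delayed times before 0 refer to the initial segment and are
  left out of that integral.\<close>

locale delay_problem = brownian_basis M F B
 for M :: "'a measure" and F and B :: "real => 'a => real ^ 'd" +
 fixes \<delta> :: "real => real" and \<tau> \<kappa> C0 :: real and \<xi> :: "'a => real => real ^ 'n"
 assumes \<tau>_nonneg: "0 <= \<tau>"
  and delay_continuous: "continuous_on {0..} \<delta>"
  and delay_nonneg: "\<And>t. 0 <= t ==> 0 <= \<delta> t"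
  and delay_ge: "\<And>t. 0 <= t ==> - \<tau> <= t - \<delta> t"
  and \<kappa>_nonneg: "0 <= \<kappa>"
  and delay_substitution: "\<And>\<phi> t. \<phi> \<in> borel_measurable borel ==> 0 <= t ==>
   (\<integral>\<^sup>+s. \<phi> (s - \<delta> s) * indicator {s. 0 <= s \<and> s <= t \<and> 0 <= s - \<delta> s} s \<partial>lborel) <= ennreal \<kappa> * (\<integral>\<^sup>+u\<in>{0..t}. \<phi> u \<partial>lborel)"
  and initial_measurable: "\<And>\<theta>. - \<tau> <= \<theta> ==> \<theta> <= 0 ==> (\<lambda>w. \<xi> w \<theta>) \<in> borel_measurable (F 0)"
  and initial_continuous: "\<And>w. w \<in> space M ==> continuous_on {-\<tau>..0} (\<xi> w)"
  and initial_bounded: "\<And>\<theta> w. - \<tau> <= \<theta> ==> \<theta> <= 0 ==> w \<in> space M ==> norm (\<xi> w \<theta>) <= C0"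
begin

definition with_history :: "(real => 'a => real ^ 'n) => real => 'a => real ^ 'n" where
 "with_history X t w = (if t <= 0 then \<xi> w t else X t w)"

definition path_process :: "(real => 'a => real ^ 'n) => bool" where
 "path_process X \<longleftrightarrow> (\<forall>t\<ge>0. X t \<in> borel_measurable (F t)) \<and>
  (\<forall>w\<in>space M. continuous_on {0..} (\<lambda>t. X t w) \<and> X 0 w = \<xi> w 0)"

lemma path_processD:
 assumes "path_process X"
 shows "0 <= t ==> X t \<in> borel_measurable (F t)"
  and "w \<in> space M ==> continuous_on {0..} (\<lambda>t. X t w)"
  and "w \<in> space M ==> X 0 w = \<xi> w 0"
 using assms by (auto simp: path_process_def)

lemma path_process_progressive: "path_process X ==> progressive X"
 by (rule progressive_continuous) (auto dest: path_processD)

lemma with_history_nonneg: "path_process X ==> 0 <= t ==> w \<in> space M ==> with_history X t w = X t w"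
 using path_processD(3)[of X w] by (cases "t = 0") (auto simp: with_history_def)

lemma with_history_continuous:
 assumes X: "path_process X" and w: "w \<in> space M"
 shows "continuous_on {-\<tau>..} (\<lambda>t. with_history X t w)"
proof -
 have "continuous_on ({-\<tau>..0} \<union> {0..}) (\<lambda>t. with_history X t w)"
 proof (rule continuous_on_closed_Un)
  show "continuous_on {-\<tau>..0} (\<lambda>t. with_history X t w)"
   using initial_continuous[OF w] by (rule continuous_on_eq) (simp add: with_history_def)
  show "continuous_on {0..} (\<lambda>t. with_history X t w)"
   using path_processD(2)[OF X w] by (rule continuous_on_eq) (simp add: with_history_nonneg[OF X _ w])
 qed auto
 moreover have "{-\<tau>..0} \<union> {0..} = {-\<tau>..}" using \<tau>_nonneg by auto
 ultimately show ?thesis by simp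
qed

lemma with_history_measurable:
 assumes X: "path_process X" and t: "- \<tau> <= t" "max 0 t <= s"
 shows "with_history X t \<in> borel_measurable (F s)"
proof (cases "t <= 0")
 case True
 then have "with_history X t = (\<lambda>w. \<xi> w t)" by (simp add: with_history_def fun_eq_iff)
 then show ?thesis using initial_measurable[OF t(1) True] t(2) True by (auto intro: measurable_F_mono)
next
 case False
 then have "with_history X t = X t" by (simp add: with_history_def fun_eq_iff)
 then show ?thesis using path_processD(1)[OF X, of t] False t(2) by (auto intro: measurable_F_mono)
qed

definition along :: "(real ^ 'n => real ^ 'n => real => 'c::euclidean_space) => (real => 'a => real ^ 'n) => real => 'a => 'c" where
 "along c X s w = c (with_history X s w) (with_history X (s - \<delta> s) w) s"

lemma progressive_with_history: "path_process X ==> progressive (with_history X)"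
 using \<tau>_nonneg by (intro progressive_continuous)
  (auto intro: continuous_on_subset[OF with_history_continuous] with_history_measurable)

lemma progressive_delayed:
 assumes X: "path_process X"
 shows "progressive (\<lambda>s. with_history X (s - \<delta> s))"
proof (rule progressive_continuous)
 show "continuous_on {0..} (\<lambda>s. with_history X (s - \<delta> s) w)" if "w \<in> space M" for w
  by (rule continuous_on_compose2[OF with_history_continuous[OF X that]])
   (auto intro!: continuous_intros delay_continuous simp: delay_ge)
 show "with_history X (s - \<delta> s) \<in> borel_measurable (F s)" if "0 <= s" for s
  using that delay_ge[OF that] delay_nonneg[OF that] by (intro with_history_measurable[OF X]) auto
qed

lemma progressive_along:
 assumes X: "path_process X" and c: "(\<lambda>(x, y, s). c x y s) \<in> borel_measurable borel"
 shows "progressive (along c X)"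
 unfolding progressively_measurable_def
proof (intro allI impI)
 fix T :: real assume T: "0 <= T"
 let ?R = "restrict_space borel {0..T} \<Otimes>\<^sub>M F T"
 have 1: "(\<lambda>p. with_history X (fst p) (snd p)) \<in> borel_measurable ?R"
  "(\<lambda>p. with_history X (fst p - \<delta> (fst p)) (snd p)) \<in> borel_measurable ?R"
  using progressive_with_history[OF X] progressive_delayed[OF X] T by (auto simp: progressively_measurable_def case_prod_beta')
 have 2: "fst \<in> borel_measurable ?R" by (rule measurable_compose[OF measurable_fst measurable_restrict_space1]) simp
 have "(\<lambda>p. (with_history X (fst p) (snd p), with_history X (fst p - \<delta> (fst p)) (snd p), fst p)) \<in> borel_measurable ?R"
  by (intro borel_measurable_Pair 1 2)
 from measurable_compose[OF this c] show "(\<lambda>(t, w). along c X t w) \<in> borel_measurable ?R"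
  by (simp add: along_def case_prod_beta')
qed

lemma prog_bdd_along:
 assumes X: "path_process X" and c: "regular_coefficient c"
 shows "prog_bdd (along c X)"
proof (rule prog_bddI)
 show "progressive (along c X)"
  using c by (intro progressive_along[OF X]) (simp add: regular_coefficient_def)
 show "\<exists>C. \<forall>t w. 0 <= t --> t <= T --> w \<in> space M --> norm (along c X t w) <= C" for T
  using c by (auto simp: regular_coefficient_def along_def)
qed

text \<open>A decreasing weight \<open>h\<close> only grows when it is evaluated at the delayed time instead.\<close>

lemma along_lipschitz:
 assumes X: "path_process X" and Y: "path_process Y" and c: "(\<lambda>(x, y, s). c x y s) \<in> borel_measurable borel"
  and L: "0 < L" "\<And>x y x' y' s. norm (c x y s - c x' y' s) <= L * (norm (x - x') + norm (y - y'))"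
  and h: "progressive h" "\<And>s w. 0 <= s ==> w \<in> space M ==> 0 <= h s w"
   "\<And>s u w. 0 <= s ==> s <= u ==> w \<in> space M ==> h u w <= h s w"
  and t: "0 <= t"
 shows "sq_norm t (\<lambda>s w. h s w *\<^sub>R (along c X s w - along c Y s w))
  <= ennreal (2 * L\<^sup>2 * (1 + \<kappa>)) * sq_norm t (\<lambda>s w. h s w *\<^sub>R (X s w - Y s w))"
proof -
 let ?E = "\<lambda>s w. along c X s w - along c Y s w"
 let ?D = "\<lambda>s w. h s w *\<^sub>R (X s w - Y s w)"
 have pD: "progressive ?D"
  by (intro progressive_scaleR progressive_diff h path_process_progressive X Y)
 have pA: "progressive (\<lambda>s w. h s w *\<^sub>R (?E s w))"
  by (intro progressive_scaleR progressive_diff h progressive_along X Y c)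
 define \<phi> where "\<phi> u = msq M (\<lambda>w. cutoff t ?D (u, w))" for u
 let ?J = "\<integral>\<^sup>+s\<in>{0..t}. \<phi> s \<partial>lborel"
 have [measurable]: "cutoff t ?D \<in> borel_measurable time_space" by (rule cutoff_M[OF pD t])
 have "(\<lambda>u. msq M (\<lambda>w. cutoff t ?D (u, w))) \<in> borel_measurable lborel" by measurable
 then have m\<phi> [measurable]: "\<phi> \<in> borel_measurable borel" by (simp add: \<phi>_def[abs_def])
 have \<phi>_in: "\<phi> u = msq M (\<lambda>w. ?D u w)" if "0 <= u" "u <= t" for u
  using that by (simp add: \<phi>_def cutoff_def)
 have mu: "(\<lambda>w. ennreal (nsq (?D u w))) \<in> borel_measurable M" if "0 <= u" for u
  using measurable_F_M[OF progressive_adapted[OF pD that] that] by measurable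
 let ?S = "{s. 0 <= s \<and> s <= t \<and> 0 <= s - \<delta> s}"
 have step: "msq M (\<lambda>w. h s w *\<^sub>R (?E s w)) * indicator {0..t} s
   <= ennreal (2 * L\<^sup>2) * (\<phi> s * indicator {0..t} s) + ennreal (2 * L\<^sup>2) * (\<phi> (s - \<delta> s) * indicator ?S s)" for s
 proof (cases "s \<in> {0..t}")
  case True
  then have s: "0 <= s" "s <= t" by auto
  have sd: "s - \<delta> s <= t" using delay_nonneg[OF s(1)] s by simp
  have "msq M (\<lambda>w. h s w *\<^sub>R (?E s w))
   <= (\<integral>\<^sup>+w. ennreal (2 * L\<^sup>2) * ennreal (nsq (?D s w)) + ennreal (2 * L\<^sup>2) * (ennreal (nsq (?D (s - \<delta> s) w)) * indicator ?S s) \<partial>M)"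
  proof (rule nn_integral_mono)
   fix w assume w: "w \<in> space M"
   let ?x = "norm (X s w - Y s w)"
   let ?y = "norm (with_history X (s - \<delta> s) w - with_history Y (s - \<delta> s) w)"
   have "norm (?E s w) <= L * (?x + ?y)"
    unfolding along_def using L(2) by (simp add: with_history_nonneg[OF X s(1) w] with_history_nonneg[OF Y s(1) w])
   then have "norm (h s w *\<^sub>R (?E s w)) <= h s w * (L * (?x + ?y))"
    using h(2)[OF s(1) w] by (simp add: mult_left_mono)
   also have "\<dots> = L * (h s w * ?x + h s w * ?y)" by (simp add: algebra_simps)
   \<comment> \<open>If the delayed time is negative, both processes take the value of the common
     initial segment there and \<open>?y\<close> is 0.\<close>
   also have "h s w * ?y <= norm (?D (s - \<delta> s) w) * indicator ?S s"
   proof (cases "0 <= s - \<delta> s")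
    case True
    have "h s w <= h (s - \<delta> s) w" using h(3)[OF True _ w, of s] delay_nonneg[OF s(1)] by simp
    moreover have "?y = norm (X (s - \<delta> s) w - Y (s - \<delta> s) w)"
     by (simp add: with_history_nonneg[OF X True w] with_history_nonneg[OF Y True w])
    ultimately show ?thesis using True s h(2)[OF True w] by (simp add: mult_right_mono)
   qed (simp add: with_history_def)
   finally have "norm (h s w *\<^sub>R (?E s w)) <= L * (norm (?D s w) + norm (?D (s - \<delta> s) w) * indicator ?S s)"
    using h(2)[OF s(1) w] L(1) by simp
   then have "nsq (h s w *\<^sub>R (?E s w)) <= (L * (norm (?D s w) + norm (?D (s - \<delta> s) w) * indicator ?S s))\<^sup>2"
    by (rule power_mono) simp
   also have "\<dots> = L\<^sup>2 * nsq (norm (?D s w) + norm (?D (s - \<delta> s) w) * indicator ?S s)" by (simp add: power_mult_distrib)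
   also have "\<dots> <= L\<^sup>2 * (2 * nsq (norm (?D s w)) + 2 * nsq (norm (?D (s - \<delta> s) w) * indicator ?S s))"
    by (intro mult_left_mono power2_norm_add_le) auto
   also have "\<dots> = 2 * L\<^sup>2 * nsq (?D s w) + 2 * L\<^sup>2 * (nsq (?D (s - \<delta> s) w) * indicator ?S s)"
    by (auto simp: algebra_simps indicator_def)
   finally have "ennreal (nsq (h s w *\<^sub>R (?E s w)))
     <= ennreal (2 * L\<^sup>2 * nsq (?D s w) + 2 * L\<^sup>2 * (nsq (?D (s - \<delta> s) w) * indicator ?S s))" by (rule ennreal_leI)
   also have "\<dots> = ennreal (2 * L\<^sup>2) * ennreal (nsq (?D s w)) + ennreal (2 * L\<^sup>2) * (ennreal (nsq (?D (s - \<delta> s) w)) * indicator ?S s)"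
    by (subst ennreal_plus) (auto simp: ennreal_mult' indicator_def)
   finally show "ennreal (nsq (h s w *\<^sub>R (?E s w)))
     <= ennreal (2 * L\<^sup>2) * ennreal (nsq (?D s w)) + ennreal (2 * L\<^sup>2) * (ennreal (nsq (?D (s - \<delta> s) w)) * indicator ?S s)" .
  qed
  also have "\<dots> = ennreal (2 * L\<^sup>2) * \<phi> s + ennreal (2 * L\<^sup>2) * (\<phi> (s - \<delta> s) * indicator ?S s)"
  proof (cases "0 <= s - \<delta> s")
   case True
   then show ?thesis using s sd mu[OF s(1)] mu[OF True]
    by (simp add: nn_integral_add nn_integral_cmult \<phi>_in[OF s] \<phi>_in[OF True sd])
  next
   case False
   then show ?thesis using mu[OF s(1)] by (simp add: nn_integral_cmult \<phi>_in[OF s])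
  qed
  finally show ?thesis using True by simp
 qed simp
 have D\<phi>: "sq_norm t ?D = ?J"
  unfolding sq_norm_times[OF pD t] by (intro nn_integral_cong) (auto simp: \<phi>_in indicator_def)
 note m2 = delayed_measurable[OF delay_continuous m\<phi>, of t]
 have "sq_norm t (\<lambda>s w. h s w *\<^sub>R (?E s w))
   <= (\<integral>\<^sup>+s. ennreal (2 * L\<^sup>2) * (\<phi> s * indicator {0..t} s) + ennreal (2 * L\<^sup>2) * (\<phi> (s - \<delta> s) * indicator ?S s) \<partial>lborel)"
  unfolding sq_norm_times[OF pA t] by (intro nn_integral_mono step)
 also have "\<dots> = ennreal (2 * L\<^sup>2) * ?J + ennreal (2 * L\<^sup>2) * (\<integral>\<^sup>+s. \<phi> (s - \<delta> s) * indicator ?S s \<partial>lborel)"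
  using m2 by (simp add: nn_integral_add nn_integral_cmult)
 also have "\<dots> <= ennreal (2 * L\<^sup>2) * ?J + ennreal (2 * L\<^sup>2) * (ennreal \<kappa> * ?J)"
  by (intro add_left_mono mult_left_mono delay_substitution m\<phi> t) auto
 also have "\<dots> = ennreal (2 * L\<^sup>2) * ((1 + ennreal \<kappa>) * ?J)"
  by (simp add: distrib_left distrib_right)
 also have "\<dots> = ennreal (2 * L\<^sup>2 * (1 + \<kappa>)) * sq_norm t ?D"
  using \<kappa>_nonneg unfolding D\<phi> by (simp add: ennreal_mult' ennreal_plus mult.assoc)
 finally show ?thesis .
qed

end

section \<open>Picard iteration\<close>

lemma nn_integral_exp_le:
 assumes "0 < l" "0 <= t"
 shows "(\<integral>\<^sup>+s\<in>{0..t}. ennreal (exp (l * s)) \<partial>lborel) <= ennreal (exp (l * t) / l)"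
proof -
 have "(\<integral>\<^sup>+s\<in>{0..t}. ennreal (exp (l * s)) \<partial>lborel) = ennreal (exp (l * t) / l - exp (l * 0) / l)"
  using assms by (intro nn_integral_FTC_Icc) (auto intro!: derivative_eq_intros)
 also have "\<dots> <= ennreal (exp (l * t) / l)" using assms by (intro ennreal_leI) simp
 finally show ?thesis .
qed

text \<open>The factor \<open>1 / 8\<close> beats the \<open>4\<^sup>j\<close> that Chebyshev's inequality costs at the level \<open>2\<^sup>-\<^sup>j\<close>.\<close>

lemma volterra_iterate:
 fixes e :: "nat => real => ennreal"
 assumes c: "0 < c" and C: "0 <= C" "\<And>t. 0 <= t ==> t <= T ==> e 0 t <= ennreal C"
  and step: "\<And>j t. 0 <= t ==> t <= T ==> e (Suc j) t <= ennreal c * (\<integral>\<^sup>+s\<in>{0..t}. e j s \<partial>lborel)"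
  and t: "0 <= t" "t <= T"
 shows "e j t <= ennreal (C * (1 / 8) ^ j * exp (8 * c * t))"
 using t
proof (induction j arbitrary: t)
 case 0
 have "C * 1 <= C * exp (8 * c * t)" using C(1) c 0 by (intro mult_left_mono) auto
 then show ?case using C(2)[OF 0] by (auto intro: order_trans ennreal_leI)
next
 case (Suc j)
 let ?A = "C * (1 / 8) ^ j"
 have "(\<integral>\<^sup>+s\<in>{0..t}. e j s \<partial>lborel) <= (\<integral>\<^sup>+s. ennreal ?A * (ennreal (exp (8 * c * s)) * indicator {0..t} s) \<partial>lborel)"
  using Suc C(1) by (intro nn_integral_mono) (auto simp: indicator_def ennreal_mult'[symmetric])
 also have "\<dots> <= ennreal ?A * ennreal (exp (8 * c * t) / (8 * c))"
  using c Suc.prems by (subst nn_integral_cmult) (auto intro!: mult_left_mono nn_integral_exp_le)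
 finally have "e (Suc j) t <= ennreal c * (ennreal ?A * ennreal (exp (8 * c * t) / (8 * c)))"
  by (intro order_trans[OF step[OF Suc.prems]] mult_left_mono) auto
 also have "\<dots> = ennreal (c * (?A * (exp (8 * c * t) / (8 * c))))"
  using c C(1) by (simp add: ennreal_mult[symmetric])
 \<comment> \<open>Integrating exp (8 c s) gains the factor 1 / (8 c), and the factor c of the
   recursion leaves 1 / 8.\<close>
 also have "c * (?A * (exp (8 * c * t) / (8 * c))) = C * (1 / 8) ^ Suc j * exp (8 * c * t)"
  using c by simp
 finally show ?case .
qed

context brownian_basis
begin

lemma nn_integral_drift_diffusion:
 fixes \<alpha> :: "real => 'a => real ^ 'n" and \<beta> :: "real => 'a => real ^ 'd ^ 'n"
 assumes \<alpha>: "prog_bdd \<alpha>" and K: "0 < K" "\<And>u w. K < u ==> w \<in> space M ==> \<alpha> u w = 0" and \<beta>: "prog_bdd \<beta>" and t: "0 <= t"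
 shows "msq M (\<lambda>w. tint \<alpha> t w + ito \<beta> t w) <= 2 * (ennreal K * sq_norm t \<alpha> + sq_norm t \<beta>)"
proof -
 have "msq M (\<lambda>w. tint \<alpha> t w + ito \<beta> t w)
   <= 2 * msq M (tint \<alpha> t) + 2 * msq M (ito \<beta> t)"
  by (intro nn_integral_square_add ito_measurable_M[OF \<beta> t] measurable_F_M[OF tint_measurable[OF prog_bddD[OF \<alpha>] t] t])
 also have "\<dots> <= 2 * (ennreal K * sq_norm t \<alpha>) + 2 * sq_norm t \<beta>"
  unfolding ito_isometry[OF \<beta> t] by (intro add_mono mult_left_mono tint_square(2)[OF \<alpha> K t]) auto
 finally show ?thesis by (simp add: distrib_left)
qed

text \<open>The drift is dominated by the running integral of its norm. That integral is
  nondecreasing, so Chebyshev's inequality at the final time controls the drift at all times; Doob's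
  inequality handles the martingale part.\<close>

lemma maximal_drift_diffusion:
 fixes \<alpha> :: "real => 'a => real ^ 'n" and \<beta> :: "real => 'a => real ^ 'd ^ 'n"
 assumes \<alpha>: "prog_bdd \<alpha>" and K: "0 < K" "\<And>u w. K < u ==> w \<in> space M ==> \<alpha> u w = 0" and \<beta>: "prog_bdd \<beta>"
  and T: "0 <= T" and e: "0 <= e"
 obtains E where "E \<in> events" "ennreal (e\<^sup>2) * emeasure M E <= ennreal K * sq_norm T \<alpha> + sq_norm T \<beta>"
  "AE w in M. w \<notin> E --> (\<forall>t\<in>{0..T}. norm (tint \<alpha> t w + ito \<beta> t w) <= 2 * e)"
proof -
 let ?n = "\<lambda>u w. norm (\<alpha> u w)"
 have n: "prog_bdd ?n"
  using \<alpha> progressive_compose[OF prog_bddD[OF \<alpha>], of norm] by (auto simp: prog_bdd_def)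
 obtain E2 where E2: "E2 \<in> events" "ennreal (e\<^sup>2) * emeasure M E2 <= msq M (ito \<beta> T)"
   "AE w in M. w \<notin> E2 --> (\<forall>t\<in>{0..T}. norm (ito \<beta> t w) <= e)"
  using maximal_continuous[OF ito_l2_martingale[OF \<beta>] AE_I2[OF ito_continuous[OF \<beta>]] e T] by blast
 have [measurable]: "tint ?n T \<in> borel_measurable M"
  by (rule measurable_F_M[OF tint_measurable[OF prog_bddD[OF n] T] T])
 define E1 where "E1 = {w \<in> space M. e < tint ?n T w}"
 have E1: "E1 \<in> events" unfolding E1_def by measurable
 have "ennreal (e\<^sup>2) * emeasure M E1 = (\<integral>\<^sup>+w. ennreal (e\<^sup>2) * indicator E1 w \<partial>M)"
  using E1 by (simp add: nn_integral_cmult_indicator)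
 also have "\<dots> <= (\<integral>\<^sup>+w. ennreal ((tint ?n T w)\<^sup>2) \<partial>M)"
  using e by (intro nn_integral_mono) (auto simp: indicator_def E1_def intro!: ennreal_leI power_mono)
 also note tint_square(1)[OF \<alpha> K T]
 finally have E1': "ennreal (e\<^sup>2) * emeasure M E1 <= ennreal K * sq_norm T \<alpha>" .
 show thesis
 proof (rule that[of "E1 \<union> E2"])
  show "E1 \<union> E2 \<in> events" using E1 E2(1) by auto
  have "ennreal (e\<^sup>2) * emeasure M (E1 \<union> E2) <= ennreal (e\<^sup>2) * (emeasure M E1 + emeasure M E2)"
   by (intro mult_left_mono emeasure_subadditive E1 E2(1)) auto
  also have "\<dots> <= ennreal K * sq_norm T \<alpha> + sq_norm T \<beta>"
   unfolding distrib_left using E1' E2(2) by (intro add_mono) (simp_all add: ito_isometry[OF \<beta> T])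
  finally show "ennreal (e\<^sup>2) * emeasure M (E1 \<union> E2) <= ennreal K * sq_norm T \<alpha> + sq_norm T \<beta>" .
  show "AE w in M. w \<notin> E1 \<union> E2 --> (\<forall>t\<in>{0..T}. norm (tint \<alpha> t w + ito \<beta> t w) <= 2 * e)"
   using E2(3) AE_space
  proof eventually_elim
   case (elim w)
   show ?case
   proof (intro impI ballI)
    fix t assume w: "w \<notin> E1 \<union> E2" and t: "t \<in> {0..T}"
    have "norm (tint \<alpha> t w) <= tint ?n t w"
     using t K elim(2) by (intro tint_cauchy_schwarz(2)[OF \<alpha> K(1)]) auto
    also have "0 <= tint ?n T w - tint ?n t w"
     using t elim(2) by (subst tint_increment(1)[OF n]) (auto simp: set_lebesgue_integral_def intro!: Bochner_Integration.integral_nonneg)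
    then have "tint ?n t w <= e" using w elim(2) by (auto simp: E1_def not_less)
    finally have "norm (tint \<alpha> t w) <= e" .
    then show "norm (tint \<alpha> t w + ito \<beta> t w) <= 2 * e" using elim(1) w t by (intro norm_triangle_le) force
   qed
  qed
 qed
qed

end

context delay_problem
begin

text \<open>Two weights occur: the constant 1 for existence and the indicator of not having left a
  ball for the comparison of solutions.\<close>

definition decreasing_weight :: "(real => 'a => real) => bool" where
 "decreasing_weight h \<longleftrightarrow> progressive h \<and>
  (\<forall>s\<ge>0. \<forall>w\<in>space M. 0 <= h s w \<and> h s w <= 1) \<and>
  (\<forall>s\<ge>0. \<forall>u\<ge>s. \<forall>w\<in>space M. h u w <= h s w)"

lemma decreasing_weight_prog_bdd:
 assumes "decreasing_weight h"
 shows "prog_bdd h"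
 using assms by (intro prog_bddI) (auto simp: decreasing_weight_def intro!: exI[of _ 1])

text \<open>The drift carries the factor \<open>K\<close> of Cauchy-Schwarz and the diffusion the
  factor 1 of the isometry; twice this combination bounds the mean square of a difference of Picard
  images.\<close>

lemma regular_pairE:
 assumes a: "regular_coefficient a" and b: "regular_coefficient b"
 obtains K c where "0 < K" "0 < c" "\<And>x y s. K < s ==> a x y s = 0" "\<And>x y s. K < s ==> b x y s = 0"
  "\<And>X Y h t. path_process X ==> path_process Y ==> decreasing_weight h ==> 0 <= t ==>
   ennreal K * sq_norm t (\<lambda>s w. h s w *\<^sub>R (along a X s w - along a Y s w))
    + sq_norm t (\<lambda>s w. h s w *\<^sub>R (along b X s w - along b Y s w))
   <= ennreal c * sq_norm t (\<lambda>s w. h s w *\<^sub>R (X s w - Y s w))"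
proof -
 obtain Ca La Ka where A: "(\<lambda>(x, y, s). a x y s) \<in> borel_measurable borel" "0 < La"
   "\<And>x y x' y' s. norm (a x y s - a x' y' s) <= La * (norm (x - x') + norm (y - y'))" "0 < Ka" "\<And>x y s. Ka < s ==> a x y s = 0"
  using regular_coefficientE[OF a] by metis
 obtain Cb Lb Kb where B: "(\<lambda>(x, y, s). b x y s) \<in> borel_measurable borel" "0 < Lb"
   "\<And>x y x' y' s. norm (b x y s - b x' y' s) <= Lb * (norm (x - x') + norm (y - y'))" "0 < Kb" "\<And>x y s. Kb < s ==> b x y s = 0"
  using regular_coefficientE[OF b] by metis
 define K where "K = max Ka Kb"
 define ca cb where "ca = 2 * La\<^sup>2 * (1 + \<kappa>)" and "cb = 2 * Lb\<^sup>2 * (1 + \<kappa>)"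
 have pos: "0 < K" "0 < ca" "0 < cb" using A(2,4) B(2,4) \<kappa>_nonneg by (auto simp: K_def ca_def cb_def intro!: mult_pos_pos)
 show thesis
 proof (rule that[of K "K * ca + cb"])
  fix X Y h and t :: real assume *: "path_process X" "path_process Y" "decreasing_weight h" "0 <= t"
  let ?D = "sq_norm t (\<lambda>s w. h s w *\<^sub>R (X s w - Y s w))"
  note h = *(3)[unfolded decreasing_weight_def]
  have "sq_norm t (\<lambda>s w. h s w *\<^sub>R (along a X s w - along a Y s w)) <= ennreal ca * ?D"
   unfolding ca_def using h by (intro along_lipschitz *(1,2,4) A) auto
  moreover have "sq_norm t (\<lambda>s w. h s w *\<^sub>R (along b X s w - along b Y s w)) <= ennreal cb * ?D"
   unfolding cb_def using h by (intro along_lipschitz *(1,2,4) B) auto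
  ultimately have "ennreal K * sq_norm t (\<lambda>s w. h s w *\<^sub>R (along a X s w - along a Y s w))
    + sq_norm t (\<lambda>s w. h s w *\<^sub>R (along b X s w - along b Y s w)) <= ennreal K * (ennreal ca * ?D) + ennreal cb * ?D"
   by (intro add_mono mult_left_mono) auto
  also have "\<dots> = ennreal (K * ca + cb) * ?D"
   using pos by (simp add: ennreal_plus ennreal_mult distrib_right mult.assoc)
  finally show "ennreal K * sq_norm t (\<lambda>s w. h s w *\<^sub>R (along a X s w - along a Y s w))
    + sq_norm t (\<lambda>s w. h s w *\<^sub>R (along b X s w - along b Y s w)) <= ennreal (K * ca + cb) * ?D" .
 qed (use pos A(5) B(5) in \<open>auto simp: K_def intro!: add_pos_pos\<close>)
qed

definition picard :: "(real ^ 'n => real ^ 'n => real => real ^ 'n) => (real ^ 'n => real ^ 'n => real => real ^ 'd ^ 'n)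
  => (real => 'a => real ^ 'n) => real => 'a => real ^ 'n" where
 "picard a b X t w = \<xi> w 0 + (tint (along a X) t w + ito (along b X) t w)"

lemma initial_value_measurable: "0 <= t ==> (\<lambda>w. \<xi> w 0) \<in> borel_measurable (F t)"
 using initial_measurable[of 0] \<tau>_nonneg by (auto intro: measurable_F_mono)

lemma path_process_picard:
 assumes X: "path_process X" and a: "regular_coefficient a" and b: "regular_coefficient b"
 shows "path_process (picard a b X)"
proof -
 note A = prog_bdd_along[OF X a] and B = prog_bdd_along[OF X b]
 show ?thesis unfolding path_process_def picard_def
  using tint_measurable[OF prog_bddD[OF A]] ito_measurable[OF B] tint_continuous[OF A] ito_continuous[OF B]
  by (auto intro!: borel_measurable_add continuous_intros initial_value_measurable simp: ito_0[OF B])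
qed

lemma picard_diff:
 assumes X: "path_process X" and Y: "path_process Y" and a: "regular_coefficient a" and b: "regular_coefficient b"
 shows "AE w in M. \<forall>t\<ge>0. picard a b X t w - picard a b Y t w
  = tint (\<lambda>s w. along a X s w - along a Y s w) t w + ito (\<lambda>s w. along b X s w - along b Y s w) t w"
proof -
 note A = prog_bdd_along[OF X a] prog_bdd_along[OF Y a] and B = prog_bdd_along[OF X b] prog_bdd_along[OF Y b]
 have D: "prog_bdd (\<lambda>s w. along b X s w - along b Y s w)" by (intro prog_bdd_diff B)
 have "AE w in M. \<forall>t\<ge>0. True --> ito (\<lambda>s w. along b X s w - along b Y s w) t w = ito (along b X) t w - ito (along b Y) t w"
  by (rule AE_all_times) (auto intro!: continuous_intros ito_continuous B D ito_diff)
 then show ?thesis using AE_space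
  by eventually_elim (auto simp: picard_def tint_diff[OF A])
qed

text \<open>Successive iterates differ in mean square by a multiple of 8^-j, fast enough for the
  maximal inequality and Borel-Cantelli to give uniform convergence of the paths. The limit is a
  fixed point because bounded Lipschitz coefficients turn convergence of paths into L^2 convergence
  of the integrands.\<close>

lemma picard_fixpoint_exists:
 assumes a: "regular_coefficient a" and b: "regular_coefficient b"
 shows "\<exists>X. path_process X \<and> (AE w in M. \<forall>t\<ge>0. X t w = picard a b X t w)"
proof -
 obtain K c where K: "0 < K" "0 < c" "\<And>x y s. K < s ==> a x y s = 0" "\<And>x y s. K < s ==> b x y s = 0"
  and con: "\<And>X Y h t. path_process X ==> path_process Y ==> decreasing_weight h ==> 0 <= t ==>
   ennreal K * sq_norm t (\<lambda>s w. h s w *\<^sub>R (along a X s w - along a Y s w))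
    + sq_norm t (\<lambda>s w. h s w *\<^sub>R (along b X s w - along b Y s w))
   <= ennreal c * sq_norm t (\<lambda>s w. h s w *\<^sub>R (X s w - Y s w))"
  using regular_pairE[OF a b] by blast
 define Z where "Z j = (picard a b ^^ j) (\<lambda>t w. \<xi> w 0)" for j
 have ZS: "Z (Suc j) = picard a b (Z j)" for j by (simp add: Z_def)
 have Z: "path_process (Z j)" for j
 proof (induction j)
  case 0
  show ?case by (auto simp: Z_def path_process_def initial_value_measurable)
 qed (simp add: ZS path_process_picard a b)
 define \<alpha> where "\<alpha> j s w = along a (Z (Suc j)) s w - along a (Z j) s w" for j s w
 define \<beta> where "\<beta> j s w = along b (Z (Suc j)) s w - along b (Z j) s w" for j s w
 have \<alpha>: "prog_bdd (\<alpha> j)" and \<beta>: "prog_bdd (\<beta> j)" for j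
  unfolding \<alpha>_def[abs_def] \<beta>_def[abs_def] by (intro prog_bdd_diff prog_bdd_along Z a b)+
 have vanish: "\<alpha> j u w = 0" "\<beta> j u w = 0" if "K < u" for j u w
  using that K(3,4) by (simp_all add: \<alpha>_def \<beta>_def along_def)
 have ab: "ennreal K * sq_norm t (\<alpha> j) + sq_norm t (\<beta> j) <= ennreal c * sq_norm t (\<lambda>s w. Z (Suc j) s w - Z j s w)" if "0 <= t" for j t
  using con[OF Z[of "Suc j"] Z[of j] _ that, of "\<lambda>_ _. 1"] progressive_time[of "\<lambda>_. 1::real"]
  by (simp add: decreasing_weight_def \<alpha>_def[abs_def] \<beta>_def[abs_def])
 have diff: "AE w in M. \<forall>t\<ge>0. Z (Suc (Suc j)) t w - Z (Suc j) t w = tint (\<alpha> j) t w + ito (\<beta> j) t w" for j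
  using picard_diff[OF Z[of "Suc j"] Z[of j] a b] by (simp add: ZS[symmetric] \<alpha>_def[abs_def] \<beta>_def[abs_def])
 define e where "e j t = msq M (\<lambda>w. Z (Suc j) t w - Z j t w)" for j t
 have pD: "progressive (\<lambda>s w. Z (Suc j) s w - Z j s w)" for j
  by (intro progressive_diff path_process_progressive Z)
 have sq: "sq_norm t (\<lambda>s w. Z (Suc j) s w - Z j s w) = (\<integral>\<^sup>+s\<in>{0..t}. e j s \<partial>lborel)" if "0 <= t" for j t
  unfolding sq_norm_times[OF pD that] e_def ..
 have step: "e (Suc j) t <= ennreal (2 * c) * (\<integral>\<^sup>+s\<in>{0..t}. e j s \<partial>lborel)" if t: "0 <= t" for j t
 proof -
  have "e (Suc j) t = msq M (\<lambda>w. tint (\<alpha> j) t w + ito (\<beta> j) t w)"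
   unfolding e_def using diff[of j] by (intro nn_integral_cong_AE) (auto elim!: eventually_mono simp: t)
  also have "\<dots> <= 2 * (ennreal c * (\<integral>\<^sup>+s\<in>{0..t}. e j s \<partial>lborel))"
   by (rule order_trans[OF nn_integral_drift_diffusion[OF \<alpha> K(1) vanish(1) \<beta> t] mult_left_mono[OF ab[OF t, unfolded sq[OF t]]]]) auto
  also have "\<dots> = ennreal (2 * c) * (\<integral>\<^sup>+s\<in>{0..t}. e j s \<partial>lborel)" using K(2) by (simp add: ennreal_mult mult.assoc)
  finally show ?thesis .
 qed
 obtain C where C: "0 <= C" "\<And>t. 0 <= t ==> t <= K ==> e 0 t <= ennreal C"
 proof -
  note A0 = prog_bdd_along[OF Z[of 0] a] and B0 = prog_bdd_along[OF Z[of 0] b]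
  define S where "S = 2 * (ennreal K * sq_norm K (along a (Z 0)) + sq_norm K (along b (Z 0)))"
  have S: "S < \<infinity>" using sq_norm_finite[OF A0, of K] sq_norm_finite[OF B0, of K] K(1)
   by (auto simp: S_def ennreal_mult_less_top)
  have "e 0 t <= S" if t: "0 <= t" "t <= K" for t
  proof -
   have "e 0 t = msq M (\<lambda>w. tint (along a (Z 0)) t w + ito (along b (Z 0)) t w)"
    unfolding e_def ZS picard_def by (simp add: Z_def)
   also have "\<dots> <= S" unfolding S_def
    using K(3) t by (intro order_trans[OF nn_integral_drift_diffusion[OF A0 K(1) _ B0 t(1)]] mult_left_mono add_mono sq_norm_mono)
     (auto simp: along_def)
   finally show ?thesis .
  qed
  then show thesis using S by (intro that[of "enn2real S"]) auto
 qed
 let ?Q = "c * C * exp (16 * c * K) * K"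
 have e_bound: "e j s <= ennreal (C * (1 / 8) ^ j * exp (8 * (2 * c) * s))" if "0 <= s" "s <= K" for j s
  by (rule volterra_iterate[of "2 * c" C K e, OF _ C step]) (use K(2) that in auto)
 \<comment> \<open>The coefficients vanish after \<open>K\<close>, so the estimate on
   \<open>[0, K]\<close> serves every horizon \<open>T\<close>.\<close>
 have ab': "ennreal K * sq_norm T (\<alpha> j) + sq_norm T (\<beta> j) <= ennreal (?Q * (1 / 8) ^ j)" if T: "0 <= T" for T j
 proof -
  have "ennreal K * sq_norm T (\<alpha> j) + sq_norm T (\<beta> j) <= ennreal K * sq_norm K (\<alpha> j) + sq_norm K (\<beta> j)"
   by (intro add_mono mult_left_mono sq_norm_vanish vanish) auto
  also have "\<dots> <= ennreal c * (\<integral>\<^sup>+s\<in>{0..K}. e j s \<partial>lborel)" using ab[of K j] K(1) by (simp add: sq)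
  also have "\<dots> <= ennreal c * (\<integral>\<^sup>+s. ennreal (C * (1 / 8) ^ j * exp (16 * c * K)) * indicator {0..K} s \<partial>lborel)"
  proof (intro mult_left_mono nn_integral_mono)
   fix s
   have "e j s <= ennreal (C * (1 / 8) ^ j * exp (16 * c * K))" if s: "0 <= s" "s <= K"
    using C(1) s K(2) by (intro order_trans[OF e_bound[OF s]] ennreal_leI mult_left_mono) auto
   then show "e j s * indicator {0..K} s <= ennreal (C * (1 / 8) ^ j * exp (16 * c * K)) * indicator {0..K} s"
    by (auto simp: indicator_def)
  qed auto
  also have "\<dots> = ennreal (?Q * (1 / 8) ^ j)"
   using K(1,2) C(1) by (subst nn_integral_cmult_indicator) (simp_all add: ennreal_mult[symmetric] mult_ac)
  finally show ?thesis .
 qed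
 \<comment> \<open>The level is 2^-(j+1) because the maximal inequality controls the sum of drift
   and martingale by twice the level.\<close>
 have "\<exists>E. \<forall>j. E j \<in> events \<and> ennreal (((1 / 2) ^ Suc j)\<^sup>2) * emeasure M (E j) <= ennreal (?Q * (1 / 8) ^ j)
   \<and> (AE w in M. w \<notin> E j --> (\<forall>t\<in>{0..real j}. norm (tint (\<alpha> j) t w + ito (\<beta> j) t w) <= (1 / 2) ^ j))"
 proof (rule choice, rule allI)
  fix j
  obtain E where "E \<in> events" "ennreal (((1 / 2) ^ Suc j)\<^sup>2) * emeasure M E <= ennreal K * sq_norm (real j) (\<alpha> j) + sq_norm (real j) (\<beta> j)"
   "AE w in M. w \<notin> E --> (\<forall>t\<in>{0..real j}. norm (tint (\<alpha> j) t w + ito (\<beta> j) t w) <= 2 * (1 / 2) ^ Suc j)"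
   by (rule maximal_drift_diffusion[OF \<alpha> K(1) vanish(1) \<beta>, of "real j" "(1 / 2) ^ Suc j" j j]) auto
  then show "\<exists>E. E \<in> events \<and> ennreal (((1 / 2) ^ Suc j)\<^sup>2) * emeasure M E <= ennreal (?Q * (1 / 8) ^ j)
   \<and> (AE w in M. w \<notin> E --> (\<forall>t\<in>{0..real j}. norm (tint (\<alpha> j) t w + ito (\<beta> j) t w) <= (1 / 2) ^ j))"
   using ab'[of "real j" j] by (intro exI[of _ E]) (auto intro: order_trans)
 qed
 then obtain E where E: "\<And>j. E j \<in> events"
   "\<And>j. ennreal (((1 / 2) ^ Suc j)\<^sup>2) * emeasure M (E j) <= ennreal (?Q * (1 / 8) ^ j)"
   "\<And>j. AE w in M. w \<notin> E j --> (\<forall>t\<in>{0..real j}. norm (tint (\<alpha> j) t w + ito (\<beta> j) t w) <= (1 / 2) ^ j)" by blast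
 have prob_le: "prob (E j) <= 4 * (?Q) * (1 / 2) ^ j" for j
 proof -
  have "((1 / 2) ^ Suc j)\<^sup>2 * prob (E j) <= ?Q * (1 / 8) ^ j"
   using E(2)[of j] K C(1) by (simp add: emeasure_eq_measure ennreal_mult'[symmetric] del: power_Suc)
  also have "(1 / 8 :: real) ^ j = ((1 / 2) ^ Suc j)\<^sup>2 * (4 * (1 / 2) ^ j)"
   by (simp add: power2_eq_square power_mult_distrib[symmetric])
  finally have "((1 / 2) ^ Suc j)\<^sup>2 * prob (E j) <= ((1 / 2) ^ Suc j)\<^sup>2 * (4 * (?Q) * (1 / 2) ^ j)"
   by (simp only: mult_ac)
  then show ?thesis by (rule mult_left_le_imp_le) simp
 qed
 \<comment> \<open>The initial value is subtracted because \<open>limit_process\<close> asks for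
   processes that start at 0.\<close>
 obtain X' where X': "\<And>t. 0 <= t ==> X' t \<in> borel_measurable (F t)"
  "\<And>w. w \<in> space M ==> continuous_on {0..} (\<lambda>t. X' t w)" "\<And>w. w \<in> space M ==> X' 0 w = 0"
  "AE w in M. \<forall>T. uniform_limit {0..T} (\<lambda>j t. Z (Suc j) t w - \<xi> w 0) (\<lambda>t. X' t w) sequentially"
 proof (rule limit_process[of "\<lambda>j t w. Z (Suc j) t w - \<xi> w 0" E])
  show "summable (\<lambda>j. prob (E j))"
   by (rule summable_comparison_test'[of "\<lambda>j. 4 * (?Q) * (1 / 2) ^ j"])
    (use prob_le in \<open>auto intro: summable_mult summable_geometric\<close>)
  show "AE w in M. w \<notin> E j --> (\<forall>t\<in>{0..real j}. norm (Z (Suc (Suc j)) t w - \<xi> w 0 - (Z (Suc j) t w - \<xi> w 0)) <= (1 / 2) ^ j)" for j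
   using E(3)[of j] diff[of j] by eventually_elim auto
 qed (use path_processD[OF Z] initial_value_measurable E(1) in \<open>auto intro!: continuous_intros\<close>)
 define X where "X t w = \<xi> w 0 + X' t w" for t w
 have X: "path_process X"
  unfolding path_process_def X_def using X'(1,2,3) by (auto intro!: borel_measurable_add initial_value_measurable continuous_intros)
 have lim: "AE w in M. \<forall>t\<ge>0. (\<lambda>j. Z (Suc j) t w) \<longlonglongrightarrow> X t w"
  using X'(4)
 proof eventually_elim
  case (elim w)
  show ?case
  proof (intro allI impI)
   fix t :: real assume "0 <= t"
   then have "(\<lambda>j. Z (Suc j) t w - \<xi> w 0) \<longlonglongrightarrow> X' t w" using elim by (intro tendsto_uniform_limitI[where S = "{0..t}"]) auto
   from tendsto_add[OF tendsto_const[of "\<xi> w 0"] this] show "(\<lambda>j. Z (Suc j) t w) \<longlonglongrightarrow> X t w" by (simp add: X_def)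
  qed
 qed
 have to_0: "(\<lambda>j. sq_norm t (\<lambda>s w. along c' (Z (Suc j)) s w - along c' X s w)) \<longlonglongrightarrow> 0"
  if c': "regular_coefficient c'" and t: "0 <= t" for c' :: "real ^ 'n => real ^ 'n => real => 'e::euclidean_space" and t
 proof -
  obtain C L K where R: "(\<lambda>(x, y, s). c' x y s) \<in> borel_measurable borel" "0 < C" "\<And>x y s. norm (c' x y s) <= C"
   "0 < L" "\<And>x y x' y' s. norm (c' x y s - c' x' y' s) <= L * (norm (x - x') + norm (y - y'))"
   "0 < K" "\<And>x y s. K < s ==> c' x y s = 0"
   using regular_coefficientE[OF c'] by metis
  show ?thesis
  proof (rule sq_norm_tendsto_0[where C = "C + C"])
   show "norm (along c' (Z (Suc j)) u w - along c' X u w) <= C + C" for j u w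
    unfolding along_def by (intro norm_triangle_le_diff add_mono R)
   show "AE w in M. \<forall>u. 0 <= u --> u <= t --> (\<lambda>j. along c' (Z (Suc j)) u w - along c' X u w) \<longlonglongrightarrow> 0"
    using lim
   proof eventually_elim
    case (elim w)
    have h: "(\<lambda>j. with_history (Z (Suc j)) r w - with_history X r w) \<longlonglongrightarrow> 0" for r
     using elim by (cases "r <= 0") (auto simp: with_history_def LIM_zero)
    show ?case
    proof (intro allI impI)
     fix u :: real
     show "(\<lambda>j. along c' (Z (Suc j)) u w - along c' X u w) \<longlonglongrightarrow> 0"
     proof (rule tendsto_0_le[where K = 1])
      show "(\<lambda>j. L * (norm (with_history (Z (Suc j)) u w - with_history X u w)
        + norm (with_history (Z (Suc j)) (u - \<delta> u) w - with_history X (u - \<delta> u) w))) \<longlonglongrightarrow> 0"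
       using tendsto_mult_left[OF tendsto_add[OF tendsto_norm_zero[OF h] tendsto_norm_zero[OF h]], of L] by simp
     qed (use R(4,5) in \<open>auto simp: along_def intro!: always_eventually\<close>)
    qed
   qed
  qed (auto intro!: progressive_diff progressive_along Z X R(1) t)
 qed
 \<comment> \<open>The iterate with index j + 2 is the Picard image of the one before it. It tends
   to \<open>X t\<close> along paths and to the Picard image of \<open>X\<close> in mean square;
   Fatou identifies the two limits.\<close>
 have "AE w in M. X t w = picard a b X t w" if t: "0 <= t" for t
 proof -
  have mZ: "Z j t \<in> borel_measurable M" for j using path_processD(1)[OF Z t] measurable_F_M[OF _ t] by blast
  have mX: "X t \<in> borel_measurable M" using path_processD(1)[OF X t] measurable_F_M[OF _ t] by blast
  have mP: "picard a b X t \<in> borel_measurable M"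
   using path_processD(1)[OF path_process_picard[OF X a b] t] measurable_F_M[OF _ t] by blast
  let ?f = "\<lambda>j w. ennreal (nsq (Z (Suc (Suc j)) t w - picard a b X t w))"
  let ?r = "\<lambda>j. 2 * (ennreal K * sq_norm t (\<lambda>s w. along a (Z (Suc j)) s w - along a X s w)
    + sq_norm t (\<lambda>s w. along b (Z (Suc j)) s w - along b X s w))"
  have "(\<integral>\<^sup>+w. ?f j w \<partial>M) <= ?r j" for j
  proof -
   have "(\<integral>\<^sup>+w. ?f j w \<partial>M) = msq M (\<lambda>w. tint (\<lambda>s w. along a (Z (Suc j)) s w - along a X s w) t w
     + ito (\<lambda>s w. along b (Z (Suc j)) s w - along b X s w) t w)"
    using picard_diff[OF Z[of "Suc j"] X a b] by (intro nn_integral_cong_AE) (auto elim!: eventually_mono simp: t ZS)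
   also have "\<dots> <= ?r j"
    by (intro nn_integral_drift_diffusion prog_bdd_diff prog_bdd_along Z X a b K(1) t) (simp add: along_def K(3))
   finally show ?thesis .
  qed
  moreover have "?r \<longlonglongrightarrow> 2 * (ennreal K * 0 + 0)"
   by (intro ennreal_tendsto_cmult tendsto_add to_0 a b t) auto
  ultimately have "(\<lambda>j. \<integral>\<^sup>+w. ?f j w \<partial>M) \<longlonglongrightarrow> 0"
   by (intro tendsto_sandwich[of "\<lambda>_. 0" "\<lambda>j. \<integral>\<^sup>+w. ?f j w \<partial>M" _ ?r]) auto
  then have "liminf (\<lambda>j. \<integral>\<^sup>+w. ?f j w \<partial>M) = 0" by (rule lim_imp_Liminf[OF sequentially_bot])
  moreover have "(\<integral>\<^sup>+w. liminf (\<lambda>j. ?f j w) \<partial>M) <= liminf (\<lambda>j. \<integral>\<^sup>+w. ?f j w \<partial>M)"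
   using mZ mP by (intro nn_integral_liminf) auto
  moreover have "(\<integral>\<^sup>+w. liminf (\<lambda>j. ?f j w) \<partial>M) = msq M (\<lambda>w. X t w - picard a b X t w)"
  proof (rule nn_integral_cong_AE)
   show "AE w in M. liminf (\<lambda>j. ?f j w) = ennreal (nsq (X t w - picard a b X t w))"
    using lim
   proof eventually_elim
    case (elim w)
    have "(\<lambda>j. Z (Suc (Suc j)) t w) \<longlonglongrightarrow> X t w" using LIMSEQ_Suc[of "\<lambda>j. Z (Suc j) t w"] elim t by simp
    then show ?case by (intro lim_imp_Liminf sequentially_bot tendsto_intros)
   qed
  qed
  ultimately have "msq M (\<lambda>w. X t w - picard a b X t w) = 0" by simp
  then have "AE w in M. ennreal (nsq (X t w - picard a b X t w)) = 0"
   using mX mP by (subst (asm) nn_integral_0_iff_AE) auto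
  then show ?thesis by (auto elim: eventually_mono)
 qed
 then have "AE w in M. \<forall>t\<ge>0. True --> X t w = picard a b X t w"
  by (intro AE_all_times) (auto intro: path_processD(2)[OF X] path_processD(2)[OF path_process_picard[OF X a b]])
 then show ?thesis using X by auto
qed

end

text \<open>Time 0 is exempt because the truncated coefficients vanish there, so they agree with the
  original ones at positive times only; one point does not affect the integral.\<close>

lemma set_integral_cong_open:
 fixes u v :: "real => 'b::euclidean_space"
 assumes v: "set_integrable lborel {0..t} v" and eq: "\<And>s. 0 < s ==> s <= t ==> u s = v s" and t: "0 <= t"
 shows "set_integrable lborel {0..t} u" "(LINT s:{0..t}|lborel. u s) = (LINT s:{0..t}|lborel. v s)"
proof -
 have "has_bochner_integral lborel (\<lambda>s. indicator {0..t} s *\<^sub>R v s + indicator {0} s *\<^sub>R (u 0 - v 0))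
   ((LINT s:{0..t}|lborel. v s) + measure lborel {0::real} *\<^sub>R (u 0 - v 0))"
  using v unfolding set_integrable_def set_lebesgue_integral_def
  by (intro has_bochner_integral_add has_bochner_integral_integrable has_bochner_integral_indicator) auto
 also have "(\<lambda>s. indicator {0..t} s *\<^sub>R v s + indicator {0} s *\<^sub>R (u 0 - v 0)) = (\<lambda>s. indicator {0..t} s *\<^sub>R u s)"
  using eq t by (force simp: indicator_def fun_eq_iff)
 finally have "has_bochner_integral lborel (\<lambda>s. indicator {0..t} s *\<^sub>R u s) (LINT s:{0..t}|lborel. v s)" by simp
 then show "set_integrable lborel {0..t} u" "(LINT s:{0..t}|lborel. u s) = (LINT s:{0..t}|lborel. v s)"
  unfolding set_integrable_def set_lebesgue_integral_def[of lborel _ u] by (auto dest: has_bochner_integral_integral_eq simp: has_bochner_integral_iff)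
qed

text \<open>For a continuous \<open>Z\<close> this is the indicator of the time before its exit above \<open>R\<close>; no exit times are needed.\<close>

definition below :: "(real => 'a => real) => real => real => 'a => real" where
 "below Z R s w = of_bool (\<forall>u\<in>{0..s}. Z u w <= R)"

lemma below_eq_1: "below Z R s w = 1 \<longleftrightarrow> (\<forall>u\<in>{0..s}. Z u w <= R)" by (simp add: below_def)

lemma below_antimono: "s <= u ==> below Z R u w <= below Z R s w"
 by (auto simp: below_def)

text \<open>By continuity the condition on all of \<open>[0, s]\<close> reduces to the times
  \<open>s * q\<close> with rational \<open>q\<close> in \<open>[0, 1]\<close>. Fractions keep the
  countable index set independent of \<open>s\<close>, and each rescaled process is progressive
  because \<open>s * q <= s\<close>.\<close>

lemma (in brownian_basis) progressive_below:
 assumes Z: "\<And>w. w \<in> space M ==> continuous_on {0..} (\<lambda>t. Z t w)" "\<And>t. 0 <= t ==> Z t \<in> borel_measurable (F t)"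
 shows "progressive (below Z R)"
proof -
 have eq: "below Z R s w = of_bool (\<forall>q\<in>\<rat> \<inter> {0..1}. Z (s * q) w <= R)" if s: "0 <= s" and w: "w \<in> space M" for s w
 proof -
  have "Z u w <= R" if q: "\<forall>q\<in>\<rat> \<inter> {0..1}. Z (s * q) w <= R" and u: "0 <= u" "u <= s" for u
  proof -
   define v where "v = (if s = 0 then 0 else u / s)"
   have v: "0 <= v" "v <= 1" "s * v = u" using s u by (auto simp: v_def divide_le_eq)
   obtain r where r: "\<And>n. 0 <= r n" "\<And>n. r n <= v" "\<And>n. r n \<in> \<rat>" and lim: "r \<longlonglongrightarrow> v"
    by (rule rational_below[OF v(1)]) blast
   have "(\<lambda>n. Z (s * r n) w) \<longlonglongrightarrow> Z (s * v) w"
    using s r v by (intro continuous_on_tendsto_compose[OF Z(1)[OF w]] tendsto_mult_left lim) auto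
   moreover have "Z (s * r n) w <= R" for n using q r[of n] v(2) by (meson IntI atLeastAtMost_iff order_trans)
   ultimately show ?thesis unfolding v by (intro LIMSEQ_le_const2) auto
  qed
  moreover have "s * q \<in> {0..s}" if "q \<in> {0..1}" for q using that s mult_left_mono[of q 1 s] by auto
  ultimately show ?thesis unfolding below_def of_bool_eq_iff by fastforce
 qed
 show ?thesis unfolding progressively_measurable_def
 proof (intro allI impI)
  fix T :: real assume T: "0 <= T"
  let ?R = "restrict_space borel {0..T} \<Otimes>\<^sub>M F T"
  have sp: "p \<in> space ?R ==> 0 <= fst p \<and> fst p <= T \<and> snd p \<in> space M" for p
   by (auto simp: space_pair_measure space_restrict_space space_F)
  have m: "(\<lambda>p. Z (fst p * q) (snd p)) \<in> borel_measurable ?R" if q: "q \<in> {0..1}" for q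
  proof -
   have "progressive (\<lambda>s. Z (s * q))"
   proof (rule progressive_continuous)
    show "continuous_on {0..} (\<lambda>s. Z (s * q) w)" if "w \<in> space M" for w
     using q by (intro continuous_on_compose2[OF Z(1)[OF that]] continuous_intros) auto
    show "Z (s * q) \<in> borel_measurable (F s)" if "0 <= s" for s
    proof -
     have "0 <= s * q" "s * q <= s" using q that mult_left_mono[of q 1 s] by auto
     then show ?thesis using Z(2) by (auto intro: measurable_F_mono)
    qed
   qed
   then show ?thesis using T by (simp add: progressively_measurable_def case_prod_beta')
  qed
  have S: "{p \<in> space ?R. \<forall>q\<in>\<rat> \<inter> {0..1}. Z (fst p * q) (snd p) <= R} \<in> sets ?R"
  proof -
   have "Measurable.pred ?R (\<lambda>p. \<forall>q\<in>\<rat> \<inter> {0..1}. Z (fst p * q) (snd p) <= R)"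
   proof (rule measurable_pred_countable(1))
    fix q :: real assume "q \<in> \<rat> \<inter> {0..1}"
    then have [measurable]: "(\<lambda>p. Z (fst p * q) (snd p)) \<in> borel_measurable ?R" using m by auto
    show "Measurable.pred ?R (\<lambda>p. Z (fst p * q) (snd p) <= R)" by measurable
   qed (simp add: countable_rat countable_Int1)
   then show ?thesis by (simp add: pred_def)
  qed
  have "(\<lambda>p. indicator {p \<in> space ?R. \<forall>q\<in>\<rat> \<inter> {0..1}. Z (fst p * q) (snd p) <= R} p :: real) \<in> borel_measurable ?R"
   using S by measurable
  then show "(\<lambda>(t, w). below Z R t w) \<in> borel_measurable ?R"
   using sp by (subst measurable_cong) (auto simp: case_prod_beta' eq indicator_def)
 qed
qed

section \<open>Comparison of solutions up to the exit from a ball\<close>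

context delay_problem
begin

lemma decreasing_weight_below:
 assumes "\<And>w. w \<in> space M ==> continuous_on {0..} (\<lambda>t. Z t w)" "\<And>t. 0 <= t ==> Z t \<in> borel_measurable (F t)"
 shows "decreasing_weight (below Z R)"
 using progressive_below[OF assms, where R = R] below_antimono[of _ _ Z R]
 by (auto simp: decreasing_weight_def below_def)

text \<open>Until \<open>X\<close> leaves the ball of radius \<open>R\<close>, its coefficients are
  those of the regular equation. The indicator \<open>h\<close> of this phase may be put into the
  integrands by locality and decreases in time, so the weighted mean-square difference satisfies a
  linear Volterra inequality and vanishes. Since \<open>I\<close> is any Ito integral in the sense
  of the definition, the comparison applies both to truncated solutions and to a solution about
  which nothing else is known.\<close>

lemma stopped_comparison:
 assumes a: "regular_coefficient a" and b: "regular_coefficient b"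
  and Y: "path_process Y" "AE w in M. \<forall>t\<ge>0. Y t w = picard a b Y t w"
  and X: "path_process X" and I: "has_ito_integral M F B G I"
  and eqX: "AE w in M. \<forall>t\<in>{0..T}. X t w = \<xi> w 0 + (LINT s:{0..t}|lborel. \<alpha> s w) + I t w"
  and agree: "AE w in M. \<forall>s. 0 < s \<and> s <= T \<and> (\<forall>u\<in>{0..s}. norm (X u w) <= R) -->
   \<alpha> s w = along a X s w \<and> G s w = along b X s w"
  and T: "0 <= T"
 shows "AE w in M. \<forall>t\<in>{0..T}. (\<forall>u\<in>{0..t}. norm (X u w) <= R) --> X t w = Y t w"
proof -
 obtain K c where K: "0 < K" "0 < c" "\<And>x y s. K < s ==> a x y s = 0" "\<And>x y s. K < s ==> b x y s = 0"
  and con: "\<And>X Y h t. path_process X ==> path_process Y ==> decreasing_weight h ==> 0 <= t ==>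
   ennreal K * sq_norm t (\<lambda>s w. h s w *\<^sub>R (along a X s w - along a Y s w))
    + sq_norm t (\<lambda>s w. h s w *\<^sub>R (along b X s w - along b Y s w))
   <= ennreal c * sq_norm t (\<lambda>s w. h s w *\<^sub>R (X s w - Y s w))"
  using regular_pairE[OF a b] by blast
 define h where "h = below (\<lambda>t w. norm (X t w)) R"
 have h: "decreasing_weight h" unfolding h_def
  using path_processD(1,2)[OF X] by (intro decreasing_weight_below continuous_on_norm measurable_compose[OF _ borel_measurable_norm])
 note hb = decreasing_weight_prog_bdd[OF h]
 have h1: "h t w = 1 \<longleftrightarrow> (\<forall>u\<in>{0..t}. norm (X u w) <= R)" for t w unfolding h_def by (rule below_eq_1)
 have h0: "h t w \<noteq> 1 ==> h t w = 0" for t w by (simp add: h_def below_def)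
 have h_le: "h t w = 1 ==> s <= t ==> h s w = 1" for s t w unfolding h1 by auto
 define da where "da s w = along a X s w - along a Y s w" for s w
 define db where "db s w = along b X s w - along b Y s w" for s w
 have d: "prog_bdd da" "prog_bdd db" unfolding da_def[abs_def] db_def[abs_def] by (intro prog_bdd_diff prog_bdd_along X Y a b)+
 let ?a = "\<lambda>s w. h s w *\<^sub>R da s w" and ?b = "\<lambda>s w. h s w *\<^sub>R db s w"
 have hd: "prog_bdd ?a" "prog_bdd ?b" by (intro prog_bdd_scaleR hb d)+
 note A = prog_bdd_along[OF X a] and B = prog_bdd_along[OF X b]
 have diff: "AE w in M. h t w = 1 --> X t w - Y t w = tint ?a t w + ito ?b t w"
  if t: "0 <= t" "t <= T" for t
 proof -
  define E where "E = {w \<in> space M. h t w = 1}"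
  have [measurable]: "h t \<in> borel_measurable M"
   using measurable_F_M[OF progressive_adapted[OF prog_bddD[OF hb] t(1)] t(1)] .
  have E: "E \<in> events" unfolding E_def by measurable
  \<comment> \<open>On the event that \<open>X\<close> has stayed in the ball up to
    \<open>t\<close>, the given integrand agrees with the bounded one at all positive times up to
    \<open>t\<close>, which is the situation of the locality statement.\<close>
  have "AE w in M. w \<in> E --> I t w = ito (along b X) t w"
   using agree by (intro has_ito_integral_cong_on[OF I B t(1) E], eventually_elim) (use t h_le h1 in \<open>auto simp: E_def\<close>)
  moreover have "AE w in M. w \<in> E --> ito db t w = ito ?b t w"
   by (intro ito_cong_on d hd t E AE_I2) (auto simp: E_def dest: h_le)
  moreover note eqX agree Y(2) picard_diff[OF X Y(1) a b] AE_space
  ultimately show ?thesis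
  proof eventually_elim
   case (elim w)
   show ?case
   proof
    assume "h t w = 1"
    then have hs: "h s w = 1" if "s <= t" for s using that by (rule h_le)
    then have w: "w \<in> E" using elim(7) by (simp add: E_def)
    have ag: "\<alpha> s w = along a X s w" if "0 < s" "s <= t" for s
     using elim(4) hs that t by (auto simp: h1)
    have "(LINT s:{0..t}|lborel. \<alpha> s w) = tint (along a X) t w"
     unfolding tint_def
     by (rule set_integral_cong_open(2)[OF tint_set_integrable[OF A order_refl elim(7)] ag t(1)])
    then have "X t w = picard a b X t w" using elim(1,3) w t by (simp add: picard_def)
    then have "X t w - Y t w = tint da t w + ito db t w"
     using elim(5,6) t by (simp add: da_def[abs_def] db_def[abs_def])
    moreover have "tint da t w = tint ?a t w"
     by (rule tint_cong[OF d(1) hd(1) t(1) elim(7)]) (simp add: hs)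
    ultimately show "X t w - Y t w = tint ?a t w + ito ?b t w"
     using elim(2) w by simp
   qed
  qed
 qed
 let ?D = "\<lambda>s w. h s w *\<^sub>R (X s w - Y s w)"
 have pD: "progressive ?D"
  by (intro progressive_scaleR progressive_diff path_process_progressive X Y prog_bddD hb)
 define e where "e t = msq M (\<lambda>w. ?D t w)" for t
 let ?r = "\<lambda>t. ennreal K * sq_norm t ?a + sq_norm t ?b"
 have e_le: "e t <= 2 * ?r t" if t: "0 <= t" "t <= T" for t
 proof -
  have "e t <= msq M (\<lambda>w. tint ?a t w + ito ?b t w)"
   unfolding e_def
  proof (rule nn_integral_mono_AE)
   show "AE w in M. ennreal (nsq (?D t w))
     <= ennreal (nsq (tint ?a t w + ito ?b t w))"
    using diff[OF t]
   proof eventually_elim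
    case (elim w)
    then show ?case using h0[of t w] by (cases "h t w = 1") auto
   qed
  qed
  also have "\<dots> <= 2 * ?r t"
   by (intro nn_integral_drift_diffusion hd K(1) t) (simp add: da_def along_def K(3))
  finally show ?thesis .
 qed
 have step: "e t <= ennreal (2 * c) * (\<integral>\<^sup>+s\<in>{0..t}. e s \<partial>lborel)" if t: "0 <= t" "t <= T" for t
 proof -
  have "?r t <= ennreal c * (\<integral>\<^sup>+s\<in>{0..t}. e s \<partial>lborel)"
   using con[OF X Y(1) h t(1)] unfolding sq_norm_times[OF pD t(1)] e_def da_def db_def .
  from order_trans[OF e_le[OF t] mult_left_mono[OF this]] show ?thesis
   using K(2) by (simp add: ennreal_mult mult.assoc)
 qed
 obtain C where C: "0 <= C" "\<And>t. 0 <= t ==> t <= T ==> e t <= ennreal C"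
 proof -
  have S: "2 * ?r T < \<infinity>" using sq_norm_finite[OF hd(1) T] sq_norm_finite[OF hd(2) T] K(1) by (auto simp: ennreal_mult_less_top)
  have "e t <= 2 * ?r T" if "0 <= t" "t <= T" for t
   by (rule order_trans[OF e_le[OF that]]) (intro mult_left_mono add_mono sq_norm_mono that, auto)
  then show thesis using S by (intro that[of "enn2real (2 * ?r T)"]) (auto simp del: ennreal_enn2real_if)
 qed
 have zero: "AE w in M. h t w = 1 --> X t w = Y t w" if t: "0 <= t" "t <= T" for t
 proof -
  \<comment> \<open>The constant sequence with value \<open>e\<close> satisfies the recursion, so
    \<open>e t\<close> is below a multiple of 8^-j for every \<open>j\<close>.\<close>
  have "e t <= ennreal (C * (1 / 8) ^ j * exp (8 * (2 * c) * t))" for j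
   by (rule volterra_iterate[of "2 * c" C T "\<lambda>_. e", OF _ C step t]) (use K(2) in auto)
  moreover have "(\<lambda>j. ennreal (C * (1 / 8) ^ j * exp (8 * (2 * c) * t))) \<longlonglongrightarrow> ennreal (C * 0 * exp (8 * (2 * c) * t))"
   by (intro tendsto_intros) auto
  ultimately have "e t <= 0" by (intro LIMSEQ_le_const[of "\<lambda>j. ennreal (C * (1 / 8) ^ j * exp (8 * (2 * c) * t))"]) auto
  then have "msq M (\<lambda>w. ?D t w) = 0" by (simp add: e_def)
  moreover have [measurable]: "?D t \<in> borel_measurable M" by (rule measurable_F_M[OF progressive_adapted[OF pD t(1)] t(1)])
  have "(\<lambda>w. ennreal (nsq (?D t w))) \<in> borel_measurable M" by measurable
  ultimately have "AE w in M. ennreal (nsq (?D t w)) = 0" using nn_integral_0_iff_AE by blast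
  then show ?thesis by (auto elim!: eventually_mono)
 qed
 have "AE w in M. \<forall>t\<ge>0. t <= T \<and> h t w = 1 --> X t w = Y t w"
 proof (rule AE_all_times)
  show "AE w in M. t <= T \<and> h t w = 1 --> X t w = Y t w" if "0 <= t" for t
   using zero[OF that] by (cases "t <= T") auto
 qed (use path_processD(2)[OF X] path_processD(2)[OF Y(1)] h_le in auto)
 then show ?thesis
 proof eventually_elim
  case (elim w)
  show ?case
  proof (intro ballI impI)
   fix t assume "t \<in> {0..T}" "\<forall>u\<in>{0..t}. norm (X u w) <= R"
   then show "X t w = Y t w" using elim[rule_format, of t] by (simp add: h1)
  qed
 qed
qed

end

section \<open>The stopped energy estimate\<close>

text \<open>\<open>c\<close> compares the weight at time \<open>s\<close> with the weight at the
  delayed time, and \<open>rate\<close> says that after the substitution the delayed energy and the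
  growth of the weight cost no more than the dissipation gains. Only up to \<open>s1\<close> can the
  delayed time lie before 0. \<open>A <= R\<^sup>2\<close> keeps the path, until its exit, in the
  ball where the dissipation inequality is available.\<close>

locale stopped_estimate = delay_problem M F B \<delta> \<tau> \<kappa> C0 \<xi>
 for M :: "'a measure" and F and B :: "real => 'a => real ^ 'd" and \<delta> \<tau> \<kappa> C0 and \<xi> :: "'a => real => real ^ 'n" +
 fixes a :: "real ^ 'n => real ^ 'n => real => real ^ 'n" and b :: "real ^ 'n => real ^ 'n => real => real ^ 'd ^ 'n"
  and X :: "real => 'a => real ^ 'n" and T R A K l0 l1 l2 \<gamma> c s1 :: real
 assumes a: "regular_coefficient a" and b: "regular_coefficient b"
  and X: "path_process X" "AE w in M. \<forall>t\<ge>0. X t w = picard a b X t w"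
  and T: "0 <= T" and C0: "0 <= C0" "C0 <= R" and A: "0 <= A" "A <= R\<^sup>2"
  and dissipative: "\<And>u x y. 0 < u ==> u <= T ==> norm x <= R ==> norm y <= R ==>
   2 * (x \<bullet> a x y u) + nsq (b x y u) <= (K * (1 + u) powr - l0 - l1 * nsq x + l2 * nsq y) / (1 + u)"
  and K: "0 <= K" and l2: "0 <= l2" and \<gamma>: "0 <= \<gamma>" "\<gamma> < l0" and c: "0 <= c"
  and delayed_weight: "\<And>s. 0 <= s ==> 0 <= s - \<delta> s ==> (1 + s) powr (\<gamma> - 1) <= c * (1 + (s - \<delta> s)) powr (\<gamma> - 1)"
  and rate: "\<gamma> - l1 + l2 * c * \<kappa> <= 0"
  and gap: "\<And>s. 0 <= s ==> s - \<delta> s < 0 ==> s <= s1" and s1: "0 <= s1"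
begin

text \<open>The coefficients and the growth of the weight are switched off at the exit time, which replaces
 optional stopping: up to the exit \<open>Y = X\<close> and \<open>wt t = (1 + t)\<^sup>\<gamma>\<close>, afterwards both are constant.\<close>

definition Z :: "real => 'a => real" where "Z t w = (1 + t) powr \<gamma> * nsq (X t w)"
definition "h = below Z A"
definition \<alpha> :: "real => 'a => real ^ 'n" where "\<alpha> u w = h u w *\<^sub>R along a X u w"
definition \<beta> :: "real => 'a => real ^ 'd ^ 'n" where "\<beta> u w = h u w *\<^sub>R along b X u w"
definition v :: "real => 'a => real" where "v u w = h u w *\<^sub>R (\<gamma> * (1 + u) powr (\<gamma> - 1))"
definition Y :: "real => 'a => real ^ 'n" where "Y t w = \<xi> w 0 + tint \<alpha> t w + ito \<beta> t w"
definition wt :: "real => 'a => real" where "wt t w = 1 + tint v t w"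
text \<open>The initial energy, the integral of the source term over all times, which converges
  because \<open>\<gamma> < l0\<close>, and the contribution of delayed values taken from the
  initial segment up to time \<open>s1\<close>.\<close>

definition "energy_bound = C0\<^sup>2 + K / (l0 - \<gamma>) + l2 * ((1 + s1) powr \<gamma> * C0\<^sup>2 * s1)"

lemma Z_continuous: "w \<in> space M ==> continuous_on {0..} (\<lambda>t. Z t w)"
 unfolding Z_def by (intro continuous_intros path_processD(2)[OF X(1)]) auto

lemma Z_measurable: "0 <= t ==> Z t \<in> borel_measurable (F t)"
 using path_processD(1)[OF X(1), of t] unfolding Z_def by measurable

lemma h_weight: "decreasing_weight h"
 unfolding h_def by (rule decreasing_weight_below[OF Z_continuous Z_measurable])

lemma h_prog_bdd: "prog_bdd h" by (rule decreasing_weight_prog_bdd[OF h_weight])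

lemma h_1: "h t w = 1 \<longleftrightarrow> (\<forall>u\<in>{0..t}. Z u w <= A)" unfolding h_def by (rule below_eq_1)

lemma h_cases: obtains "h t w = 1" | "h t w = 0" by (auto simp: h_def below_def)

lemma h_le: "h t w = 1 ==> s <= t ==> h s w = 1" unfolding h_1 by auto

lemma h_ge: "h s w = 0 ==> s <= t ==> h t w = 0" using h_le[of t w s] h_cases[of t w] by force

lemma powr_weight_bound:
 assumes "0 <= u" "u <= t"
 shows "(1 + u) powr (\<gamma> - 1) <= (1 + t) powr \<gamma>"
proof -
 have "(1 + u) powr (\<gamma> - 1) <= (1 + u) powr \<gamma>" using assms by (intro powr_mono) auto
 also have "\<dots> <= (1 + t) powr \<gamma>" using assms \<gamma> by (intro powr_mono2) auto
 finally show ?thesis .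
qed

lemma v_weight_prog_bdd: "prog_bdd (\<lambda>u w. \<gamma> * (1 + u) powr (\<gamma> - 1))"
proof (rule prog_bddI)
 show "progressive (\<lambda>u w. \<gamma> * (1 + u) powr (\<gamma> - 1))" by (rule progressive_time) measurable
 show "\<exists>C. \<forall>t w. 0 <= t --> t <= S --> w \<in> space M --> norm (\<gamma> * (1 + t) powr (\<gamma> - 1)) <= C" if "0 <= S" for S
  using \<gamma> powr_weight_bound by (intro exI[of _ "\<gamma> * (1 + S) powr \<gamma>"]) (auto simp: abs_mult intro: mult_left_mono)
qed

lemma prog_bdd_stopped: "prog_bdd \<alpha>" "prog_bdd \<beta>" "prog_bdd v"
 unfolding \<alpha>_def[abs_def] \<beta>_def[abs_def] v_def[abs_def]
 by (intro prog_bdd_scaleR h_prog_bdd prog_bdd_along X a b v_weight_prog_bdd)+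

lemma w_nonneg:
 assumes "0 <= t" "w \<in> space M" shows "0 <= 1 + tint v t w"
proof -
 have "0 <= tint v t w" unfolding tint_def set_lebesgue_integral_def
  using \<gamma> by (intro Bochner_Integration.integral_nonneg) (auto simp: indicator_def v_def h_def below_def)
 then show ?thesis by simp
qed

lemma w_eq:
 assumes "h t w = 1" "0 <= t" "w \<in> space M"
 shows "wt t w = (1 + t) powr \<gamma>"
proof -
 have "tint v t w = tint (\<lambda>u w. \<gamma> * (1 + u) powr (\<gamma> - 1)) t w"
  by (rule tint_cong[OF prog_bdd_stopped(3) v_weight_prog_bdd assms(2,3)]) (simp add: v_def h_le[OF assms(1)])
 also have "\<dots> = (1 + t) powr \<gamma> - (1 + 0) powr \<gamma>"
  unfolding tint_def set_lebesgue_integral_def using assms(2)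
  by (intro integral_FTC_atLeastAtMost)
   (auto intro!: derivative_eq_intros continuous_intros simp: has_real_derivative_iff_has_vector_derivative[symmetric])
 finally show ?thesis by (simp add: wt_def)
qed

lemma Y_eq: "AE w in M. \<forall>t\<ge>0. h t w = 1 --> Y t w = X t w"
proof (rule AE_all_times)
 show "continuous_on {0..} (\<lambda>t. Y t w)" if "w \<in> space M" for w
  unfolding Y_def by (intro continuous_intros tint_continuous ito_continuous prog_bdd_stopped that)
 show "AE w in M. h t w = 1 --> Y t w = X t w" if t: "0 <= t" for t
 proof -
  have [measurable]: "h t \<in> borel_measurable M"
   using measurable_F_M[OF progressive_adapted[OF prog_bddD[OF h_prog_bdd] t] t] .
  have "AE w in M. w \<in> {w \<in> space M. h t w = 1} --> ito \<beta> t w = ito (along b X) t w"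
   by (intro ito_cong_on prog_bdd_stopped prog_bdd_along X b t AE_I2) (auto simp: \<beta>_def dest: h_le)
  then show ?thesis using X(2) AE_space
  proof eventually_elim
   case (elim w)
   have "tint \<alpha> t w = tint (along a X) t w" if "h t w = 1"
    by (rule tint_cong[OF prog_bdd_stopped(1) prog_bdd_along[OF X(1) a] t elim(3)]) (simp add: \<alpha>_def h_le[OF that])
   then show ?case using elim t by (auto simp: Y_def picard_def)
  qed
 qed
qed (auto intro: path_processD(2)[OF X(1)] h_le)

text \<open>For \<open>0 <= \<gamma>\<close> the weight is at least 1, so a level of at most
  \<open>A <= R\<^sup>2\<close> confines the path; before time 0 the bound \<open>C0 <= R\<close> on
  the initial segment applies.\<close>

lemma norm_le_radius:
 assumes "h t w = 1" "s <= t" "- \<tau> <= s" "w \<in> space M"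
 shows "norm (with_history X s w) <= R"
proof (cases "s <= 0")
 case True
 then show ?thesis using initial_bounded[OF assms(3) True assms(4)] C0 by (simp add: with_history_def)
next
 case False
 have "nsq (X s w) <= Z s w"
  using ge_one_powr_ge_zero[of "1 + s" \<gamma>] \<gamma> False mult_right_mono[of 1 "(1 + s) powr \<gamma>" "nsq (X s w)"] by (simp add: Z_def)
 also have "\<dots> <= R\<^sup>2" using assms(1,2) False A by (auto simp: h_1 intro: order_trans)
 finally show ?thesis using False C0 by (auto simp: with_history_def intro: power2_le_imp_le)
qed

text \<open>The exponent is \<open>\<gamma> - 1\<close> because the dissipation condition divides by
  \<open>1 + u\<close>. \<psi> is the energy density to be absorbed; \<open>V\<close> collects what
  stays on the right-hand side, the source and the delayed energy.\<close>

definition \<psi> :: "real => 'a => real" where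
 "\<psi> u w = h u w * ((1 + u) powr (\<gamma> - 1) * nsq (X u w))"
definition V :: "real => 'a => real" where
 "V u w = h u w * ((1 + u) powr (\<gamma> - 1) * (K * (1 + u) powr - l0 + l2 * nsq (with_history X (u - \<delta> u) w)))"

text \<open>Before the exit \<open>Y\<close> is \<open>X\<close> and the weight is
  \<open>(1 + u) powr \<gamma>\<close>, whose derivative contributes \<gamma> times \<psi>. After
  the exit every term is zero.\<close>

lemma dissipation:
 assumes u: "0 < u" "u <= T" and w: "w \<in> space M" and eq: "h u w = 1 --> Y u w = X u w"
 shows "v u w * nsq (Y u w) + wt u w * (2 * (Y u w \<bullet> \<alpha> u w) + nsq (\<beta> u w)) + (l1 - \<gamma>) * \<psi> u w <= V u w"
proof (cases rule: h_cases[of u w])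
 case 1
 let ?x = "X u w" and ?y = "with_history X (u - \<delta> u) w" and ?p = "(1 + u) powr (\<gamma> - 1)"
 have "0 <= u" using u by simp
 have x: "with_history X u w = ?x" using u by (simp add: with_history_def)
 have "2 * (?x \<bullet> a ?x ?y u) + nsq (b ?x ?y u)
   <= (K * (1 + u) powr - l0 - l1 * nsq ?x + l2 * nsq ?y) / (1 + u)"
  using norm_le_radius[OF 1 order_refl _ w] norm_le_radius[OF 1 _ delay_ge[OF \<open>0 <= u\<close>] w] u \<tau>_nonneg delay_nonneg[OF \<open>0 <= u\<close>]
  by (intro dissipative) (auto simp: x)
 then have "(1 + u) powr \<gamma> * (2 * (?x \<bullet> a ?x ?y u) + nsq (b ?x ?y u))
   <= (1 + u) powr \<gamma> * ((K * (1 + u) powr - l0 - l1 * nsq ?x + l2 * nsq ?y) / (1 + u))"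
  by (intro mult_left_mono) auto
 also have "\<dots> = ?p * (K * (1 + u) powr - l0 - l1 * nsq ?x + l2 * nsq ?y)"
  using u by (simp add: powr_diff)
 finally show ?thesis
  using 1 eq w_eq[OF 1 \<open>0 <= u\<close> w] by (simp add: v_def \<alpha>_def \<beta>_def \<psi>_def V_def along_def x algebra_simps)
qed (simp add: v_def \<alpha>_def \<beta>_def \<psi>_def V_def)

lemma progressive_\<psi>_V: "progressive \<psi>" "progressive V"
proof -
 have *: "progressive (\<lambda>u w. h u w *\<^sub>R (g u *\<^sub>R (k u + l *\<^sub>R nsq (P u w))))"
  if "progressive P" "g \<in> borel_measurable borel" "k \<in> borel_measurable borel"
  for g k :: "real => real" and P :: "real => 'a => real ^ 'n" and l
  by (intro progressive_scaleR progressive_add prog_bddD[OF h_prog_bdd] progressive_time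
    progressive_compose[OF that(1), of "\<lambda>x. nsq x"] that(2,3)) auto
 have m: "(\<lambda>u. (1 + u) powr (\<gamma> - 1)) \<in> borel_measurable borel" "(\<lambda>u. K * (1 + u) powr - l0) \<in> borel_measurable borel" by measurable
 show "progressive \<psi>"
  using *[OF path_process_progressive[OF X(1)] m(1) borel_measurable_const, of 0 1] by (simp add: \<psi>_def[abs_def])
 show "progressive V"
  using *[OF progressive_delayed[OF X(1)] m, of l2] by (simp add: V_def[abs_def])
qed

text \<open>The primitive has the negative exponent \<open>\<gamma> - l0\<close>, so the boundary
  term at \<open>T\<close> has a favourable sign and the bound is the same for every
  \<open>T\<close>.\<close>

lemma nn_integral_weight_le:
 "(\<integral>\<^sup>+u\<in>{0..T}. ennreal ((1 + u) powr (\<gamma> - 1) * (K * (1 + u) powr - l0)) \<partial>lborel) <= ennreal (K / (l0 - \<gamma>))"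
proof -
 have "(\<integral>\<^sup>+u\<in>{0..T}. ennreal (K * (1 + u) powr (\<gamma> - l0 - 1)) \<partial>lborel)
   = ennreal (K * (1 + T) powr (\<gamma> - l0) / (\<gamma> - l0) - K * (1 + 0) powr (\<gamma> - l0) / (\<gamma> - l0))"
  using T K \<gamma> by (intro nn_integral_FTC_Icc) (auto intro!: derivative_eq_intros)
 also have "\<dots> <= ennreal (K / (l0 - \<gamma>))"
 proof (rule ennreal_leI)
  have "K * (1 + T) powr (\<gamma> - l0) / (\<gamma> - l0) <= 0" using K \<gamma> by (intro divide_nonneg_nonpos) auto
  moreover have "K / (\<gamma> - l0) = - (K / (l0 - \<gamma>))" by (metis minus_diff_eq minus_divide_right)
  ultimately show "K * (1 + T) powr (\<gamma> - l0) / (\<gamma> - l0) - K * (1 + 0) powr (\<gamma> - l0) / (\<gamma> - l0) <= K / (l0 - \<gamma>)" by simp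
 qed
 finally show ?thesis
  by (rule order_trans[rotated], intro nn_integral_mono)
   (auto simp: indicator_def powr_add[symmetric] algebra_simps)
qed

text \<open>Where the delayed time is nonnegative, \<open>delayed_weight\<close> and the
  monotonicity of \<open>h\<close> bound the delayed energy by \<open>c\<close> times \<psi> at the
  delayed time, and the substitution costs the factor \<kappa>. Where it is negative, the time is at
  most \<open>s1\<close> and the delayed value at most \<open>C0\<close>.\<close>

lemma nn_integral_V_le:
 "(\<integral>\<^sup>+p. ennreal (cutoff T V p) \<partial>time_space)
  <= ennreal (energy_bound - C0\<^sup>2) + ennreal (l2 * c * \<kappa>) * (\<integral>\<^sup>+p. ennreal (cutoff T \<psi> p) \<partial>time_space)"
proof -
 let ?v = "\<lambda>u. \<integral>\<^sup>+w. ennreal (cutoff T V (u, w)) \<partial>M"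
 have [measurable]: "cutoff T V \<in> borel_measurable time_space" "cutoff T \<psi> \<in> borel_measurable time_space"
  by (intro cutoff_M progressive_\<psi>_V T)+
 define \<phi> where "\<phi> u = (\<integral>\<^sup>+w. ennreal (cutoff T \<psi> (u, w)) \<partial>M)" for u
 have "(\<lambda>u. \<integral>\<^sup>+w. ennreal (cutoff T \<psi> (u, w)) \<partial>M) \<in> borel_measurable lborel" by measurable
 then have m\<phi> [measurable]: "\<phi> \<in> borel_measurable borel" by (simp add: \<phi>_def[abs_def])
 let ?S = "{s. 0 <= s \<and> s <= T \<and> 0 <= s - \<delta> s}"
 let ?c = "(1 + s1) powr \<gamma> * C0\<^sup>2"
 let ?k = "\<lambda>u. (1 + u) powr (\<gamma> - 1) * (K * (1 + u) powr - l0)"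
 have step: "?v u
   <= ennreal (?k u) * indicator {0..T} u + ennreal (l2 * ?c) * indicator {0..s1} u + ennreal (l2 * c) * (\<phi> (u - \<delta> u) * indicator ?S u)" for u
 proof (cases "0 <= u \<and> u <= T")
  case True
  then have u: "0 <= u" "u <= T" by auto
  have V_split: "V u w <= ?k u + l2 * (h u w * ((1 + u) powr (\<gamma> - 1) * nsq (with_history X (u - \<delta> u) w)))" for w
   using K by (cases rule: h_cases[of u w]) (auto simp: V_def algebra_simps)
  show ?thesis
  proof (cases "0 <= u - \<delta> u")
   case d: True
   have dT: "u - \<delta> u <= T" using delay_nonneg[OF u(1)] u by simp
   have le: "V u w <= ?k u + l2 * c * \<psi> (u - \<delta> u) w" if w: "w \<in> space M" for w
   proof -
    let ?n = "nsq (X (u - \<delta> u) w)"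
    have "h u w <= h (u - \<delta> u) w" unfolding h_def using delay_nonneg[OF u(1)] by (intro below_antimono) simp
    then have "h u w * ((1 + u) powr (\<gamma> - 1) * ?n) <= h (u - \<delta> u) w * (c * (1 + (u - \<delta> u)) powr (\<gamma> - 1) * ?n)"
     by (intro mult_mono mult_right_mono delayed_weight[OF u(1) d]) (auto simp: h_def below_def)
    then have "l2 * (h u w * ((1 + u) powr (\<gamma> - 1) * ?n)) <= l2 * (h (u - \<delta> u) w * (c * (1 + (u - \<delta> u)) powr (\<gamma> - 1) * ?n))"
     using l2 by (rule mult_left_mono)
    also have "\<dots> = l2 * c * \<psi> (u - \<delta> u) w" by (simp add: \<psi>_def)
    finally show ?thesis using V_split[of w] with_history_nonneg[OF X(1) d w] by simp
   qed
   have "?v u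
     <= (\<integral>\<^sup>+w. ennreal (?k u) + ennreal (l2 * c) * ennreal (cutoff T \<psi> (u - \<delta> u, w)) \<partial>M)"
    using u d dT l2 c K le by (intro nn_integral_mono) (auto simp: cutoff_def \<psi>_def h_def below_def
     ennreal_plus[symmetric] ennreal_mult[symmetric] intro!: ennreal_leI simp del: ennreal_plus)
   also have "\<dots> = ennreal (?k u) + ennreal (l2 * c) * \<phi> (u - \<delta> u)"
    unfolding \<phi>_def by (subst nn_integral_add) (auto simp: nn_integral_cmult emeasure_space_1)
   also have "\<dots> <= ennreal (?k u) * indicator {0..T} u + ennreal (l2 * ?c) * indicator {0..s1} u + ennreal (l2 * c) * (\<phi> (u - \<delta> u) * indicator ?S u)"
    using u d by (auto intro!: add_mono)
   finally show ?thesis .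
  next
   case d: False
   have us: "u <= s1" using gap[OF u(1)] d by simp
   have le: "V u w <= ?k u + l2 * ?c" if w: "w \<in> space M" for w
   proof -
    have "norm (with_history X (u - \<delta> u) w) <= C0"
     using d initial_bounded[OF delay_ge[OF u(1)] _ w] by (simp add: with_history_def)
    then have "(1 + u) powr (\<gamma> - 1) * nsq (with_history X (u - \<delta> u) w) <= ?c"
     by (intro mult_mono powr_weight_bound u us power_mono) auto
    then have "h u w * ((1 + u) powr (\<gamma> - 1) * nsq (with_history X (u - \<delta> u) w)) <= ?c"
     by (cases rule: h_cases[of u w]) auto
    from mult_left_mono[OF this l2] show ?thesis using V_split[of w] by simp
   qed
   have "?v u <= (\<integral>\<^sup>+w. ennreal (?k u) + ennreal (l2 * ?c) \<partial>M)"
    using u l2 K le by (intro nn_integral_mono) (auto simp: cutoff_def ennreal_plus[symmetric] intro!: ennreal_leI simp del: ennreal_plus)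
   then show ?thesis using u us d by (simp add: emeasure_space_1)
  qed
 qed (simp add: cutoff_def)
 have "(\<integral>\<^sup>+p. ennreal (cutoff T V p) \<partial>time_space) = (\<integral>\<^sup>+u. ?v u \<partial>lborel)"
  by (rule nn_integral_fst[symmetric]) measurable
 also have "\<dots> <= (\<integral>\<^sup>+u. ennreal (?k u) * indicator {0..T} u + ennreal (l2 * ?c) * indicator {0..s1} u
   + ennreal (l2 * c) * (\<phi> (u - \<delta> u) * indicator ?S u) \<partial>lborel)"
  by (intro nn_integral_mono step)
 also have "\<dots> = (\<integral>\<^sup>+u. ennreal (?k u) * indicator {0..T} u \<partial>lborel) + ennreal (l2 * ?c) * ennreal s1
   + ennreal (l2 * c) * (\<integral>\<^sup>+u. \<phi> (u - \<delta> u) * indicator ?S u \<partial>lborel)"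
  using delayed_measurable[OF delay_continuous m\<phi>, of T] s1 by (simp add: nn_integral_add nn_integral_cmult nn_integral_cmult_indicator)
 also have "\<dots> <= ennreal (K / (l0 - \<gamma>)) + ennreal (l2 * ?c) * ennreal s1
   + ennreal (l2 * c) * (ennreal \<kappa> * (\<integral>\<^sup>+u\<in>{0..T}. \<phi> u \<partial>lborel))"
  by (intro add_mono mult_left_mono nn_integral_weight_le delay_substitution m\<phi> T) auto
 also have "(\<integral>\<^sup>+u\<in>{0..T}. \<phi> u \<partial>lborel) = (\<integral>\<^sup>+u. \<phi> u \<partial>lborel)"
  by (intro nn_integral_cong) (auto simp: \<phi>_def cutoff_def indicator_def)
 also have "\<dots> = (\<integral>\<^sup>+p. ennreal (cutoff T \<psi> p) \<partial>time_space)"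
  unfolding \<phi>_def by (rule nn_integral_fst) measurable
 also have "ennreal (K / (l0 - \<gamma>)) + ennreal (l2 * ?c) * ennreal s1 = ennreal (energy_bound - C0\<^sup>2)"
  using K \<gamma> l2 s1 by (simp add: energy_bound_def ennreal_mult[symmetric] ennreal_plus[symmetric] mult_ac del: ennreal_plus)
 finally show ?thesis using l2 c \<kappa>_nonneg by (simp add: ennreal_mult mult.assoc)
qed

lemma energy_le:
 "integrable M (\<lambda>w. wt T w * nsq (Y T w))" "expectation (\<lambda>w. wt T w * nsq (Y T w)) <= energy_bound"
proof -
 define H where "H u w = v u w * nsq (Y u w) + wt u w * (2 * (Y u w \<bullet> \<alpha> u w) + nsq (\<beta> u w))" for u w
 have x0: "norm (\<xi> w 0) <= C0" if "w \<in> space M" for w using initial_bounded[of 0, OF _ _ that] \<tau>_nonneg by simp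
 note E = energy_identity[OF prog_bdd_stopped T initial_value_measurable[OF order_refl] x0 w_nonneg, simplified,
   folded Y_def wt_def, folded H_def]
 have H: "integrable time_space (cutoff T H)"
  and eq: "expectation (\<lambda>w. wt T w * nsq (Y T w)) = expectation (\<lambda>w. nsq (\<xi> w 0)) + (LINT p|time_space. cutoff T H p)"
  using E unfolding H_def[abs_def] by auto
 show "integrable M (\<lambda>w. wt T w * nsq (Y T w))" using E by auto
 have [measurable]: "cutoff T V \<in> borel_measurable time_space" "cutoff T \<psi> \<in> borel_measurable time_space"
  by (intro cutoff_M progressive_\<psi>_V T)+
 have nonneg: "0 <= cutoff T V p" "0 <= cutoff T \<psi> p" for p
  using K l2 by (auto simp: cutoff_def V_def \<psi>_def h_def below_def indicator_def)
 \<comment> \<open>\<open>J\<close> must be finite before it can be cancelled. Up to the exit the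
   level is at most \<open>A\<close>, hence so is \<psi>, and afterwards \<psi> is zero.\<close>
 have "(\<integral>\<^sup>+p. ennreal (cutoff T \<psi> p) \<partial>time_space) = (\<integral>\<^sup>+u. (\<integral>\<^sup>+w. ennreal (cutoff T \<psi> (u, w)) \<partial>M) \<partial>lborel)"
  by (rule nn_integral_fst[symmetric]) measurable
 also have "\<dots> <= (\<integral>\<^sup>+u. (\<integral>\<^sup>+w. ennreal A * indicator {0..T} u \<partial>M) \<partial>lborel)"
 proof (intro nn_integral_mono)
  fix u w
  have "\<psi> u w <= A" if u: "0 <= u"
  proof (cases rule: h_cases[of u w])
   case 1
   have "(1 + u) powr (\<gamma> - 1) * nsq (X u w) <= Z u w"
    unfolding Z_def using u by (intro mult_right_mono powr_weight_bound) auto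
   also have "\<dots> <= A" using 1 u by (simp add: h_1)
   finally show ?thesis by (simp add: \<psi>_def 1)
  qed (simp add: \<psi>_def A)
  then show "ennreal (cutoff T \<psi> (u, w)) <= ennreal A * indicator {0..T} u"
   by (auto simp: cutoff_def indicator_def intro: ennreal_leI)
 qed
 also have "\<dots> < \<infinity>" using T by (simp add: emeasure_space_1 nn_integral_cmult_indicator ennreal_mult_less_top)
 finally have fin\<psi>: "(\<integral>\<^sup>+p. ennreal (cutoff T \<psi> p) \<partial>time_space) < \<infinity>" .
 then have i\<psi>: "integrable time_space (cutoff T \<psi>)" by (intro integrableI_nonneg) (auto simp: nonneg)
 define J where "J = (LINT p|time_space. cutoff T \<psi> p)"
 have J: "(\<integral>\<^sup>+p. ennreal (cutoff T \<psi> p) \<partial>time_space) = ennreal J" "0 <= J"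
  unfolding J_def by (rule nn_integral_eq_integral[OF i\<psi> AE_I2[OF nonneg(2)]]) (rule Bochner_Integration.integral_nonneg[OF nonneg(2)])
 have B: "0 <= energy_bound - C0\<^sup>2" using K \<gamma> l2 s1 by (simp add: energy_bound_def)
 have "(\<integral>\<^sup>+p. ennreal (cutoff T V p) \<partial>time_space) <= ennreal (energy_bound - C0\<^sup>2 + l2 * c * \<kappa> * J)"
  using nn_integral_V_le B J(2) l2 c \<kappa>_nonneg by (simp add: J ennreal_plus ennreal_mult)
 then have iV: "integrable time_space (cutoff T V)" and LV: "(LINT p|time_space. cutoff T V p) <= energy_bound - C0\<^sup>2 + l2 * c * \<kappa> * J"
 proof -
  assume le: "(\<integral>\<^sup>+p. ennreal (cutoff T V p) \<partial>time_space) <= ennreal (energy_bound - C0\<^sup>2 + l2 * c * \<kappa> * J)"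
  then have "(\<integral>\<^sup>+p. ennreal (cutoff T V p) \<partial>time_space) < \<infinity>" by (rule order_le_less_trans) simp
  then show i: "integrable time_space (cutoff T V)" by (intro integrableI_nonneg) (auto simp: nonneg)
  show "(LINT p|time_space. cutoff T V p) <= energy_bound - C0\<^sup>2 + l2 * c * \<kappa> * J"
   using le[unfolded nn_integral_eq_integral[OF i AE_I2[OF nonneg(1)]]] B J(2) l2 c \<kappa>_nonneg
   by (subst (asm) ennreal_le_iff) auto
 qed
 obtain N where N: "N \<in> null_sets M" "\<And>w. w \<in> space M ==> w \<notin> N ==> \<forall>t\<ge>0. h t w = 1 --> Y t w = X t w"
  using AE_null_set[OF Y_eq] by blast
 note AE_time_space[OF N(1)]
 then have "(LINT p|time_space. cutoff T H p + (l1 - \<gamma>) * cutoff T \<psi> p) <= (LINT p|time_space. cutoff T V p)"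
 proof (intro integral_mono_AE Bochner_Integration.integrable_add integrable_mult_right H i\<psi> iV)
  assume "AE p in time_space. fst p \<noteq> 0 \<and> snd p \<notin> N"
  then show "AE p in time_space. cutoff T H p + (l1 - \<gamma>) * cutoff T \<psi> p <= cutoff T V p"
   using AE_space
  proof eventually_elim
   case (elim p)
   obtain u w where p: "p = (u, w)" by (cases p)
   have "w \<in> space M" using elim(2) by (simp add: p space_pair_measure)
   then show ?case using dissipation[of u w] N(2)[of w] elim(1) by (auto simp: p cutoff_def indicator_def H_def)
  qed
 qed
 then have "(LINT p|time_space. cutoff T H p) + (l1 - \<gamma>) * J <= energy_bound - C0\<^sup>2 + l2 * c * \<kappa> * J"
  using LV H i\<psi> by (simp add: J_def)
 moreover have "(\<gamma> - l1 + l2 * c * \<kappa>) * J <= 0" using rate J(2) by (rule mult_nonpos_nonneg)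
 ultimately have "(LINT p|time_space. cutoff T H p) <= energy_bound - C0\<^sup>2" by (simp add: algebra_simps)
 moreover have "expectation (\<lambda>w. nsq (\<xi> w 0)) <= expectation (\<lambda>w. C0\<^sup>2)"
  using x0 measurable_F_M[OF initial_value_measurable[OF order_refl]]
  by (intro integral_mono integrable_const_bound[where B = "C0\<^sup>2"]) (auto intro!: AE_I2 power_mono)
 ultimately show "expectation (\<lambda>w. wt T w * nsq (Y T w)) <= energy_bound" unfolding eq by (simp add: prob_space)
qed

text \<open>Each time brings its own null set, so only countably many times are treated; the
  continuity of weight and process extends the conclusion where it is used.\<close>

lemma stopped_constant:
 "AE w in M. \<forall>q\<in>\<rat> \<inter> {0..T}. h q w = 0 --> wt q w = wt T w \<and> Y q w = Y T w"
proof (rule AE_ball_countable[THEN iffD2])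
 show "\<forall>q\<in>\<rat> \<inter> {0..T}. AE w in M. h q w = 0 --> wt q w = wt T w \<and> Y q w = Y T w"
 proof
  fix q assume "q \<in> \<rat> \<inter> {0..T}"
  then have q: "0 <= q" "q <= T" by auto
  have [measurable]: "h q \<in> borel_measurable M"
   using measurable_F_M[OF progressive_adapted[OF prog_bddD[OF h_prog_bdd] q(1)] q(1)] .
  have vanish: "\<alpha> u w = 0" "\<beta> u w = 0" "v u w = 0" if "h q w = 0" "q <= u" for u w
   using h_ge[OF that] by (simp_all add: \<alpha>_def \<beta>_def v_def)
  have "AE w in M. w \<in> {w \<in> space M. h q w = 0} --> ito \<beta> T w = ito \<beta> q w"
   by (intro ito_const_on prog_bdd_stopped q) (use vanish(2) in auto)
  then show "AE w in M. h q w = 0 --> wt q w = wt T w \<and> Y q w = Y T w" using AE_space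
  proof eventually_elim
   case (elim w)
   show ?case
   proof
    assume q0: "h q w = 0"
    have "norm (tint \<alpha> T w - tint \<alpha> q w) <= 0 * (T - q)"
     by (rule tint_lipschitz[OF prog_bdd_stopped(1) q order_refl elim(2)]) (simp add: vanish(1)[OF q0])
    moreover have "norm (tint v T w - tint v q w) <= 0 * (T - q)"
     by (rule tint_lipschitz[OF prog_bdd_stopped(3) q order_refl elim(2)]) (simp add: vanish(3)[OF q0])
    ultimately show "wt q w = wt T w \<and> Y q w = Y T w" using elim q0 by (simp add: wt_def Y_def)
   qed
  qed
 qed
qed (simp add: countable_rat countable_Int1)

text \<open>Let \<open>u\<close> be the infimum of the times at which the level exceeds
  \<open>A\<close>. The level at \<open>u\<close> is at least \<open>A\<close> because the set where
  this holds is closed. The energy of \<open>Y\<close> equals the level before \<open>u\<close>,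
  hence also at \<open>u\<close>, and it has its final value at rational times after
  \<open>u\<close>, hence again at \<open>u\<close>. Continuity does the work of optional
  stopping.\<close>

lemma exit_energy: "AE w in M. h T w = 0 --> A <= wt T w * nsq (Y T w)"
 using stopped_constant Y_eq AE_space
proof eventually_elim
 case (elim w)
 show ?case
 proof
  assume hT: "h T w = 0"
  define g where "g s = wt s w * nsq (Y s w)" for s
  have gc: "continuous_on {0..} g"
   unfolding g_def wt_def Y_def by (intro continuous_intros tint_continuous ito_continuous prog_bdd_stopped elim(3))
  define D where "D = {r \<in> {0..T}. A < Z r w}"
  have "\<exists>r\<in>{0..T}. A < Z r w" using h_1[of T w] hT by (auto simp: not_le)
  then have D: "D \<noteq> {}" "bdd_below D" by (auto simp: D_def intro: bdd_belowI[of _ 0])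
  define u where "u = Inf D"
  have u: "0 <= u" "u <= T" unfolding u_def using D by (auto intro: cInf_greatest cInf_lower2 simp: D_def)
  have before: "h s w = 1" if "0 <= s" "s < u" for s
   unfolding h_1
  proof
   fix r assume r: "r \<in> {0..s}"
   then have "r \<notin> D" using that cInf_lower[OF _ D(2), of r] by (auto simp: u_def)
   then show "Z r w <= A" using r that u by (auto simp: D_def)
  qed
  have after: "h s w = 0" if s: "u < s" for s
  proof -
   obtain r where "r \<in> D" "r < s" using cInf_lessD[OF D(1), of s] s by (auto simp: u_def)
   then have "h s w \<noteq> 1" unfolding h_1 by (force simp: D_def)
   then show ?thesis using h_cases[of s w] by blast
  qed
  have "D \<subseteq> {r \<in> {0..T}. A <= Z r w}" by (auto simp: D_def)
  moreover have "closed {r \<in> {0..T}. A <= Z r w}"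
   using continuous_on_subset[OF Z_continuous[OF elim(3)], of "{0..T}"] by (intro continuous_on_closed_Collect_le) auto
  ultimately have "closure D \<subseteq> {r \<in> {0..T}. A <= Z r w}" by (rule closure_minimal)
  then have Zu: "A <= Z u w" using closure_contains_Inf[OF D] by (auto simp: u_def)
  have "g u = Z u w"
  proof (cases "u = 0")
   case True
   then show ?thesis using path_processD(3)[OF X(1) elim(3)] elim(3)
    by (simp add: g_def wt_def Y_def Z_def ito_0[OF prog_bdd_stopped(2)])
  next
   case False
   define s where "s n = u - u / real (Suc n)" for n
   have s: "0 <= s n" "s n < u" for n using u False by (auto simp: s_def field_simps)
   have lim: "s \<longlonglongrightarrow> u"
   proof -
    have "(\<lambda>n. u - u / real (Suc n)) \<longlonglongrightarrow> u - 0" by (intro tendsto_diff tendsto_const LIMSEQ_Suc lim_const_over_n)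
    then show ?thesis by (simp add: s_def[abs_def])
   qed
   have "g (s n) = Z (s n) w" for n
    using before[OF s] elim(2) s w_eq[OF before[OF s] s(1) elim(3)] by (simp add: g_def Z_def)
   moreover have "(\<lambda>n. g (s n)) \<longlonglongrightarrow> g u" "(\<lambda>n. Z (s n) w) \<longlonglongrightarrow> Z u w"
    using u s by (auto intro!: continuous_on_tendsto_compose[OF gc lim] continuous_on_tendsto_compose[OF Z_continuous[OF elim(3)] lim])
   ultimately show ?thesis using LIMSEQ_unique by simp
  qed
  moreover have "g u = g T"
  proof (cases "u = T")
   case False
   then have uT: "u < T" using u by simp
   have "\<forall>n. \<exists>q. q \<in> \<rat> \<and> u < q \<and> q < min T (u + 1 / real (Suc n))"
    using uT by (intro allI Rats_dense_in_real[unfolded Bex_def]) auto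
   then obtain q where q: "\<And>n. q n \<in> \<rat>" "\<And>n. u < q n" "\<And>n. q n < min T (u + 1 / real (Suc n))"
    using choice[of "\<lambda>n q. q \<in> \<rat> \<and> u < q \<and> q < min T (u + 1 / real (Suc n))"] by blast
   have lim: "q \<longlonglongrightarrow> u"
   proof (rule tendsto_sandwich[of "\<lambda>_. u" _ _ "\<lambda>n. u + 1 / real (Suc n)"])
    have "(\<lambda>n. u + 1 / real (Suc n)) \<longlonglongrightarrow> u + 0"
     by (intro tendsto_add tendsto_const LIMSEQ_Suc lim_1_over_n)
    then show "(\<lambda>n. u + 1 / real (Suc n)) \<longlonglongrightarrow> u" by simp
   qed (use q in \<open>auto intro!: always_eventually less_imp_le\<close>)
   have "g (q n) = g T" for n
    using elim(1)[rule_format, of "q n"] after[OF q(2)[of n]] q(1-3)[of n] u by (simp add: g_def)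
   moreover have "(\<lambda>n. g (q n)) \<longlonglongrightarrow> g u"
    using u order_le_less_trans[OF u(1) q(2)] by (intro continuous_on_tendsto_compose[OF gc lim]) (auto intro!: always_eventually less_imp_le)
   ultimately show ?thesis using LIMSEQ_unique[of "\<lambda>_. g T"] by auto
  qed simp
  ultimately show "A <= wt T w * nsq (Y T w)" using Zu by (simp add: g_def)
 qed
qed

lemma stopped_moment: "(\<integral>\<^sup>+w. ennreal (h T w * Z T w) \<partial>M) <= ennreal energy_bound"
 and exit_probability: "A * prob {w \<in> space M. h T w \<noteq> 1} <= energy_bound"
proof -
 let ?E = "{w \<in> space M. h T w \<noteq> 1}"
 have nn: "0 <= wt T w * nsq (Y T w)" if "w \<in> space M" for w
  using w_nonneg[OF T that] by (simp add: wt_def)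
 have E: "(\<integral>\<^sup>+w. ennreal (wt T w * nsq (Y T w)) \<partial>M) <= ennreal energy_bound"
  using nn_integral_eq_integral[OF energy_le(1) AE_I2[OF nn]] energy_le(2) by (simp add: ennreal_leI)
 have "(\<integral>\<^sup>+w. ennreal (h T w * Z T w) \<partial>M) <= (\<integral>\<^sup>+w. ennreal (wt T w * nsq (Y T w)) \<partial>M)"
 proof (rule nn_integral_mono_AE)
  show "AE w in M. ennreal (h T w * Z T w) <= ennreal (wt T w * nsq (Y T w))"
   using Y_eq AE_space
  proof eventually_elim
   case (elim w)
   show ?case
   proof (cases rule: h_cases[of T w])
    case 1
    then show ?thesis using elim T w_eq[OF 1 T elim(2)] by (simp add: Z_def)
   qed simp
  qed
 qed
 then show "(\<integral>\<^sup>+w. ennreal (h T w * Z T w) \<partial>M) <= ennreal energy_bound" using E by (rule order_trans)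
 have m: "?E \<in> events"
 proof -
  have [measurable]: "h T \<in> borel_measurable M"
   using measurable_F_M[OF progressive_adapted[OF prog_bddD[OF h_prog_bdd] T] T] .
  show ?thesis by measurable
 qed
 have "ennreal A * emeasure M ?E = (\<integral>\<^sup>+w. ennreal A * indicator ?E w \<partial>M)"
  using m by (simp add: nn_integral_cmult_indicator)
 also have "\<dots> <= (\<integral>\<^sup>+w. ennreal (wt T w * nsq (Y T w)) \<partial>M)"
 proof (rule nn_integral_mono_AE)
  show "AE w in M. ennreal A * indicator ?E w <= ennreal (wt T w * nsq (Y T w))"
   using exit_energy
  proof eventually_elim
   case (elim w)
   then show ?case using h_cases[of T w] by (auto simp: indicator_def intro: ennreal_leI)
  qed
 qed
 also note E
 finally have "ennreal (A * prob ?E) <= ennreal energy_bound"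
  using A(1) by (simp add: emeasure_eq_measure ennreal_mult)
 moreover have "0 <= energy_bound" using K \<gamma> l2 s1 by (simp add: energy_bound_def)
 ultimately show "A * prob ?E <= energy_bound" by simp
qed

end

section \<open>Recognizing an integral by localization\<close>

context brownian_basis
begin

lemma null_in_probability_cong_off:
 assumes X': "null_in_probability M X'" and X: "\<And>k. X k \<in> borel_measurable M" and E: "\<And>k. E k \<in> events" "(\<lambda>k. prob (E k)) \<longlonglongrightarrow> 0"
  and eq: "\<And>k. AE w in M. w \<notin> E k --> X k w = X' k w"
 shows "null_in_probability M X"
 unfolding null_in_probability_def
proof (intro conjI allI impI X)
 fix e :: real assume e: "0 < e"
 note [measurable] = X E(1)
 have [measurable]: "X' k \<in> borel_measurable M" for k using X' by (simp add: null_in_probability_def)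
 have le: "prob {w \<in> space M. ennreal e < X k w} <= prob (E k) + prob {w \<in> space M. ennreal e < X' k w}" for k
 proof -
  have "prob {w \<in> space M. ennreal e < X k w} <= prob (E k \<union> {w \<in> space M. ennreal e < X' k w})"
   using eq[of k] by (intro finite_measure_mono_AE) (auto elim!: eventually_mono)
  also have "\<dots> <= prob (E k) + prob {w \<in> space M. ennreal e < X' k w}" by (intro measure_Un_le) measurable
  finally show ?thesis .
 qed
 have "(\<lambda>k. prob {w \<in> space M. ennreal e < X' k w}) \<longlonglongrightarrow> 0" using X' e by (simp add: null_in_probability_def)
 then have lim: "(\<lambda>k. prob (E k) + prob {w \<in> space M. ennreal e < X' k w}) \<longlonglongrightarrow> 0"
  using tendsto_add[OF E(2)] by fastforce
 show "(\<lambda>k. prob {w \<in> space M. ennreal e < X k w}) \<longlonglongrightarrow> 0"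
  by (rule tendsto_sandwich[OF _ _ tendsto_const lim]) (simp_all add: le)
qed

lemma AE_exists_outside:
 assumes E: "\<And>j. E j \<in> events" "(\<lambda>j. prob (E j)) \<longlonglongrightarrow> 0"
 shows "AE w in M. \<exists>j\<ge>J. w \<notin> E j"
proof (rule AE_I[of _ _ "\<Inter>j\<in>{J..}. E j"])
 have "prob (\<Inter>j\<in>{J..}. E j) <= 0"
  using E by (intro LIMSEQ_le_const[OF E(2)] exI[of _ J]) (auto intro!: finite_measure_mono)
 then show "emeasure M (\<Inter>j\<in>{J..}. E j) = 0" by (simp add: emeasure_eq_measure measure_le_0_iff)
qed (use E in auto)

text \<open>A diagonal choice: outside \<open>E (J k)\<close> the integrand and \<open>I\<close>
  agree with a bounded integrand and its integral up to \<open>t\<close>, and the averages for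
  \<open>H (J k)\<close> are taken at a level \<open>n k\<close> where both mean-square errors are
  below 1/(k+1). The exceptional probabilities tend to 0, which is enough for limits in
  probability.\<close>

lemma has_ito_integral_localized:
 fixes G :: "real => 'a => real ^ 'd ^ 'n"
 assumes G: "progressive G" and I: "\<And>t. 0 <= t ==> I t \<in> borel_measurable (F t)"
  and H: "\<And>j. prog_bdd (H j)" and E: "\<And>j. E j \<in> events" "(\<lambda>j. prob (E j)) \<longlonglongrightarrow> 0"
  and eq: "\<And>j. AE w in M. w \<notin> E j --> (\<forall>t. 0 <= t \<and> t <= real j --> (0 < t --> G t w = H j t w) \<and> I t w = ito (H j) t w)"
 shows "has_ito_integral M F B G I"
proof -
 have eqs: "AE w in M. \<forall>j. w \<notin> E j --> (\<forall>t. 0 <= t \<and> t <= real j --> (0 < t --> G t w = H j t w) \<and> I t w = ito (H j) t w)"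
  using eq by (simp add: AE_all_countable)
 have not_0: "AE u in lborel. u \<noteq> (0::real)" by (rule AE_lborel_singleton)
 have outside: "AE w in M. \<forall>J. \<exists>j\<ge>J. w \<notin> E j" using AE_exists_outside[OF E] by (simp add: AE_all_countable)
 have finite: "AE w in M. (psq T (\<lambda>u. G u w)) < \<infinity>" if T: "0 <= T" for T
  using eqs outside AE_space
 proof eventually_elim
  case (elim w)
  obtain j where j: "nat \<lceil>T\<rceil> <= j" "w \<notin> E j" using elim(2) by blast
  then have "T <= real j" by linarith
  then have "psq T (\<lambda>u. G u w) = psq T (\<lambda>u. H j u w)"
   using not_0 elim(1) j(2) by (intro nn_integral_cong_AE) (auto elim!: eventually_mono simp: indicator_def)
  also have "\<dots> < \<infinity>" using tint_nonneg_nn[OF prog_bdd_norm2[OF H] elim(3), of j T] by simp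
  finally show ?case .
 qed
 have cont: "AE w in M. continuous_on {0..} (\<lambda>t. I t w)"
  using eqs outside AE_space
 proof eventually_elim
  case (elim w)
  show ?case
  proof (rule continuous_on_atLeastI)
   fix T :: real assume T: "0 <= T"
   obtain j where j: "nat \<lceil>T\<rceil> <= j" "w \<notin> E j" using elim(2) by blast
   then have "T <= real j" by linarith
   moreover have "continuous_on {0..T} (\<lambda>t. ito (H j) t w)" by (rule continuous_on_subset[OF ito_continuous[OF H elim(3)]]) auto
   ultimately show "continuous_on {0..T} (\<lambda>t. I t w)" using elim(1) j(2) by (elim continuous_on_eq) auto
  qed
 qed
 have approx: "\<exists>m s A. (\<forall>k. elementary_process M F (m k) (s k) (A k)) \<and>
    null_in_probability M (\<lambda>k w. psq t (\<lambda>u. elementary_value (m k) (s k) (A k) u w - G u w)) \<and>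
    null_in_probability M (\<lambda>k w. ennreal (norm (elementary_integral B (m k) (s k) (A k) t w - I t w)))"
  if t: "0 <= t" for t
 proof -
  \<comment> \<open>The shift makes the horizon \<open>real (J k)\<close> contain \<open>t\<close>
    for every \<open>k\<close>.\<close>
  define J where "J k = k + nat \<lceil>t\<rceil>" for k
  have tJ: "t <= real (J k)" for k unfolding J_def by linarith
  have EJ: "(\<lambda>k. prob (E (J k))) \<longlonglongrightarrow> 0" unfolding J_def by (rule LIMSEQ_ignore_initial_segment[OF E(2)])
  let ?S = "\<lambda>k n. sq_norm t (\<lambda>u w. avg_process n (H (J k)) u w - H (J k) u w)"
  let ?V = "\<lambda>k n. \<integral>\<^sup>+w. ennreal (nsq (avg_integral n (H (J k)) t w - ito (H (J k)) t w)) \<partial>M"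
  have "\<exists>n. \<forall>k. ?S k (n k) < ennreal (1 / real (Suc k)) \<and> ?V k (n k) < ennreal (1 / real (Suc k))"
  proof (rule choice, rule allI)
   fix k
   have "\<forall>\<^sub>F n in sequentially. ?S k n < ennreal (1 / real (Suc k)) \<and> ?V k n < ennreal (1 / real (Suc k))"
    by (intro eventually_conj order_tendstoD(2)[OF avg_process_tendsto[OF H t]] order_tendstoD(2)[OF ito_tendsto[OF H t]]) simp_all
   then show "\<exists>n. ?S k n < ennreal (1 / real (Suc k)) \<and> ?V k n < ennreal (1 / real (Suc k))"
    by (rule eventually_happens'[OF sequentially_bot])
  qed
  then obtain n where n: "\<And>k. ?S k (n k) < ennreal (1 / real (Suc k))" "\<And>k. ?V k (n k) < ennreal (1 / real (Suc k))" by blast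
  have to_0: "(\<lambda>k. e k) \<longlonglongrightarrow> 0" if "\<And>k. e k < ennreal (1 / real (Suc k))" for e :: "nat => ennreal"
  proof (rule tendsto_sandwich[of "\<lambda>_. 0" _ _ "\<lambda>k. ennreal (1 / real (Suc k))"])
   have "(\<lambda>k. ennreal (1 / real (Suc k))) \<longlonglongrightarrow> ennreal 0" by (intro tendsto_ennrealI LIMSEQ_Suc lim_1_over_n)
   then show "(\<lambda>k. ennreal (1 / real (Suc k))) \<longlonglongrightarrow> 0" by simp
  qed (use that in \<open>auto intro!: always_eventually less_imp_le\<close>)
  have pA: "progressive (avg_process (n k) (H (J k)))" for k
   by (intro prog_bddD prog_bdd_avg_process H)
  have pH: "progressive (\<lambda>u w. avg_process (n k) (H (J k)) u w - H (J k) u w)" for k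
   by (intro progressive_diff pA prog_bddD H)
  have ev: "elementary_value (n k * 2 ^ n k) (dyad (n k)) (avg_blocks (n k) (H (J k))) = avg_process (n k) (H (J k))"
   "elementary_integral B (n k * 2 ^ n k) (dyad (n k)) (avg_blocks (n k) (H (J k))) = avg_integral (n k) (H (J k))" for k
   by (simp_all add: elementary_value_block elementary_integral_block avg_process_def avg_integral_def)
  have nA: "null_in_probability M (\<lambda>k w. psq t (\<lambda>u. avg_process (n k) (H (J k)) u w - G u w))"
  proof (rule null_in_probability_cong_off[OF _ _ E(1) EJ])
   show "null_in_probability M (\<lambda>k w. psq t (\<lambda>u. avg_process (n k) (H (J k)) u w - H (J k) u w))"
    using to_0[OF n(1)] by (intro null_in_probabilityI sq_norm_paths(2)[OF pH t]) (simp add: sq_norm_paths(1)[OF pH t])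
   show "AE w in M. w \<notin> E (J k) --> (psq t (\<lambda>u. avg_process (n k) (H (J k)) u w - G u w))
     = psq t (\<lambda>u. avg_process (n k) (H (J k)) u w - H (J k) u w)" for k
    using eq[of "J k"]
   proof eventually_elim
    case (elim w)
    then show ?case using not_0 tJ[of k]
     by (intro impI nn_integral_cong_AE) (auto elim!: eventually_mono simp: indicator_def)
   qed
  qed (intro sq_norm_paths(2) progressive_diff pA G t)
  have mI: "(\<lambda>w. norm (avg_integral (n k) (H (J k)) t w - Z w)) \<in> borel_measurable M" if "Z \<in> borel_measurable M" for k Z
   using avg_integral_measurable[OF H t, of "n k" "J k"] that by measurable
  have nI: "null_in_probability M (\<lambda>k w. ennreal (norm (avg_integral (n k) (H (J k)) t w - I t w)))"
  proof (rule null_in_probability_cong_off[OF _ _ E(1) EJ])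
   show "null_in_probability M (\<lambda>k w. ennreal (norm (avg_integral (n k) (H (J k)) t w - ito (H (J k)) t w)))"
   proof (rule null_in_probability_sqrt[OF null_in_probabilityI[OF _ to_0[OF n(2)]]])
    show m: "(\<lambda>w. norm (avg_integral (n k) (H (J k)) t w - ito (H (J k)) t w)) \<in> borel_measurable M" for k
     by (rule mI[OF ito_measurable_M[OF H t]])
    show "(\<lambda>w. ennreal (nsq (avg_integral (n k) (H (J k)) t w - ito (H (J k)) t w))) \<in> borel_measurable M" for k
     using m by measurable
   qed simp
   show "AE w in M. w \<notin> E (J k) --> ennreal (norm (avg_integral (n k) (H (J k)) t w - I t w))
     = ennreal (norm (avg_integral (n k) (H (J k)) t w - ito (H (J k)) t w))" for k
    using eq[of "J k"] by eventually_elim (use t tJ[of k] in auto)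
  qed (rule measurable_compose[OF mI[OF measurable_F_M[OF I[OF t] t]] measurable_ennreal])
  show ?thesis
   by (intro exI[of _ "\<lambda>k. n k * 2 ^ n k"] exI[of _ "\<lambda>k. dyad (n k)"] exI[of _ "\<lambda>k. avg_blocks (n k) (H (J k))"] conjI allI)
    (simp_all only: ev nA nI elementary_avg[OF H])
 qed
 show ?thesis unfolding has_ito_integral_def by (intro conjI allI impI G I finite cont approx)
qed

end

section \<open>Removing the truncation of the coefficients\<close>

text \<open>Projection of the arguments onto the ball is nonexpansive and so preserves the Lipschitz
  constant. The time window \<open>(0, k]\<close> is one on which the local Lipschitz condition is
  uniform.\<close>

definition truncated :: "nat => ('b::euclidean_space => 'b => real => 'c::euclidean_space) => 'b => 'b => real => 'c" where
 "truncated k c x y s = (if 0 < s \<and> s <= real k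
  then c (closest_point (cball 0 (real k)) x) (closest_point (cball 0 (real k)) y) s else 0)"

lemma truncated_eq: "0 < s ==> s <= real k ==> norm x <= real k ==> norm y <= real k ==> truncated k c x y s = c x y s"
 by (simp add: truncated_def closest_point_self)

lemma borel_measurable_nonneg_time:
 fixes c :: "'b::euclidean_space => 'b => real => 'c::euclidean_space"
 assumes c: "(\<lambda>(x, y, s). c x y s) \<in> borel_measurable (restrict_space borel (UNIV \<times> UNIV \<times> {0..}))"
 shows "(\<lambda>(x, y, s). if 0 <= s then c x y s else 0) \<in> borel_measurable borel"
proof -
 have "closed (UNIV \<times> UNIV \<times> {0..} :: ('b \<times> 'b \<times> real) set)" by (intro closed_Times) auto
 then have "(\<lambda>p. indicator (UNIV \<times> UNIV \<times> {0..}) p *\<^sub>R (case p of (x, y, s) => c x y s)) \<in> borel_measurable borel"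
  using c by (subst (asm) borel_measurable_restrict_space_iff) auto
 also have "(\<lambda>p. indicator (UNIV \<times> UNIV \<times> {0..}) p *\<^sub>R (case p of (x, y, s) => c x y s)) = (\<lambda>(x, y, s). if 0 <= s then c x y s else 0)"
  by (auto simp: indicator_def fun_eq_iff)
 finally show ?thesis .
qed

text \<open>Boundedness follows from the Lipschitz bound on the ball, because the coefficient
  vanishes at the origin.\<close>

lemma regular_truncated:
 fixes c :: "'b::euclidean_space => 'b => real => 'c::euclidean_space"
 assumes c: "(\<lambda>(x, y, s). c x y s) \<in> borel_measurable (restrict_space borel (UNIV \<times> UNIV \<times> {0..}))"
  and c0: "\<And>s. 0 <= s ==> c 0 0 s = 0"
  and lip: "\<And>t R. 0 < t ==> \<exists>L>0. \<forall>s\<in>{0<..t}. \<forall>x y x' y'. norm x <= R \<and> norm x' <= R \<and> norm y <= R \<and> norm y' <= R -->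
   norm (c x y s - c x' y' s) <= L * (norm (x - x') + norm (y - y'))"
 shows "regular_coefficient (truncated k c)"
proof -
 let ?P = "closest_point (cball (0 :: 'b) (real k))"
 have S: "closed (cball (0 :: 'b) (real k))" "convex (cball (0 :: 'b) (real k))" "cball (0 :: 'b) (real k) \<noteq> {}" by auto
 have P: "norm (?P x) <= real k" for x using closest_point_in_set[OF S(1,3), of x] by simp
 have PL: "norm (?P x - ?P x') <= norm (x - x')" for x x' using closest_point_lipschitz[OF S(2,1,3), of x x'] by (simp add: dist_norm)
 \<comment> \<open>The horizon is \<open>k + 1\<close> because the Lipschitz condition asks for a
   positive time and \<open>k\<close> may be 0.\<close>
 obtain L where L: "0 < L" "\<And>s x y x' y'. 0 < s ==> s <= real k + 1 ==> norm x <= real k ==> norm x' <= real k ==> norm y <= real k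
   ==> norm y' <= real k ==> norm (c x y s - c x' y' s) <= L * (norm (x - x') + norm (y - y'))"
  using lip[of "real k + 1" "real k"] by auto
 have lipP: "norm (truncated k c x y s - truncated k c x' y' s) <= L * (norm (x - x') + norm (y - y'))" for x y x' y' s
 proof (cases "0 < s \<and> s <= real k")
  case True
  then have "norm (truncated k c x y s - truncated k c x' y' s) <= L * (norm (?P x - ?P x') + norm (?P y - ?P y'))"
   unfolding truncated_def by (simp add: L(2) P)
  also have "\<dots> <= L * (norm (x - x') + norm (y - y'))" using L(1) by (intro mult_left_mono add_mono PL) auto
  finally show ?thesis .
 qed (use L(1) in \<open>simp add: truncated_def if_not_P\<close>)
 have bound: "norm (truncated k c x y s) <= L * (real k + real k)" for x y s
 proof (cases "0 < s \<and> s <= real k")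
  case True
  then have "norm (c (?P x) (?P y) s - c 0 0 s) <= L * (norm (?P x - 0) + norm (?P y - 0))" by (intro L(2) P) auto
  also have "\<dots> <= L * (real k + real k)" using L(1) P by (intro mult_left_mono add_mono) auto
  finally show ?thesis using True by (simp add: truncated_def c0)
 qed (use L(1) in \<open>simp add: truncated_def if_not_P\<close>)
 have "(\<lambda>p. (?P (fst p), ?P (fst (snd p)), snd (snd p))) \<in> borel_measurable (borel :: ('b \<times> 'b \<times> real) measure)"
  by (intro borel_measurable_continuous_onI continuous_on_Pair continuous_on_compose2[OF continuous_on_closest_point[OF S(2,1,3)]]
   continuous_on_fst continuous_on_snd continuous_on_id) auto
 from measurable_compose[OF this borel_measurable_nonneg_time[OF c]]
 have m1: "(\<lambda>p. if 0 <= snd (snd p) then c (?P (fst p)) (?P (fst (snd p))) (snd (snd p)) else 0) \<in> borel_measurable borel"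
  by (simp add: case_prod_beta' cong: if_cong)
 have "(\<lambda>p :: 'b \<times> 'b \<times> real. snd (snd p)) \<in> borel_measurable borel"
  by (intro borel_measurable_continuous_onI continuous_on_snd continuous_on_id)
 then have m2: "(\<lambda>p :: 'b \<times> 'b \<times> real. indicator {0<..real k} (snd (snd p)) :: real) \<in> borel_measurable borel"
  by (rule measurable_compose) simp
 have "(\<lambda>p. indicator {0<..real k} (snd (snd p)) *\<^sub>R (if 0 <= snd (snd p) then c (?P (fst p)) (?P (fst (snd p))) (snd (snd p)) else 0)) \<in> borel_measurable (borel :: ('b \<times> 'b \<times> real) measure)"
  by (intro borel_measurable_scaleR m1 m2)
 moreover have "(\<lambda>p. indicator {0<..real k} (snd (snd p)) *\<^sub>R (if 0 <= snd (snd p) then c (?P (fst p)) (?P (fst (snd p))) (snd (snd p)) else 0))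
   = (\<lambda>(x, y, s). truncated k c x y s)"
  by (auto simp: fun_eq_iff truncated_def indicator_def)
 ultimately have "(\<lambda>(x, y, s). truncated k c x y s) \<in> borel_measurable borel" by simp
 moreover have "\<forall>x y s. real k < s --> truncated k c x y s = 0" by (simp add: truncated_def)
 ultimately show ?thesis unfolding regular_coefficient_def using lipP bound by blast
qed

locale delay_equation = delay_problem M F B \<delta> \<tau> \<kappa> C0 \<xi>
 for M :: "'a measure" and F and B :: "real => 'a => real ^ 'd" and \<delta> \<tau> \<kappa> C0 and \<xi> :: "'a => real => real ^ 'n" +
 fixes f :: "real ^ 'n => real ^ 'n => real => real ^ 'n" and g :: "real ^ 'n => real ^ 'n => real => real ^ 'd ^ 'n"
  and K l0 l1 l2 s1 :: real
 assumes f_borel: "(\<lambda>(x, y, t). f x y t) \<in> borel_measurable (restrict_space borel (UNIV \<times> UNIV \<times> {0..}))"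
  and g_borel: "(\<lambda>(x, y, t). g x y t) \<in> borel_measurable (restrict_space borel (UNIV \<times> UNIV \<times> {0..}))"
  and f_0: "\<And>t. 0 <= t ==> f 0 0 t = 0" and g_0: "\<And>t. 0 <= t ==> g 0 0 t = 0"
  and lipschitz: "locally_Lipschitz_coefficients f g"
  and constants: "0 <= C0" "0 <= K" "0 < l0" "0 <= l2" "l2 * \<kappa> <= l1" "0 <= s1"
  and monotone: "\<And>t x y. 0 <= t ==> 2 * (x \<bullet> f x y t) + nsq (g x y t)
   <= (K * (1 + t) powr - l0 - l1 * nsq x + l2 * nsq y) / (1 + t)"
  and gap: "\<And>s. 0 <= s ==> s - \<delta> s < 0 ==> s <= s1"
begin

lemma regular_f: "regular_coefficient (truncated k f)"
proof (rule regular_truncated[OF f_borel f_0])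
 fix t R :: real assume "0 < t"
 then show "\<exists>L>0. \<forall>s\<in>{0<..t}. \<forall>x y x' y'. norm x <= R \<and> norm x' <= R \<and> norm y <= R \<and> norm y' <= R -->
   norm (f x y s - f x' y' s) <= L * (norm (x - x') + norm (y - y'))"
  using lipschitz unfolding locally_Lipschitz_coefficients_def max.bounded_iff by meson
qed

lemma regular_g: "regular_coefficient (truncated k g)"
proof (rule regular_truncated[OF g_borel g_0])
 fix t R :: real assume "0 < t"
 then show "\<exists>L>0. \<forall>s\<in>{0<..t}. \<forall>x y x' y'. norm x <= R \<and> norm x' <= R \<and> norm y <= R \<and> norm y' <= R -->
   norm (g x y s - g x' y' s) <= L * (norm (x - x') + norm (y - y'))"
  using lipschitz unfolding locally_Lipschitz_coefficients_def max.bounded_iff by meson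
qed

section \<open>Energy of the truncated solutions and their patching\<close>

definition sol :: "nat => real => 'a => real ^ 'n" where
 "sol k = (SOME X. path_process X \<and> (AE w in M. \<forall>t\<ge>0. X t w = picard (truncated k f) (truncated k g) X t w))"

lemma sol: "path_process (sol k)" "AE w in M. \<forall>t\<ge>0. sol k t w = picard (truncated k f) (truncated k g) (sol k) t w"
 using someI_ex[OF picard_fixpoint_exists[OF regular_f regular_g], of k k] by (auto simp: sol_def)

definition level :: "real => (real => 'a => real ^ 'n) => real => 'a => real" where
 "level \<gamma> X t w = (1 + t) powr \<gamma> * nsq (X t w)"

lemma level_continuous:
 assumes "path_process X" "w \<in> space M"
 shows "continuous_on {0..} (\<lambda>t. level \<gamma> X t w)"
 unfolding level_def by (intro continuous_intros path_processD(2)[OF assms]) auto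

lemma level_measurable:
 assumes "path_process X" "0 <= t"
 shows "level \<gamma> X t \<in> borel_measurable (F t)"
proof -
 have [measurable]: "X t \<in> borel_measurable (F t)" by (rule path_processD(1)[OF assms])
 show ?thesis unfolding level_def[abs_def] by measurable
qed

lemma below_level_event:
 assumes "path_process X" "0 <= t"
 shows "{w \<in> space M. below (level \<gamma> X) A t w \<noteq> 1} \<in> events"
proof -
 have [measurable]: "below (level \<gamma> X) A t \<in> borel_measurable M"
  by (rule measurable_F_M[OF progressive_adapted[OF progressive_below assms(2)] assms(2)])
   (auto intro: level_continuous level_measurable assms)
 show ?thesis by measurable
qed

text \<open>The constant \<open>c\<close> compares the weight \<open>(1 + s)\<^bsup>\<gamma> - 1\<^esup>\<close> with its value at the delayed time.\<close>

definition admissible :: "real => bool" where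
 "admissible \<gamma> \<longleftrightarrow> 0 <= \<gamma> \<and> \<gamma> < l0 \<and> (\<exists>c\<ge>0. \<gamma> - l1 + l2 * c * \<kappa> <= 0 \<and>
  (\<forall>s. 0 <= s \<and> 0 <= s - \<delta> s --> (1 + s) powr (\<gamma> - 1) <= c * (1 + (s - \<delta> s)) powr (\<gamma> - 1)))"

lemma admissible_0: "admissible 0"
proof -
 have "(1 + s) powr - 1 <= (1 + (s - \<delta> s)) powr - 1" if "0 <= s" "0 <= s - \<delta> s" for s
  using that delay_nonneg[OF that(1)] by (intro powr_mono2') auto
 then show ?thesis using constants by (auto simp: admissible_def intro!: exI[of _ 1])
qed

definition energy :: "real => real" where
 "energy \<gamma> = C0\<^sup>2 + K / (l0 - \<gamma>) + l2 * ((1 + s1) powr \<gamma> * C0\<^sup>2 * s1)"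

text \<open>\<open>A <= (real k)\<^sup>2\<close> and \<open>T <= real k\<close> keep the truncation
  inactive until the exit, so the dissipation condition of the original coefficients is available
  there. The resulting bound contains neither \<open>k\<close> nor \<open>T\<close> nor
  \<open>A\<close>.\<close>

lemma sol_estimate:
 assumes \<gamma>: "admissible \<gamma>" and k: "C0 <= real k" "0 <= T" "T <= real k" "0 <= A" "A <= (real k)\<^sup>2"
 shows "(\<integral>\<^sup>+w. ennreal (below (level \<gamma> (sol k)) A T w * level \<gamma> (sol k) T w) \<partial>M) <= ennreal (energy \<gamma>)"
  and "A * prob {w \<in> space M. below (level \<gamma> (sol k)) A T w \<noteq> 1} <= energy \<gamma>"
proof -
 obtain c where c: "0 <= c" "\<gamma> - l1 + l2 * c * \<kappa> <= 0"
  "\<And>s. 0 <= s ==> 0 <= s - \<delta> s ==> (1 + s) powr (\<gamma> - 1) <= c * (1 + (s - \<delta> s)) powr (\<gamma> - 1)"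
  using \<gamma> by (auto simp: admissible_def)
 interpret E: stopped_estimate M F B \<delta> \<tau> \<kappa> C0 \<xi> "truncated k f" "truncated k g" "sol k" T "real k" A K l0 l1 l2 \<gamma> c s1
 proof (unfold_locales, rule regular_f, rule regular_g, rule sol(1), rule sol(2), rule k(2), rule constants(1), rule k(1), rule k(4), rule k(5))
  show "2 * (x \<bullet> truncated k f x y u) + nsq (truncated k g x y u)
    <= (K * (1 + u) powr - l0 - l1 * nsq x + l2 * nsq y) / (1 + u)"
   if "0 < u" "u <= T" "norm x <= real k" "norm y <= real k" for u x y
   using that k(3) monotone[of u x y] by (simp add: truncated_eq)
  show "s <= s1" if "0 <= s" "s - \<delta> s < 0" for s using gap that .
  show "(1 + s) powr (\<gamma> - 1) <= c * (1 + (s - \<delta> s)) powr (\<gamma> - 1)" if "0 <= s" "0 <= s - \<delta> s" for s using c(3) that .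
  show "0 <= \<gamma>" "\<gamma> < l0" using \<gamma> by (auto simp: admissible_def)
 qed (rule constants c)+
 have "E.Z = level \<gamma> (sol k)" "E.energy_bound = energy \<gamma>"
  by (simp_all add: E.Z_def level_def fun_eq_iff E.energy_bound_def energy_def)
 then show "(\<integral>\<^sup>+w. ennreal (below (level \<gamma> (sol k)) A T w * level \<gamma> (sol k) T w) \<partial>M) <= ennreal (energy \<gamma>)"
  "A * prob {w \<in> space M. below (level \<gamma> (sol k)) A T w \<noteq> 1} <= energy \<gamma>"
  using E.stopped_moment E.exit_probability by (simp_all add: E.h_def)
qed

text \<open>At exponent 0 the weight is 1, so this is the event that the truncated solution leaves
  the ball of radius \<open>k\<close> by time \<open>k\<close>.\<close>

definition large :: "nat => 'a set" where
 "large k = {w \<in> space M. below (level 0 (sol k)) ((real k)\<^sup>2) (real k) w \<noteq> 1}"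

lemma not_large: "w \<in> space M ==> w \<notin> large k \<longleftrightarrow> (\<forall>u\<in>{0..real k}. norm (sol k u w) <= real k)"
 by (auto simp: large_def below_eq_1 level_def abs_le_square_iff[symmetric])

lemma large_event: "large k \<in> events"
 unfolding large_def by (rule below_level_event[OF sol(1)]) simp

lemma prob_large: "C0 <= real k ==> (real k)\<^sup>2 * prob (large k) <= energy 0"
 unfolding large_def by (rule sol_estimate(2)[OF admissible_0]) auto

lemma along_eq:
 assumes "0 <= s" "\<And>u. 0 <= u ==> u <= s ==> X u w = X' u w"
 shows "along c X s w = along c X' s w"
 using assms delay_nonneg[OF assms(1)] by (simp add: along_def with_history_def)

lemma along_truncated:
 assumes s: "0 < s" "s <= real k" and k: "C0 <= real k" and w: "w \<in> space M"
  and X: "\<And>u. 0 <= u ==> u <= s ==> norm (X u w) <= real k"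
 shows "along (truncated k c) X s w = along c X s w"
proof -
 have "norm (with_history X r w) <= real k" if "- \<tau> <= r" "r <= s" for r
  using X[of r] that initial_bounded[OF that(1) _ w] k by (auto simp: with_history_def)
 then show ?thesis unfolding along_def using s delay_ge[of s] delay_nonneg[of s] \<tau>_nonneg by (intro truncated_eq) auto
qed

text \<open>Inside the ball of radius \<open>k\<close> both truncations reduce to the original
  coefficients, so the comparison up to the exit applies with \<open>sol m\<close> as the solution
  of the regular equation.\<close>

lemma sol_agree:
 assumes k: "C0 <= real k" "k <= m"
 shows "AE w in M. w \<notin> large k --> (\<forall>t\<in>{0..real k}. sol k t w = sol m t w)"
proof -
 have "AE w in M. \<forall>t\<in>{0..real k}. (\<forall>u\<in>{0..t}. norm (sol k u w) <= real k) --> sol k t w = sol m t w"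
 proof (rule stopped_comparison[OF regular_f regular_g sol sol(1) has_ito_integral_ito[OF prog_bdd_along[OF sol(1) regular_g]]])
  show "AE w in M. \<forall>t\<in>{0..real k}. sol k t w = \<xi> w 0
    + (LINT s:{0..t}|lborel. along (truncated k f) (sol k) s w) + ito (along (truncated k g) (sol k)) t w"
   using sol(2)[of k] by eventually_elim (auto simp: picard_def tint_def)
  show "AE w in M. \<forall>s. 0 < s \<and> s <= real k \<and> (\<forall>u\<in>{0..s}. norm (sol k u w) <= real k) -->
    along (truncated k f) (sol k) s w = along (truncated m f) (sol k) s w
    \<and> along (truncated k g) (sol k) s w = along (truncated m g) (sol k) s w"
  proof (intro AE_I2 allI impI)
   fix w s assume w: "w \<in> space M" and s: "0 < s \<and> s <= real k \<and> (\<forall>u\<in>{0..s}. norm (sol k u w) <= real k)"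
   have t1: "along (truncated m c) (sol k) s w = along c (sol k) s w" for c :: "real ^ 'n => real ^ 'n => real => 'e::euclidean_space"
    using s k by (intro along_truncated w) (auto intro: order_trans[where y = "real k"])
   have t2: "along (truncated k c) (sol k) s w = along c (sol k) s w" for c :: "real ^ 'n => real ^ 'n => real => 'e::euclidean_space"
    using s k by (intro along_truncated w) auto
   show "along (truncated k f) (sol k) s w = along (truncated m f) (sol k) s w
    \<and> along (truncated k g) (sol k) s w = along (truncated m g) (sol k) s w" by (simp add: t1 t2)
  qed
 qed simp
 then show ?thesis using AE_space
 proof eventually_elim
  case (elim w)
  show ?case
  proof (intro impI ballI)
   fix t assume l: "w \<notin> large k" and t: "t \<in> {0..real k}"
   have "\<forall>u\<in>{0..t}. norm (sol k u w) <= real k" using l t unfolding not_large[OF elim(2)] by fastforce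
   then show "sol k t w = sol m t w" using elim(1) t by blast
  qed
 qed
qed

text \<open>From this index on, the radius dominates the initial segment and is at least 1, which
  permits division by it and makes it at most its square.\<close>

definition "start = nat \<lceil>C0\<rceil> + 1"

lemma start: "start <= k ==> C0 <= real k" "start <= k ==> 1 <= real k"
 by (simp_all add: start_def) linarith+

text \<open>The bound on the second moment gives probabilities of order 1 / k^2, so Borel-Cantelli
  applies along all integers \<open>k\<close> without passing to a subsequence.\<close>

lemma summable_large: "summable (\<lambda>j. prob (large (j + start)))"
proof (rule summable_comparison_test'[of "\<lambda>j. energy 0 * inverse (real (j + start) ^ 2)"])
 show "summable (\<lambda>j. energy 0 * inverse (real (j + start) ^ 2))"
  using summable_ignore_initial_segment[OF inverse_power_summable[of 2], where 'a1 = real] by (intro summable_mult) auto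
 show "norm (prob (large (j + start))) <= energy 0 * inverse (real (j + start) ^ 2)" if "0 <= j" for j
  using prob_large[OF start(1), of "j + start"] start(2)[of "j + start"] by (simp add: divide_simps mult.commute)
qed

text \<open>Outside \<open>large\<close> the truncated solutions coincide up to time
  \<open>k\<close>, so the increments that \<open>limit_process\<close> wants to be small are
  exactly 0.\<close>

lemma limit_exists:
 "\<exists>x. path_process x \<and> (AE w in M. \<forall>k\<ge>start. w \<notin> large k --> (\<forall>t\<in>{0..real k}. x t w = sol k t w))"
proof -
 have agree: "AE w in M. \<forall>k\<ge>start. \<forall>m\<ge>k. w \<notin> large k --> (\<forall>t\<in>{0..real k}. sol k t w = sol m t w)"
  unfolding AE_all_countable using sol_agree[OF start(1)] by (auto simp: AE_all_countable)
 obtain X' where X': "\<And>t. 0 <= t ==> X' t \<in> borel_measurable (F t)"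
  "\<And>w. w \<in> space M ==> continuous_on {0..} (\<lambda>t. X' t w)" "\<And>w. w \<in> space M ==> X' 0 w = 0"
  "AE w in M. \<forall>T. uniform_limit {0..T} (\<lambda>j t. sol (j + start) t w - \<xi> w 0) (\<lambda>t. X' t w) sequentially"
 proof (rule limit_process[of "\<lambda>j t w. sol (j + start) t w - \<xi> w 0" "\<lambda>j. large (j + start)"])
  show "AE w in M. w \<notin> large (j + start) --> (\<forall>t\<in>{0..real j}.
    norm (sol (Suc j + start) t w - \<xi> w 0 - (sol (j + start) t w - \<xi> w 0)) <= (1 / 2) ^ j)" for j
   using agree
  proof eventually_elim
   case (elim w)
   show ?case using elim[rule_format, of "j + start" "Suc j + start"] by auto
  qed
 qed (use path_processD[OF sol(1)] initial_value_measurable large_event summable_large in \<open>auto intro!: continuous_intros\<close>)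
 define x where "x t w = \<xi> w 0 + X' t w" for t w
 have "path_process x"
  unfolding path_process_def x_def using X'(1,2,3) by (auto intro!: borel_measurable_add initial_value_measurable continuous_intros)
 moreover have "AE w in M. \<forall>k\<ge>start. w \<notin> large k --> (\<forall>t\<in>{0..real k}. x t w = sol k t w)"
  using X'(4) agree
 proof eventually_elim
  case (elim w)
  show ?case
  proof (intro allI impI ballI)
   fix k t assume k: "start <= k" "w \<notin> large k" and t: "t \<in> {0..real k}"
   have "(\<lambda>j. sol (j + start) t w - \<xi> w 0) \<longlonglongrightarrow> X' t w"
    using elim(1) t by (intro tendsto_uniform_limitI[where S = "{0..real k}"]) auto
   moreover have "\<forall>\<^sub>F j in sequentially. sol (j + start) t w - \<xi> w 0 = sol k t w - \<xi> w 0"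
   proof (rule eventually_mono[OF eventually_ge_at_top[of k]])
    fix j assume "k <= j"
    then show "sol (j + start) t w - \<xi> w 0 = sol k t w - \<xi> w 0"
     using elim(2)[rule_format, OF k(1) _ k(2) t, of "j + start"] by simp
   qed
   ultimately have "(\<lambda>j. sol k t w - \<xi> w 0 :: real ^ 'n) \<longlonglongrightarrow> X' t w" by (rule Lim_transform_eventually)
   then have "sol k t w - \<xi> w 0 = X' t w" by (simp add: LIMSEQ_const_iff)
   then show "x t w = sol k t w" by (simp add: x_def algebra_simps)
  qed
 qed
 ultimately show ?thesis by blast
qed

definition limit :: "real => 'a => real ^ 'n" where
 "limit = (SOME x. path_process x \<and> (AE w in M. \<forall>k\<ge>start. w \<notin> large k --> (\<forall>t\<in>{0..real k}. x t w = sol k t w)))"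

lemma limit: "path_process limit" "AE w in M. \<forall>k\<ge>start. w \<notin> large k --> (\<forall>t\<in>{0..real k}. limit t w = sol k t w)"
 using someI_ex[OF limit_exists] by (auto simp: limit_def)

lemma eventually_not_large: "AE w in M. \<forall>\<^sub>F k in sequentially. w \<notin> large k"
proof -
 have "AE w in M. \<forall>\<^sub>F j in sequentially. w \<in> space M - large (j + start)"
  by (rule borel_cantelli_AE1) (use large_event summable_large in \<open>auto simp: emeasure_eq_measure\<close>)
 then show ?thesis
  by eventually_elim (subst (asm) eventually_sequentially_seg, auto elim: eventually_mono)
qed

end

section \<open>Solutions and their decay rates\<close>

text \<open>\<open>ln C / ln (1 + t)\<close> tends to 0, so the constant does not influence the
  rate; where \<open>r\<close> vanishes the logarithm is minus infinity and the bound is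
  trivial.\<close>

lemma Limsup_elog_le:
 assumes C: "0 < C" and r: "\<And>t. 0 <= t ==> r t <= ennreal (C * (1 + t) powr - \<beta>)"
 shows "Limsup at_top (\<lambda>t. elog (r t) / ereal (ln (1 + t))) <= ereal (- \<beta>)"
proof -
 have "Limsup at_top (\<lambda>t. elog (r t) / ereal (ln (1 + t))) <= Limsup at_top (\<lambda>t. ereal (ln C / ln (1 + t) - \<beta>))"
 proof (rule Limsup_mono, rule eventually_mono[OF eventually_gt_at_top[of 0]])
  fix t :: real assume t: "0 < t"
  then have l: "0 < ln (1 + t)" by simp
  have "elog (r t) <= ereal (ln C - \<beta> * ln (1 + t))"
  proof (cases "r t = 0")
   case False
   have fin: "r t < \<infinity>" using r[of t] t by (auto intro: order_le_less_trans)
   have "0 < enn2real (r t)" using False fin by (simp add: enn2real_positive_iff zero_less_iff_neq_zero)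
   moreover have "enn2real (r t) <= C * (1 + t) powr - \<beta>" using r[of t] t C by (intro enn2real_leI) auto
   ultimately have "ln (enn2real (r t)) <= ln (C * (1 + t) powr - \<beta>)" by (subst ln_le_cancel_iff) auto
   also have "\<dots> = ln C - \<beta> * ln (1 + t)" using C t by (simp add: ln_mult ln_powr)
   finally show ?thesis using False fin by (simp add: elog_def less_top)
  qed (simp add: elog_def)
  then have "elog (r t) / ereal (ln (1 + t)) <= ereal (ln C - \<beta> * ln (1 + t)) / ereal (ln (1 + t))"
   using l by (intro ereal_divide_right_mono) auto
  also have "\<dots> = ereal (ln C / ln (1 + t) - \<beta>)" using l by (simp add: diff_divide_distrib)
  finally show "elog (r t) / ereal (ln (1 + t)) <= ereal (ln C / ln (1 + t) - \<beta>)" .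
 qed
 also have "((\<lambda>t. ln C / ln (1 + t) - \<beta>) \<longlongrightarrow> 0 - \<beta>) at_top"
  by (intro tendsto_diff tendsto_const tendsto_divide_0[OF tendsto_const] filterlim_at_top_imp_at_infinity
    filterlim_compose[OF ln_at_top] filterlim_tendsto_add_at_top[OF tendsto_const] filterlim_ident)
 then have "Limsup at_top (\<lambda>t. ereal (ln C / ln (1 + t) - \<beta>)) = ereal (- \<beta>)"
  by (intro lim_imp_Limsup) auto
 finally show ?thesis .
qed

context delay_equation
begin

lemma progressive_along_nonneg:
 fixes c :: "real ^ 'n => real ^ 'n => real => 'c::euclidean_space"
 assumes X: "path_process X" and c: "(\<lambda>(x, y, s). c x y s) \<in> borel_measurable (restrict_space borel (UNIV \<times> UNIV \<times> {0..}))"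
 shows "progressive (along c X)"
 unfolding progressively_measurable_def
proof (intro allI impI)
 fix T :: real assume T: "0 <= T"
 have "(\<lambda>(t, w). along (\<lambda>x y s. if 0 <= s then c x y s else 0) X t w) \<in> borel_measurable (restrict_space borel {0..T} \<Otimes>\<^sub>M F T)"
  using progressive_along[OF X borel_measurable_nonneg_time[OF c]] T by (simp add: progressively_measurable_def)
 also have "?this \<longleftrightarrow> (\<lambda>(t, w). along c X t w) \<in> borel_measurable (restrict_space borel {0..T} \<Otimes>\<^sub>M F T)"
  by (rule measurable_cong) (auto simp: space_pair_measure space_restrict_space along_def)
 finally show "(\<lambda>(t, w). along c X t w) \<in> borel_measurable (restrict_space borel {0..T} \<Otimes>\<^sub>M F T)" .
qed

lemma along_limit:
 assumes w: "w \<in> space M" and k: "start <= k" "w \<notin> large k"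
  and eq: "\<forall>t\<in>{0..real k}. limit t w = sol k t w" and s: "0 < s" "s <= real k"
 shows "along c limit s w = along (truncated k c) (sol k) s w"
proof -
 have "along (truncated k c) (sol k) s w = along c (sol k) s w"
  using k(2) s by (intro along_truncated s start(1)[OF k(1)] w) (simp add: not_large[OF w])
 also have "\<dots> = along c limit s w" using eq s by (intro along_eq) auto
 finally show ?thesis by simp
qed

lemma drift_limit:
 assumes w: "w \<in> space M" and k: "start <= k" "w \<notin> large k"
  and eq: "\<forall>t\<in>{0..real k}. limit t w = sol k t w" and t: "0 <= t" "t <= real k"
 shows "set_integrable lborel {0..t} (\<lambda>s. along f limit s w)"
  and "tint (along f limit) t w = tint (along (truncated k f) (sol k)) t w"
proof -
 have e: "along f limit s w = along (truncated k f) (sol k) s w" if "0 < s" "s <= t" for s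
  using that t by (intro along_limit[OF w k eq]) auto
 show "set_integrable lborel {0..t} (\<lambda>s. along f limit s w)"
  "tint (along f limit) t w = tint (along (truncated k f) (sol k)) t w"
  unfolding tint_def
  using set_integral_cong_open[OF tint_set_integrable[OF prog_bdd_along[OF sol(1) regular_f] order_refl w] e t(1)] by auto
qed

lemma limit_solution: "sdde_solution M F B f g \<delta> \<tau> \<xi> (with_history limit)"
proof -
 \<comment> \<open>\<open>I\<close> is what the equation leaves over, so the equation holds by
   construction. What remains to be shown is that \<open>I\<close> is the stochastic integral, by
   comparison with the truncated equations outside \<open>large\<close>.\<close>
 define I where "I t w = limit t w - \<xi> w 0 - tint (along f limit) t w" for t w
 have "has_ito_integral M F B (along g limit) I"
 proof (rule has_ito_integral_localized[where E = "\<lambda>j. large (j + start)" and H = "\<lambda>j. along (truncated (j + start) g) (sol (j + start))"])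
  show "I t \<in> borel_measurable (F t)" if t: "0 <= t" for t
   unfolding I_def using t
   by (intro borel_measurable_diff path_processD(1)[OF limit(1)] initial_value_measurable tint_measurable progressive_along_nonneg[OF limit(1) f_borel])
  show "AE w in M. w \<notin> large (j + start) --> (\<forall>t. 0 <= t \<and> t <= real j -->
    (0 < t --> along g limit t w = along (truncated (j + start) g) (sol (j + start)) t w)
    \<and> I t w = ito (along (truncated (j + start) g) (sol (j + start))) t w)" for j
   using limit(2) sol(2)[of "j + start"] AE_space
  proof eventually_elim
   case (elim w)
   show ?case
   proof (intro impI allI)
    fix t assume l: "w \<notin> large (j + start)" and t: "0 <= t \<and> t <= real j"
    have t': "0 <= t" "t <= real (j + start)" using t by auto
    have eq: "\<forall>t\<in>{0..real (j + start)}. limit t w = sol (j + start) t w" using elim(1) l by simp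
    have "I t w = ito (along (truncated (j + start) g) (sol (j + start))) t w"
     unfolding I_def drift_limit(2)[OF elim(3) le_add2 l eq t']
     using eq t' elim(2)[rule_format, OF t'(1)] by (simp add: picard_def)
    then show "(0 < t --> along g limit t w = along (truncated (j + start) g) (sol (j + start)) t w)
      \<and> I t w = ito (along (truncated (j + start) g) (sol (j + start))) t w"
     using along_limit[OF elim(3) le_add2 l eq _ t'(2), of g] by simp
   qed
  qed
 qed (auto intro: progressive_along_nonneg[OF limit(1) g_borel] prog_bdd_along sol(1) regular_g large_event summable_LIMSEQ_zero[OF summable_large])
 moreover have "AE w in M. set_integrable lborel {0..T} (\<lambda>s. along f limit s w)" if T: "0 <= T" for T
  using limit(2) eventually_not_large AE_space
 proof eventually_elim
  case (elim w)
  obtain N where N: "\<And>k. N <= k ==> w \<notin> large k" using elim(2) by (auto simp: eventually_sequentially)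
  define k where "k = max (max N start) (nat \<lceil>T\<rceil>)"
  have k: "N <= k" "start <= k" "T <= real k" unfolding k_def by linarith+
  show ?case using elim(1) N k by (intro drift_limit(1)[OF elim(3) k(2) N[OF k(1)] _ T k(3)]) auto
 qed
 moreover have "with_history limit t w = with_history limit 0 w + tint (along f limit) t w + I t w" if "0 <= t" "w \<in> space M" for t w
  unfolding with_history_nonneg[OF limit(1) that] by (simp add: I_def with_history_def)
 moreover have "with_history limit t \<in> borel_measurable (F (max 0 t))" if "- \<tau> <= t" for t
  by (rule with_history_measurable[OF limit(1) that order_refl])
 ultimately show ?thesis
  unfolding sdde_solution_def using with_history_continuous[OF limit(1)]
  by (auto simp: along_def[abs_def] tint_def with_history_def[of _ "_ :: real" _] intro!: AE_I2 exI[of _ I])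
qed

text \<open>A path is bounded on \<open>[0, t]\<close>, so for large \<open>k\<close> it has not
  left the ball of radius \<open>k\<close> and agrees with \<open>sol k\<close>, while outside
  \<open>large\<close> the limit agrees with \<open>sol k\<close> as well.\<close>

lemma solution_eq_limit:
 assumes y: "sdde_solution M F B f g \<delta> \<tau> \<xi> y"
 shows "AE w in M. \<forall>t\<ge>-\<tau>. y t w = with_history limit t w"
proof -
 note y' = y[unfolded sdde_solution_def]
 have ym: "y t \<in> borel_measurable (F t)" if "0 <= t" for t using y' that \<tau>_nonneg by (metis max.absorb2 neg_le_0_iff_le order_trans)
 obtain I where I: "has_ito_integral M F B (\<lambda>s w. g (y s w) (y (s - \<delta> s) w) s) I"
  "AE w in M. \<forall>t\<ge>0. y t w = y 0 w + (LINT s:{0..t}|lborel. f (y s w) (y (s - \<delta> s) w) s) + I t w"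
  using y' by blast
 have yi: "AE w in M. \<forall>\<theta>\<in>{-\<tau>..0}. y \<theta> w = \<xi> w \<theta>" using y' by blast
 have yc: "w \<in> space M ==> continuous_on {-\<tau>..} (\<lambda>t. y t w)" for w using y' by blast
 \<comment> \<open>\<open>y\<close> takes the prescribed initial values only almost surely, whereas
   \<open>path_process\<close> asks for them at every outcome; the shift changes \<open>y\<close> on
   a null set only.\<close>
 define z where "z t w = y t w - y 0 w + \<xi> w 0" for t w
 have z: "path_process z"
  unfolding path_process_def z_def[abs_def]
 proof (intro conjI allI impI ballI)
  show "(\<lambda>w. y t w - y 0 w + \<xi> w 0) \<in> borel_measurable (F t)" if t: "0 <= t" for t
   using ym[OF t] measurable_F_mono[OF ym[OF order_refl], of t] initial_value_measurable[OF t] t by (intro borel_measurable_add borel_measurable_diff) auto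
  show "continuous_on {0..} (\<lambda>t. y t w - y 0 w + \<xi> w 0)" if "w \<in> space M" for w
   using \<tau>_nonneg by (intro continuous_intros continuous_on_subset[OF yc[OF that]]) auto
 qed simp
 have zy: "with_history z r w = y r w" if "\<forall>\<theta>\<in>{-\<tau>..0}. y \<theta> w = \<xi> w \<theta>" "- \<tau> <= r" for r w
  using that \<tau>_nonneg by (simp add: with_history_def z_def)
 have cmp: "AE w in M. \<forall>t\<in>{0..real k}. (\<forall>u\<in>{0..t}. norm (z u w) <= real k) --> z t w = sol k t w" if k: "start <= k" for k
 proof (rule stopped_comparison[OF regular_f regular_g sol z I(1)])
  show "AE w in M. \<forall>t\<in>{0..real k}. z t w = \<xi> w 0 + (LINT s:{0..t}|lborel. f (y s w) (y (s - \<delta> s) w) s) + I t w"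
   using I(2)
  proof eventually_elim
   case (elim w)
   show ?case
   proof
    fix t assume "t \<in> {0..real k}"
    then have "y t w = y 0 w + (LINT s:{0..t}|lborel. f (y s w) (y (s - \<delta> s) w) s) + I t w" by (intro elim[rule_format]) simp
    then show "z t w = \<xi> w 0 + (LINT s:{0..t}|lborel. f (y s w) (y (s - \<delta> s) w) s) + I t w" unfolding z_def by simp
   qed
  qed
  show "AE w in M. \<forall>s. 0 < s \<and> s <= real k \<and> (\<forall>u\<in>{0..s}. norm (z u w) <= real k) -->
    f (y s w) (y (s - \<delta> s) w) s = along (truncated k f) z s w \<and> g (y s w) (y (s - \<delta> s) w) s = along (truncated k g) z s w"
   using yi AE_space
  proof eventually_elim
   case (elim w)
   show ?case
   proof (intro allI impI)
    fix s assume s: "0 < s \<and> s <= real k \<and> (\<forall>u\<in>{0..s}. norm (z u w) <= real k)"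
    have 1: "along (truncated k c) z s w = along c z s w" for c :: "real ^ 'n => real ^ 'n => real => 'e::euclidean_space"
     using s by (intro along_truncated start(1) k elim(2)) auto
    have 2: "along c z s w = c (y s w) (y (s - \<delta> s) w) s" for c :: "real ^ 'n => real ^ 'n => real => 'e::euclidean_space"
     using s delay_ge[of s] \<tau>_nonneg by (simp add: along_def zy[OF elim(1)])
    show "f (y s w) (y (s - \<delta> s) w) s = along (truncated k f) z s w \<and> g (y s w) (y (s - \<delta> s) w) s = along (truncated k g) z s w"
     by (simp only: 1) (auto simp only: 2)
   qed
  qed
 qed simp
 have "AE w in M. \<forall>k\<ge>start. \<forall>t\<in>{0..real k}. (\<forall>u\<in>{0..t}. norm (z u w) <= real k) --> z t w = sol k t w"
  using cmp by (simp add: AE_all_countable)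
 then show ?thesis using yi limit(2) eventually_not_large AE_space
 proof eventually_elim
  case (elim w)
  show ?case
  proof (intro allI impI)
   fix t assume t: "- \<tau> <= t"
   show "y t w = with_history limit t w"
   proof (cases "t <= 0")
    case True
    then show ?thesis using elim(2) t by (simp add: with_history_def)
   next
    case False
    have "bounded ((\<lambda>u. z u w) ` {0..t})"
     by (intro compact_imp_bounded compact_continuous_image continuous_on_subset[OF path_processD(2)[OF z elim(5)]]) auto
    then obtain C where C: "\<And>u. u \<in> {0..t} ==> norm (z u w) <= C" unfolding bounded_iff by blast
    obtain N where N: "\<And>k. N <= k ==> w \<notin> large k" using elim(4) by (auto simp: eventually_sequentially)
    define k where "k = max (max N start) (nat \<lceil>max C t\<rceil>)"
    have k: "N <= k" "start <= k" "C <= real k" "t <= real k" unfolding k_def by linarith+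
    have "\<forall>u\<in>{0..t}. norm (z u w) <= real k" using C k(3) by (meson order_trans)
    moreover have "t \<in> {0..real k}" using False k(4) by simp
    ultimately have "z t w = sol k t w" using elim(1) k(2) by blast
    also have "\<dots> = limit t w" using elim(3)[rule_format, OF k(2) N[OF k(1)], of t] k False by simp
    finally show ?thesis using zy[OF elim(2) t] False by (simp add: with_history_def)
   qed
  qed
 qed
qed

lemma energy_nonneg: "admissible \<gamma> ==> 0 <= energy \<gamma>"
 using constants by (auto simp: energy_def admissible_def)

text \<open>Along almost every path the truncated solutions eventually agree with the limit and have
  not exceeded the growing threshold by time \<open>t\<close>. The stopped levels therefore
  converge, and Fatou passes on the bound that is uniform in the truncation.\<close>

lemma limit_moment:
 assumes \<gamma>: "admissible \<gamma>" and t: "0 <= t"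
 shows "(\<integral>\<^sup>+w. ennreal (level \<gamma> limit t w) \<partial>M) <= ennreal (energy \<gamma>)"
proof -
 define N where "N = start + nat \<lceil>t\<rceil>"
 have N: "start <= j + N" "t <= real (j + N)" for j unfolding N_def by linarith+
 let ?b = "\<lambda>j w. below (level \<gamma> (sol (j + N))) ((real (j + N))\<^sup>2) t w * level \<gamma> (sol (j + N)) t w"
 have "AE w in M. liminf (\<lambda>j. ennreal (?b j w)) = ennreal (level \<gamma> limit t w)"
  using limit(2) eventually_not_large AE_space
 proof eventually_elim
  case (elim w)
  have "bounded ((\<lambda>u. level \<gamma> limit u w) ` {0..t})"
   by (intro compact_imp_bounded compact_continuous_image continuous_on_subset[OF level_continuous[OF limit(1) elim(3)]]) auto
  then obtain C where C: "\<And>u. u \<in> {0..t} ==> norm (level \<gamma> limit u w) <= C" unfolding bounded_iff by blast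
  obtain J where J: "\<And>k. J <= k ==> w \<notin> large k" using elim(2) by (auto simp: eventually_sequentially)
  have "?b j w = level \<gamma> limit t w" if j: "max J (nat \<lceil>C\<rceil>) <= j" for j
  proof -
   have jN: "J <= j + N" "C <= real (j + N)" using j by linarith+
   have eq: "level \<gamma> (sol (j + N)) u w = level \<gamma> limit u w" if "0 <= u" "u <= t" for u
    using elim(1)[rule_format, OF N(1) J[OF jN(1)], of u] that N(2)[of j] by (simp add: level_def)
   have "1 <= real (j + N)" using start(2)[OF N(1)] .
   then have C2: "C <= (real (j + N))\<^sup>2" using jN(2) self_le_power[of "real (j + N)" 2] by linarith
   have "level \<gamma> (sol (j + N)) u w <= (real (j + N))\<^sup>2" if "u \<in> {0..t}" for u
    using C[OF that] eq[of u] that C2 by simp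
   then show ?thesis using eq[OF t] by (simp add: below_def)
  qed
  then have "\<forall>\<^sub>F j in sequentially. ennreal (?b j w) = ennreal (level \<gamma> limit t w)"
   by (intro eventually_sequentiallyI[of "max J (nat \<lceil>C\<rceil>)"]) simp
  then show ?case by (intro lim_imp_Liminf tendsto_eventually) auto
 qed
 then have "(\<integral>\<^sup>+w. ennreal (level \<gamma> limit t w) \<partial>M) = (\<integral>\<^sup>+w. liminf (\<lambda>j. ennreal (?b j w)) \<partial>M)"
  by (intro nn_integral_cong_AE) (auto elim!: eventually_mono)
 also have "\<dots> <= liminf (\<lambda>j. \<integral>\<^sup>+w. ennreal (?b j w) \<partial>M)"
 proof (rule nn_integral_liminf)
  fix j
  have m: "below (level \<gamma> (sol (j + N))) A t \<in> borel_measurable M" "level \<gamma> (sol (j + N)) t \<in> borel_measurable M" for A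
   by (rule measurable_F_M[OF progressive_adapted[OF progressive_below t] t] measurable_F_M[OF _ t];
    intro level_continuous level_measurable sol(1); assumption?)+ (use t in auto)
  show "(\<lambda>w. ennreal (?b j w)) \<in> borel_measurable M" using m by measurable
 qed
 also have "\<dots> <= ennreal (energy \<gamma>)"
  using N t by (intro Liminf_le always_eventually allI sol_estimate(1)[OF \<gamma>] start(1)) auto
 finally show ?thesis .
qed

text \<open>The exit estimate bounds \<open>A\<close> times the probability that the level exceeds
  \<open>A\<close> by time \<open>n\<close>, uniformly in \<open>n\<close>; the error of replacing
  the limit by a truncated solution disappears as the truncation grows. Letting first
  \<open>n\<close> and then \<open>A\<close> tend to infinity shows that the supremum over all times
  is almost surely finite.\<close>

lemma limit_level_bounded:
 assumes \<gamma>: "admissible \<gamma>"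
 shows "AE w in M. \<exists>A. \<forall>t\<ge>0. level \<gamma> limit t w <= A"
proof -
 define D where "D A n = {w \<in> space M. below (level \<gamma> limit) A (real n) w \<noteq> 1}" for A and n :: nat
 have D [measurable]: "D A n \<in> events" for A n unfolding D_def by (rule below_level_event[OF limit(1)]) simp
 have bound: "A * prob (D A n) <= energy \<gamma>" if A: "0 <= A" for A n
 proof -
  define N where "N = start + n + nat \<lceil>A\<rceil>"
  have "A * prob (D A n) <= energy \<gamma> + A * prob (large (j + start))" if j: "N <= j" for j
  proof -
   let ?k = "j + start"
   have k: "start <= ?k" "real n <= real ?k" "A <= real ?k" using j unfolding N_def by linarith+
   have "1 <= real ?k" using start(2)[OF k(1)] .
   then have kA: "A <= (real ?k)\<^sup>2" using k(3) self_le_power[of "real ?k" 2] by linarith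
   let ?S = "{w \<in> space M. below (level \<gamma> (sol ?k)) A (real n) w \<noteq> 1}"
   have S: "?S \<in> events" by (rule below_level_event[OF sol(1)]) simp
   have "prob (D A n) <= prob (?S \<union> large ?k)"
   proof (rule finite_measure_mono_AE)
    show "AE w in M. w \<in> D A n --> w \<in> ?S \<union> large ?k"
     using limit(2)
    proof eventually_elim
     case (elim w)
     then have "level \<gamma> (sol ?k) u w = level \<gamma> limit u w" if "w \<notin> large ?k" "u \<in> {0..real n}" for u
      using elim[rule_format, OF k(1) that(1), of u] that(2) k(2) by (simp add: level_def)
     then show ?case unfolding D_def below_eq_1 by fastforce
    qed
   qed (use S large_event in auto)
   also have "\<dots> <= prob ?S + prob (large ?k)" by (rule measure_Un_le[OF S large_event])
   finally have "A * prob (D A n) <= A * (prob ?S + prob (large ?k))" using A by (rule mult_left_mono)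
   also have "\<dots> <= energy \<gamma> + A * prob (large ?k)"
    using sol_estimate(2)[OF \<gamma> start(1)[OF k(1)] _ k(2) A kA] by (simp add: distrib_left)
   finally show ?thesis .
  qed
  moreover have "(\<lambda>j. energy \<gamma> + A * prob (large (j + start))) \<longlonglongrightarrow> energy \<gamma> + A * 0"
   by (intro tendsto_intros summable_LIMSEQ_zero[OF summable_large])
  ultimately show ?thesis by (intro LIMSEQ_le_const[where X = "\<lambda>j. energy \<gamma> + A * prob (large (j + start))"]) auto
 qed
 have boundU: "A * prob (\<Union>n. D A n) <= energy \<gamma>" if A: "0 <= A" for A
 proof -
  have "incseq (D A)"
  proof (rule incseq_SucI, rule subsetI)
   fix n w assume "w \<in> D A n"
   then show "w \<in> D A (Suc n)" unfolding D_def below_eq_1 mem_Collect_eq by force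
  qed
  then have "(\<lambda>n. prob (D A n)) \<longlonglongrightarrow> prob (\<Union>n. D A n)" by (intro finite_Lim_measure_incseq) auto
  from tendsto_mult_left[OF this, of A] show ?thesis by (rule LIMSEQ_le_const2) (use bound[OF A] in auto)
 qed
 define S where "S = (\<Inter>m :: nat. \<Union>n. D (real m) n)"
 have S: "S \<in> events" unfolding S_def by measurable
 have "real m * prob S <= energy \<gamma>" for m
 proof -
  have "prob S <= prob (\<Union>n. D (real m) n)" by (intro finite_measure_mono) (auto simp: S_def)
  then have "real m * prob S <= real m * prob (\<Union>n. D (real m) n)" by (rule mult_left_mono) simp
  also have "\<dots> <= energy \<gamma>" by (rule boundU) simp
  finally show ?thesis .
 qed
 then have "\<not> 0 < prob S" using reals_Archimedean3[of "prob S"] by (meson not_less)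
 then have "prob S = 0" using measure_nonneg[of M S] by linarith
 then have "S \<in> null_sets M" using S by (simp add: null_sets_def emeasure_eq_measure)
 from AE_not_in[OF this] AE_space show ?thesis
 proof eventually_elim
  case (elim w)
  then obtain m where m: "\<And>n. w \<notin> D (real m) n" by (auto simp: S_def)
  have "level \<gamma> limit t w <= real m" if t: "0 <= t" for t
  proof -
   have "t \<in> {0..real (nat \<lceil>t\<rceil>)}" using t real_nat_ceiling_ge[of t] by simp
   then show ?thesis using m[of "nat \<lceil>t\<rceil>"] elim(2) unfolding D_def below_eq_1 by blast
  qed
  then show ?case by blast
 qed
qed

text \<open>Boundedness of the weighted square gives \<gamma> for the mean square; the square root
  halves the exponent for the norm of a path.\<close>

lemma solution_rates:
 assumes \<gamma>: "admissible \<gamma>" and y: "sdde_solution M F B f g \<delta> \<tau> \<xi> y"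
 shows "AE w in M. pathwise_rate y w <= ereal (- \<gamma> / 2)" and "mean_square_rate M y <= ereal (- \<gamma>)"
proof -
 have yl: "AE w in M. \<forall>t\<ge>0. y t w = limit t w"
  using solution_eq_limit[OF y] AE_space by eventually_elim (use \<tau>_nonneg in \<open>auto simp: with_history_nonneg[OF limit(1)]\<close>)
 have bd: "n <= C * (1 + t) powr - \<gamma>" if "(1 + t) powr \<gamma> * n <= C" "0 <= t" for C t n
  using that by (simp add: powr_minus divide_simps mult.commute)
 show "AE w in M. pathwise_rate y w <= ereal (- \<gamma> / 2)"
  using limit_level_bounded[OF \<gamma>] yl
 proof eventually_elim
  case (elim w)
  then obtain A where A: "\<And>t. 0 <= t ==> level \<gamma> limit t w <= A" by blast
  \<comment> \<open>The maximum with 1 keeps the constant positive, as the logarithm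
    requires.\<close>
  define C where "C = sqrt (max A 1)"
  have "ennreal (norm (y t w)) <= ennreal (C * (1 + t) powr - (\<gamma> / 2))" if t: "0 <= t" for t
  proof (rule ennreal_leI, rule power2_le_imp_le)
   have "nsq (y t w) <= max A 1 * (1 + t) powr - \<gamma>"
    using A[OF t] elim(2) t by (intro bd) (auto simp: level_def)
   also have "\<dots> = (C * (1 + t) powr - (\<gamma> / 2))\<^sup>2"
    unfolding C_def power_mult_distrib by (simp add: power2_eq_square[of "(1 + t) powr _"] powr_add[symmetric])
   finally show "nsq (y t w) <= (C * (1 + t) powr - (\<gamma> / 2))\<^sup>2" .
  qed (simp add: C_def)
  from Limsup_elog_le[OF _ this] show ?case by (simp add: pathwise_rate_def C_def)
 qed
 show "mean_square_rate M y <= ereal (- \<gamma>)"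
  unfolding mean_square_rate_def
 proof (rule Limsup_elog_le)
  show "0 < energy \<gamma> + 1" using energy_nonneg[OF \<gamma>] by simp
  fix t :: real assume t: "0 <= t"
  have m: "level \<gamma> limit t \<in> borel_measurable M" by (rule measurable_F_M[OF level_measurable[OF limit(1) t] t])
  have "msq M (y t) = (\<integral>\<^sup>+w. ennreal ((1 + t) powr - \<gamma>) * ennreal (level \<gamma> limit t w) \<partial>M)"
  proof (rule nn_integral_cong_AE)
   show "AE w in M. ennreal (nsq (y t w)) = ennreal ((1 + t) powr - \<gamma>) * ennreal (level \<gamma> limit t w)"
    using yl by eventually_elim (use t in \<open>simp add: level_def ennreal_mult[symmetric] powr_add[symmetric] mult.assoc[symmetric]\<close>)
  qed
  also have "\<dots> = ennreal ((1 + t) powr - \<gamma>) * (\<integral>\<^sup>+w. ennreal (level \<gamma> limit t w) \<partial>M)"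
   using m by (intro nn_integral_cmult) measurable
  also have "\<dots> <= ennreal ((1 + t) powr - \<gamma>) * ennreal (energy \<gamma>)"
   by (intro mult_left_mono limit_moment[OF \<gamma> t]) simp
  also have "\<dots> <= ennreal ((energy \<gamma> + 1) * (1 + t) powr - \<gamma>)"
   using energy_nonneg[OF \<gamma>] by (simp add: ennreal_mult[symmetric] mult.commute mult_left_mono ennreal_leI)
  finally show "msq M (y t) <= ennreal ((energy \<gamma> + 1) * (1 + t) powr - \<gamma>)" .
 qed
qed

end

section \<open>Initial segments and the delay\<close>

lemma norm_le_segment_norm:
 assumes "\<phi> \<in> segments \<tau>" "- \<tau> <= \<theta>" "\<theta> <= 0"
 shows "norm (\<phi> \<theta>) <= segment_norm \<tau> \<phi>"
proof -
 have "compact ((\<lambda>\<theta>. norm (\<phi> \<theta>)) ` {-\<tau>..0})"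
  using assms(1) by (intro compact_continuous_image continuous_intros) (auto simp: segments_def)
 then show ?thesis unfolding segment_norm_def
  using assms(2,3) by (intro cSUP_upper bounded_imp_bdd_above compact_imp_bounded) auto
qed

text \<open>Evaluation at a point is continuous for the supremum norm, so preimages of open sets are
  among the generators of the \<sigma>-algebra.\<close>

lemma borel_measurable_evaluation:
 assumes \<theta>: "- \<tau> <= \<theta>" "\<theta> <= 0"
 shows "(\<lambda>\<phi>. \<phi> \<theta>) \<in> borel_measurable (segment_borel \<tau> :: (real => real ^ 'n) measure)"
proof (rule borel_measurableI)
 fix S :: "(real ^ 'n) set" assume S: "open S"
 have sub: "{U. segment_open \<tau> U} \<subseteq> Pow (segments \<tau> :: (real => real ^ 'n) set)" by (auto simp: segment_open_def)
 have "segment_open \<tau> {\<phi> \<in> segments \<tau>. \<phi> \<theta> \<in> S}"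
  unfolding segment_open_def
 proof (intro conjI ballI)
  fix \<phi> assume "\<phi> \<in> {\<phi> \<in> segments \<tau>. \<phi> \<theta> \<in> S}"
  then have \<phi>: "\<phi> \<in> segments \<tau>" "\<phi> \<theta> \<in> S" by auto
  obtain e where e: "0 < e" "ball (\<phi> \<theta>) e \<subseteq> S" using S \<phi>(2) by (auto simp: open_contains_ball)
  have "\<psi> \<theta> \<in> S" if "\<psi> \<in> segments \<tau>" "segment_norm \<tau> (\<lambda>\<theta>. \<psi> \<theta> - \<phi> \<theta>) < e" for \<psi>
  proof -
   have "(\<lambda>\<theta>. \<psi> \<theta> - \<phi> \<theta>) \<in> segments \<tau>" using that(1) \<phi>(1) by (auto simp: segments_def intro: continuous_on_diff)
   from norm_le_segment_norm[OF this \<theta>] that(2) have "\<psi> \<theta> \<in> ball (\<phi> \<theta>) e"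
    by (simp add: dist_norm norm_minus_commute)
   then show ?thesis using e(2) by blast
  qed
  then show "\<exists>\<epsilon>>0. \<forall>\<psi>\<in>segments \<tau>. segment_norm \<tau> (\<lambda>\<theta>. \<psi> \<theta> - \<phi> \<theta>) < \<epsilon> --> \<psi> \<in> {\<phi> \<in> segments \<tau>. \<phi> \<theta> \<in> S}"
   using e(1) by auto
 qed auto
 moreover have "(\<lambda>\<phi>. \<phi> \<theta>) -` S \<inter> space (segment_borel \<tau>) = {\<phi> \<in> segments \<tau>. \<phi> \<theta> \<in> S}"
  using sub by (auto simp: segment_borel_def space_measure_of)
 ultimately show "(\<lambda>\<phi>. \<phi> \<theta>) -` S \<inter> space (segment_borel \<tau>) \<in> sets (segment_borel \<tau>)"
  using sub by (simp add: segment_borel_def sets_measure_of sigma_sets.Basic)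
qed

lemma (in stochastic_basis) initial_valuesE:
 fixes \<xi> :: "'a => real => real ^ 'n"
 assumes "\<xi> \<in> initial_values M F \<tau>"
 obtains C where "0 <= C" "\<And>\<theta>. - \<tau> <= \<theta> ==> \<theta> <= 0 ==> (\<lambda>w. \<xi> w \<theta>) \<in> borel_measurable (F 0)"
  "\<And>w. w \<in> space M ==> continuous_on {-\<tau>..0} (\<xi> w)"
  "\<And>\<theta> w. - \<tau> <= \<theta> ==> \<theta> <= 0 ==> w \<in> space M ==> norm (\<xi> w \<theta>) <= C"
proof -
 obtain C where \<xi>: "\<xi> \<in> measurable (F 0) (segment_borel \<tau>)" and C: "\<And>w. w \<in> space M ==> segment_norm \<tau> (\<xi> w) <= C"
  using assms by (auto simp: initial_values_def)
 have "space (segment_borel \<tau>) = (segments \<tau> :: (real => real ^ 'n) set)"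
  unfolding segment_borel_def by (rule space_measure_of) (auto simp: segment_open_def)
 then have seg: "\<xi> w \<in> segments \<tau>" if "w \<in> space M" for w using measurable_space[OF \<xi>, of w] that by (simp add: space_F)
 show thesis
 proof (rule that[of "\<bar>C\<bar>"])
  show "(\<lambda>w. \<xi> w \<theta>) \<in> borel_measurable (F 0)" if "- \<tau> <= \<theta>" "\<theta> <= 0" for \<theta>
   by (rule measurable_compose[OF \<xi> borel_measurable_evaluation[OF that]])
  show "norm (\<xi> w \<theta>) <= \<bar>C\<bar>" if "- \<tau> <= \<theta>" "\<theta> <= 0" "w \<in> space M" for \<theta> w
   using norm_le_segment_norm[OF seg[OF that(3)] that(1,2)] C[OF that(3)] by linarith
 qed (use seg in \<open>auto simp: segments_def\<close>)
qed

locale delay_function =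
 fixes \<delta> \<delta>' :: "real => real" and \<tau> \<eta> :: real
 assumes delay_derivative: "\<And>t. 0 <= t ==> (\<delta> has_real_derivative \<delta>' t) (at t within {0..})"
  and delay_derivative_continuous: "continuous_on {0..} \<delta>'"
  and delay_pos: "\<And>t. 0 <= t ==> 0 <= \<delta> t" and delay_0: "\<delta> 0 = \<tau>"
  and \<eta>: "\<eta> < 1" "\<And>t. 0 <= t ==> \<delta>' t <= \<eta>"
begin

lemma continuous_delay: "continuous_on {0..} \<delta>"
 by (rule DERIV_continuous_on[of _ _ \<delta>']) (use delay_derivative in auto)

lemma delay_derivative_at:
 assumes "0 < t" shows "(\<delta> has_real_derivative \<delta>' t) (at t)"
proof -
 have "at t within {0..} = at t" using assms by (intro at_within_interior) (auto simp: interior_real_atLeast)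
 then show ?thesis using delay_derivative[of t] assms by simp
qed

text \<open>\<open>\<eta> * t - \<delta> t\<close> is nondecreasing and starts at -\<tau>.
  Consequently delayed times stay above -\<tau> and are nonnegative from
  \<open>\<tau> / (1 - \<eta>)\<close> on.\<close>

lemma delay_growth: "0 <= t ==> (1 - \<eta>) * t - \<tau> <= t - \<delta> t"
proof -
 assume t: "0 <= t"
 have "\<eta> * 0 - \<delta> 0 <= \<eta> * t - \<delta> t"
 proof (rule DERIV_nonneg_imp_increasing_open[OF t])
  show "\<exists>y. ((\<lambda>t. \<eta> * t - \<delta> t) has_real_derivative y) (at x) \<and> 0 <= y" if "0 < x" for x
   using \<eta>(2)[of x] that by (intro exI[of _ "\<eta> - \<delta>' x"]) (auto intro!: derivative_eq_intros delay_derivative_at)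
  show "continuous_on {0..t} (\<lambda>t. \<eta> * t - \<delta> t)"
   by (intro continuous_intros continuous_on_subset[OF continuous_delay]) auto
 qed
 then show ?thesis by (simp add: delay_0 algebra_simps)
qed

text \<open>Change of variables \<open>u = s - \<delta> s\<close>, whose derivative is at least
  \<open>1 - \<eta>\<close>. The derivative is two-sided at positive times only, so the substitution
  is made on \<open>[e, t]\<close>, and Fatou lets \<open>e\<close> tend to 0.\<close>

lemma nn_integral_delayed_le:
 assumes [measurable]: "\<phi> \<in> borel_measurable borel" and t: "0 <= t"
 shows "(\<integral>\<^sup>+s. \<phi> (s - \<delta> s) * indicator {s. 0 <= s \<and> s <= t \<and> 0 <= s - \<delta> s} s \<partial>lborel)
  <= ennreal (1 / (1 - \<eta>)) * (\<integral>\<^sup>+u\<in>{0..t}. \<phi> u \<partial>lborel)" (is "integral\<^sup>N _ ?f <= ?R")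
proof -
 have m [measurable]: "?f \<in> borel_measurable lborel" by (rule delayed_measurable[OF continuous_delay assms(1)])
 have le: "(\<integral>\<^sup>+s. ?f s * indicator {e..t} s \<partial>lborel) <= ?R" if e: "0 < e" "e < t" for e
 proof -
  let ?h = "\<lambda>u. \<phi> u * indicator {0..t} u" and ?g = "\<lambda>s. s - \<delta> s"
  have "(\<integral>\<^sup>+s. ?f s * indicator {e..t} s \<partial>lborel)
    <= (\<integral>\<^sup>+s. ennreal (1 / (1 - \<eta>)) * (?h (?g s) * ennreal (1 - \<delta>' s) * indicator {e..t} s) \<partial>lborel)"
  proof (rule nn_integral_mono)
   fix s
   show "?f s * indicator {e..t} s <= ennreal (1 / (1 - \<eta>)) * (?h (?g s) * ennreal (1 - \<delta>' s) * indicator {e..t} s)"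
   proof (cases "s \<in> {e..t} \<and> 0 <= ?g s")
    case True
    have "1 * (1 - \<eta>) <= 1 - \<delta>' s" using \<eta>(2)[of s] True e by simp
    then have "1 <= 1 / (1 - \<eta>) * (1 - \<delta>' s)" using \<eta>(1) by (simp add: divide_simps)
    then have "\<phi> (?g s) * ennreal 1 <= \<phi> (?g s) * ennreal (1 / (1 - \<eta>) * (1 - \<delta>' s))" by (intro mult_left_mono ennreal_leI) auto
    also have "ennreal (1 / (1 - \<eta>) * (1 - \<delta>' s)) = ennreal (1 / (1 - \<eta>)) * ennreal (1 - \<delta>' s)"
     using \<eta>(1) \<eta>(2)[of s] True e by (intro ennreal_mult) auto
    finally have "\<phi> (?g s) <= ennreal (1 / (1 - \<eta>)) * (\<phi> (?g s) * ennreal (1 - \<delta>' s))" by (simp add: mult_ac)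
    then show ?thesis using True e delay_pos[of s] by simp
   qed auto
  qed
  also have "\<dots> = ennreal (1 / (1 - \<eta>)) * (\<integral>\<^sup>+s. ?h (?g s) * ennreal (1 - \<delta>' s) * indicator {e..t} s \<partial>lborel)"
  proof (rule nn_integral_cmult)
   have "(\<lambda>s. indicator {e..t} s *\<^sub>R \<delta> s) \<in> borel_measurable borel" "(\<lambda>s. indicator {e..t} s *\<^sub>R \<delta>' s) \<in> borel_measurable borel"
    using e by (intro borel_measurable_continuous_on_indicator continuous_on_subset[OF continuous_delay]
     continuous_on_subset[OF delay_derivative_continuous]; auto)+
   then have "(\<lambda>s. ?h (s - indicator {e..t} s *\<^sub>R \<delta> s) * ennreal (1 - indicator {e..t} s *\<^sub>R \<delta>' s) * indicator {e..t} s) \<in> borel_measurable lborel"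
    by measurable
   also have "(\<lambda>s. ?h (s - indicator {e..t} s *\<^sub>R \<delta> s) * ennreal (1 - indicator {e..t} s *\<^sub>R \<delta>' s) * indicator {e..t} s)
     = (\<lambda>s. ?h (?g s) * ennreal (1 - \<delta>' s) * indicator {e..t} s)" by (auto simp: fun_eq_iff indicator_def)
   finally show "(\<lambda>s. ?h (?g s) * ennreal (1 - \<delta>' s) * indicator {e..t} s) \<in> borel_measurable lborel" .
  qed
  also have "(\<integral>\<^sup>+s. ?h (?g s) * ennreal (1 - \<delta>' s) * indicator {e..t} s \<partial>lborel) = (\<integral>\<^sup>+u. ?h u * indicator {?g e..?g t} u \<partial>lborel)"
  proof (rule nn_integral_substitution_aux[symmetric])
   show "(?g has_real_derivative 1 - \<delta>' x) (at x)" if "x \<in> {e..t}" for x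
    using that e by (auto intro!: derivative_eq_intros delay_derivative_at)
   show "0 <= 1 - \<delta>' x" if "x \<in> {e..t}" for x using \<eta>(1) \<eta>(2)[of x] that e by auto
   show "continuous_on {e..t} (\<lambda>s. 1 - \<delta>' s)"
    using e by (intro continuous_intros continuous_on_subset[OF delay_derivative_continuous]) auto
  qed (use e in auto)
  also have "\<dots> <= (\<integral>\<^sup>+u\<in>{0..t}. \<phi> u \<partial>lborel)" by (intro nn_integral_mono) (auto simp: indicator_def)
  finally show ?thesis by (simp add: mult_left_mono)
 qed
 have "AE s in lborel. s \<noteq> (0 :: real)" by (rule AE_lborel_singleton)
 \<comment> \<open>For \<open>0 < t\<close> the cut-off \<open>t / (i + 2)\<close> is positive and
   strictly below \<open>t\<close>, as the substitution requires.\<close>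
 then have eq: "AE s in lborel. ?f s = liminf (\<lambda>i. ?f s * indicator {t / real (i + 2)..t} s)"
 proof eventually_elim
  case (elim s)
  have "\<forall>\<^sub>F i in sequentially. ?f s * indicator {t / real (i + 2)..t} s = ?f s"
  proof (cases "0 < s \<and> s <= t")
   case True
   have "(\<lambda>i. t / real (i + 2)) \<longlonglongrightarrow> 0" using LIMSEQ_ignore_initial_segment[OF lim_const_over_n[of t], of 2] by simp
   from order_tendstoD(2)[OF this, of s] True show ?thesis by (auto elim!: eventually_mono)
  qed (use elim in \<open>auto intro!: always_eventually simp: indicator_def\<close>)
  then show ?case by (intro lim_imp_Liminf[symmetric] tendsto_eventually) auto
 qed
 have "integral\<^sup>N lborel ?f = (\<integral>\<^sup>+s. liminf (\<lambda>i. ?f s * indicator {t / real (i + 2)..t} s) \<partial>lborel)"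
  by (rule nn_integral_cong_AE[OF eq])
 also have "\<dots> <= liminf (\<lambda>i. \<integral>\<^sup>+s. ?f s * indicator {t / real (i + 2)..t} s \<partial>lborel)"
  by (rule nn_integral_liminf) (intro borel_measurable_times_ennreal m borel_measurable_indicator, simp)
 also have "\<dots> <= ?R"
 proof (intro Liminf_le always_eventually allI)
  fix i
  show "(\<integral>\<^sup>+s. ?f s * indicator {t / real (i + 2)..t} s \<partial>lborel) <= ?R"
  proof (cases "t = 0")
   case True
   have "AE s in lborel. s \<noteq> (0 :: real)" by (rule AE_lborel_singleton)
   then have "(\<integral>\<^sup>+s. ?f s * indicator {t / real (i + 2)..t} s \<partial>lborel) = (\<integral>\<^sup>+s. 0 \<partial>(lborel :: real measure))"
    using True by (intro nn_integral_cong_AE) (auto elim!: eventually_mono simp: indicator_def)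
   then show ?thesis by simp
  next
   case False
   then show ?thesis using t by (intro le) (auto simp: divide_less_eq)
  qed
 qed simp
 finally show ?thesis .
qed

end

section \<open>Stability and the critical rate\<close>

lemma stable_of_rates:
 assumes "0 < s" "polynomial_rates_below s M F B f g \<delta> \<tau>"
 shows "almost_surely_polynomially_stable M F B f g \<delta> \<tau>" "mean_square_polynomially_stable M F B f g \<delta> \<tau>"
proof -
 have r: "(AE w in M. pathwise_rate x w <= ereal (- (s / 2) / 2)) \<and> mean_square_rate M x <= ereal (- (s / 2))"
  if "\<xi> \<in> initial_values M F \<tau>" "sdde_solution M F B f g \<delta> \<tau> \<xi> x" for \<xi> x
 proof -
  have "0 < s / 2 \<and> s / 2 < s" using assms(1) by simp
  then show ?thesis using assms(2) that unfolding polynomial_rates_below_def by blast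
 qed
 \<comment> \<open>Stability asks for strict inequalities: the rates s / 4 and s / 2, obtained at
   \<gamma> = s / 2, both lie strictly beyond s / 8.\<close>
 have lt: "ereal (- (s / 2) / 2) < ereal (- (s / 8))" "ereal (- (s / 2)) < ereal (- (s / 8))" using assms(1) by auto
 show "almost_surely_polynomially_stable M F B f g \<delta> \<tau>"
  unfolding almost_surely_polynomially_stable_def
 proof (intro exI[of _ "s / 8"] conjI ballI allI impI)
  fix \<xi> x assume "\<xi> \<in> initial_values M F \<tau>" "sdde_solution M F B f g \<delta> \<tau> \<xi> x"
  from r[OF this] have "AE w in M. pathwise_rate x w <= ereal (- (s / 2) / 2)" by blast
  then show "AE w in M. pathwise_rate x w < ereal (- (s / 8))" by eventually_elim (rule order_le_less_trans[OF _ lt(1)])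
 qed (use assms(1) in simp)
 show "mean_square_polynomially_stable M F B f g \<delta> \<tau>"
  unfolding mean_square_polynomially_stable_def
 proof (intro exI[of _ "s / 8"] conjI ballI allI impI)
  fix \<xi> x assume "\<xi> \<in> initial_values M F \<tau>" "sdde_solution M F B f g \<delta> \<tau> \<xi> x"
  from r[OF this] have "mean_square_rate M x <= ereal (- (s / 2))" by blast
  then show "mean_square_rate M x < ereal (- (s / 8))" using lt(2) by (rule order_le_less_trans)
 qed (use assms(1) in simp)
qed

text \<open>The linear term is strictly increasing and the other one nondecreasing. At 0 the maximum
  is 1, so the sign there is the dissipativity condition; at \<open>l1\<close> only a nonnegative
  term is left.\<close>

lemma critical_rate_exists1:
 fixes \<tau> l1 l2 :: real
 assumes "0 <= \<tau>" "0 < l1" "0 < l2" "\<eta> < 1" "l2 / (1 - \<eta>) < l1"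
 defines "G \<equiv> \<lambda>\<gamma>. \<gamma> - l1 + l2 * max 1 ((1 + \<tau>) powr (\<gamma> - 1)) / (1 - \<eta>)"
 shows "strict_mono G" "\<exists>!\<gamma>. 0 < \<gamma> \<and> G \<gamma> = 0"
proof -
 show mono: "strict_mono G"
 proof (rule strict_monoI)
  fix x y :: real assume "x < y"
  then have "max 1 ((1 + \<tau>) powr (x - 1)) <= max 1 ((1 + \<tau>) powr (y - 1))" using assms(1) by (intro max.mono powr_mono) auto
  then have "l2 * max 1 ((1 + \<tau>) powr (x - 1)) / (1 - \<eta>) <= l2 * max 1 ((1 + \<tau>) powr (y - 1)) / (1 - \<eta>)"
   using assms(3,4) by (intro divide_right_mono mult_left_mono) auto
  then show "G x < G y" using \<open>x < y\<close> by (simp add: G_def)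
 qed
 have "(1 + \<tau>) powr - 1 <= 1" using powr_mono[of "-1" 0 "1 + \<tau>"] assms(1) by simp
 then have G0: "G 0 < 0" using assms(5) by (simp add: G_def max_def)
 have G1: "0 <= G l1" using assms(3,4) by (simp add: G_def)
 have "continuous_on {0..l1} G" unfolding G_def using assms(1,4) by (intro continuous_intros) auto
 then obtain x where x: "0 <= x" "G x = 0" using IVT'[of G 0 0 l1] G0 G1 assms(2) by auto
 have "x \<noteq> 0" using x(2) G0 by auto
 show "\<exists>!\<gamma>. 0 < \<gamma> \<and> G \<gamma> = 0"
 proof (rule ex1I[of _ x])
  show "0 < x \<and> G x = 0" using x \<open>x \<noteq> 0\<close> by simp
  show "\<gamma> = x" if "0 < \<gamma> \<and> G \<gamma> = 0" for \<gamma> using strict_mono_eq[OF mono, of \<gamma> x] that x(2) by simp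
 qed
qed

theorem theorem1p5:
  fixes M :: "'a measure" and F :: "real \<Rightarrow> 'a measure"
    and B :: "real \<Rightarrow> 'a \<Rightarrow> real ^ 'd"
    and f :: "real ^ 'n \<Rightarrow> real ^ 'n \<Rightarrow> real \<Rightarrow> real ^ 'n"
    and g :: "real ^ 'n \<Rightarrow> real ^ 'n \<Rightarrow> real \<Rightarrow> real ^ 'd ^ 'n"
    and \<delta> \<delta>' :: "real \<Rightarrow> real"
    and \<tau> \<eta> K lam0 lam1 lam2 :: real
  assumes basis: "stochastic_basis M F"
    and brownian: "brownian_motion M F B"
    and tau: "\<tau> \<ge> 0"
    and delta_C1: "\<And>t. t \<ge> 0 \<Longrightarrow> (\<delta> has_real_derivative \<delta>' t) (at t within {0..})"
      "continuous_on {0..} \<delta>'"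
    and delta_nonneg: "\<And>t. t \<ge> 0 \<Longrightarrow> \<delta> t \<ge> 0"
    and delta_0: "\<delta> 0 = \<tau>"
    and f_borel: "(\<lambda>(x, y, t). f x y t) \<in> borel_measurable (restrict_space borel (UNIV \<times> UNIV \<times> {0..}))"
    and g_borel: "(\<lambda>(x, y, t). g x y t) \<in> borel_measurable (restrict_space borel (UNIV \<times> UNIV \<times> {0..}))"
    and f_0: "\<And>t. t \<ge> 0 \<Longrightarrow> f 0 0 t = 0"
    and g_0: "\<And>t. t \<ge> 0 \<Longrightarrow> g 0 0 t = 0"
    and eta: "\<eta> < 1" "\<And>t. t \<ge> 0 \<Longrightarrow> \<delta>' t \<le> \<eta>"
    and lipschitz: "locally_Lipschitz_coefficients f g"
    and pos: "K > 0" "lam0 > 0" "lam1 > 0" "lam2 > 0"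
    and monotone: "\<And>t x y. t \<ge> 0 \<Longrightarrow>
      2 * (x \<bullet> f x y t) + (norm (g x y t))\<^sup>2
        \<le> (K * (1 + t) powr (- lam0) - lam1 * (norm x)\<^sup>2 + lam2 * (norm y)\<^sup>2) / (1 + t)"
    and dissipative: "lam1 - lam2 / (1 - \<eta>) > 0"
  shows "(\<forall>\<xi>\<in>initial_values M F \<tau>. \<exists>x. sdde_solution M F B f g \<delta> \<tau> \<xi> x \<and>
        (\<forall>y. sdde_solution M F B f g \<delta> \<tau> \<xi> y \<longrightarrow> (AE \<omega> in M. \<forall>t\<ge>-\<tau>. y t \<omega> = x t \<omega>))) \<and>
    ((\<forall>t\<ge>0. \<delta> t \<le> \<tau>) \<or> \<not> bounded (\<delta> ` {0..}) \<longrightarrow>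
      almost_surely_polynomially_stable M F B f g \<delta> \<tau> \<and>
      mean_square_polynomially_stable M F B f g \<delta> \<tau>) \<and>
    ((\<forall>t\<ge>0. \<delta> t \<le> \<tau>) \<longrightarrow>
      (\<exists>!\<gamma>0. 0 < \<gamma>0 \<and> \<gamma>0 - lam1 + lam2 * max 1 ((1 + \<tau>) powr (\<gamma>0 - 1)) / (1 - \<eta>) = 0) \<and>
      (\<forall>\<gamma>0. 0 < \<gamma>0 \<and> \<gamma>0 - lam1 + lam2 * max 1 ((1 + \<tau>) powr (\<gamma>0 - 1)) / (1 - \<eta>) = 0 \<longrightarrow>
        polynomial_rates_below (min lam0 \<gamma>0) M F B f g \<delta> \<tau>)) \<and>
    (\<not> bounded (\<delta> ` {0..}) \<longrightarrow>
      polynomial_rates_below (min lam0 (min (lam1 - lam2 / (1 - \<eta>)) 1)) M F B f g \<delta> \<tau>)"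
proof -
 interpret brownian_basis M F B using basis brownian by (simp add: brownian_basis_def brownian_basis_axioms_def)
 interpret delay_function \<delta> \<delta>' \<tau> \<eta> using delta_C1 delta_nonneg delta_0 eta by unfold_locales auto
 have equation: "\<exists>C. delay_equation M F B \<delta> \<tau> (1 / (1 - \<eta>)) C \<xi> f g K lam0 lam1 lam2 (\<tau> / (1 - \<eta>))"
  if \<xi>: "\<xi> \<in> initial_values M F \<tau>" for \<xi> :: "'a => real => real ^ 'n"
 proof -
  obtain C where C: "0 <= C" "\<And>\<theta>. - \<tau> <= \<theta> ==> \<theta> <= 0 ==> (\<lambda>w. \<xi> w \<theta>) \<in> borel_measurable (F 0)"
   "\<And>w. w \<in> space M ==> continuous_on {-\<tau>..0} (\<xi> w)"
   "\<And>\<theta> w. - \<tau> <= \<theta> ==> \<theta> <= 0 ==> w \<in> space M ==> norm (\<xi> w \<theta>) <= C"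
   using initial_valuesE[OF \<xi>] by blast
  have ge: "- \<tau> <= t - \<delta> t" if "0 <= t" for t
  proof -
   have "0 <= (1 - \<eta>) * t" using that eta(1) by simp
   then show ?thesis using delay_growth[OF that] by linarith
  qed
  have gap: "t <= \<tau> / (1 - \<eta>)" if "0 <= t" "t - \<delta> t < 0" for t
  proof -
   have "(1 - \<eta>) * t <= \<tau>" using delay_growth[OF that(1)] that(2) by linarith
   then show ?thesis using eta(1) by (simp add: pos_le_divide_eq mult.commute)
  qed
  have "delay_equation M F B \<delta> \<tau> (1 / (1 - \<eta>)) C \<xi> f g K lam0 lam1 lam2 (\<tau> / (1 - \<eta>))"
   by unfold_locales (fact tau continuous_delay delta_nonneg ge nn_integral_delayed_le C f_borel g_borel f_0 g_0 lipschitz monotone gap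
    | use eta(1) tau pos dissipative in simp)+
  then show ?thesis ..
 qed
 \<comment> \<open>Both cases of the theorem come down to a comparison constant
   \<open>c \<gamma>\<close> for the weight and the range of rates for which the resulting sign
   condition holds.\<close>
 have rates: "polynomial_rates_below s M F B f g \<delta> \<tau>"
  if s: "s <= lam0" and c: "\<And>\<gamma>. 0 < \<gamma> ==> \<gamma> < s ==> 0 <= c \<gamma>" "\<And>\<gamma>. 0 < \<gamma> ==> \<gamma> < s ==> \<gamma> - lam1 + lam2 * c \<gamma> / (1 - \<eta>) <= 0"
   "\<And>\<gamma> t. 0 < \<gamma> ==> \<gamma> < s ==> 0 <= t ==> 0 <= t - \<delta> t ==> (1 + t) powr (\<gamma> - 1) <= c \<gamma> * (1 + (t - \<delta> t)) powr (\<gamma> - 1)"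
  for s and c :: "real => real"
  unfolding polynomial_rates_below_def
 proof (intro ballI allI impI)
  fix \<xi> :: "'a => real => real ^ 'n" and x \<gamma>
  assume \<xi>: "\<xi> \<in> initial_values M F \<tau>" and x: "sdde_solution M F B f g \<delta> \<tau> \<xi> x" and \<gamma>: "0 < \<gamma> \<and> \<gamma> < s"
  obtain C where "delay_equation M F B \<delta> \<tau> (1 / (1 - \<eta>)) C \<xi> f g K lam0 lam1 lam2 (\<tau> / (1 - \<eta>))" using equation[OF \<xi>] by blast
  then interpret E: delay_equation M F B \<delta> \<tau> "1 / (1 - \<eta>)" C \<xi> f g K lam0 lam1 lam2 "\<tau> / (1 - \<eta>)" .
  have "E.admissible \<gamma>" unfolding E.admissible_def using \<gamma> s c[of \<gamma>] by (auto intro!: exI[of _ "c \<gamma>"])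
  then show "(AE w in M. pathwise_rate x w <= ereal (- \<gamma> / 2)) \<and> mean_square_rate M x <= ereal (- \<gamma>)"
   using E.solution_rates[OF _ x] by blast
 qed
 have decreasing: "(1 + t) powr (\<gamma> - 1) <= (1 + (t - \<delta> t)) powr (\<gamma> - 1)" if "\<gamma> <= 1" "0 <= t" "0 <= t - \<delta> t" for \<gamma> t
  using that delta_nonneg[of t] by (intro powr_mono2') auto
 have "lam2 / (1 - \<eta>) < lam1" using dissipative by simp
 note critical = critical_rate_exists1[OF tau pos(3,4) eta(1) this]
 have bounded_case: "polynomial_rates_below (min lam0 \<gamma>0) M F B f g \<delta> \<tau>"
  if \<delta>: "\<forall>t\<ge>0. \<delta> t <= \<tau>" and \<gamma>0: "\<gamma>0 - lam1 + lam2 * max 1 ((1 + \<tau>) powr (\<gamma>0 - 1)) / (1 - \<eta>) = 0" for \<gamma>0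
 \<comment> \<open>For \<gamma> <= 1 the weight decreases and the constant 1 suffices; beyond that
   the factor is \<open>(1 + \<tau>) powr (\<gamma> - 1)\<close>. Their maximum is the term in the
   equation for the critical rate, and monotonicity gives the sign condition below that
   rate.\<close>
 proof (rule rates[of _ "\<lambda>\<gamma>. max 1 ((1 + \<tau>) powr (\<gamma> - 1))"])
  fix \<gamma> assume \<gamma>: "0 < \<gamma>" "\<gamma> < min lam0 \<gamma>0"
  show "\<gamma> - lam1 + lam2 * max 1 ((1 + \<tau>) powr (\<gamma> - 1)) / (1 - \<eta>) <= 0"
   using strict_monoD[OF critical(1), of \<gamma> \<gamma>0] \<gamma> \<gamma>0 by simp
  fix t assume t: "0 <= t" "0 <= t - \<delta> t"
  show "(1 + t) powr (\<gamma> - 1) <= max 1 ((1 + \<tau>) powr (\<gamma> - 1)) * (1 + (t - \<delta> t)) powr (\<gamma> - 1)"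
  proof (cases "\<gamma> <= 1")
   case True
   have "1 * (1 + (t - \<delta> t)) powr (\<gamma> - 1) <= max 1 ((1 + \<tau>) powr (\<gamma> - 1)) * (1 + (t - \<delta> t)) powr (\<gamma> - 1)" by (intro mult_right_mono) auto
   then show ?thesis using decreasing[OF True t] by simp
  next
   case False
   \<comment> \<open>The product below exceeds \<open>1 + t\<close> by
     \<open>(\<tau> - \<delta> t) + \<tau> * (t - \<delta> t)\<close>.\<close>
   have "0 <= \<tau> * (t - \<delta> t)" "\<delta> t <= \<tau>" using tau t \<delta> by auto
   then have "1 + t <= (1 + \<tau>) * (1 + (t - \<delta> t))" by (simp add: algebra_simps)
   then have "(1 + t) powr (\<gamma> - 1) <= ((1 + \<tau>) * (1 + (t - \<delta> t))) powr (\<gamma> - 1)" using False t by (intro powr_mono2) auto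
   also have "\<dots> = (1 + \<tau>) powr (\<gamma> - 1) * (1 + (t - \<delta> t)) powr (\<gamma> - 1)" using tau t by (simp add: powr_mult)
   also have "\<dots> <= max 1 ((1 + \<tau>) powr (\<gamma> - 1)) * (1 + (t - \<delta> t)) powr (\<gamma> - 1)" by (intro mult_right_mono) auto
   finally show ?thesis .
  qed
 qed auto
 have unbounded_case: "polynomial_rates_below (min lam0 (min (lam1 - lam2 / (1 - \<eta>)) 1)) M F B f g \<delta> \<tau>"
  \<comment> \<open>The minimum with 1 keeps all rates in the range where the weight decreases, so
    the constant 1 compares it with its delayed value.\<close>
  by (rule rates[of _ "\<lambda>_. 1"]) (use decreasing in auto)

 have unique: "\<exists>x. sdde_solution M F B f g \<delta> \<tau> \<xi> x \<and>
    (\<forall>y. sdde_solution M F B f g \<delta> \<tau> \<xi> y --> (AE w in M. \<forall>t\<ge>-\<tau>. y t w = x t w))"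
  if \<xi>: "\<xi> \<in> initial_values M F \<tau>" for \<xi> :: "'a => real => real ^ 'n"
 proof -
  obtain C where "delay_equation M F B \<delta> \<tau> (1 / (1 - \<eta>)) C \<xi> f g K lam0 lam1 lam2 (\<tau> / (1 - \<eta>))" using equation[OF \<xi>] by blast
  then interpret E: delay_equation M F B \<delta> \<tau> "1 / (1 - \<eta>)" C \<xi> f g K lam0 lam1 lam2 "\<tau> / (1 - \<eta>)" .
  show ?thesis using E.limit_solution E.solution_eq_limit by blast
 qed
 have "0 < min lam0 (min (lam1 - lam2 / (1 - \<eta>)) 1)" using pos dissipative by simp
 note stable = stable_of_rates[OF this unbounded_case]
 show ?thesis
  using unique stable critical(2) bounded_case unbounded_case by (intro conjI ballI impI allI) blast+
qed

end
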